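(* Let $M,N$ be $\lambda$-terms with $M\to_\beta N$ (one-step $\beta$-reduction), and let $\vec x$ be a list of distinct variables with $FV(M)\cup FV(N)\subseteq\vec x$. There is a natural isomorphism $\llbracket M\rrbracket_{\vec x}\cong\llbracket N\rrbracket_{\vec x}$.
   Context: $[n]=\{1,\dots,n\}$. Fix a class $\mathcal C$ of functions between finite ordinals equal to one of: all bijections, all injections, all surjections, all functions. For a small category $X$, $SX$ has finite lists of objects of $X$ as objects and morphisms $\langle x_1,\dots,x_n\rangle\to\langle y_1,\dots,y_m\rangle$ the tuples $\langle\alpha,f_1,\dots,f_m\rangle$ with $\alpha:[m]\to[n]$ in $\mathcal C$, $f_i:x_{\alpha(i)}\to y_i$; composite of $\langle\alpha,\vec f\rangle$ then $\langle\beta,\vec g\rangle$ is $\langle\alpha\circ\beta,(g_i\circ f_{\beta(i)})_i\rangle$; tensor $\oplus$ = concatenation, unit $\langle\rangle$. Fix a small category $A$. $D=D_A$ is the colimit of $D_0=A$, $D_{k+1}=(SD_k)^{o}\times D_k\sqcup A$ along canonical inclusions: objects $a::=o\mid\vec a\Rightarrow a$ ($o\in\mathrm{Ob}(A)$); morphisms are those of $A$ and $\langle\alpha,\vec f\rangle\Rightarrow f:(\vec a\Rightarrow a)\to(\vec a'\Rightarrow a')$ for $\langle\alpha,\vec f\rangle:\vec a'\to\vec a$ in $SD$, $f:a\to a'$. $SD=S(D_A)$. Contexts are objects of $(SD)^n$; $\otimes$ is componentwise concatenation; $\Delta\oplus\langle\vec a\rangle$ appends a component. Denotation $\llbracket M\rrbracket_{\vec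 x}:((SD)^n)^{o}\times D\to\mathrm{Set}$ for $\vec x=\langle x_1..x_n\rangle\supseteq FV(M)$ (functorial action from hom-functors and coends; in the abstraction case $\langle\alpha,\vec f\rangle\Rightarrow f$ acts as $\llbracket M\rrbracket(1\oplus\langle\alpha,\vec f\rangle,f)$): $\llbracket x_i\rrbracket_{\vec x}(\Delta,a)=(SD)^n(\Delta,\langle\langle\rangle,\dots,\langle a\rangle,\dots,\langle\rangle\rangle)$ ($\langle a\rangle$ at position $i$); $\llbracket\lambda y.P\rrbracket_{\vec x}(\Delta,a)=\llbracket P\rrbracket_{\vec x\oplus\langle y\rangle}(\Delta\oplus\langle\vec a'\rangle,a')$ if $a=\vec a'\Rightarrow a'$, $\emptyset$ if $a$ atomic; $\llbracket PQ\rrbracket_{\vec x}(\Delta,a)=\int^{\vec a=\langle a_1..a_k\rangle\in SD}\int^{\Gamma_0..\Gamma_k\in(SD)^n}\llbracket P\rrbracket_{\vec x}(\Gamma_0,\vec a\Rightarrow a)\times\prod_{i=1}^k\llbracket Q\rrbracket_{\vec x}(\Gamma_i,a_i)\times(SD)^n(\Delta,\bigotimes_{i=0}^k\Gamma_i)$. *)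

theory Defs
  imports Main
begin

text \<open>A small category is given by a type of objects and a type of morphisms
  (every element of the morphism type is a morphism) with domain, codomain,
  identities and composition (ccomp A g f = g after f).\<close>

record ('o, 'm) cat =
  cdom :: "'m \<Rightarrow> 'o"
  ccod :: "'m \<Rightarrow> 'o"
  cid :: "'o \<Rightarrow> 'm"
  ccomp :: "'m \<Rightarrow> 'm \<Rightarrow> 'm"

definition is_category :: "('o, 'm) cat \<Rightarrow> bool" where
  "is_category A \<longleftrightarrow>
     (\<forall>ob. cdom A (cid A ob) = ob \<and> ccod A (cid A ob) = ob) \<and>
     (\<forall>f g. ccod A f = cdom A g \<longrightarrow>
        cdom A (ccomp A g f) = cdom A f \<and> ccod A (ccomp A g f) = ccod A g) \<and>
     (\<forall>f. ccomp A f (cid A (cdom A f)) = f \<and> ccomp A (cid A (ccod A f)) f = f) \<and>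
     (\<forall>f g h. ccod A f = cdom A g \<longrightarrow> ccod A g = cdom A h \<longrightarrow>
        ccomp A h (ccomp A g f) = ccomp A (ccomp A h g) f)"

datatype fclass = Bijections | Injections | Surjections | AllFunctions

text \<open>A function alpha : [m] -> [n] is represented (0-based) by the list of its
  values, alpha ! i being the image of i.\<close>

definition in_class :: "fclass \<Rightarrow> nat \<Rightarrow> nat \<Rightarrow> nat list \<Rightarrow> bool" where
  "in_class C m n \<alpha> \<longleftrightarrow> length \<alpha> = m \<and> (\<forall>j\<in>set \<alpha>. j < n) \<and>
     (case C of Bijections \<Rightarrow> distinct \<alpha> \<and> set \<alpha> = {..<n}
      | Injections \<Rightarrow> distinct \<alpha>
      | Surjections \<Rightarrow> set \<alpha> = {..<n}
      | AllFunctions \<Rightarrow> True)"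

datatype 'o ty = At 'o | Fn "'o ty list" "'o ty"

text \<open>FM alpha fs f is the morphism <alpha, fs> => f.\<close>
datatype 'm dmor = AM 'm | FM "nat list" "'m dmor list" "'m dmor"

type_synonym 'm smor = "nat list \<times> 'm dmor list"
type_synonym 'o ctx = "'o ty list list"

inductive dhom :: "('o, 'm) cat \<Rightarrow> fclass \<Rightarrow> 'o ty \<Rightarrow> 'o ty \<Rightarrow> 'm dmor \<Rightarrow> bool"
  for A C where
  dhom_At: "cdom A m = ob \<Longrightarrow> ccod A m = ob' \<Longrightarrow> dhom A C (At ob) (At ob') (AM m)"
| dhom_Fn: "in_class C (length as) (length bs) \<alpha> \<Longrightarrow> length fs = length as \<Longrightarrow>
     (\<forall>i<length as. dhom A C (bs ! (\<alpha> ! i)) (as ! i) (fs ! i)) \<Longrightarrow>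
     dhom A C a b f \<Longrightarrow> dhom A C (Fn as a) (Fn bs b) (FM \<alpha> fs f)"

definition shom :: "('o, 'm) cat \<Rightarrow> fclass \<Rightarrow> 'o ty list \<Rightarrow> 'o ty list \<Rightarrow> 'm smor \<Rightarrow> bool" where
  "shom A C xs ys u \<longleftrightarrow> (case u of (\<alpha>, fs) \<Rightarrow>
     in_class C (length ys) (length xs) \<alpha> \<and> length fs = length ys \<and>
     (\<forall>i<length ys. dhom A C (xs ! (\<alpha> ! i)) (ys ! i) (fs ! i)))"

fun did :: "('o, 'm) cat \<Rightarrow> 'o ty \<Rightarrow> 'm dmor" where
  "did A (At ob) = AM (cid A ob)"
| "did A (Fn as a) = FM [0..<length as] (map (did A) as) (did A a)"

text \<open>dcomp A f g : diagrammatic composite, first f then g.\<close>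
function dcomp :: "('o, 'm) cat \<Rightarrow> 'm dmor \<Rightarrow> 'm dmor \<Rightarrow> 'm dmor" where
  "dcomp A (AM m) (AM m') = AM (ccomp A m' m)"
| "dcomp A (FM \<alpha> fs f) (FM \<beta> gs g) =
     FM (map (\<lambda>i. \<beta> ! i) \<alpha>)
        (map (\<lambda>(j, h). dcomp A (if j < length gs then gs ! j else AM undefined) h) (zip \<alpha> fs))
        (dcomp A f g)"
| "dcomp A (AM m) (FM \<beta> gs g) = AM undefined"
| "dcomp A (FM \<alpha> fs f) (AM m) = AM undefined"
  by pat_completeness auto
termination
proof (relation "measure (\<lambda>(A, x, y). size x + size y)", goal_cases)
  case 1 then show ?case by simp
next
  case (2 A \<alpha> fs f \<beta> gs g x j h)
  then have "h \<in> set fs" by (auto dest: set_zip_rightD)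
  then have "size h \<le> size_list size fs" by (rule size_list_estimation') simp
  then have a: "size h < size (FM \<alpha> fs f)" by simp
  have "j < length gs \<Longrightarrow> size (gs ! j) \<le> size_list size gs"
    by (rule size_list_estimation'[of "gs ! j"]) simp_all
  then have b: "size (if j < length gs then gs ! j else AM undefined) \<le> size (FM \<beta> gs g)"
    by auto
  from a b show ?case by simp
next
  case 3 then show ?case by simp
qed

text \<open>Composition in SD: first u then v.\<close>
definition scomp :: "('o, 'm) cat \<Rightarrow> 'm smor \<Rightarrow> 'm smor \<Rightarrow> 'm smor" where
  "scomp A u v = (case u of (\<alpha>, fs) \<Rightarrow> case v of (\<beta>, gs) \<Rightarrow>
     (map (\<lambda>j. \<alpha> ! j) \<beta>, map (\<lambda>(j, g). dcomp A (fs ! j) g) (zip \<beta> gs)))"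

definition sid :: "('o, 'm) cat \<Rightarrow> 'o ty list \<Rightarrow> 'm smor" where
  "sid A xs = ([0..<length xs], map (did A) xs)"

definition ctxhom :: "('o, 'm) cat \<Rightarrow> fclass \<Rightarrow> 'o ctx \<Rightarrow> 'o ctx \<Rightarrow> 'm smor list \<Rightarrow> bool" where
  "ctxhom A C \<Delta> \<Gamma> us \<longleftrightarrow> length \<Gamma> = length \<Delta> \<and> length us = length \<Delta> \<and>
     (\<forall>c<length \<Delta>. shom A C (\<Delta> ! c) (\<Gamma> ! c) (us ! c))"

definition ccompc :: "('o, 'm) cat \<Rightarrow> 'm smor list \<Rightarrow> 'm smor list \<Rightarrow> 'm smor list" where
  "ccompc A us vs = map2 (scomp A) us vs"

definition cidc :: "('o, 'm) cat \<Rightarrow> 'o ctx \<Rightarrow> 'm smor list" where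
  "cidc A \<Delta> = map (sid A) \<Delta>"

definition ctensor :: "nat \<Rightarrow> 'o ctx list \<Rightarrow> 'o ctx" where
  "ctensor n \<Gamma>s = map (\<lambda>c. concat (map (\<lambda>\<Gamma>. \<Gamma> ! c) \<Gamma>s)) [0..<n]"

definition coff :: "'o ctx list \<Rightarrow> nat \<Rightarrow> nat \<Rightarrow> nat" where
  "coff \<Gamma>s c j = sum_list (map (\<lambda>\<Gamma>. length (\<Gamma> ! c)) (take j \<Gamma>s))"

text \<open>Tensor of context morphisms vs ! j : Gammas ! j -> _ (sources Gammas).\<close>
definition ctensor_mor :: "nat \<Rightarrow> 'o ctx list \<Rightarrow> 'm smor list list \<Rightarrow> 'm smor list" where
  "ctensor_mor n \<Gamma>s vs = map (\<lambda>c.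
     (concat (map (\<lambda>j. map (\<lambda>t. coff \<Gamma>s c j + t) (fst (vs ! j ! c))) [0..<length vs]),
      concat (map (\<lambda>j. snd (vs ! j ! c)) [0..<length vs]))) [0..<n]"

text \<open>Reindexing morphism tensor(Gammas) -> tensor(map (nth Gammas) beta).\<close>
definition cblock :: "('o, 'm) cat \<Rightarrow> nat \<Rightarrow> 'o ctx list \<Rightarrow> nat list \<Rightarrow> 'm smor list" where
  "cblock A n \<Gamma>s \<beta> = map (\<lambda>c.
     (concat (map (\<lambda>j. map (\<lambda>t. coff \<Gamma>s c j + t) [0..<length (\<Gamma>s ! j ! c)]) \<beta>),
      map (did A) (concat (map (\<lambda>j. \<Gamma>s ! j ! c) \<beta>)))) [0..<n]"

definition vctx :: "nat \<Rightarrow> nat \<Rightarrow> 'o ty \<Rightarrow> 'o ctx" where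
  "vctx n p a = map (\<lambda>c. if c = p then [a] else []) [0..<n]"

datatype lterm = LVar nat | LLam lterm | LApp lterm lterm

fun lift :: "lterm \<Rightarrow> nat \<Rightarrow> lterm" where
  "lift (LVar i) k = (if i < k then LVar i else LVar (Suc i))"
| "lift (LLam s) k = LLam (lift s (Suc k))"
| "lift (LApp s t) k = LApp (lift s k) (lift t k)"

fun subst :: "lterm \<Rightarrow> lterm \<Rightarrow> nat \<Rightarrow> lterm" where
  "subst (LVar i) s k = (if k < i then LVar (i - 1) else if i = k then s else LVar i)"
| "subst (LLam t) s k = LLam (subst t (lift s 0) (Suc k))"
| "subst (LApp t u) s k = LApp (subst t s k) (subst u s k)"

inductive beta :: "lterm \<Rightarrow> lterm \<Rightarrow> bool" where
  beta_redex: "beta (LApp (LLam s) t) (subst s t 0)"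
| beta_appL: "beta s t \<Longrightarrow> beta (LApp s u) (LApp t u)"
| beta_appR: "beta s t \<Longrightarrow> beta (LApp u s) (LApp u t)"
| beta_abs: "beta s t \<Longrightarrow> beta (LLam s) (LLam t)"

text \<open>All free (de Bruijn) variables of M are below n, i.e. FV(M) is contained
  in a list of n distinct variables.\<close>
fun fv_below :: "nat \<Rightarrow> lterm \<Rightarrow> bool" where
  "fv_below n (LVar i) = (i < n)"
| "fv_below n (LLam t) = fv_below (Suc n) t"
| "fv_below n (LApp t u) = (fv_below n t \<and> fv_below n u)"

text \<open>Raw elements (representatives) of the denotation sets.
  EV h: element of a variable denotation (a context morphism);
  EL x: element of an abstraction denotation;
  EA as Gammas p qs h: representative of the coend for an application
  (Gammas = [Gamma_0,...,Gamma_k], k = length as).\<close>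
datatype ('o, 'm) el =
    EV "'m smor list"
  | EL "('o, 'm) el"
  | EA "'o ty list" "'o ctx list" "('o, 'm) el" "('o, 'm) el list" "'m smor list"

text \<open>Functorial action of [[M]] along (u, f), where u : Delta' -> Delta in
  (SD)^n and f : a -> a' in D, on representatives.
  Variable LVar i in a context of length n is the variable at position n-1-i
  (0-based), i.e. the newest binder is appended at the end.\<close>
fun act :: "('o, 'm) cat \<Rightarrow> lterm \<Rightarrow> 'm smor list \<Rightarrow> 'm dmor \<Rightarrow> ('o, 'm) el \<Rightarrow> ('o, 'm) el" where
  "act A (LVar i) u f x = (case x of
      EV h \<Rightarrow> EV (ccompc A (ccompc A u h)
               (map (\<lambda>c. if c = length h - 1 - i then ([0], [f]) else ([], [])) [0..<length h]))
    | _ \<Rightarrow> x)"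
| "act A (LLam P) u f x = (case (f, x) of
      (FM \<alpha> fs f', EL x') \<Rightarrow> EL (act A P (u @ [(\<alpha>, fs)]) f' x')
    | _ \<Rightarrow> x)"
| "act A (LApp P Q) u f x = (case x of
      EA as \<Gamma>s p qs h \<Rightarrow>
        EA as \<Gamma>s (act A P (cidc A (\<Gamma>s ! 0)) (FM [0..<length as] (map (did A) as) f) p) qs
           (ccompc A u h)
    | _ \<Rightarrow> x)"

text \<open>sem A C M n Delta a x : x is a representative of an element of
  [[M]]_n(Delta, a).\<close>
fun sem :: "('o, 'm) cat \<Rightarrow> fclass \<Rightarrow> lterm \<Rightarrow> nat \<Rightarrow> 'o ctx \<Rightarrow> 'o ty \<Rightarrow> ('o, 'm) el \<Rightarrow> bool" where
  "sem A C (LVar i) n \<Delta> a x =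
     (i < n \<and> (\<exists>h. x = EV h \<and> ctxhom A C \<Delta> (vctx n (n - 1 - i) a) h))"
| "sem A C (LLam P) n \<Delta> a x = (case a of
      At _ \<Rightarrow> False
    | Fn as b \<Rightarrow> (\<exists>x'. x = EL x' \<and> sem A C P (Suc n) (\<Delta> @ [as]) b x'))"
| "sem A C (LApp P Q) n \<Delta> a x =
     (\<exists>as \<Gamma>s p qs h. x = EA as \<Gamma>s p qs h \<and>
        length \<Gamma>s = Suc (length as) \<and> (\<forall>\<Gamma>\<in>set \<Gamma>s. length \<Gamma> = n) \<and>
        sem A C P n (\<Gamma>s ! 0) (Fn as a) p \<and>
        length qs = length as \<and>
        (\<forall>i<length as. sem A C Q n (\<Gamma>s ! Suc i) (as ! i) (qs ! i)) \<and>
        ctxhom A C \<Delta> (ctensor n \<Gamma>s) h)"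

inductive equivclose :: "('a \<Rightarrow> bool) \<Rightarrow> ('a \<Rightarrow> 'a \<Rightarrow> bool) \<Rightarrow> 'a \<Rightarrow> 'a \<Rightarrow> bool"
  for S R where
  ec_refl: "S x \<Longrightarrow> equivclose S R x x"
| ec_gen: "S x \<Longrightarrow> S y \<Longrightarrow> R x y \<Longrightarrow> equivclose S R x y"
| ec_sym: "equivclose S R x y \<Longrightarrow> equivclose S R y x"
| ec_trans: "equivclose S R x y \<Longrightarrow> equivclose S R y z \<Longrightarrow> equivclose S R x z"

text \<open>Generating relation of the coend for [[P Q]]_n(Delta, a):
  (i) componentwise equivalence in [[P]] and [[Q]];
  (ii) the coend over Gamma_0..Gamma_k in (SD)^n;
  (iii) the coend over as in SD.
  eP, eQ are the equivalences of [[P]]_n and [[Q]]_n.\<close>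
definition app_gen ::
  "('o, 'm) cat \<Rightarrow> fclass \<Rightarrow> lterm \<Rightarrow> lterm \<Rightarrow> nat \<Rightarrow> 'o ctx \<Rightarrow> 'o ty \<Rightarrow>
   ('o ctx \<Rightarrow> 'o ty \<Rightarrow> ('o, 'm) el \<Rightarrow> ('o, 'm) el \<Rightarrow> bool) \<Rightarrow>
   ('o ctx \<Rightarrow> 'o ty \<Rightarrow> ('o, 'm) el \<Rightarrow> ('o, 'm) el \<Rightarrow> bool) \<Rightarrow>
   ('o, 'm) el \<Rightarrow> ('o, 'm) el \<Rightarrow> bool" where
  "app_gen A C P Q n \<Delta> a eP eQ x y \<longleftrightarrow>
     \<comment> \<open>(i)\<close>
     (\<exists>as \<Gamma>s p qs p' qs' h. x = EA as \<Gamma>s p qs h \<and> y = EA as \<Gamma>s p' qs' h \<and>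
        eP (\<Gamma>s ! 0) (Fn as a) p p' \<and> length qs' = length qs \<and>
        (\<forall>i<length as. eQ (\<Gamma>s ! Suc i) (as ! i) (qs ! i) (qs' ! i)))
   \<or> \<comment> \<open>(ii): vs ! j : Gammas ! j -> Gammas' ! j, p in [[P]](Gamma'_0, as => a),
        qs ! i in [[Q]](Gamma'_(i+1), as ! i), h : Delta -> tensor Gammas\<close>
     (\<exists>as \<Gamma>s \<Gamma>s' vs p qs h.
        length \<Gamma>s = Suc (length as) \<and> length \<Gamma>s' = length \<Gamma>s \<and> length vs = length \<Gamma>s \<and>
        (\<forall>\<Gamma>\<in>set \<Gamma>s. length \<Gamma> = n) \<and> (\<forall>\<Gamma>\<in>set \<Gamma>s'. length \<Gamma> = n) \<and>
        (\<forall>j<length \<Gamma>s. ctxhom A C (\<Gamma>s ! j) (\<Gamma>s' ! j) (vs ! j)) \<and>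
        sem A C P n (\<Gamma>s' ! 0) (Fn as a) p \<and> length qs = length as \<and>
        (\<forall>i<length as. sem A C Q n (\<Gamma>s' ! Suc i) (as ! i) (qs ! i)) \<and>
        ctxhom A C \<Delta> (ctensor n \<Gamma>s) h \<and>
        x = EA as \<Gamma>s (act A P (vs ! 0) (did A (Fn as a)) p)
              (map (\<lambda>i. act A Q (vs ! Suc i) (did A (as ! i)) (qs ! i)) [0..<length as]) h \<and>
        y = EA as \<Gamma>s' p qs (ccompc A h (ctensor_mor n \<Gamma>s vs)))
   \<or> \<comment> \<open>(iii): <alpha, fs> : as -> bs in SD, p in [[P]](Gamma_0, bs => a),
        qs ! i in [[Q]](Gamma_(i+1), as ! i), h : Delta -> tensor Gammas\<close>
     (\<exists>as bs \<alpha> fs \<Gamma>s p qs h.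
        shom A C as bs (\<alpha>, fs) \<and>
        length \<Gamma>s = Suc (length as) \<and> (\<forall>\<Gamma>\<in>set \<Gamma>s. length \<Gamma> = n) \<and>
        sem A C P n (\<Gamma>s ! 0) (Fn bs a) p \<and> length qs = length as \<and>
        (\<forall>i<length as. sem A C Q n (\<Gamma>s ! Suc i) (as ! i) (qs ! i)) \<and>
        ctxhom A C \<Delta> (ctensor n \<Gamma>s) h \<and>
        x = EA as \<Gamma>s (act A P (cidc A (\<Gamma>s ! 0)) (FM \<alpha> fs (did A a)) p) qs h \<and>
        y = EA bs (map (\<lambda>j. \<Gamma>s ! j) (0 # map Suc \<alpha>)) p
              (map (\<lambda>(j, g). act A Q (cidc A (\<Gamma>s ! Suc j)) g (qs ! j)) (zip \<alpha> fs))
              (ccompc A h (cblock A n \<Gamma>s (0 # map Suc \<alpha>))))"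

text \<open>eqv A C M n Delta a : the equivalence on representatives whose quotient is
  [[M]]_n(Delta, a).\<close>
fun eqv :: "('o, 'm) cat \<Rightarrow> fclass \<Rightarrow> lterm \<Rightarrow> nat \<Rightarrow> 'o ctx \<Rightarrow> 'o ty \<Rightarrow>
    ('o, 'm) el \<Rightarrow> ('o, 'm) el \<Rightarrow> bool" where
  "eqv A C (LVar i) n \<Delta> a x y = (sem A C (LVar i) n \<Delta> a x \<and> x = y)"
| "eqv A C (LLam P) n \<Delta> a x y = (case (a, x, y) of
      (Fn as b, EL x', EL y') \<Rightarrow> eqv A C P (Suc n) (\<Delta> @ [as]) b x' y'
    | _ \<Rightarrow> False)"
| "eqv A C (LApp P Q) n \<Delta> a x y =
     equivclose (sem A C (LApp P Q) n \<Delta> a)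
       (app_gen A C P Q n \<Delta> a (eqv A C P n) (eqv A C Q n)) x y"

definition Den :: "('o, 'm) cat \<Rightarrow> fclass \<Rightarrow> lterm \<Rightarrow> nat \<Rightarrow> 'o ctx \<Rightarrow> 'o ty \<Rightarrow>
    ('o, 'm) el set set" where
  "Den A C M n \<Delta> a = {{y. eqv A C M n \<Delta> a x y} | x. sem A C M n \<Delta> a x}"

definition DAct :: "('o, 'm) cat \<Rightarrow> fclass \<Rightarrow> lterm \<Rightarrow> nat \<Rightarrow> 'o ctx \<Rightarrow> 'o ty \<Rightarrow>
    'm smor list \<Rightarrow> 'm dmor \<Rightarrow> ('o, 'm) el set \<Rightarrow> ('o, 'm) el set" where
  "DAct A C M n \<Delta>' a' u f X = {y. eqv A C M n \<Delta>' a' (act A M u f (SOME x. x \<in> X)) y}"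

end

(*
  For a beta-redex the two coends of [[(lambda y. P) Q]] say: an element of [[P]] at (Gamma, <a_1,...,a_k>), elements of [[Q]]
  at (Gamma_i, a_i), and a morphism from Delta to the tensor of Gamma, Gamma_1, ..., Gamma_k. This is the composite of [[P]]
  with the functor "environments" which feeds the last component of the context from [[Q]] (subst_env). It remains to see
  that composing with environments is substitution, by induction on P: environments over a tensor are the Day convolution of
  environments over the factors (application), an extra identity component may be carried along (abstraction), and
  variables are representable (co-Yoneda). The induction has to go under binders, where Q is weakened; weakening is itself
  a composition with environments, those without any Q, so one induction (cmp_iso) serves both.

  All four classes of functions are treated at once: equations are checked in the completion that allows all functions,
  where the tensor is a product and morphisms into it are determined by their projections, although the projections
  themselves need not lie in the given class.
*)

theory Submission
  imports Defs
begin

text \<open>A coend is a generated equivalence without normal forms. Therefore functors are kept on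
  representatives, with values in setoids; a map out of a coend is verified on the generators, and
  one that depends on several coend variables is changed in one variable at a time. The action of a
  denotation is functorial only up to the equivalence, and this decides which laws below are
  equations and which are not: environments compose strictly with morphisms of their source, but
  only up to equivalence with morphisms of their target, which act on the elements of
  \<open>Q\<close>. Membership in the class of functions is kept apart from the equations. It
  follows from closure under composition, disjoint sum and block reindexing; for the symmetry that
  sorts the blocks of several environments it follows from invertibility, since bijections lie in
  all four classes. The number \<open>k\<close> of binders passed is a parameter of every
  construction, because the variable that is replaced stays at a fixed position of the context while
  its de Bruijn index grows with \<open>k\<close>.\<close>

section \<open>Closure properties of the four classes of functions\<close>

definition cls :: "fclass \<Rightarrow> nat \<Rightarrow> nat list \<Rightarrow> bool" where
  "cls C n \<alpha> \<longleftrightarrow> (case C of Bijections \<Rightarrow> distinct \<alpha> \<and> set \<alpha> = {..<n}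
      | Injections \<Rightarrow> distinct \<alpha>
      | Surjections \<Rightarrow> set \<alpha> = {..<n}
      | AllFunctions \<Rightarrow> True)"

lemma in_class_iff: "in_class C m n \<alpha> \<longleftrightarrow> length \<alpha> = m \<and> (\<forall>j\<in>set \<alpha>. j < n) \<and> cls C n \<alpha>"
  by (simp add: in_class_def cls_def)

text \<open>Bijections lie in all four classes, so identities and symmetries are available whatever
  \<open>C\<close> is.\<close>

lemma cls_bij: "distinct \<alpha> \<Longrightarrow> set \<alpha> = {..<n} \<Longrightarrow> cls C n \<alpha>"
  by (auto simp: cls_def split: fclass.split)

lemma cls_id [simp]: "cls C n [0..<n]"
  by (rule cls_bij) auto

text \<open>The range condition on \<open>\<beta>\<close> keeps \<open>(!)\<close> away from
  positions outside \<open>\<alpha>\<close>, where its value is unspecified.\<close>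

lemma cls_comp:
  assumes "cls C n \<alpha>" "cls C m \<beta>" "length \<alpha> = m" "\<forall>j\<in>set \<beta>. j < m"
  shows "cls C n (map ((!) \<alpha>) \<beta>)"
proof -
  have d: "distinct (map ((!) \<alpha>) \<beta>)" if "distinct \<alpha>" "distinct \<beta>"
    using that assms by (auto simp: distinct_map inj_on_def nth_eq_iff_index_eq)
  have s: "set (map ((!) \<alpha>) \<beta>) = set \<alpha>" if "set \<beta> = {..<m}"
    unfolding set_map that by (simp add: assms(3)[symmetric] atLeast0LessThan[symmetric] nth_image)
  show ?thesis using assms d s by (auto simp: cls_def split: fclass.splits)
qed

text \<open>A tensor product of morphisms has a disjoint sum as index function. The bound on
  \<open>\<alpha>\<close> keeps its values apart from the shifted values of \<open>\<beta>\<close>,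
  which preserves injectivity.\<close>

lemma cls_append:
  assumes "cls C n \<alpha>" "cls C m \<beta>" "\<forall>j\<in>set \<alpha>. j < n"
  shows "cls C (n + m) (\<alpha> @ map ((+) n) \<beta>)"
proof -
  have d: "distinct (\<alpha> @ map ((+) n) \<beta>)" if "distinct \<alpha>" "distinct \<beta>"
    using that assms(3) by (auto simp: distinct_map)
  have s: "set (\<alpha> @ map ((+) n) \<beta>) = {..<n + m}" if "set \<alpha> = {..<n}" "set \<beta> = {..<m}"
  proof -
    have "(+) n ` {..<m} = {n..<n+m}" by (auto simp: image_iff Bex_def) presburger
    then show ?thesis using that by auto
  qed
  show ?thesis using assms d s by (auto simp: cls_def split: fclass.splits)
qed

section \<open>The categories D and SD\<close>

locale dcat =
  fixes A :: "('o, 'm) cat" and C :: fclass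
  assumes cat: "is_category A"
begin

inductive_cases dhom_AtE: "dhom A C (At ob) b f"
inductive_cases dhom_FnE: "dhom A C (Fn as a) b f"
inductive_cases dhom_AtE': "dhom A C b (At ob) f"
inductive_cases dhom_FnE': "dhom A C b (Fn as a) f"

text \<open>The list component of an arrow runs backwards, from \<open>bs\<close> to
  \<open>as\<close>; read in that direction, the premises of \<open>dhom_Fn\<close> on the lists say
  that it is a morphism of SD.\<close>

lemma dhom_FnI:
  "shom A C bs as (\<alpha>, fs) \<Longrightarrow> dhom A C a b f \<Longrightarrow> dhom A C (Fn as a) (Fn bs b) (FM \<alpha> fs f)"
  unfolding shom_def by (auto intro: dhom_Fn)

lemma dhom_Fn_iff:
  "dhom A C (Fn as a) (Fn bs b) (FM \<alpha> fs f) \<longleftrightarrow> shom A C bs as (\<alpha>, fs) \<and> dhom A C a b f"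
  by (auto intro!: dhom_FnI elim: dhom_FnE simp: shom_def)

text \<open>The guard with \<open>AM undefined\<close> serves the termination of
  \<open>dcomp\<close>; for well-typed arguments every index is in range and the guard
  disappears.\<close>

lemma dcomp_FM:
  "dcomp A (FM \<alpha> fs f) (FM \<beta> gs g) =
    FM (map ((!) \<beta>) \<alpha>) (map2 (\<lambda>j h. dcomp A (if j < length gs then gs ! j else AM undefined) h) \<alpha> fs)
      (dcomp A f g)"
  by simp

lemma dhom_did: "dhom A C a a (did A a)"
proof (induction a)
  case (At x)
  then show ?case using cat by (auto intro!: dhom_At simp: is_category_def)
next
  case (Fn as a)
  then show ?case by (auto intro!: dhom_Fn simp: in_class_iff)
qed

text \<open>Induction on the middle object: in the contravariant list part the two factors change
  order, but their common object is a component of \<open>b\<close> all the same.\<close>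

lemma dhom_dcomp:
  "dhom A C a b f \<Longrightarrow> dhom A C b c g \<Longrightarrow> dhom A C a c (dcomp A f g)"
proof (induction b arbitrary: a c f g)
  case (At x)
  then show ?case using cat
    by (auto elim!: dhom_AtE dhom_AtE' intro!: dhom_At simp: is_category_def)
next
  case (Fn bs b)
  from Fn.prems(1) obtain as a' \<alpha> fs f' where
    1: "a = Fn as a'" "f = FM \<alpha> fs f'" "in_class C (length as) (length bs) \<alpha>"
       "length fs = length as" "\<forall>i<length as. dhom A C (bs ! (\<alpha> ! i)) (as ! i) (fs ! i)" "dhom A C a' b f'"
    by (auto elim!: dhom_FnE')
  from Fn.prems(2) obtain cs c' \<beta> gs g' where
    2: "c = Fn cs c'" "g = FM \<beta> gs g'" "in_class C (length bs) (length cs) \<beta>"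
       "length gs = length bs" "\<forall>i<length bs. dhom A C (cs ! (\<beta> ! i)) (bs ! i) (gs ! i)" "dhom A C b c' g'"
    by (auto elim!: dhom_FnE)
  have "dhom A C (Fn as a') (Fn cs c') (dcomp A f g)"
    unfolding 1(2) 2(2) dcomp_FM
  proof (rule dhom_Fn)
    show "in_class C (length as) (length cs) (map ((!) \<beta>) \<alpha>)"
      using 1(3) 2(3) by (auto simp: in_class_iff intro!: cls_comp)
    show "dhom A C a' c' (dcomp A f' g')" by (rule Fn.IH(2)) fact+
    show "\<forall>i<length as. dhom A C (cs ! (map ((!) \<beta>) \<alpha> ! i)) (as ! i)
       (map2 (\<lambda>j. dcomp A (if j < length gs then gs ! j else AM undefined)) \<alpha> fs ! i)"
    proof (intro allI impI)
      fix i assume i: "i < length as"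
      then have ai: "\<alpha> ! i < length bs" using 1(3) by (auto simp: in_class_iff)
      have "dhom A C (cs ! (\<beta> ! (\<alpha> ! i))) (as ! i) (dcomp A (gs ! (\<alpha> ! i)) (fs ! i))"
        by (rule Fn.IH(1)[of "bs ! (\<alpha> ! i)"]) (use ai i 1 2 in auto)
      then show "dhom A C (cs ! (map ((!) \<beta>) \<alpha> ! i)) (as ! i)
       (map2 (\<lambda>j. dcomp A (if j < length gs then gs ! j else AM undefined)) \<alpha> fs ! i)"
        using i 1 2 ai by (simp add: in_class_iff)
    qed
  qed (use 1 2 in \<open>auto simp: in_class_iff\<close>)
  then show ?case using 1 2 by simp
qed

lemma dcomp_ids: "dhom A C a b f \<Longrightarrow> dcomp A (did A a) f = f \<and> dcomp A f (did A b) = f"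
proof (induction rule: dhom.induct)
  case (dhom_At m ob ob')
  then show ?case using cat by (auto simp: is_category_def)
next
  case (dhom_Fn as bs \<alpha> fs a b f)
  then show ?case
    by (auto simp: in_class_iff intro!: nth_equalityI)
qed

lemmas dcomp_idl = dcomp_ids[THEN conjunct1] and dcomp_idr = dcomp_ids[THEN conjunct2]

text \<open>The contravariant part reverses the three factors, so the components of \<open>b\<close>
  and \<open>c\<close> swap their roles as the two middle objects. The sum of their sizes is
  symmetric under this swap and decreases.\<close>

lemma dcomp_assoc:
  "dhom A C a b f \<Longrightarrow> dhom A C b c g \<Longrightarrow> dhom A C c d h \<Longrightarrow>
   dcomp A (dcomp A f g) h = dcomp A f (dcomp A g h)"
proof (induction "size b + size c" arbitrary: a b c d f g h rule: less_induct)
  case less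
  show ?case
  proof (cases b)
    case (At ob)
    then show ?thesis using cat less.prems
      by (auto elim!: dhom_AtE dhom_AtE' simp: is_category_def)
  next
    case (Fn bs b')
    from less.prems(1) Fn obtain as a' \<alpha> fs f' where
      1: "f = FM \<alpha> fs f'" "in_class C (length as) (length bs) \<alpha>"
       "length fs = length as" "\<forall>i<length as. dhom A C (bs ! (\<alpha> ! i)) (as ! i) (fs ! i)" "dhom A C a' b' f'"
      by (auto elim!: dhom_FnE')
    from less.prems(2) Fn obtain cs c' \<beta> gs g' where
      2: "c = Fn cs c'" "g = FM \<beta> gs g'" "in_class C (length bs) (length cs) \<beta>"
       "length gs = length bs" "\<forall>i<length bs. dhom A C (cs ! (\<beta> ! i)) (bs ! i) (gs ! i)" "dhom A C b' c' g'"
      by (auto elim!: dhom_FnE)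
    from less.prems(3) 2(1) obtain ds d' \<gamma> hs h' where
      3: "h = FM \<gamma> hs h'" "in_class C (length cs) (length ds) \<gamma>"
       "length hs = length cs" "\<forall>i<length cs. dhom A C (ds ! (\<gamma> ! i)) (cs ! i) (hs ! i)" "dhom A C c' d' h'"
      by (auto elim!: dhom_FnE)
    have e: "dcomp A (dcomp A (hs ! (\<beta> ! (\<alpha> ! i))) (gs ! (\<alpha> ! i))) (fs ! i) =
          dcomp A (hs ! (\<beta> ! (\<alpha> ! i))) (dcomp A (gs ! (\<alpha> ! i)) (fs ! i))" if "i < length as" for i
    proof -
      have ai: "\<alpha> ! i < length bs" using that 1 by (auto simp: in_class_iff)
      then have bi: "\<beta> ! (\<alpha> ! i) < length cs" using 2 by (auto simp: in_class_iff)
      have s1: "size (bs ! (\<alpha> ! i)) < size b"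
        using Fn ai size_list_estimation'[of "bs ! (\<alpha> ! i)" bs "size (bs ! (\<alpha> ! i))" size]
        by (auto simp: less_Suc_eq_le)
      have s2: "size (cs ! (\<beta> ! (\<alpha> ! i))) < size c"
        using 2(1) bi size_list_estimation'[of "cs ! (\<beta> ! (\<alpha> ! i))" cs "size (cs ! (\<beta> ! (\<alpha> ! i)))" size]
        by (auto simp: less_Suc_eq_le)
      show ?thesis
        by (rule less.hyps[of "cs ! (\<beta> ! (\<alpha> ! i))" "bs ! (\<alpha> ! i)"])
          (use s1 s2 1 2 3 ai bi that in auto)
    qed
    have e': "dcomp A (dcomp A f' g') h' = dcomp A f' (dcomp A g' h')"
      by (rule less.hyps[of b' c']) (use 1 2 3 Fn in auto)
    show ?thesis
      using e e' 1(1-4) 2(1-4) 3(1-3)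
      by (auto simp: in_class_iff intro!: nth_equalityI)
  qed
qed

text \<open>Morphisms of the free finite-product completion, i.e. of SD for the class of all functions.\<close>

definition shomw :: "'o ty list \<Rightarrow> 'o ty list \<Rightarrow> 'm smor \<Rightarrow> bool" where
  "shomw xs ys u \<longleftrightarrow> length (fst u) = length ys \<and> length (snd u) = length ys \<and>
     (\<forall>i<length ys. fst u ! i < length xs \<and> dhom A C (xs ! (fst u ! i)) (ys ! i) (snd u ! i))"

lemma shom_iff: "shom A C xs ys u \<longleftrightarrow> shomw xs ys u \<and> cls C (length xs) (fst u)"
  by (cases u) (auto simp: shom_def shomw_def in_class_iff all_set_conv_all_nth)

lemma shom_shomw: "shom A C xs ys u \<Longrightarrow> shomw xs ys u"
  by (simp add: shom_iff)

lemma scomp_eq: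
  "scomp A u v = (map ((!) (fst u)) (fst v), map2 (\<lambda>j g. dcomp A (snd u ! j) g) (fst v) (snd v))"
  by (cases u; cases v) (simp add: scomp_def)

lemma fst_scomp [simp]: "fst (scomp A u v) = map ((!) (fst u)) (fst v)"
  by (simp add: scomp_eq)

lemma snd_scomp: "snd (scomp A u v) = map2 (\<lambda>j g. dcomp A (snd u ! j) g) (fst v) (snd v)"
  by (simp add: scomp_eq)

lemma shomw_scomp: "shomw xs ys u \<Longrightarrow> shomw ys zs v \<Longrightarrow> shomw xs zs (scomp A u v)"
  by (auto simp: shomw_def snd_scomp intro: dhom_dcomp)

lemma shom_scomp: "shom A C xs ys u \<Longrightarrow> shom A C ys zs v \<Longrightarrow> shom A C xs zs (scomp A u v)"
  unfolding shom_iff fst_scomp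
  by (intro conjI, blast intro: shomw_scomp, rule cls_comp) (auto simp: shomw_def in_set_conv_nth)

lemma fst_sid [simp]: "fst (sid A xs) = [0..<length xs]"
  and snd_sid: "snd (sid A xs) = map (did A) xs"
  by (simp_all add: sid_def)

lemma shom_sid: "shom A C xs xs (sid A xs)"
  by (auto simp: shom_iff shomw_def snd_sid dhom_did)

lemma scomp_idl: "shomw xs ys u \<Longrightarrow> scomp A (sid A xs) u = u"
  by (auto simp: shomw_def snd_sid snd_scomp dcomp_idl intro!: prod_eqI nth_equalityI)

lemma scomp_idr: "shomw xs ys u \<Longrightarrow> scomp A u (sid A ys) = u"
  by (auto simp: shomw_def snd_sid snd_scomp dcomp_idr intro!: prod_eqI nth_equalityI)

lemma scomp_assoc:
  "shomw xs ys u \<Longrightarrow> shomw ys zs v \<Longrightarrow> shomw zs ws w \<Longrightarrow>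
   scomp A (scomp A u v) w = scomp A u (scomp A v w)"
proof (intro prod_eqI nth_equalityI, goal_cases)
  case (4 i)
  then have i: "i < length (snd w)" "length (fst w) = length (snd w)" by (auto simp: shomw_def snd_scomp)
  have "dcomp A (dcomp A (snd u ! (fst v ! (fst w ! i))) (snd v ! (fst w ! i))) (snd w ! i) =
    dcomp A (snd u ! (fst v ! (fst w ! i))) (dcomp A (snd v ! (fst w ! i)) (snd w ! i))"
    by (rule dcomp_assoc[of "xs ! (fst u ! (fst v ! (fst w ! i)))" "ys ! (fst v ! (fst w ! i))" _
        "zs ! (fst w ! i)" _ "ws ! i"]) (use 4 in \<open>auto simp: shomw_def snd_scomp\<close>)
  then show ?case using 4(1-3) i by (simp add: shomw_def snd_scomp)
qed (auto simp: shomw_def snd_scomp)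

text \<open>On the list parts, composition in D is composition in SD in the reverse order; through
  this the laws of SD apply to arrows.\<close>

lemma dcomp_FM_scomp:
  assumes "shomw bs as (\<alpha>, fs)" "shomw cs bs (\<beta>, gs)"
  shows "dcomp A (FM \<alpha> fs f) (FM \<beta> gs g) =
    FM (fst (scomp A (\<beta>, gs) (\<alpha>, fs))) (snd (scomp A (\<beta>, gs) (\<alpha>, fs))) (dcomp A f g)"
  using assms unfolding dcomp_FM by (auto simp: snd_scomp shomw_def set_zip intro!: nth_equalityI)

text \<open>One inverse law makes the index function of \<open>u\<close> injective, the other
  surjective, and a bijection lies in each class. Membership of a symmetry in \<open>C\<close> thus
  follows from equations, without a computation on indices.\<close>

lemma shomw_inverse_shom:
  assumes "shomw xs ys u" "shomw ys xs v" "scomp A u v = sid A xs" "scomp A v u = sid A ys"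
  shows "shom A C xs ys u"
proof -
  from assms(3) have 1: "map ((!) (fst u)) (fst v) = [0..<length xs]"
    using fst_scomp fst_sid by metis
  from assms(4) have 2: "map ((!) (fst v)) (fst u) = [0..<length ys]"
    using fst_scomp fst_sid by metis
  have "distinct (map ((!) (fst v)) (fst u))" unfolding 2 by simp
  then have d: "distinct (fst u)" by (simp add: distinct_map)
  have "{..<length xs} = (!) (fst u) ` set (fst v)" using arg_cong[OF 1, of set] by auto
  also have "\<dots> \<subseteq> set (fst u)" using assms(1,2) by (auto simp: shomw_def in_set_conv_nth) metis
  finally have "set (fst u) = {..<length xs}" using assms(1) by (auto simp: shomw_def in_set_conv_nth)
  with d assms(1) show ?thesis by (auto simp: shom_iff intro: cls_bij)
qed

end

section \<open>Offsets in concatenated lists\<close>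

text \<open>The list form of \<open>coff\<close>, detached from contexts, so that facts on positions
  can be proved for arbitrary concatenations.\<close>

definition off :: "'a list list \<Rightarrow> nat \<Rightarrow> nat" where
  "off xss j = length (concat (take j xss))"

lemma off_0 [simp]: "off xss 0 = 0"
  by (simp add: off_def)

lemma off_Cons_Suc [simp]: "off (x # xss) (Suc j) = length x + off xss j"
  by (simp add: off_def)

lemma off_cong:
  "map length xss = map length yss \<Longrightarrow> off xss j = off yss j"
  by (simp add: off_def length_concat take_map[symmetric])

lemma take_off_concat:
  assumes "j < length xss" "t \<le> length (xss ! j)"
  shows "take (off xss j + t) (concat xss) = concat (take j xss) @ take t (xss ! j)"
proof -
  have "concat xss = concat (take j xss) @ xss ! j @ concat (drop (Suc j) xss)"
    by (metis assms(1) concat.simps(2) concat_append id_take_nth_drop)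
  then show ?thesis using assms(2) by (simp add: off_def)
qed

lemma off_bound: "j < length xss \<Longrightarrow> t < length (xss ! j) \<Longrightarrow> off xss j + t < length (concat xss)"
proof (induction xss arbitrary: j)
  case (Cons x xss) then show ?case by (cases j) auto
qed simp

lemma off_le: "j < length xss \<Longrightarrow> off xss j + length (xss ! j) \<le> length (concat xss)"
proof (induction xss arbitrary: j)
  case (Cons x xss) then show ?case by (cases j) auto
qed simp

lemma nth_concat_off:
  "j < length xss \<Longrightarrow> t < length (xss ! j) \<Longrightarrow> concat xss ! (off xss j + t) = xss ! j ! t"
proof (induction xss arbitrary: j)
  case (Cons x xss) then show ?case by (cases j) (auto simp: nth_append)
qed simp

text \<open>With \<open>off_bound\<close> and \<open>off_inj\<close>, positions of a concatenation
  correspond to pairs of a block and a position inside it. This replaces inductions over the list of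
  blocks.\<close>

lemma ex_off:
  "p < length (concat xss) \<Longrightarrow> \<exists>j t. j < length xss \<and> t < length (xss ! j) \<and> p = off xss j + t"
proof (induction xss arbitrary: p)
  case (Cons x xss)
  show ?case
  proof (cases "p < length x")
    case True then show ?thesis by (intro exI[of _ 0] exI[of _ p]) auto
  next
    case False
    then have "p - length x < length (concat xss)" using Cons.prems by auto
    from Cons.IH[OF this] obtain j t where
      "j < length xss" "t < length (xss ! j)" "p - length x = off xss j + t" by blast
    then show ?thesis using False by (intro exI[of _ "Suc j"] exI[of _ t]) auto
  qed
qed simp

lemma off_inj:
  "j < length xss \<Longrightarrow> t < length (xss ! j) \<Longrightarrow> j' < length xss \<Longrightarrow> t' < length (xss ! j') \<Longrightarrow>
   off xss j + t = off xss j' + t' \<Longrightarrow> j = j' \<and> t = t'"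
proof (induction xss arbitrary: j j')
  case (Cons x xss) then show ?case by (cases j; cases j') auto
qed simp

text \<open>An iterated disjoint sum, by \<open>cls_append\<close>. The empty sum is the identity of
  the empty ordinal and hence in every class.\<close>

lemma cls_tensor:
  assumes "length \<alpha>s = length xss"
    and "\<And>j. j < length xss \<Longrightarrow> cls C (length (xss ! j)) (\<alpha>s ! j) \<and> (\<forall>i\<in>set (\<alpha>s ! j). i < length (xss ! j))"
  shows "cls C (length (concat xss)) (concat (map (\<lambda>j. map ((+) (off xss j)) (\<alpha>s ! j)) [0..<length \<alpha>s]))"
  using assms
proof (induction xss arbitrary: \<alpha>s)
  case Nil
  then show ?case using cls_id[of C 0] by simp
next
  case (Cons x xss)
  obtain \<alpha> \<beta>s where \<alpha>: "\<alpha>s = \<alpha> # \<beta>s" using Cons.prems(1) by (cases \<alpha>s) auto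
  have "cls C (length (concat xss)) (concat (map (\<lambda>j. map ((+) (off xss j)) (\<beta>s ! j)) [0..<length \<beta>s]))"
    using Cons.prems \<alpha> by (intro Cons.IH) force+
  then have "cls C (length x + length (concat xss))
    (\<alpha> @ map ((+) (length x)) (concat (map (\<lambda>j. map ((+) (off xss j)) (\<beta>s ! j)) [0..<length \<beta>s])))"
    using Cons.prems(2)[of 0] \<alpha> by (intro cls_append) auto
  also have "\<alpha> @ map ((+) (length x)) (concat (map (\<lambda>j. map ((+) (off xss j)) (\<beta>s ! j)) [0..<length \<beta>s]))
    = concat (map (\<lambda>j. map ((+) (off (x # xss) j)) (\<alpha>s ! j)) [0..<length \<alpha>s])"
    by (simp add: \<alpha> map_upt_Suc map_concat comp_def add.assoc del: upt_Suc)
      (auto simp: map_idI add.assoc intro!: arg_cong[of _ _ concat])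
  finally show ?case by simp
qed

text \<open>Different blocks occupy disjoint intervals, so an injective choice of blocks stays
  injective; all blocks together cover all positions, so a surjective choice stays
  surjective.\<close>

lemma cls_block:
  assumes "cls C (length xss) \<beta>" "\<forall>j\<in>set \<beta>. j < length xss"
  shows "cls C (length (concat xss))
    (concat (map (\<lambda>j. map ((+) (off xss j)) [0..<length (xss ! j)]) \<beta>))" (is "cls C _ ?c")
proof -
  have d: "distinct ?c" if "distinct \<beta>"
    using that assms(2)
  proof (induction \<beta>)
    case (Cons b \<beta>)
    have "j = b" if "j < length xss" "off xss b \<le> x" "x < length (xss ! b) + off xss b"
      "off xss j \<le> x" "x < length (xss ! j) + off xss j" for j x
      using off_inj[of j xss "x - off xss j" b "x - off xss b"] that Cons.prems by auto
    with Cons show ?case by (auto simp: distinct_map) metis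
  qed simp
  have "set ?c = (\<Union>j\<in>set \<beta>. (+) (off xss j) ` {..<length (xss ! j)})"
    by (simp add: atLeast0LessThan)
  then have s: "set ?c = {..<length (concat xss)}" if "set \<beta> = {..<length xss}"
    unfolding that by (auto simp: off_bound image_iff simp del: length_concat dest!: ex_off)
  show ?thesis using assms(1) d s by (auto simp: cls_def split: fclass.splits)
qed

section \<open>Cartesian structure\<close>

context dcat
begin

definition prj :: "'o ty list list \<Rightarrow> nat \<Rightarrow> 'm smor" where
  "prj yss j = (map ((+) (off yss j)) [0..<length (yss ! j)], map (did A) (yss ! j))"

definition tup :: "'m smor list \<Rightarrow> 'm smor" where
  "tup us = (concat (map fst us), concat (map snd us))"

lemma shomw_prj: "j < length yss \<Longrightarrow> shomw (concat yss) (yss ! j) (prj yss j)"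
  by (auto simp: shomw_def prj_def nth_concat_off off_bound dhom_did)

lemma shomw_append:
  "shomw xs ys u \<Longrightarrow> shomw xs zs v \<Longrightarrow> shomw xs (ys @ zs) (fst u @ fst v, snd u @ snd v)"
  by (auto simp: shomw_def nth_append)

lemma shomw_tup:
  assumes "length us = length yss" "\<And>j. j < length yss \<Longrightarrow> shomw xs (yss ! j) (us ! j)"
  shows "shomw xs (concat yss) (tup us)"
  using assms
proof (induction us yss rule: list_induct2)
  case Nil
  then show ?case by (simp add: shomw_def tup_def)
next
  case (Cons u us ys yss)
  have "shomw xs (ys @ concat yss) (fst u @ fst (tup us), snd u @ snd (tup us))"
    using Cons.prems[of 0] Cons.IH Cons.prems[of "Suc _"] by (intro shomw_append) auto
  then show ?case by (simp add: tup_def)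
qed

text \<open>The arrows of \<open>prj\<close> are identities, so composing with it only cuts a slice
  out of both lists. Pairing and uniqueness come down to slicing a concatenation.\<close>

lemma scomp_prj:
  assumes "shomw xs (concat yss) u" "j < length yss"
  shows "scomp A u (prj yss j) = (take (length (yss ! j)) (drop (off yss j) (fst u)),
     take (length (yss ! j)) (drop (off yss j) (snd u)))"
proof -
  have b: "off yss j + t < length (concat yss)" if "t < length (yss ! j)" for t
    using off_bound[OF assms(2) that] .
  have l: "length (fst u) = length (concat yss)" "length (snd u) = length (concat yss)"
    using assms(1) by (auto simp: shomw_def)
  have m: "off yss j + length (yss ! j) \<le> length (concat yss)"
    using off_le[OF assms(2)] .
  have d: "dcomp A (snd u ! (off yss j + t)) (did A (yss ! j ! t)) = snd u ! (off yss j + t)"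
    if "t < length (yss ! j)" for t
    using assms(1) b[OF that] unfolding shomw_def nth_concat_off[OF assms(2) that, symmetric]
    by (blast intro: dcomp_idr)
  show ?thesis
    using l m by (auto simp: prj_def snd_scomp d intro!: prod_eqI nth_equalityI)
qed

lemma slice_concat:
  "j < length xss \<Longrightarrow> take (length (xss ! j)) (drop (off xss j) (concat xss)) = xss ! j"
proof (induction xss arbitrary: j)
  case (Cons x xss) then show ?case by (cases j) auto
qed simp

lemma tup_prj:
  assumes "length us = length yss" "\<And>j. j < length yss \<Longrightarrow> shomw xs (yss ! j) (us ! j)" "j < length yss"
  shows "scomp A (tup us) (prj yss j) = us ! j"
proof -
  have l: "map length yss = map length (map fst us)" "map length yss = map length (map snd us)"
    using assms(1,2) by (auto simp: shomw_def intro!: nth_equalityI)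
  have "take (length (yss ! j)) (drop (off yss j) (concat (map fst us))) = fst (us ! j)"
    unfolding off_cong[OF l(1)] using slice_concat[of j "map fst us"] assms by (simp add: shomw_def)
  moreover have "take (length (yss ! j)) (drop (off yss j) (concat (map snd us))) = snd (us ! j)"
    unfolding off_cong[OF l(2)] using slice_concat[of j "map snd us"] assms by (simp add: shomw_def)
  ultimately show ?thesis
    by (subst scomp_prj[OF shomw_tup[OF assms(1,2)]]) (use assms(3) in \<open>auto simp: tup_def\<close>)
qed

text \<open>The slices at all blocks determine both lists, as every position lies in some
  block.\<close>

lemma shomw_ext:
  assumes u: "shomw xs (concat yss) u" and v: "shomw xs (concat yss) v"
    and e: "\<And>j. j < length yss \<Longrightarrow> scomp A u (prj yss j) = scomp A v (prj yss j)"
  shows "u = v"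
proof -
  have l: "length (fst u) = length (concat yss)" "length (snd u) = length (concat yss)"
    "length (fst v) = length (concat yss)" "length (snd v) = length (concat yss)"
    using u v by (auto simp: shomw_def)
  have "fst u ! p = fst v ! p \<and> snd u ! p = snd v ! p" if "p < length (concat yss)" for p
  proof -
    obtain j t where jt: "j < length yss" "t < length (yss ! j)" "p = off yss j + t"
      using ex_off[OF \<open>p < length (concat yss)\<close>] by blast
    from e[OF jt(1)] have "take (length (yss ! j)) (drop (off yss j) (fst u)) ! t = take (length (yss ! j)) (drop (off yss j) (fst v)) ! t"
      "take (length (yss ! j)) (drop (off yss j) (snd u)) ! t = take (length (yss ! j)) (drop (off yss j) (snd v)) ! t"
      unfolding scomp_prj[OF u jt(1)] scomp_prj[OF v jt(1)] by auto
    then show ?thesis using jt that l by simp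
  qed
  then show ?thesis using l by (auto intro!: prod_eqI nth_equalityI)
qed

end

section \<open>Contexts\<close>

context dcat
begin

abbreviation ccomp_infix (infixl "\<odot>" 70) where "u \<odot> v \<equiv> ccompc A u v"

definition ctxw :: "'o ctx \<Rightarrow> 'o ctx \<Rightarrow> 'm smor list \<Rightarrow> bool" where
  "ctxw \<Delta> \<Gamma> us \<longleftrightarrow> length \<Gamma> = length \<Delta> \<and> length us = length \<Delta> \<and>
     (\<forall>c<length \<Delta>. shomw (\<Delta> ! c) (\<Gamma> ! c) (us ! c))"

lemma ctxhom_ctxw: "ctxhom A C \<Delta> \<Gamma> u \<Longrightarrow> ctxw \<Delta> \<Gamma> u"
  by (simp add: ctxhom_def ctxw_def shom_shomw)

lemma length_ccompc [simp]: "length (u \<odot> v) = min (length u) (length v)"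
  by (simp add: ccompc_def)

lemma nth_ccompc [simp]: "c < length u \<Longrightarrow> c < length v \<Longrightarrow> (u \<odot> v) ! c = scomp A (u ! c) (v ! c)"
  by (simp add: ccompc_def)

lemma ctxw_comp: "ctxw \<Delta> \<Gamma> u \<Longrightarrow> ctxw \<Gamma> \<Theta> v \<Longrightarrow> ctxw \<Delta> \<Theta> (u \<odot> v)"
  by (auto simp: ctxw_def intro: shomw_scomp)

lemma ctxhom_comp: "ctxhom A C \<Delta> \<Gamma> u \<Longrightarrow> ctxhom A C \<Gamma> \<Theta> v \<Longrightarrow> ctxhom A C \<Delta> \<Theta> (u \<odot> v)"
  by (auto simp: ctxhom_def intro: shom_scomp)

lemma length_cidc [simp]: "length (cidc A \<Delta>) = length \<Delta>"
  by (simp add: cidc_def)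

lemma nth_cidc [simp]: "c < length \<Delta> \<Longrightarrow> cidc A \<Delta> ! c = sid A (\<Delta> ! c)"
  by (simp add: cidc_def)

lemma ctxhom_cidc: "ctxhom A C \<Delta> \<Delta> (cidc A \<Delta>)"
  by (simp add: ctxhom_def shom_sid)

lemmas ctxw_cidc = ctxhom_cidc[THEN ctxhom_ctxw]

lemma ccompc_idl: "ctxw \<Delta> \<Gamma> u \<Longrightarrow> cidc A \<Delta> \<odot> u = u"
  by (auto simp: ctxw_def intro!: nth_equalityI scomp_idl)

lemma ccompc_idr: "ctxw \<Delta> \<Gamma> u \<Longrightarrow> u \<odot> cidc A \<Gamma> = u"
  by (auto simp: ctxw_def intro!: nth_equalityI scomp_idr)

lemma ccompc_assoc: "ctxw \<Delta> \<Gamma> u \<Longrightarrow> ctxw \<Gamma> \<Theta> v \<Longrightarrow> ctxw \<Theta> \<Xi> w \<Longrightarrow> u \<odot> v \<odot> w = u \<odot> (v \<odot> w)"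
  by (auto simp: ctxw_def intro!: nth_equalityI scomp_assoc)

lemma ctxw_inverse_ctxhom:
  assumes "ctxw \<Delta> \<Gamma> u" "ctxw \<Gamma> \<Delta> v" "u \<odot> v = cidc A \<Delta>" "v \<odot> u = cidc A \<Gamma>"
  shows "ctxhom A C \<Delta> \<Gamma> u"
proof -
  have "shom A C (\<Delta> ! c) (\<Gamma> ! c) (u ! c)" if c: "c < length \<Delta>" for c
  proof (rule shomw_inverse_shom)
    show "scomp A (u ! c) (v ! c) = sid A (\<Delta> ! c)" "scomp A (v ! c) (u ! c) = sid A (\<Gamma> ! c)"
      using arg_cong[OF assms(3), of "\<lambda>x. x ! c"] arg_cong[OF assms(4), of "\<lambda>x. x ! c"] assms(1,2) c
      by (auto simp: ctxw_def)
  qed (use assms c in \<open>auto simp: ctxw_def\<close>)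
  then show ?thesis using assms(1) by (simp add: ctxhom_def ctxw_def)
qed

abbreviation "lens m \<Gamma>s \<equiv> (\<forall>\<Gamma>\<in>set \<Gamma>s. length \<Gamma> = m)"
abbreviation "comp_at c \<Gamma>s \<equiv> map (\<lambda>\<Gamma>. \<Gamma> ! c) \<Gamma>s"

lemma length_ctensor [simp]: "length (ctensor m \<Gamma>s) = m"
  by (simp add: ctensor_def)

lemma nth_ctensor [simp]: "c < m \<Longrightarrow> ctensor m \<Gamma>s ! c = concat (comp_at c \<Gamma>s)"
  by (simp add: ctensor_def)

lemma ctensor_single [simp]: "length \<Gamma> = m \<Longrightarrow> ctensor m [\<Gamma>] = \<Gamma>"
  by (auto simp: ctensor_def intro!: nth_equalityI)

lemma coff_off: "coff \<Gamma>s c j = off (comp_at c \<Gamma>s) j"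
  by (simp add: coff_def off_def length_concat take_map comp_def)

text \<open>Taking the projection as the reindexing along the one-element list \<open>[j]\<close>
  makes the facts on \<open>cblock\<close> available for it; for instance, the projection from a
  single context is an identity.\<close>

definition cprj :: "nat \<Rightarrow> 'o ctx list \<Rightarrow> nat \<Rightarrow> 'm smor list" where
  "cprj m \<Gamma>s j = cblock A m \<Gamma>s [j]"

lemma length_cblock [simp]: "length (cblock A m \<Gamma>s \<beta>) = m"
  by (simp add: cblock_def)

lemma nth_cblock:
  "c < m \<Longrightarrow> \<forall>j\<in>set \<beta>. j < length \<Gamma>s \<Longrightarrow> cblock A m \<Gamma>s \<beta> ! c = tup (map (prj (comp_at c \<Gamma>s)) \<beta>)"
  by (auto simp: cblock_def tup_def prj_def coff_off map_concat comp_def intro!: arg_cong[of _ _ concat])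

lemma length_cprj [simp]: "length (cprj m \<Gamma>s j) = m"
  by (simp add: cprj_def)

lemma nth_cprj: "c < m \<Longrightarrow> j < length \<Gamma>s \<Longrightarrow> cprj m \<Gamma>s j ! c = prj (comp_at c \<Gamma>s) j"
  by (simp add: cprj_def nth_cblock) (simp add: tup_def)

lemma ctxw_cprj: "j < length \<Gamma>s \<Longrightarrow> lens m \<Gamma>s \<Longrightarrow> ctxw (ctensor m \<Gamma>s) (\<Gamma>s ! j) (cprj m \<Gamma>s j)"
  using shomw_prj[of j "comp_at _ \<Gamma>s"] by (auto simp: ctxw_def nth_cprj)

text \<open>Joint monicity of the projections. Most later equations between context morphisms are
  reduced to it; \<open>tgt_ext\<close>, \<open>tgts_ext\<close> and \<open>big_ext\<close> are its
  iterated forms.\<close>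

lemma ctxw_ext:
  assumes "ctxw \<Delta> (ctensor m \<Gamma>s) u" "ctxw \<Delta> (ctensor m \<Gamma>s) v"
    and "\<And>j. j < length \<Gamma>s \<Longrightarrow> u \<odot> cprj m \<Gamma>s j = v \<odot> cprj m \<Gamma>s j"
  shows "u = v"
proof (rule nth_equalityI)
  show l: "length u = length v" using assms by (simp add: ctxw_def)
  fix c assume c: "c < length u"
  show "u ! c = v ! c"
  proof (rule shomw_ext[of "\<Delta> ! c" "comp_at c \<Gamma>s"])
    fix j assume j: "j < length (comp_at c \<Gamma>s)"
    show "scomp A (u ! c) (prj (comp_at c \<Gamma>s) j) = scomp A (v ! c) (prj (comp_at c \<Gamma>s) j)"
      using arg_cong[OF assms(3)[of j], of "\<lambda>x. x ! c"] c l j assms(1,2)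
      by (simp add: nth_cprj ctxw_def)
  qed (use assms c in \<open>auto simp: ctxw_def\<close>)
qed

definition ctup :: "nat \<Rightarrow> 'm smor list list \<Rightarrow> 'm smor list" where
  "ctup m us = map (\<lambda>c. tup (map (\<lambda>u. u ! c) us)) [0..<m]"

lemma ctup:
  assumes "length us = length \<Gamma>s" "length \<Delta> = m" "lens m \<Gamma>s"
    and "\<And>j. j < length \<Gamma>s \<Longrightarrow> ctxw \<Delta> (\<Gamma>s ! j) (us ! j)"
  shows ctxw_ctup: "ctxw \<Delta> (ctensor m \<Gamma>s) (ctup m us)"
    and ctup_cprj: "j < length \<Gamma>s \<Longrightarrow> ctup m us \<odot> cprj m \<Gamma>s j = us ! j"
proof -
  show "ctxw \<Delta> (ctensor m \<Gamma>s) (ctup m us)"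
    unfolding ctxw_def using assms by (auto simp: ctup_def ctxw_def intro!: shomw_tup)
  show "ctup m us \<odot> cprj m \<Gamma>s j = us ! j" if "j < length \<Gamma>s"
    using assms that
    by (auto simp: ctup_def ctxw_def nth_cprj intro!: nth_equalityI)
      (subst tup_prj[of _ _ "\<Delta> ! _"]; auto)
qed

text \<open>This moves \<open>cblock\<close> from index lists to the universal property of the
  product; \<open>cblock_cprj\<close> is the form in which equations use it.\<close>

lemma cblock_eq_ctup:
  "\<forall>j\<in>set \<beta>. j < length \<Gamma>s \<Longrightarrow> cblock A m \<Gamma>s \<beta> = ctup m (map (cprj m \<Gamma>s) \<beta>)"
  by (auto simp: ctup_def nth_cblock nth_cprj comp_def intro!: nth_equalityI arg_cong[of _ _ tup])

lemma cblock_weak: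
  assumes "\<forall>j\<in>set \<beta>. j < length \<Gamma>s" "lens m \<Gamma>s"
  shows ctxw_cblock: "ctxw (ctensor m \<Gamma>s) (ctensor m (map ((!) \<Gamma>s) \<beta>)) (cblock A m \<Gamma>s \<beta>)"
    and cblock_cprj: "j < length \<beta> \<Longrightarrow>
      cblock A m \<Gamma>s \<beta> \<odot> cprj m (map ((!) \<Gamma>s) \<beta>) j = cprj m \<Gamma>s (\<beta> ! j)"
  unfolding cblock_eq_ctup[OF assms(1)] using assms
  by (auto intro!: ctxw_ctup ctxw_cprj simp: ctup_cprj ctxw_cprj)
     (subst ctup_cprj; auto intro!: ctxw_cprj)

text \<open>The typing comes from the projections; only the index function has to respect the class,
  and \<open>cls_block\<close> supplies that.\<close>

lemma ctxhom_cblock: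
  assumes "in_class C (length \<beta>) (length \<Gamma>s) \<beta>" "lens m \<Gamma>s"
  shows "ctxhom A C (ctensor m \<Gamma>s) (ctensor m (map ((!) \<Gamma>s) \<beta>)) (cblock A m \<Gamma>s \<beta>)"
proof -
  have b: "\<forall>j\<in>set \<beta>. j < length \<Gamma>s" "cls C (length \<Gamma>s) \<beta>" using assms(1) by (auto simp: in_class_iff)
  have "cls C (length (concat (comp_at c \<Gamma>s))) (fst (cblock A m \<Gamma>s \<beta> ! c))" if c: "c < m" for c
  proof -
    have "fst (cblock A m \<Gamma>s \<beta> ! c) =
       concat (map (\<lambda>j. map ((+) (off (comp_at c \<Gamma>s) j)) [0..<length (comp_at c \<Gamma>s ! j)]) \<beta>)"
      using c b by (simp add: nth_cblock) (simp add: tup_def prj_def comp_def)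
    then show ?thesis using cls_block[of C "comp_at c \<Gamma>s" \<beta>] b by simp
  qed
  then show ?thesis using ctxw_cblock[OF b(1) assms(2)] by (auto simp: ctxhom_def ctxw_def shom_iff)
qed

lemma length_ctensor_mor [simp]: "length (ctensor_mor m \<Gamma>s vs) = m"
  by (simp add: ctensor_mor_def)

lemma ctensor_mor_eq_ctup:
  assumes "length vs = length \<Gamma>s" "lens m \<Gamma>s"
    "\<And>j. j < length \<Gamma>s \<Longrightarrow> ctxw (\<Gamma>s ! j) (\<Gamma>s' ! j) (vs ! j)"
  shows "ctensor_mor m \<Gamma>s vs = ctup m (map (\<lambda>j. cprj m \<Gamma>s j \<odot> vs ! j) [0..<length \<Gamma>s])"
proof (rule nth_equalityI)
  fix c assume c: "c < length (ctensor_mor m \<Gamma>s vs)"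
  \<comment> \<open>Composing with a projection shifts the indices by the offset and leaves the
    arrows alone, as the arrows of the projection are identities.\<close>
  have e: "(map ((+) (off (comp_at c \<Gamma>s) j)) (fst (vs ! j ! c)), snd (vs ! j ! c)) = (cprj m \<Gamma>s j \<odot> vs ! j) ! c"
    if j: "j < length \<Gamma>s" for j
  proof -
    have w: "shomw (\<Gamma>s ! j ! c) (\<Gamma>s' ! j ! c) (vs ! j ! c)" "length (vs ! j) = m"
      using assms(2) assms(3)[of j] c j by (auto simp: ctxw_def)
    have "dcomp A (did A (\<Gamma>s ! j ! c ! (fst (vs ! j ! c) ! i))) (snd (vs ! j ! c) ! i) = snd (vs ! j ! c) ! i"
      if "i < length (\<Gamma>s' ! j ! c)" for i
      using w that by (auto simp: shomw_def intro: dcomp_idl)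
    then show ?thesis using w c j
      by (auto simp: nth_cprj snd_scomp prj_def shomw_def intro!: prod_eqI nth_equalityI)
  qed
  have *: "fst ((cprj m \<Gamma>s j \<odot> vs ! j) ! c) = map ((+) (off (comp_at c \<Gamma>s) j)) (fst (vs ! j ! c))"
     "snd ((cprj m \<Gamma>s j \<odot> vs ! j) ! c) = snd (vs ! j ! c)" if "j < length \<Gamma>s" for j
    using e[OF that, symmetric] by auto
  show "ctensor_mor m \<Gamma>s vs ! c = ctup m (map (\<lambda>j. cprj m \<Gamma>s j \<odot> vs ! j) [0..<length \<Gamma>s]) ! c"
    using c by (auto simp: ctensor_mor_def ctup_def tup_def coff_off comp_def assms(1) *
      intro!: arg_cong[of _ _ concat])
qed (simp add: ctup_def)

lemma ctensor_mor_weak: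
  assumes "length vs = length \<Gamma>s" "lens m \<Gamma>s" "length \<Gamma>s' = length \<Gamma>s"
    "\<And>j. j < length \<Gamma>s \<Longrightarrow> ctxw (\<Gamma>s ! j) (\<Gamma>s' ! j) (vs ! j)"
  shows ctxw_ctensor_mor: "ctxw (ctensor m \<Gamma>s) (ctensor m \<Gamma>s') (ctensor_mor m \<Gamma>s vs)"
    and ctensor_mor_cprj: "j < length \<Gamma>s \<Longrightarrow>
      ctensor_mor m \<Gamma>s vs \<odot> cprj m \<Gamma>s' j = cprj m \<Gamma>s j \<odot> vs ! j"
proof -
  have l: "lens m \<Gamma>s'" using assms(2-4) by (auto simp: ctxw_def all_set_conv_all_nth)
  have t: "ctxw (ctensor m \<Gamma>s) (\<Gamma>s' ! j) (map (\<lambda>j. cprj m \<Gamma>s j \<odot> vs ! j) [0..<length \<Gamma>s] ! j)"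
    if "j < length \<Gamma>s'" for j
    using that assms by (auto intro!: ctxw_comp[OF ctxw_cprj])
  show "ctxw (ctensor m \<Gamma>s) (ctensor m \<Gamma>s') (ctensor_mor m \<Gamma>s vs)"
    using t l assms(3) by (subst ctensor_mor_eq_ctup[of vs \<Gamma>s m \<Gamma>s', OF assms(1,2,4)])
      (auto intro!: ctxw_ctup)
  show "ctensor_mor m \<Gamma>s vs \<odot> cprj m \<Gamma>s' j = cprj m \<Gamma>s j \<odot> vs ! j" if "j < length \<Gamma>s"
    using t l assms(3) that by (subst ctensor_mor_eq_ctup[of vs \<Gamma>s m \<Gamma>s', OF assms(1,2,4)])
      (auto simp: ctup_cprj[of _ _ "ctensor m \<Gamma>s"])
qed

lemma ctxhom_ctensor_mor:
  assumes "length vs = length \<Gamma>s" "lens m \<Gamma>s" "length \<Gamma>s' = length \<Gamma>s"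
    "\<And>j. j < length \<Gamma>s \<Longrightarrow> ctxhom A C (\<Gamma>s ! j) (\<Gamma>s' ! j) (vs ! j)"
  shows "ctxhom A C (ctensor m \<Gamma>s) (ctensor m \<Gamma>s') (ctensor_mor m \<Gamma>s vs)"
proof -
  have "cls C (length (concat (comp_at c \<Gamma>s))) (fst (ctensor_mor m \<Gamma>s vs ! c))" if c: "c < m" for c
  proof -
    have "fst (ctensor_mor m \<Gamma>s vs ! c) =
      concat (map (\<lambda>j. map ((+) (off (comp_at c \<Gamma>s) j)) (map (\<lambda>v. fst (v ! c)) vs ! j))
        [0..<length (map (\<lambda>v. fst (v ! c)) vs)])"
      using c by (auto simp: ctensor_mor_def coff_off intro!: arg_cong[of _ _ concat])
    moreover have "cls C (length (concat (comp_at c \<Gamma>s))) \<dots>"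
    proof (rule cls_tensor)
      fix j assume j: "j < length (comp_at c \<Gamma>s)"
      then have "shom A C (\<Gamma>s ! j ! c) (\<Gamma>s' ! j ! c) (vs ! j ! c)"
        using assms(2) assms(4)[of j] c by (auto simp: ctxhom_def)
      then show "cls C (length (comp_at c \<Gamma>s ! j)) (map (\<lambda>v. fst (v ! c)) vs ! j) \<and>
         (\<forall>i\<in>set (map (\<lambda>v. fst (v ! c)) vs ! j). i < length (comp_at c \<Gamma>s ! j))"
        using j assms(1) by (auto simp: shom_iff shomw_def in_set_conv_nth)
    qed (use assms(1) in simp)
    ultimately show ?thesis by simp
  qed
  then show ?thesis using ctxw_ctensor_mor[of vs \<Gamma>s m \<Gamma>s'] assms
    by (auto simp: ctxhom_def ctxw_def shom_iff)
qed

text \<open>After projection \<open>j\<close> both sides are the projection of the source followed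
  by \<open>us ! j\<close> and \<open>vs ! j\<close>.\<close>

lemma ctensor_mor_comp:
  assumes "length us = length \<Gamma>s" "length vs = length \<Gamma>s" "lens m \<Gamma>s" "length \<Gamma>s' = length \<Gamma>s" "length \<Gamma>s'' = length \<Gamma>s"
    "\<And>j. j < length \<Gamma>s \<Longrightarrow> ctxw (\<Gamma>s ! j) (\<Gamma>s' ! j) (us ! j)"
    "\<And>j. j < length \<Gamma>s \<Longrightarrow> ctxw (\<Gamma>s' ! j) (\<Gamma>s'' ! j) (vs ! j)"
  shows "ctensor_mor m \<Gamma>s us \<odot> ctensor_mor m \<Gamma>s' vs = ctensor_mor m \<Gamma>s (map2 (ccompc A) us vs)"
proof (rule ctxw_ext)
  have l': "lens m \<Gamma>s'" using assms(3,4,6) by (auto simp: ctxw_def all_set_conv_all_nth)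
  have l'': "lens m \<Gamma>s''" using l' assms(4,5,7) by (auto simp: ctxw_def all_set_conv_all_nth)
  have u: "ctxw (ctensor m \<Gamma>s) (ctensor m \<Gamma>s') (ctensor_mor m \<Gamma>s us)"
    using assms by (intro ctxw_ctensor_mor) auto
  have v: "ctxw (ctensor m \<Gamma>s') (ctensor m \<Gamma>s'') (ctensor_mor m \<Gamma>s' vs)"
    using assms l' by (intro ctxw_ctensor_mor) auto
  have uv: "ctxw (\<Gamma>s ! j) (\<Gamma>s'' ! j) (map2 (ccompc A) us vs ! j)" if "j < length \<Gamma>s" for j
    using that assms by (auto intro: ctxw_comp)
  show "ctxw (ctensor m \<Gamma>s) (ctensor m \<Gamma>s'') (ctensor_mor m \<Gamma>s us \<odot> ctensor_mor m \<Gamma>s' vs)"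
    using u v by (rule ctxw_comp)
  show "ctxw (ctensor m \<Gamma>s) (ctensor m \<Gamma>s'') (ctensor_mor m \<Gamma>s (map2 (ccompc A) us vs))"
    using uv assms by (intro ctxw_ctensor_mor) auto
  fix j assume "j < length \<Gamma>s''"
  then have j: "j < length \<Gamma>s" using assms by simp
  have p: "ctxw (ctensor m \<Gamma>s) (\<Gamma>s ! j) (cprj m \<Gamma>s j)" "ctxw (ctensor m \<Gamma>s') (\<Gamma>s' ! j) (cprj m \<Gamma>s' j)"
    "ctxw (ctensor m \<Gamma>s'') (\<Gamma>s'' ! j) (cprj m \<Gamma>s'' j)"
    using j assms l' l'' by (auto intro!: ctxw_cprj)
  have "ctensor_mor m \<Gamma>s us \<odot> ctensor_mor m \<Gamma>s' vs \<odot> cprj m \<Gamma>s'' j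
      = ctensor_mor m \<Gamma>s us \<odot> (cprj m \<Gamma>s' j \<odot> vs ! j)"
    using ccompc_assoc[OF u v p(3)] ctensor_mor_cprj[of vs \<Gamma>s' m \<Gamma>s'' j] assms l' j by simp
  also have "\<dots> = cprj m \<Gamma>s j \<odot> us ! j \<odot> vs ! j"
    using ccompc_assoc[OF u p(2) assms(7)[OF j]] ctensor_mor_cprj[of us \<Gamma>s m \<Gamma>s' j] assms j by simp
  also have "\<dots> = cprj m \<Gamma>s j \<odot> (us ! j \<odot> vs ! j)"
    using ccompc_assoc[OF p(1) assms(6,7)[OF j]] by simp
  also have "\<dots> = ctensor_mor m \<Gamma>s (map2 (ccompc A) us vs) \<odot> cprj m \<Gamma>s'' j"
    using ctensor_mor_cprj[of "map2 (ccompc A) us vs" \<Gamma>s m \<Gamma>s'' j] assms uv j by simp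
  finally show "ctensor_mor m \<Gamma>s us \<odot> ctensor_mor m \<Gamma>s' vs \<odot> cprj m \<Gamma>s'' j =
    ctensor_mor m \<Gamma>s (map2 (ccompc A) us vs) \<odot> cprj m \<Gamma>s'' j" .
qed

lemma ctensor_mor_id:
  assumes "lens m \<Gamma>s"
  shows "ctensor_mor m \<Gamma>s (map (cidc A) \<Gamma>s) = cidc A (ctensor m \<Gamma>s)"
proof (rule ctxw_ext)
  show "ctxw (ctensor m \<Gamma>s) (ctensor m \<Gamma>s) (ctensor_mor m \<Gamma>s (map (cidc A) \<Gamma>s))"
    using assms by (auto intro!: ctxw_ctensor_mor ctxw_cidc)
  show "ctxw (ctensor m \<Gamma>s) (ctensor m \<Gamma>s) (cidc A (ctensor m \<Gamma>s))" by (rule ctxw_cidc)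
  fix j assume "j < length \<Gamma>s"
  then show "ctensor_mor m \<Gamma>s (map (cidc A) \<Gamma>s) \<odot> cprj m \<Gamma>s j = cidc A (ctensor m \<Gamma>s) \<odot> cprj m \<Gamma>s j"
    using assms ctensor_mor_cprj[of "map (cidc A) \<Gamma>s" \<Gamma>s m \<Gamma>s j]
    by (simp add: ctxw_cidc ccompc_idl[OF ctxw_cprj] ccompc_idr[OF ctxw_cprj])
qed

lemma cblock_id:
  assumes "lens m \<Gamma>s"
  shows "cblock A m \<Gamma>s [0..<length \<Gamma>s] = cidc A (ctensor m \<Gamma>s)"
proof (rule ctxw_ext)
  have e: "map ((!) \<Gamma>s) [0..<length \<Gamma>s] = \<Gamma>s" by (rule map_nth)
  show "ctxw (ctensor m \<Gamma>s) (ctensor m \<Gamma>s) (cblock A m \<Gamma>s [0..<length \<Gamma>s])"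
    using ctxw_cblock[of "[0..<length \<Gamma>s]" \<Gamma>s m] assms unfolding e by simp
  show "ctxw (ctensor m \<Gamma>s) (ctensor m \<Gamma>s) (cidc A (ctensor m \<Gamma>s))" by (rule ctxw_cidc)
  fix j assume "j < length \<Gamma>s"
  then show "cblock A m \<Gamma>s [0..<length \<Gamma>s] \<odot> cprj m \<Gamma>s j = cidc A (ctensor m \<Gamma>s) \<odot> cprj m \<Gamma>s j"
    using cblock_cprj[of "[0..<length \<Gamma>s]" \<Gamma>s m j] assms unfolding e
    by (simp add: ccompc_idl[OF ctxw_cprj])
qed

end

section \<open>Functors valued in setoids\<close>

text \<open>Set-valued functors are given by representatives \<open>fS\<close>, the equivalence \<open>fE\<close> on them, and the action \<open>fA\<close> on
  representatives, which is functorial only up to \<open>fE\<close>.\<close>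

record ('o, 'm, 'x) fn =
  fS :: "'o ctx \<Rightarrow> 'o ty \<Rightarrow> 'x \<Rightarrow> bool"
  fE :: "'o ctx \<Rightarrow> 'o ty \<Rightarrow> 'x \<Rightarrow> 'x \<Rightarrow> bool"
  fA :: "'m smor list \<Rightarrow> 'm dmor \<Rightarrow> 'x \<Rightarrow> 'x"

lemma equivclose_dom: "equivclose S R x y \<Longrightarrow> S x \<and> S y"
  by (induction rule: equivclose.induct) auto

lemma equivclose_map:
  assumes "equivclose S R x y"
    and "\<And>x. S x \<Longrightarrow> T (f x) (f x)"
    and "\<And>x y. S x \<Longrightarrow> S y \<Longrightarrow> R x y \<Longrightarrow> T (f x) (f y)"
    and "\<And>x y. T x y \<Longrightarrow> T y x" "\<And>x y z. T x y \<Longrightarrow> T y z \<Longrightarrow> T x z"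
  shows "T (f x) (f y)"
  using assms(1) by (induction rule: equivclose.induct) (blast intro: assms)+

context dcat
begin

text \<open>The context argument is contravariant: in the last clause \<open>u'\<close> acts after
  \<open>u\<close>, but comes first in the composite \<open>u' \<odot> u\<close>. The functor laws
  are required up to \<open>fE\<close> only.\<close>

definition isf :: "nat \<Rightarrow> ('o, 'm, 'x) fn \<Rightarrow> bool" where
  "isf n F \<longleftrightarrow>
    (\<forall>\<Delta> a x. fS F \<Delta> a x \<longrightarrow> length \<Delta> = n \<and> fE F \<Delta> a x x) \<and>
    (\<forall>\<Delta> a x y. fE F \<Delta> a x y \<longrightarrow> fS F \<Delta> a x \<and> fS F \<Delta> a y \<and> fE F \<Delta> a y x) \<and>
    (\<forall>\<Delta> a x y z. fE F \<Delta> a x y \<longrightarrow> fE F \<Delta> a y z \<longrightarrow> fE F \<Delta> a x z) \<and>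
    (\<forall>\<Delta> a \<Delta>' a' u f x. fS F \<Delta> a x \<longrightarrow> ctxhom A C \<Delta>' \<Delta> u \<longrightarrow> dhom A C a a' f \<longrightarrow>
       fS F \<Delta>' a' (fA F u f x)) \<and>
    (\<forall>\<Delta> a \<Delta>' a' u f x y. fE F \<Delta> a x y \<longrightarrow> ctxhom A C \<Delta>' \<Delta> u \<longrightarrow> dhom A C a a' f \<longrightarrow>
       fE F \<Delta>' a' (fA F u f x) (fA F u f y)) \<and>
    (\<forall>\<Delta> a x. fS F \<Delta> a x \<longrightarrow> fE F \<Delta> a (fA F (cidc A \<Delta>) (did A a) x) x) \<and>
    (\<forall>\<Delta> a \<Delta>' a' \<Delta>'' a'' u f u' f' x. fS F \<Delta> a x \<longrightarrow>
       ctxhom A C \<Delta>' \<Delta> u \<longrightarrow> dhom A C a a' f \<longrightarrow> ctxhom A C \<Delta>'' \<Delta>' u' \<longrightarrow> dhom A C a' a'' f' \<longrightarrow>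
       fE F \<Delta>'' a'' (fA F (u' \<odot> u) (dcomp A f f') x) (fA F u' f' (fA F u f x)))"

lemma isf_D:
  assumes "isf n F"
  shows isf_len: "fS F \<Delta> a x \<Longrightarrow> length \<Delta> = n"
    and isf_refl: "fS F \<Delta> a x \<Longrightarrow> fE F \<Delta> a x x"
    and isf_dom1: "fE F \<Delta> a x y \<Longrightarrow> fS F \<Delta> a x"
    and isf_dom2: "fE F \<Delta> a x y \<Longrightarrow> fS F \<Delta> a y"
    and isf_sym: "fE F \<Delta> a x y \<Longrightarrow> fE F \<Delta> a y x"
    and isf_trans: "fE F \<Delta> a x y \<Longrightarrow> fE F \<Delta> a y z \<Longrightarrow> fE F \<Delta> a x z"
    and isf_act: "fS F \<Delta> a x \<Longrightarrow> ctxhom A C \<Delta>' \<Delta> u \<Longrightarrow> dhom A C a a' f \<Longrightarrow> fS F \<Delta>' a' (fA F u f x)"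
    and isf_cong: "fE F \<Delta> a x y \<Longrightarrow> ctxhom A C \<Delta>' \<Delta> u \<Longrightarrow> dhom A C a a' f \<Longrightarrow>
       fE F \<Delta>' a' (fA F u f x) (fA F u f y)"
    and isf_id: "fS F \<Delta> a x \<Longrightarrow> fE F \<Delta> a (fA F (cidc A \<Delta>) (did A a) x) x"
    and isf_comp: "fS F \<Delta> a x \<Longrightarrow> ctxhom A C \<Delta>' \<Delta> u \<Longrightarrow> dhom A C a a' f \<Longrightarrow>
       ctxhom A C \<Delta>'' \<Delta>' u' \<Longrightarrow> dhom A C a' a'' f' \<Longrightarrow>
       fE F \<Delta>'' a'' (fA F (u' \<odot> u) (dcomp A f f') x) (fA F u' f' (fA F u f x))"
proof -
  note h = assms[unfolded isf_def]
  note h1 = h[THEN conjunct1] and h = h[THEN conjunct2]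
  note h2 = h[THEN conjunct1] and h = h[THEN conjunct2]
  note h3 = h[THEN conjunct1] and h = h[THEN conjunct2]
  note h4 = h[THEN conjunct1] and h = h[THEN conjunct2]
  note h5 = h[THEN conjunct1] and h = h[THEN conjunct2]
  note h6 = h[THEN conjunct1] and h7 = h[THEN conjunct2]
  show "fS F \<Delta> a x \<Longrightarrow> length \<Delta> = n" "fS F \<Delta> a x \<Longrightarrow> fE F \<Delta> a x x"
    by (simp_all add: h1)
  show "fE F \<Delta> a x y \<Longrightarrow> fS F \<Delta> a x" "fE F \<Delta> a x y \<Longrightarrow> fS F \<Delta> a y" "fE F \<Delta> a x y \<Longrightarrow> fE F \<Delta> a y x"
    using h2[rule_format, of \<Delta> a x y] by simp_all
  show "fE F \<Delta> a x y \<Longrightarrow> fE F \<Delta> a y z \<Longrightarrow> fE F \<Delta> a x z" by (rule h3[rule_format])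
qed (rule assms[unfolded isf_def, THEN conjunct2, THEN conjunct2, THEN conjunct2, THEN conjunct1, rule_format]
    assms[unfolded isf_def, THEN conjunct2, THEN conjunct2, THEN conjunct2, THEN conjunct2, THEN conjunct1, rule_format]
    assms[unfolded isf_def, THEN conjunct2, THEN conjunct2, THEN conjunct2, THEN conjunct2, THEN conjunct2, THEN conjunct1, rule_format]
    assms[unfolded isf_def, THEN conjunct2, THEN conjunct2, THEN conjunct2, THEN conjunct2, THEN conjunct2, THEN conjunct2, rule_format];
   assumption)+

text \<open>Inserting an identity on either side of the composite splits an action in both variables
  into two actions in one variable each, in either order.\<close>

lemma isf_interchange:
  assumes F: "isf n F" and x: "fS F \<Delta> a x" and u: "ctxhom A C \<Delta>' \<Delta> u" and f: "dhom A C a a' f"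
  shows isf_ctx_last: "fE F \<Delta>' a' (fA F u f x) (fA F u (did A a') (fA F (cidc A \<Delta>) f x))"
    and isf_ctx_first: "fE F \<Delta>' a' (fA F u f x) (fA F (cidc A \<Delta>') f (fA F u (did A a) x))"
proof -
  show "fE F \<Delta>' a' (fA F u f x) (fA F u (did A a') (fA F (cidc A \<Delta>) f x))"
    using isf_comp[OF F x ctxhom_cidc f u dhom_did] ccompc_idr[OF ctxhom_ctxw[OF u]] dcomp_idr[OF f] by simp
  show "fE F \<Delta>' a' (fA F u f x) (fA F (cidc A \<Delta>') f (fA F u (did A a) x))"
    using isf_comp[OF F x u dhom_did ctxhom_cidc f] ccompc_idl[OF ctxhom_ctxw[OF u]] dcomp_idl[OF f] by simp
qed

text \<open>The coend relations slide context morphisms, which act with an identity of D, whereas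
  arrows of D act with an identity of the context. This is the exchange needed whenever the two
  meet.\<close>

lemma isf_swap:
  assumes F: "isf n F" and x: "fS F \<Delta> a x" and u: "ctxhom A C \<Delta>' \<Delta> u" and f: "dhom A C a a' f"
  shows "fE F \<Delta>' a' (fA F (cidc A \<Delta>') f (fA F u (did A a) x)) (fA F u (did A a') (fA F (cidc A \<Delta>) f x))"
  by (rule isf_trans[OF F isf_sym[OF F isf_ctx_first[OF assms]] isf_ctx_last[OF assms]])

definition nat_trans :: "('o, 'm, 'x) fn \<Rightarrow> ('o, 'm, 'y) fn \<Rightarrow> ('o ctx \<Rightarrow> 'o ty \<Rightarrow> 'x \<Rightarrow> 'y) \<Rightarrow> bool" where
  "nat_trans F G \<phi> \<longleftrightarrow>
    (\<forall>\<Delta> a x y. fE F \<Delta> a x y \<longrightarrow> fE G \<Delta> a (\<phi> \<Delta> a x) (\<phi> \<Delta> a y)) \<and>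
    (\<forall>\<Delta> a \<Delta>' a' u f x. fS F \<Delta> a x \<longrightarrow> ctxhom A C \<Delta>' \<Delta> u \<longrightarrow> dhom A C a a' f \<longrightarrow>
       fE G \<Delta>' a' (\<phi> \<Delta>' a' (fA F u f x)) (fA G u f (\<phi> \<Delta> a x)))"

lemma nat_trans_resp: "nat_trans F G \<phi> \<Longrightarrow> fE F \<Delta> a x y \<Longrightarrow> fE G \<Delta> a (\<phi> \<Delta> a x) (\<phi> \<Delta> a y)"
  unfolding nat_trans_def by blast

lemma nat_trans_natural: "nat_trans F G \<phi> \<Longrightarrow> fS F \<Delta> a x \<Longrightarrow> ctxhom A C \<Delta>' \<Delta> u \<Longrightarrow> dhom A C a a' f \<Longrightarrow>
   fE G \<Delta>' a' (\<phi> \<Delta>' a' (fA F u f x)) (fA G u f (\<phi> \<Delta> a x))"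
  unfolding nat_trans_def by blast

lemma nat_trans_typed: "nat_trans F G \<phi> \<Longrightarrow> isf n F \<Longrightarrow> isf n G \<Longrightarrow> fS F \<Delta> a x \<Longrightarrow> fS G \<Delta> a (\<phi> \<Delta> a x)"
  by (meson isf_dom1 isf_refl nat_trans_resp)

definition iso_by :: "('o, 'm, 'x) fn \<Rightarrow> ('o, 'm, 'y) fn \<Rightarrow> ('o ctx \<Rightarrow> 'o ty \<Rightarrow> 'x \<Rightarrow> 'y) \<Rightarrow>
    ('o ctx \<Rightarrow> 'o ty \<Rightarrow> 'y \<Rightarrow> 'x) \<Rightarrow> bool" where
  "iso_by F G \<phi> \<psi> \<longleftrightarrow> nat_trans F G \<phi> \<and> nat_trans G F \<psi> \<and>
    (\<forall>\<Delta> a x. fS F \<Delta> a x \<longrightarrow> fE F \<Delta> a (\<psi> \<Delta> a (\<phi> \<Delta> a x)) x) \<and>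
    (\<forall>\<Delta> a x. fS G \<Delta> a x \<longrightarrow> fE G \<Delta> a (\<phi> \<Delta> a (\<psi> \<Delta> a x)) x)"

text \<open>Naturality of the inverse is inherited: apply \<open>\<psi>\<close> to the naturality
  square of \<open>\<phi>\<close> at \<open>\<psi> \<Delta> a x\<close> and cancel.\<close>

lemma iso_byI:
  assumes F: "isf n F" and G: "isf n G" and nt: "nat_trans F G \<phi>"
    and resp: "\<And>\<Delta> a x y. fE G \<Delta> a x y \<Longrightarrow> fE F \<Delta> a (\<psi> \<Delta> a x) (\<psi> \<Delta> a y)"
    and l: "\<And>\<Delta> a x. fS F \<Delta> a x \<Longrightarrow> fE F \<Delta> a (\<psi> \<Delta> a (\<phi> \<Delta> a x)) x"
    and r: "\<And>\<Delta> a x. fS G \<Delta> a x \<Longrightarrow> fE G \<Delta> a (\<phi> \<Delta> a (\<psi> \<Delta> a x)) x"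
  shows "iso_by F G \<phi> \<psi>"
proof -
  have "fE F \<Delta>' a' (\<psi> \<Delta>' a' (fA G u f x)) (fA F u f (\<psi> \<Delta> a x))"
    if x: "fS G \<Delta> a x" and u: "ctxhom A C \<Delta>' \<Delta> u" and f: "dhom A C a a' f" for \<Delta> a \<Delta>' a' u f x
  proof -
    have y: "fS F \<Delta> a (\<psi> \<Delta> a x)" using isf_dom1[OF F resp[OF isf_refl[OF G x]]] .
    have "fE G \<Delta>' a' (fA G u f x) (fA G u f (\<phi> \<Delta> a (\<psi> \<Delta> a x)))"
      by (rule isf_cong[OF G isf_sym[OF G r[OF x]] u f])
    moreover have "fE G \<Delta>' a' (fA G u f (\<phi> \<Delta> a (\<psi> \<Delta> a x))) (\<phi> \<Delta>' a' (fA F u f (\<psi> \<Delta> a x)))"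
      by (rule isf_sym[OF G nat_trans_natural[OF nt y u f]])
    ultimately have "fE F \<Delta>' a' (\<psi> \<Delta>' a' (fA G u f x)) (\<psi> \<Delta>' a' (\<phi> \<Delta>' a' (fA F u f (\<psi> \<Delta> a x))))"
      by (rule resp[OF isf_trans[OF G]])
    then show ?thesis by (rule isf_trans[OF F _ l[OF isf_act[OF F y u f]]])
  qed
  then show ?thesis unfolding iso_by_def nat_trans_def[of G F] using nt resp l r by blast
qed

definition isom :: "('o, 'm, 'x) fn \<Rightarrow> ('o, 'm, 'y) fn \<Rightarrow> bool" where
  "isom F G \<longleftrightarrow> (\<exists>\<phi> \<psi>. iso_by F G \<phi> \<psi>)"

lemma isom_refl: "isf n F \<Longrightarrow> isom F F"
  unfolding isom_def iso_by_def nat_trans_def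
  by (intro exI[of _ "\<lambda>\<Delta> a x. x"]) (auto intro: isf_refl isf_act)

lemma nat_trans_comp:
  assumes "isf n F" "isf n G" "isf n H" "nat_trans F G \<phi>" "nat_trans G H \<psi>"
  shows "nat_trans F H (\<lambda>\<Delta> a x. \<psi> \<Delta> a (\<phi> \<Delta> a x))"
proof -
  note t = nat_trans_typed[OF assms(4,1,2)] and n = assms(4,5)
  show ?thesis unfolding nat_trans_def[of F H]
    by (blast intro: t n[THEN nat_trans_resp] isf_trans[OF assms(3)] nat_trans_natural[OF n(1)] nat_trans_natural[OF n(2)])
qed

lemma isom_trans:
  assumes F: "isf n F" and G: "isf n G" and H: "isf n H" and 1: "isom F G" and 2: "isom G H"
  shows "isom F H"
proof -
  obtain \<phi> \<psi> where a: "iso_by F G \<phi> \<psi>" using 1 unfolding isom_def by blast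
  obtain \<phi>' \<psi>' where b: "iso_by G H \<phi>' \<psi>'" using 2 unfolding isom_def by blast
  have n: "nat_trans F G \<phi>" "nat_trans G F \<psi>" "nat_trans G H \<phi>'" "nat_trans H G \<psi>'"
    using a b unfolding iso_by_def by auto
  note t = nat_trans_typed[OF n(1) F G] nat_trans_typed[OF n(4) H G]
  have "iso_by F H (\<lambda>\<Delta> a x. \<phi>' \<Delta> a (\<phi> \<Delta> a x)) (\<lambda>\<Delta> a x. \<psi> \<Delta> a (\<psi>' \<Delta> a x))"
    unfolding iso_by_def
  proof (intro conjI allI impI nat_trans_comp[OF F G H n(1,3)] nat_trans_comp[OF H G F n(4,2)])
    show "fE F \<Delta> a (\<psi> \<Delta> a (\<psi>' \<Delta> a (\<phi>' \<Delta> a (\<phi> \<Delta> a x)))) x" if x: "fS F \<Delta> a x" for \<Delta> a x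
      by (rule isf_trans[OF F nat_trans_resp[OF n(2), of _ _ _ "\<phi> \<Delta> a x"]]) (use a b x t in \<open>auto simp: iso_by_def\<close>)
    show "fE H \<Delta> a (\<phi>' \<Delta> a (\<phi> \<Delta> a (\<psi> \<Delta> a (\<psi>' \<Delta> a x)))) x" if x: "fS H \<Delta> a x" for \<Delta> a x
      by (rule isf_trans[OF H nat_trans_resp[OF n(3), of _ _ _ "\<psi>' \<Delta> a x"]]) (use a b x t in \<open>auto simp: iso_by_def\<close>)
  qed
  then show ?thesis unfolding isom_def by blast
qed

section \<open>Denotations are functors\<close>

definition den :: "lterm \<Rightarrow> nat \<Rightarrow> ('o, 'm, ('o, 'm) el) fn" where
  "den M n = \<lparr>fS = sem A C M n, fE = eqv A C M n, fA = act A M\<rparr>"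

lemma den_simps [simp]: "fS (den M n) = sem A C M n" "fE (den M n) = eqv A C M n" "fA (den M n) = act A M"
  by (simp_all add: den_def)

text \<open>The morphism with which \<open>act\<close> composes at a variable.
  \<open>vctx n p\<close> and \<open>vmor n p\<close> form the functor that inserts a type at
  position \<open>p\<close>, and a variable denotes the hom-functor into its values.\<close>

definition vmor :: "nat \<Rightarrow> nat \<Rightarrow> 'm dmor \<Rightarrow> 'm smor list" where
  "vmor n p f = map (\<lambda>c. if c = p then ([0], [f]) else ([], [])) [0..<n]"

lemma length_vctx [simp]: "length (vctx n p a) = n"
  by (simp add: vctx_def)

lemma nth_vctx: "c < n \<Longrightarrow> vctx n p a ! c = (if c = p then [a] else [])"
  by (simp add: vctx_def)

lemma length_vmor [simp]: "length (vmor n p f) = n"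
  by (simp add: vmor_def)

lemma nth_vmor: "c < n \<Longrightarrow> vmor n p f ! c = (if c = p then ([0], [f]) else ([], []))"
  by (simp add: vmor_def)

lemma cls_small [simp]: "cls C 0 []" "cls C (Suc 0) [0]"
  using cls_id[of C 0] cls_id[of C 1] by simp_all

lemma shom_Nil [simp]: "shom A C [] [] ([], [])"
  by (simp add: shom_iff shomw_def)

lemma shom_single [simp]: "shom A C [a] [b] ([0], [f]) \<longleftrightarrow> dhom A C a b f"
  by (simp add: shom_iff shomw_def)

lemma sid_Nil: "sid A [] = ([], [])" and sid_single: "sid A [a] = ([0], [did A a])"
  by (simp_all add: sid_def)

lemma ctxhom_vmor: "dhom A C a b f \<Longrightarrow> ctxhom A C (vctx n p a) (vctx n p b) (vmor n p f)"
  by (simp add: ctxhom_def nth_vctx nth_vmor)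

lemma vmor_did: "vmor n p (did A a) = cidc A (vctx n p a)"
  by (rule nth_equalityI) (auto simp: nth_vctx nth_vmor sid_Nil sid_single)

lemma vmor_dcomp: "vmor n p (dcomp A f g) = vmor n p f \<odot> vmor n p g"
  by (rule nth_equalityI) (auto simp: nth_vmor scomp_eq)

lemma ctxhom_len: "ctxhom A C \<Delta> \<Gamma> u \<Longrightarrow> length \<Gamma> = length \<Delta>" "ctxhom A C \<Delta> \<Gamma> u \<Longrightarrow> length u = length \<Delta>"
  by (simp_all add: ctxhom_def)

lemma act_LVar: "ctxhom A C \<Delta> (vctx n p a) h \<Longrightarrow> ctxhom A C \<Delta>' \<Delta> u \<Longrightarrow>
   act A (LVar i) u f (EV h) = EV (u \<odot> h \<odot> vmor n (n - 1 - i) f)"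
  by (auto simp: vmor_def ctxhom_def)

text \<open>The equivalence is equality here, so the laws are the strict laws of composition in
  \<open>(SD)^n\<close>.\<close>

lemma isf_den_LVar: "isf n (den (LVar i) n)"
proof -
  let ?p = "n - 1 - i"
  have id: "cidc A \<Delta> \<odot> h \<odot> vmor n ?p (did A a) = h" if "ctxhom A C \<Delta> (vctx n ?p a) h" for \<Delta> a h
    using that ctxhom_ctxw[OF that] by (simp add: vmor_did ccompc_idl[OF ctxhom_ctxw[OF that]] ccompc_idr)
  have comp: "u' \<odot> u \<odot> h \<odot> vmor n ?p (dcomp A f f') = u' \<odot> (u \<odot> h \<odot> vmor n ?p f) \<odot> vmor n ?p f'"
    if "ctxhom A C \<Delta> (vctx n ?p a) h" "ctxhom A C \<Delta>' \<Delta> u" "dhom A C a a' f" "ctxhom A C \<Delta>'' \<Delta>' u'" "dhom A C a' a'' f'"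
    for \<Delta> \<Delta>' \<Delta>'' a a' a'' h u u' f f'
  proof -
    note w = that(1,2,4)[THEN ctxhom_ctxw] ctxhom_vmor[OF that(3), THEN ctxhom_ctxw] ctxhom_vmor[OF that(5), THEN ctxhom_ctxw]
    have e1: "u' \<odot> u \<odot> h \<odot> (vmor n ?p f \<odot> vmor n ?p f') = u' \<odot> u \<odot> h \<odot> vmor n ?p f \<odot> vmor n ?p f'"
      using w by (intro ccompc_assoc[symmetric]) (auto intro: ctxw_comp)
    have e2: "u' \<odot> u \<odot> h = u' \<odot> (u \<odot> h)" using w by (intro ccompc_assoc)
    have e3: "u' \<odot> (u \<odot> h) \<odot> vmor n ?p f = u' \<odot> (u \<odot> h \<odot> vmor n ?p f)"
      using w by (intro ccompc_assoc) (auto intro: ctxw_comp)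
    show ?thesis unfolding vmor_dcomp by (rule trans[OF e1]) (simp only: e2 e3)
  qed
  have act: "act A (LVar i) u f (EV h) = EV (u \<odot> h \<odot> vmor n ?p f)"
    if "ctxhom A C \<Delta> (vctx n ?p a) h" "ctxhom A C \<Delta>' \<Delta> u" for \<Delta> a h \<Delta>' u f
    using act_LVar[OF that] .
  have typd: "ctxhom A C \<Delta>' (vctx n ?p a') (u \<odot> h \<odot> vmor n ?p f)"
    if "ctxhom A C \<Delta> (vctx n ?p a) h" "ctxhom A C \<Delta>' \<Delta> u" "dhom A C a a' f" for \<Delta> a h \<Delta>' u f a'
    using that by (blast intro: ctxhom_comp ctxhom_vmor)
  show ?thesis unfolding isf_def den_simps
  proof (intro conjI allI impI)
    fix \<Delta> a x assume "sem A C (LVar i) n \<Delta> a x"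
    then obtain h where i: "i < n" and x: "x = EV h" and h: "ctxhom A C \<Delta> (vctx n ?p a) h" by auto
    show "length \<Delta> = n" using ctxhom_len(1)[OF h] by simp
    show "eqv A C (LVar i) n \<Delta> a x x" using i x h by simp
    show "eqv A C (LVar i) n \<Delta> a (act A (LVar i) (cidc A \<Delta>) (did A a) x) x"
      unfolding x act[OF h ctxhom_cidc] id[OF h] using i h by simp
    fix \<Delta>' a' u f assume u: "ctxhom A C \<Delta>' \<Delta> u" and f: "dhom A C a a' f"
    show "sem A C (LVar i) n \<Delta>' a' (act A (LVar i) u f x)"
      unfolding x act[OF h u] using typd[OF h u f] i by simp
    fix \<Delta>'' a'' u' f' assume u': "ctxhom A C \<Delta>'' \<Delta>' u'" and f': "dhom A C a' a'' f'"
    show "eqv A C (LVar i) n \<Delta>'' a'' (act A (LVar i) (u' \<odot> u) (dcomp A f f') x)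
        (act A (LVar i) u' f' (act A (LVar i) u f x))"
      unfolding x act[OF h u] act[OF h ctxhom_comp[OF u' u]] act[OF typd[OF h u f] u'] comp[OF h u f u' f']
      using typd[OF typd[OF h u f] u' f'] i by simp
  next
    fix \<Delta> a x y assume "eqv A C (LVar i) n \<Delta> a x y"
    then obtain h where i: "i < n" and x: "x = EV h" "y = EV h" and h: "ctxhom A C \<Delta> (vctx n ?p a) h" by auto
    show "sem A C (LVar i) n \<Delta> a x" "sem A C (LVar i) n \<Delta> a y" "eqv A C (LVar i) n \<Delta> a y x"
      using i x h by simp_all
    fix \<Delta>' a' u f assume u: "ctxhom A C \<Delta>' \<Delta> u" and f: "dhom A C a a' f"
    show "eqv A C (LVar i) n \<Delta>' a' (act A (LVar i) u f x) (act A (LVar i) u f y)"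
      unfolding x act[OF h u] using typd[OF h u f] i by simp
  qed auto
qed

lemma ctxhom_snoc: "length \<Gamma> = length \<Delta> \<Longrightarrow> length u = length \<Delta> \<Longrightarrow>
    ctxhom A C (\<Delta> @ [x]) (\<Gamma> @ [y]) (u @ [s]) \<longleftrightarrow> ctxhom A C \<Delta> \<Gamma> u \<and> shom A C x y s"
  by (auto simp: ctxhom_def nth_append less_Suc_eq)

lemma ctxhom_snocI: "ctxhom A C \<Delta> \<Gamma> u \<Longrightarrow> shom A C x y s \<Longrightarrow> ctxhom A C (\<Delta> @ [x]) (\<Gamma> @ [y]) (u @ [s])"
  by (auto simp: ctxhom_def nth_append less_Suc_eq)

lemma cidc_snoc: "cidc A (\<Delta> @ [x]) = cidc A \<Delta> @ [sid A x]"
  by (simp add: cidc_def)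

lemma ccompc_snoc: "length u = length v \<Longrightarrow> (u @ [s]) \<odot> (v @ [t]) = (u \<odot> v) @ [scomp A s t]"
  by (simp add: ccompc_def)

text \<open>An arrow \<open>FM \<alpha> fs f'\<close> acts on the body as \<open>f'\<close> together
  with the context morphism extended by \<open>(\<alpha>, fs)\<close>. The composition law survives
  because the context and the list part of an arrow are both contravariant.\<close>

lemma isf_den_LLam:
  assumes P: "isf (Suc n) (den P (Suc n))"
  shows "isf n (den (LLam P) n)"
proof -
  note D = isf_D[OF P, unfolded den_simps]
  have act: "act A (LLam P) u f (EL x) = EL (act A P (u @ [(\<alpha>, fs)]) f' x)" if "f = FM \<alpha> fs f'" for u f x \<alpha> fs f'
    using that by simp
  show ?thesis unfolding isf_def den_simps
  proof (intro conjI allI impI; (elim conjE)?)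
    fix \<Delta> a x assume x: "sem A C (LLam P) n \<Delta> a x"
    then obtain as b x' where e: "a = Fn as b" "x = EL x'" "sem A C P (Suc n) (\<Delta> @ [as]) b x'"
      by (auto split: ty.splits)
    show "length \<Delta> = n" "eqv A C (LLam P) n \<Delta> a x x" using e D(1,2)[OF e(3)] by auto
    have "cidc A \<Delta> @ [sid A as] = cidc A (\<Delta> @ [as])" by (simp add: cidc_snoc)
    then show "eqv A C (LLam P) n \<Delta> a (act A (LLam P) (cidc A \<Delta>) (did A a) x) x"
      using e D(9)[OF e(3)] by (simp add: sid_def del: act.simps add: act)
    fix \<Delta>' a' u f assume u: "ctxhom A C \<Delta>' \<Delta> u" and f: "dhom A C a a' f"
    then obtain as' b' \<alpha> fs f' where e': "a' = Fn as' b'" "f = FM \<alpha> fs f'"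
      using e by (auto elim!: dhom_FnE)
    then have f': "shom A C as' as (\<alpha>, fs)" "dhom A C b b' f'" using f e by (auto simp: dhom_Fn_iff)
    show "sem A C (LLam P) n \<Delta>' a' (act A (LLam P) u f x)"
      using e e' D(7)[OF e(3) ctxhom_snocI[OF u f'(1)] f'(2)] by simp
    fix \<Delta>'' a'' u' g assume u': "ctxhom A C \<Delta>'' \<Delta>' u'" and g: "dhom A C a' a'' g"
    then obtain as'' b'' \<beta> gs g' where e'': "a'' = Fn as'' b''" "g = FM \<beta> gs g'"
      using e' by (auto elim!: dhom_FnE)
    then have g': "shom A C as'' as' (\<beta>, gs)" "dhom A C b' b'' g'" using g e' by (auto simp: dhom_Fn_iff)
    have l: "length u' = length u" using u u' by (simp add: ctxhom_def)
    obtain \<gamma> hs where sc: "scomp A (\<beta>, gs) (\<alpha>, fs) = (\<gamma>, hs)" by fastforce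
    have d: "dcomp A f g = FM \<gamma> hs (dcomp A f' g')"
      unfolding e' e'' using dcomp_FM_scomp[OF f'(1)[THEN shom_shomw] g'(1)[THEN shom_shomw]] sc by simp
    have "eqv A C P (Suc n) (\<Delta>'' @ [as'']) b'' (act A P ((u' @ [(\<beta>, gs)]) \<odot> (u @ [(\<alpha>, fs)])) (dcomp A f' g') x')
        (act A P (u' @ [(\<beta>, gs)]) g' (act A P (u @ [(\<alpha>, fs)]) f' x'))"
      using e f' g' u u' by (intro D(10)) (auto intro: ctxhom_snocI)
    then show "eqv A C (LLam P) n \<Delta>'' a'' (act A (LLam P) (u' \<odot> u) (dcomp A f g) x)
        (act A (LLam P) u' g (act A (LLam P) u f x))"
      unfolding ccompc_snoc[OF l] sc e'(1) e''(1) e(2) act[OF d]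
      using e'(2) e''(2) by simp
  next
    fix \<Delta> a x y assume xy: "eqv A C (LLam P) n \<Delta> a x y"
    then obtain as b x' y' where e: "a = Fn as b" "x = EL x'" "y = EL y'" "eqv A C P (Suc n) (\<Delta> @ [as]) b x' y'"
      by (auto split: ty.splits el.splits)
    show "sem A C (LLam P) n \<Delta> a x" "sem A C (LLam P) n \<Delta> a y" "eqv A C (LLam P) n \<Delta> a y x"
      using e D(3,4,5)[OF e(4)] by auto
    show "eqv A C (LLam P) n \<Delta> a x z" if "eqv A C (LLam P) n \<Delta> a y z" for z
      using e that D(6)[OF e(4)] by (auto split: el.splits)
    fix \<Delta>' a' u f assume u: "ctxhom A C \<Delta>' \<Delta> u" and f: "dhom A C a a' f"
    then obtain as' b' \<alpha> fs f' where e': "a' = Fn as' b'" "f = FM \<alpha> fs f'"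
      using e by (auto elim!: dhom_FnE)
    then have f': "shom A C as' as (\<alpha>, fs)" "dhom A C b b' f'" using f e by (auto simp: dhom_Fn_iff)
    show "eqv A C (LLam P) n \<Delta>' a' (act A (LLam P) u f x) (act A (LLam P) u f y)"
      using e e' D(8)[OF e(4) ctxhom_snocI[OF u f'(1)] f'(2)] by simp
  qed
qed

end

section \<open>Functoriality of application, with the coend relations as proof rules\<close>

context dcat
begin

text \<open>Position 0 in a list of contexts belongs to the function and the arguments start at
  position 1; hence the reindexing \<open>0 # map Suc \<alpha>\<close> in the third coend
  relation.\<close>

lemma in_class_Suc: "in_class C m n \<alpha> \<Longrightarrow> in_class C (Suc m) (Suc n) (0 # map Suc \<alpha>)"
  using cls_append[of C 1 "[0]" n \<alpha>, unfolded plus_1_eq_Suc] by (auto simp: in_class_iff)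

lemma lens_block: "lens n \<Gamma>s \<Longrightarrow> length \<Gamma>s = Suc k \<Longrightarrow> \<forall>j\<in>set \<alpha>. j < k \<Longrightarrow> lens n (map ((!) \<Gamma>s) (0 # map Suc \<alpha>))"
  by auto

lemma shom_in_class: "shom A C xs ys (\<alpha>, fs) \<Longrightarrow> in_class C (length ys) (length xs) \<alpha>"
  by (simp add: shom_def)

lemma dhom_Fn_snd: "dhom A C a a' f \<Longrightarrow> dhom A C (Fn as a) (Fn as a') (FM [0..<length as] (map (did A) as) f)"
  using shom_sid[of as] by (simp add: dhom_Fn_iff sid_def)

lemma dhom_Fn_fst: "shom A C as bs (\<alpha>, fs) \<Longrightarrow> dhom A C (Fn bs a) (Fn as a) (FM \<alpha> fs (did A a))"
  by (simp add: dhom_Fn_iff dhom_did)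

text \<open>Domain and codomain of an arrow vary independently. This makes the action on the result
  type commute with the coend over the argument types.\<close>

lemma dcomp_Fn:
  assumes "shom A C as bs (\<alpha>, fs)" "dhom A C a a' f"
  shows "dcomp A (FM \<alpha> fs (did A a)) (FM [0..<length as] (map (did A) as) f) = FM \<alpha> fs f"
    and "dcomp A (FM [0..<length bs] (map (did A) bs) f) (FM \<alpha> fs (did A a')) = FM \<alpha> fs f"
proof -
  note w = shom_shomw[OF assms(1)]
  have s: "shomw xs xs ([0..<length xs], map (did A) xs)" for xs
    using shom_shomw[OF shom_sid, of xs] by (simp add: sid_def)
  show "dcomp A (FM \<alpha> fs (did A a)) (FM [0..<length as] (map (did A) as) f) = FM \<alpha> fs f"
    unfolding dcomp_FM_scomp[OF w s] sid_def[symmetric] scomp_idl[OF w] using dcomp_idl[OF assms(2)] by simp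
  show "dcomp A (FM [0..<length bs] (map (did A) bs) f) (FM \<alpha> fs (did A a')) = FM \<alpha> fs f"
    unfolding dcomp_FM_scomp[OF s w] sid_def[symmetric] scomp_idr[OF w] using dcomp_idr[OF assms(2)] by simp
qed

lemma semApp:
  "sem A C (LApp P Q) n \<Delta> a (EA as \<Gamma>s p qs h) \<longleftrightarrow>
     length \<Gamma>s = Suc (length as) \<and> lens n \<Gamma>s \<and> sem A C P n (\<Gamma>s ! 0) (Fn as a) p \<and>
     length qs = length as \<and> (\<forall>i<length as. sem A C Q n (\<Gamma>s ! Suc i) (as ! i) (qs ! i)) \<and>
     ctxhom A C \<Delta> (ctensor n \<Gamma>s) h"
  by simp

lemma semApp_cases:
  assumes "sem A C (LApp P Q) n \<Delta> a x"
  obtains as \<Gamma>s p qs h where "x = EA as \<Gamma>s p qs h" "length \<Gamma>s = Suc (length as)" "lens n \<Gamma>s"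
    "sem A C P n (\<Gamma>s ! 0) (Fn as a) p" "length qs = length as"
    "\<And>i. i < length as \<Longrightarrow> sem A C Q n (\<Gamma>s ! Suc i) (as ! i) (qs ! i)"
    "ctxhom A C \<Delta> (ctensor n \<Gamma>s) h"
  using assms by auto

lemma eqvApp_sym: "eqv A C (LApp P Q) n \<Delta> a x y \<Longrightarrow> eqv A C (LApp P Q) n \<Delta> a y x"
  by (auto intro: ec_sym)

lemma eqvApp_trans: "eqv A C (LApp P Q) n \<Delta> a x y \<Longrightarrow> eqv A C (LApp P Q) n \<Delta> a y z \<Longrightarrow> eqv A C (LApp P Q) n \<Delta> a x z"
  by (auto intro: ec_trans)

lemma eqvApp_gen:
  "sem A C (LApp P Q) n \<Delta> a x \<Longrightarrow> sem A C (LApp P Q) n \<Delta> a y \<Longrightarrow>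
   app_gen A C P Q n \<Delta> a (eqv A C P n) (eqv A C Q n) x y \<Longrightarrow> eqv A C (LApp P Q) n \<Delta> a x y"
  unfolding eqv.simps by (rule ec_gen)

lemma app_cong:
  assumes P: "isf n (den P n)" and Q: "isf n (den Q n)"
    and "sem A C (LApp P Q) n \<Delta> a (EA as \<Gamma>s p qs h)" "eqv A C P n (\<Gamma>s ! 0) (Fn as a) p p'"
    "length qs' = length as" "\<And>i. i < length as \<Longrightarrow> eqv A C Q n (\<Gamma>s ! Suc i) (as ! i) (qs ! i) (qs' ! i)"
  shows "eqv A C (LApp P Q) n \<Delta> a (EA as \<Gamma>s p qs h) (EA as \<Gamma>s p' qs' h)"
proof (rule eqvApp_gen[OF assms(3)])
  show "sem A C (LApp P Q) n \<Delta> a (EA as \<Gamma>s p' qs' h)"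
    using assms(3-6) isf_dom2[OF P] isf_dom2[OF Q] unfolding semApp den_simps by blast
  show "app_gen A C P Q n \<Delta> a (eqv A C P n) (eqv A C Q n) (EA as \<Gamma>s p qs h) (EA as \<Gamma>s p' qs' h)"
    unfolding app_gen_def using assms(3-6) unfolding semApp by (intro disjI1) auto
qed

text \<open>The second coend relation with \<open>p'\<close> and \<open>qs'\<close> given only up to
  equivalence: the first relation brings them to the literal form that \<open>app_gen\<close>
  demands.\<close>

lemma app_ctx:
  assumes P: "isf n (den P n)" and Q: "isf n (den Q n)"
    and l: "length \<Gamma>s = Suc (length as)" "length \<Gamma>s' = Suc (length as)" "length vs = Suc (length as)"
    and L: "lens n \<Gamma>s" "lens n \<Gamma>s'"
    and v: "\<And>j. j < Suc (length as) \<Longrightarrow> ctxhom A C (\<Gamma>s ! j) (\<Gamma>s' ! j) (vs ! j)"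
    and p: "sem A C P n (\<Gamma>s' ! 0) (Fn as a) p"
    and q: "length qs = length as" "\<And>i. i < length as \<Longrightarrow> sem A C Q n (\<Gamma>s' ! Suc i) (as ! i) (qs ! i)"
    and h: "ctxhom A C \<Delta> (ctensor n \<Gamma>s) h"
    and p': "eqv A C P n (\<Gamma>s ! 0) (Fn as a) p' (act A P (vs ! 0) (did A (Fn as a)) p)"
    and q': "length qs' = length as"
      "\<And>i. i < length as \<Longrightarrow> eqv A C Q n (\<Gamma>s ! Suc i) (as ! i) (qs' ! i) (act A Q (vs ! Suc i) (did A (as ! i)) (qs ! i))"
  shows "eqv A C (LApp P Q) n \<Delta> a (EA as \<Gamma>s p' qs' h) (EA as \<Gamma>s' p qs (h \<odot> ctensor_mor n \<Gamma>s vs))"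
proof -
  let ?m = "EA as \<Gamma>s (act A P (vs ! 0) (did A (Fn as a)) p)
              (map (\<lambda>i. act A Q (vs ! Suc i) (did A (as ! i)) (qs ! i)) [0..<length as]) h"
  let ?y = "EA as \<Gamma>s' p qs (h \<odot> ctensor_mor n \<Gamma>s vs)"
  have s: "sem A C (LApp P Q) n \<Delta> a (EA as \<Gamma>s p' qs' h)"
    using isf_dom1[OF P] isf_dom1[OF Q] l L p' q' h unfolding semApp den_simps by blast
  have 1: "eqv A C (LApp P Q) n \<Delta> a (EA as \<Gamma>s p' qs' h) ?m"
    using p' q' by (intro app_cong[OF P Q s]) auto
  have y: "sem A C (LApp P Q) n \<Delta> a ?y"
    unfolding semApp using l L p q v by (auto intro!: ctxhom_comp[OF h] ctxhom_ctensor_mor)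
  have m: "sem A C (LApp P Q) n \<Delta> a ?m" using equivclose_dom[OF 1[unfolded eqv.simps]] by blast
  have "eqv A C (LApp P Q) n \<Delta> a ?m ?y"
  proof (rule eqvApp_gen[OF m y])
    show "app_gen A C P Q n \<Delta> a (eqv A C P n) (eqv A C Q n) ?m ?y"
      unfolding app_gen_def
      apply (rule disjI2, rule disjI1)
      apply (rule exI[of _ as], rule exI[of _ \<Gamma>s], rule exI[of _ \<Gamma>s'], rule exI[of _ vs], rule exI[of _ p], rule exI[of _ qs], rule exI[of _ h])
      using l L p q v h by auto
  qed
  then show ?thesis by (rule eqvApp_trans[OF 1])
qed

text \<open>The third coend relation in the same relaxed form. Both ends are adjusted, since the
  morphism of SD acts on the function at one end and on the arguments at the other.\<close>

lemma app_arg: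
  assumes P: "isf n (den P n)" and Q: "isf n (den Q n)"
    and u: "shom A C as bs (\<alpha>, fs)"
    and l: "length \<Gamma>s = Suc (length as)" and L: "lens n \<Gamma>s"
    and p: "sem A C P n (\<Gamma>s ! 0) (Fn bs a) p"
    and q: "length qs = length as" "\<And>i. i < length as \<Longrightarrow> sem A C Q n (\<Gamma>s ! Suc i) (as ! i) (qs ! i)"
    and h: "ctxhom A C \<Delta> (ctensor n \<Gamma>s) h"
    and p': "eqv A C P n (\<Gamma>s ! 0) (Fn as a) p' (act A P (cidc A (\<Gamma>s ! 0)) (FM \<alpha> fs (did A a)) p)"
    and q': "length qs' = length bs"
      "\<And>i. i < length bs \<Longrightarrow> eqv A C Q n (\<Gamma>s ! Suc (\<alpha> ! i)) (bs ! i) (qs' ! i)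
         (act A Q (cidc A (\<Gamma>s ! Suc (\<alpha> ! i))) (fs ! i) (qs ! (\<alpha> ! i)))"
  shows "eqv A C (LApp P Q) n \<Delta> a (EA as \<Gamma>s p' qs h)
     (EA bs (map ((!) \<Gamma>s) (0 # map Suc \<alpha>)) p qs' (h \<odot> cblock A n \<Gamma>s (0 # map Suc \<alpha>)))"
proof -
  have c: "in_class C (length bs) (length as) \<alpha>" using shom_in_class[OF u] .
  have la: "length \<alpha> = length bs" "length fs = length bs" "\<And>i. i < length bs \<Longrightarrow> \<alpha> ! i < length as"
    using shom_shomw[OF u] by (auto simp: shomw_def)
  let ?q = "map (\<lambda>(j, g). act A Q (cidc A (\<Gamma>s ! Suc j)) g (qs ! j)) (zip \<alpha> fs)"
  let ?\<Gamma>s = "map ((!) \<Gamma>s) (0 # map Suc \<alpha>)"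
  let ?h = "h \<odot> cblock A n \<Gamma>s (0 # map Suc \<alpha>)"
  let ?x = "EA as \<Gamma>s (act A P (cidc A (\<Gamma>s ! 0)) (FM \<alpha> fs (did A a)) p) qs h"
  let ?y = "EA bs ?\<Gamma>s p ?q ?h"
  let ?z = "EA bs ?\<Gamma>s p qs' ?h"
  have 1: "eqv A C (LApp P Q) n \<Delta> a (EA as \<Gamma>s p' qs h) ?x"
    using p' q isf_dom1[OF P] isf_refl[OF Q] l L h by (intro app_cong[OF P Q]) (auto simp: semApp simp del: sem.simps)
  have x: "sem A C (LApp P Q) n \<Delta> a ?x" using equivclose_dom[OF 1[unfolded eqv.simps]] by blast
  have hh: "ctxhom A C \<Delta> (ctensor n ?\<Gamma>s) ?h"
    using in_class_Suc[OF c] l L la by (intro ctxhom_comp[OF h] ctxhom_cblock) auto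
  have z: "sem A C (LApp P Q) n \<Delta> a ?z"
    unfolding semApp
  proof (intro conjI allI impI)
    show "lens n ?\<Gamma>s" by (rule lens_block[OF L l]) (use la in \<open>auto simp: in_set_conv_nth\<close>)
    show "sem A C Q n (?\<Gamma>s ! Suc i) (bs ! i) (qs' ! i)" if "i < length bs" for i
      using isf_dom1[OF Q] q'(2)[OF that] that la by simp
  qed (use hh p q' la in auto)
  have 2: "eqv A C (LApp P Q) n \<Delta> a ?z ?y"
    using p q' la isf_refl[OF P] by (intro app_cong[OF P Q z]) auto
  have y: "sem A C (LApp P Q) n \<Delta> a ?y" using equivclose_dom[OF 2[unfolded eqv.simps]] by blast
  have "eqv A C (LApp P Q) n \<Delta> a ?x ?y"
  proof (rule eqvApp_gen[OF x y])
    show "app_gen A C P Q n \<Delta> a (eqv A C P n) (eqv A C Q n) ?x ?y"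
      unfolding app_gen_def
      apply (rule disjI2, rule disjI2)
      apply (rule exI[of _ as], rule exI[of _ bs], rule exI[of _ \<alpha>], rule exI[of _ fs], rule exI[of _ \<Gamma>s], rule exI[of _ p], rule exI[of _ qs], rule exI[of _ h])
      using u l L p q h by auto
  qed
  then show ?thesis using eqvApp_trans[OF 1 eqvApp_trans[OF _ eqvApp_sym[OF 2]]] by blast
qed

text \<open>The rule for mapping out of the coend. \<open>T\<close> is only asked to be symmetric,
  transitive and reflexive on images, so it may be the equivalence on some other set of
  representatives.\<close>

lemma eqvApp_map:
  assumes "eqv A C (LApp P Q) n \<Delta> a x y"
    and 0: "\<And>x. sem A C (LApp P Q) n \<Delta> a x \<Longrightarrow> T (f x) (f x)"
    and sym: "\<And>x y. T x y \<Longrightarrow> T y x" and trans: "\<And>x y z. T x y \<Longrightarrow> T y z \<Longrightarrow> T x z"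
    and 1: "\<And>as \<Gamma>s p qs p' qs' h. sem A C (LApp P Q) n \<Delta> a (EA as \<Gamma>s p qs h) \<Longrightarrow>
        eqv A C P n (\<Gamma>s ! 0) (Fn as a) p p' \<Longrightarrow> length qs' = length as \<Longrightarrow>
        (\<And>i. i < length as \<Longrightarrow> eqv A C Q n (\<Gamma>s ! Suc i) (as ! i) (qs ! i) (qs' ! i)) \<Longrightarrow>
        T (f (EA as \<Gamma>s p qs h)) (f (EA as \<Gamma>s p' qs' h))"
    and 2: "\<And>as \<Gamma>s \<Gamma>s' vs p qs h. length \<Gamma>s = Suc (length as) \<Longrightarrow> length \<Gamma>s' = Suc (length as) \<Longrightarrow>
        length vs = Suc (length as) \<Longrightarrow> lens n \<Gamma>s \<Longrightarrow> lens n \<Gamma>s' \<Longrightarrow>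
        (\<And>j. j < Suc (length as) \<Longrightarrow> ctxhom A C (\<Gamma>s ! j) (\<Gamma>s' ! j) (vs ! j)) \<Longrightarrow>
        sem A C P n (\<Gamma>s' ! 0) (Fn as a) p \<Longrightarrow> length qs = length as \<Longrightarrow>
        (\<And>i. i < length as \<Longrightarrow> sem A C Q n (\<Gamma>s' ! Suc i) (as ! i) (qs ! i)) \<Longrightarrow>
        ctxhom A C \<Delta> (ctensor n \<Gamma>s) h \<Longrightarrow>
        T (f (EA as \<Gamma>s (act A P (vs ! 0) (did A (Fn as a)) p)
              (map (\<lambda>i. act A Q (vs ! Suc i) (did A (as ! i)) (qs ! i)) [0..<length as]) h))
          (f (EA as \<Gamma>s' p qs (h \<odot> ctensor_mor n \<Gamma>s vs)))"
    and 3: "\<And>as bs \<alpha> fs \<Gamma>s p qs h. shom A C as bs (\<alpha>, fs) \<Longrightarrow>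
        length \<Gamma>s = Suc (length as) \<Longrightarrow> lens n \<Gamma>s \<Longrightarrow>
        sem A C P n (\<Gamma>s ! 0) (Fn bs a) p \<Longrightarrow> length qs = length as \<Longrightarrow>
        (\<And>i. i < length as \<Longrightarrow> sem A C Q n (\<Gamma>s ! Suc i) (as ! i) (qs ! i)) \<Longrightarrow>
        ctxhom A C \<Delta> (ctensor n \<Gamma>s) h \<Longrightarrow>
        T (f (EA as \<Gamma>s (act A P (cidc A (\<Gamma>s ! 0)) (FM \<alpha> fs (did A a)) p) qs h))
          (f (EA bs (map ((!) \<Gamma>s) (0 # map Suc \<alpha>)) p
              (map2 (\<lambda>j g. act A Q (cidc A (\<Gamma>s ! Suc j)) g (qs ! j)) \<alpha> fs)
              (h \<odot> cblock A n \<Gamma>s (0 # map Suc \<alpha>))))"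
  shows "T (f x) (f y)"
proof -
  have gen: "T (f x) (f y)" if sx: "sem A C (LApp P Q) n \<Delta> a x"
    and g: "app_gen A C P Q n \<Delta> a (eqv A C P n) (eqv A C Q n) x y" for x y
    using g unfolding app_gen_def
  proof (elim disjE, goal_cases)
    case a: 1
    then obtain as \<Gamma>s p qs p' qs' h where *: "x = EA as \<Gamma>s p qs h" "y = EA as \<Gamma>s p' qs' h"
        "eqv A C P n (\<Gamma>s ! 0) (Fn as a) p p'" "length qs' = length qs"
        "\<forall>i<length as. eqv A C Q n (\<Gamma>s ! Suc i) (as ! i) (qs ! i) (qs' ! i)" by blast
    show ?case unfolding *(1,2) by (rule assms(5)) (use sx * in auto)
  next
    case b: 2
    then show ?case by (elim exE conjE, hypsubst) (rule assms(6); simp)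
  next
    case c: 3
    then show ?case by (elim exE conjE, hypsubst) (rule assms(7); simp)
  qed
  show ?thesis by (rule equivclose_map[OF assms(1)[unfolded eqv.simps], of T f])
    (auto intro: 0 gen sym trans simp del: sem.simps)
qed

text \<open>Congruence of the action is the part that needs work. A context morphism touches just
  \<open>h\<close> and passes by associativity; an arrow touches just the function, and commutes
  with the second relation by \<open>isf_swap\<close> and with the third by
  \<open>dcomp_Fn\<close>.\<close>

lemma isf_den_LApp:
  assumes P: "isf n (den P n)" and Q: "isf n (den Q n)"
  shows "isf n (den (LApp P Q) n)"
proof -
  note DP = isf_D[OF P, unfolded den_simps] and DQ = isf_D[OF Q, unfolded den_simps]
  let ?F = "\<lambda>as f. FM [0..<length as] (map (did A) as) f"
  have act: "act A (LApp P Q) u f (EA as \<Gamma>s p qs h) = EA as \<Gamma>s (act A P (cidc A (\<Gamma>s ! 0)) (?F as f) p) qs (u \<odot> h)"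
    for u f as \<Gamma>s p qs h by simp
  have typd: "sem A C (LApp P Q) n \<Delta>' a' (act A (LApp P Q) u f x)"
    if x: "sem A C (LApp P Q) n \<Delta> a x" and u: "ctxhom A C \<Delta>' \<Delta> u" and f: "dhom A C a a' f" for \<Delta> a x \<Delta>' a' u f
    using x by (rule semApp_cases)
      (auto simp: act semApp simp del: sem.simps act.simps intro: DP(7)[OF _ ctxhom_cidc dhom_Fn_snd[OF f]] ctxhom_comp[OF u])
  have congI: "eqv A C (LApp P Q) n \<Delta> a (EA as \<Gamma>s p qs h) (EA as \<Gamma>s p' qs h)"
    if "sem A C (LApp P Q) n \<Delta> a (EA as \<Gamma>s p qs h)" "eqv A C P n (\<Gamma>s ! 0) (Fn as a) p p'" for \<Delta> a as \<Gamma>s p p' qs h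
    using that DQ(2) by (intro app_cong[OF P Q that]) (auto simp: semApp simp del: sem.simps)
  have refl: "eqv A C (LApp P Q) n \<Delta> a x x" if "sem A C (LApp P Q) n \<Delta> a x" for \<Delta> a x
    using that by (simp only: eqv.simps ec_refl)
  have cong: "eqv A C (LApp P Q) n \<Delta>' a' (act A (LApp P Q) u f x) (act A (LApp P Q) u f y)"
    if xy: "eqv A C (LApp P Q) n \<Delta> a x y" and u: "ctxhom A C \<Delta>' \<Delta> u" and f: "dhom A C a a' f" for \<Delta> a x y \<Delta>' a' u f
  proof (rule eqvApp_map[OF xy, where f="act A (LApp P Q) u f"])
    show "eqv A C (LApp P Q) n \<Delta>' a' (act A (LApp P Q) u f x) (act A (LApp P Q) u f x)"
      if "sem A C (LApp P Q) n \<Delta> a x" for x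
      by (rule refl[OF typd[OF that u f]])
  next
    fix as :: "'o ty list" and \<Gamma>s p qs p' qs' h
    assume x: "sem A C (LApp P Q) n \<Delta> a (EA as \<Gamma>s p qs h)"
       "eqv A C P n (\<Gamma>s ! 0) (Fn as a) p p'" "length qs' = length as"
       "\<And>i. i < length as \<Longrightarrow> eqv A C Q n (\<Gamma>s ! Suc i) (as ! i) (qs ! i) (qs' ! i)"
    show "eqv A C (LApp P Q) n \<Delta>' a' (act A (LApp P Q) u f (EA as \<Gamma>s p qs h)) (act A (LApp P Q) u f (EA as \<Gamma>s p' qs' h))"
      using typd[OF x(1) u f] unfolding act
      by (rule app_cong[OF P Q]) (use x(3,4) DP(8)[OF x(2) ctxhom_cidc dhom_Fn_snd[OF f]] in auto)
  next
    fix as :: "'o ty list" and \<Gamma>s \<Gamma>s' vs p qs h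
    assume l: "length \<Gamma>s = Suc (length as)" "length \<Gamma>s' = Suc (length as)" "length vs = Suc (length as)"
      and L: "lens n \<Gamma>s" "lens n \<Gamma>s'" and v: "\<And>j. j < Suc (length as) \<Longrightarrow> ctxhom A C (\<Gamma>s ! j) (\<Gamma>s' ! j) (vs ! j)"
      and p: "sem A C P n (\<Gamma>s' ! 0) (Fn as a) p" and q: "length qs = length as"
        "\<And>i. i < length as \<Longrightarrow> sem A C Q n (\<Gamma>s' ! Suc i) (as ! i) (qs ! i)"
      and h: "ctxhom A C \<Delta> (ctensor n \<Gamma>s) h"
    have "ctxhom A C (ctensor n \<Gamma>s) (ctensor n \<Gamma>s') (ctensor_mor n \<Gamma>s vs)"
      using l L v by (intro ctxhom_ctensor_mor) auto
    then have e: "u \<odot> (h \<odot> ctensor_mor n \<Gamma>s vs) = u \<odot> h \<odot> ctensor_mor n \<Gamma>s vs"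
      using ccompc_assoc[of _ _ u _ h _ "ctensor_mor n \<Gamma>s vs"] ctxhom_ctxw u h by metis
    have v0: "ctxhom A C (\<Gamma>s ! 0) (\<Gamma>s' ! 0) (vs ! 0)" using v by simp
    show "eqv A C (LApp P Q) n \<Delta>' a'
        (act A (LApp P Q) u f (EA as \<Gamma>s (act A P (vs ! 0) (did A (Fn as a)) p)
          (map (\<lambda>i. act A Q (vs ! Suc i) (did A (as ! i)) (qs ! i)) [0..<length as]) h))
        (act A (LApp P Q) u f (EA as \<Gamma>s' p qs (h \<odot> ctensor_mor n \<Gamma>s vs)))"
      unfolding act e
    proof (rule app_ctx[OF P Q l L v _ q])
      show "sem A C P n (\<Gamma>s' ! 0) (Fn as a') (act A P (cidc A (\<Gamma>s' ! 0)) (?F as f) p)"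
        by (rule DP(7)[OF p ctxhom_cidc dhom_Fn_snd[OF f]])
      show "ctxhom A C \<Delta>' (ctensor n \<Gamma>s) (u \<odot> h)" by (rule ctxhom_comp[OF u h])
      show "eqv A C P n (\<Gamma>s ! 0) (Fn as a') (act A P (cidc A (\<Gamma>s ! 0)) (?F as f) (act A P (vs ! 0) (did A (Fn as a)) p))
         (act A P (vs ! 0) (did A (Fn as a')) (act A P (cidc A (\<Gamma>s' ! 0)) (?F as f) p))"
        using isf_swap[OF P _ v0 dhom_Fn_snd[OF f]] p unfolding den_simps .
      show "eqv A C Q n (\<Gamma>s ! Suc i) (as ! i) (map (\<lambda>i. act A Q (vs ! Suc i) (did A (as ! i)) (qs ! i)) [0..<length as] ! i)
        (act A Q (vs ! Suc i) (did A (as ! i)) (qs ! i))" if "i < length as" for i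
        using DQ(2)[OF DQ(7)[OF q(2)[OF that] v dhom_did]] that by simp
    qed auto
  next
    fix as bs :: "'o ty list" and \<alpha> fs \<Gamma>s p qs h
    assume s: "shom A C as bs (\<alpha>, fs)" and l: "length \<Gamma>s = Suc (length as)" and L: "lens n \<Gamma>s"
      and p: "sem A C P n (\<Gamma>s ! 0) (Fn bs a) p" and q: "length qs = length as"
        "\<And>i. i < length as \<Longrightarrow> sem A C Q n (\<Gamma>s ! Suc i) (as ! i) (qs ! i)"
      and h: "ctxhom A C \<Delta> (ctensor n \<Gamma>s) h"
    have c: "ctxhom A C (ctensor n \<Gamma>s) (ctensor n (map ((!) \<Gamma>s) (0 # map Suc \<alpha>))) (cblock A n \<Gamma>s (0 # map Suc \<alpha>))"
      using in_class_Suc[OF shom_in_class[OF s]] l L s[THEN shom_shomw] by (intro ctxhom_cblock) (auto simp: shomw_def)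
    have e: "u \<odot> (h \<odot> cblock A n \<Gamma>s (0 # map Suc \<alpha>)) = u \<odot> h \<odot> cblock A n \<Gamma>s (0 # map Suc \<alpha>)"
      using ccompc_assoc[of _ _ u _ h _ "cblock A n \<Gamma>s (0 # map Suc \<alpha>)"] ctxhom_ctxw u h c by metis
    have la: "length \<alpha> = length bs" "length fs = length bs" "\<And>i. i < length bs \<Longrightarrow> \<alpha> ! i < length as"
      "\<And>i. i < length bs \<Longrightarrow> dhom A C (as ! (\<alpha> ! i)) (bs ! i) (fs ! i)"
      using shom_shomw[OF s] by (auto simp: shomw_def)
    have z: "(map ((!) \<Gamma>s) (0 # map Suc \<alpha>)) ! 0 = \<Gamma>s ! 0" by simp
    show "eqv A C (LApp P Q) n \<Delta>' a'
       (act A (LApp P Q) u f (EA as \<Gamma>s (act A P (cidc A (\<Gamma>s ! 0)) (FM \<alpha> fs (did A a)) p) qs h))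
       (act A (LApp P Q) u f (EA bs (map ((!) \<Gamma>s) (0 # map Suc \<alpha>)) p
         (map2 (\<lambda>j g. act A Q (cidc A (\<Gamma>s ! Suc j)) g (qs ! j)) \<alpha> fs) (h \<odot> cblock A n \<Gamma>s (0 # map Suc \<alpha>))))"
      unfolding act e z
    proof (rule app_arg[OF P Q s l L _ q])
      show "sem A C P n (\<Gamma>s ! 0) (Fn bs a') (act A P (cidc A (\<Gamma>s ! 0)) (?F bs f) p)"
        by (rule DP(7)[OF p ctxhom_cidc dhom_Fn_snd[OF f]])
      show "ctxhom A C \<Delta>' (ctensor n \<Gamma>s) (u \<odot> h)" by (rule ctxhom_comp[OF u h])
      have i: "cidc A (\<Gamma>s ! 0) \<odot> cidc A (\<Gamma>s ! 0) = cidc A (\<Gamma>s ! 0)" by (rule ccompc_idl[OF ctxw_cidc])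
      have "eqv A C P n (\<Gamma>s ! 0) (Fn as a') (act A P (cidc A (\<Gamma>s ! 0)) (FM \<alpha> fs f) p)
         (act A P (cidc A (\<Gamma>s ! 0)) (?F as f) (act A P (cidc A (\<Gamma>s ! 0)) (FM \<alpha> fs (did A a)) p))"
        using DP(10)[OF p ctxhom_cidc dhom_Fn_fst[OF s] ctxhom_cidc dhom_Fn_snd[OF f]]
        unfolding i dcomp_Fn(1)[OF s f] .
      moreover have "eqv A C P n (\<Gamma>s ! 0) (Fn as a') (act A P (cidc A (\<Gamma>s ! 0)) (FM \<alpha> fs f) p)
         (act A P (cidc A (\<Gamma>s ! 0)) (FM \<alpha> fs (did A a')) (act A P (cidc A (\<Gamma>s ! 0)) (?F bs f) p))"
        using DP(10)[OF p ctxhom_cidc dhom_Fn_snd[OF f] ctxhom_cidc dhom_Fn_fst[OF s]]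
        unfolding i dcomp_Fn(2)[OF s f] .
      ultimately show "eqv A C P n (\<Gamma>s ! 0) (Fn as a') (act A P (cidc A (\<Gamma>s ! 0)) (?F as f) (act A P (cidc A (\<Gamma>s ! 0)) (FM \<alpha> fs (did A a)) p))
         (act A P (cidc A (\<Gamma>s ! 0)) (FM \<alpha> fs (did A a')) (act A P (cidc A (\<Gamma>s ! 0)) (?F bs f) p))"
        by (blast intro: DP(5,6))
      show "eqv A C Q n (\<Gamma>s ! Suc (\<alpha> ! i)) (bs ! i) (map2 (\<lambda>j g. act A Q (cidc A (\<Gamma>s ! Suc j)) g (qs ! j)) \<alpha> fs ! i)
          (act A Q (cidc A (\<Gamma>s ! Suc (\<alpha> ! i))) (fs ! i) (qs ! (\<alpha> ! i)))" if "i < length bs" for i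
        using DQ(2)[OF DQ(7)[OF q(2)[OF la(3)[OF that]] ctxhom_cidc la(4)[OF that]]] that la by simp
    qed (use la in auto)
  qed (blast intro: eqvApp_sym eqvApp_trans)+
  show ?thesis unfolding isf_def den_simps
  proof (intro conjI allI impI typd cong refl)
    fix \<Delta> a x assume x: "sem A C (LApp P Q) n \<Delta> a x"
    then obtain as \<Gamma>s p qs h where e: "x = EA as \<Gamma>s p qs h" and s: "sem A C P n (\<Gamma>s ! 0) (Fn as a) p"
        "ctxhom A C \<Delta> (ctensor n \<Gamma>s) h" by (rule semApp_cases)
    show "length \<Delta> = n" using ctxhom_len(1)[OF s(2)] by simp
    show "eqv A C (LApp P Q) n \<Delta> a (act A (LApp P Q) (cidc A \<Delta>) (did A a) x) x"
      using x DP(9)[OF s(1)] unfolding e act ccompc_idl[OF ctxhom_ctxw[OF s(2)]]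
      by (intro eqvApp_sym[OF congI]) (auto intro: DP(5) simp del: sem.simps)
    fix \<Delta>' a' \<Delta>'' a'' u f u' f'
    assume u: "ctxhom A C \<Delta>' \<Delta> u" and f: "dhom A C a a' f" and u': "ctxhom A C \<Delta>'' \<Delta>' u'" and f': "dhom A C a' a'' f'"
    have a: "u' \<odot> u \<odot> h = u' \<odot> (u \<odot> h)" using u u' s(2) by (blast intro: ccompc_assoc ctxhom_ctxw)
    have i: "cidc A (\<Gamma>s ! 0) \<odot> cidc A (\<Gamma>s ! 0) = cidc A (\<Gamma>s ! 0)" by (rule ccompc_idl[OF ctxw_cidc])
    have d: "dcomp A (?F as f) (?F as f') = ?F as (dcomp A f f')"
      using dcomp_FM_scomp[OF shom_shomw shom_shomw, OF shom_sid[of as, unfolded sid_def] shom_sid[of as, unfolded sid_def]]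
      unfolding sid_def[symmetric] scomp_idl[OF shom_shomw[OF shom_sid]] by (simp only: sid_def fst_conv snd_conv)
    show "eqv A C (LApp P Q) n \<Delta>'' a'' (act A (LApp P Q) (u' \<odot> u) (dcomp A f f') x)
        (act A (LApp P Q) u' f' (act A (LApp P Q) u f x))"
      using DP(10)[OF s(1) ctxhom_cidc dhom_Fn_snd[OF f] ctxhom_cidc dhom_Fn_snd[OF f']]
        typd[OF x ctxhom_comp[OF u' u] dhom_dcomp[OF f f']]
      unfolding e act a i d by (intro congI)
  next
    fix \<Delta> a x y assume "eqv A C (LApp P Q) n \<Delta> a x y"
    then show "sem A C (LApp P Q) n \<Delta> a x" "sem A C (LApp P Q) n \<Delta> a y"
      unfolding eqv.simps by (blast dest: equivclose_dom)+
  qed (blast intro: eqvApp_sym eqvApp_trans)+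
qed

theorem isf_den: "isf n (den M n)"
  by (induction M arbitrary: n) (simp_all add: isf_den_LVar isf_den_LLam isf_den_LApp)

section \<open>Congruence of isomorphism\<close>

definition appmap where
  "appmap \<phi> \<chi> \<Delta> a x = (case x of EA as \<Gamma>s p qs h \<Rightarrow>
     EA as \<Gamma>s (\<phi> (\<Gamma>s ! 0) (Fn as a) p) (map (\<lambda>i. \<chi> (\<Gamma>s ! Suc i) (as ! i) (qs ! i)) [0..<length as]) h
   | _ \<Rightarrow> x)"

lemma appmap_EA: "appmap \<phi> \<chi> \<Delta> a (EA as \<Gamma>s p qs h) =
     EA as \<Gamma>s (\<phi> (\<Gamma>s ! 0) (Fn as a) p) (map (\<lambda>i. \<chi> (\<Gamma>s ! Suc i) (as ! i) (qs ! i)) [0..<length as]) h"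
  by (simp add: appmap_def)

lemma act_EA: "act A (LApp P Q) u f (EA as \<Gamma>s p qs h) =
    EA as \<Gamma>s (act A P (cidc A (\<Gamma>s ! 0)) (FM [0..<length as] (map (did A) as) f) p) qs (u \<odot> h)"
  by simp

lemma eqv_refl: "sem A C M n \<Delta> a x \<Longrightarrow> eqv A C M n \<Delta> a x x"
  using isf_refl[OF isf_den] by fastforce

lemma eqv_sym: "eqv A C M n \<Delta> a x y \<Longrightarrow> eqv A C M n \<Delta> a y x"
  using isf_sym[OF isf_den] by fastforce

lemma eqv_trans: "eqv A C M n \<Delta> a x y \<Longrightarrow> eqv A C M n \<Delta> a y z \<Longrightarrow> eqv A C M n \<Delta> a x z"
  using isf_trans[OF isf_den, of M n] unfolding den_simps by blast

lemma eqv_sem: "eqv A C M n \<Delta> a x y \<Longrightarrow> sem A C M n \<Delta> a x" "eqv A C M n \<Delta> a x y \<Longrightarrow> sem A C M n \<Delta> a y"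
  using isf_dom1[OF isf_den, of M n] isf_dom2[OF isf_den, of M n] unfolding den_simps by blast+

lemma sem_len: "sem A C M n \<Delta> a x \<Longrightarrow> length \<Delta> = n"
  using isf_len[OF isf_den, of M n] unfolding den_simps by blast

lemma sem_act: "sem A C M n \<Delta> a x \<Longrightarrow> ctxhom A C \<Delta>' \<Delta> u \<Longrightarrow> dhom A C a a' f \<Longrightarrow> sem A C M n \<Delta>' a' (act A M u f x)"
  using isf_act[OF isf_den, of M n] unfolding den_simps by blast

text \<open>The second and third coend relations are stated through \<open>act\<close>, so
  naturality of \<open>\<phi>\<close> and \<open>\<chi>\<close> carries them over, up to
  equivalences that \<open>app_ctx\<close> and \<open>app_arg\<close> absorb.\<close>

lemma nat_App:
  assumes \<phi>: "nat_trans (den P n) (den P' n) \<phi>" and \<chi>: "nat_trans (den Q n) (den Q' n) \<chi>"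
  shows "nat_trans (den (LApp P Q) n) (den (LApp P' Q') n) (appmap \<phi> \<chi>)"
proof -
  note i = isf_den
  note r\<phi> = nat_trans_resp[OF \<phi>, unfolded den_simps] and n\<phi> = nat_trans_natural[OF \<phi>, unfolded den_simps]
  note r\<chi> = nat_trans_resp[OF \<chi>, unfolded den_simps] and n\<chi> = nat_trans_natural[OF \<chi>, unfolded den_simps]
  note t\<phi> = nat_trans_typed[OF \<phi> i i, unfolded den_simps] and t\<chi> = nat_trans_typed[OF \<chi> i i, unfolded den_simps]
  have typd: "sem A C (LApp P' Q') n \<Delta> a (appmap \<phi> \<chi> \<Delta> a x)" if "sem A C (LApp P Q) n \<Delta> a x" for \<Delta> a x
    using that by (rule semApp_cases) (simp add: appmap_EA semApp t\<phi> t\<chi> del: sem.simps)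
  show ?thesis unfolding nat_trans_def den_simps
  proof (intro conjI allI impI)
    fix \<Delta> a x y assume xy: "eqv A C (LApp P Q) n \<Delta> a x y"
    show "eqv A C (LApp P' Q') n \<Delta> a (appmap \<phi> \<chi> \<Delta> a x) (appmap \<phi> \<chi> \<Delta> a y)"
    proof (rule eqvApp_map[OF xy, where f="appmap \<phi> \<chi> \<Delta> a"])
      show "eqv A C (LApp P' Q') n \<Delta> a (appmap \<phi> \<chi> \<Delta> a x) (appmap \<phi> \<chi> \<Delta> a x)"
        if "sem A C (LApp P Q) n \<Delta> a x" for x by (rule eqv_refl[OF typd[OF that]])
    next
      fix as :: "'o ty list" and \<Gamma>s p qs p' qs' h
      assume x: "sem A C (LApp P Q) n \<Delta> a (EA as \<Gamma>s p qs h)"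
       "eqv A C P n (\<Gamma>s ! 0) (Fn as a) p p'" "length qs' = length as"
       "\<And>i. i < length as \<Longrightarrow> eqv A C Q n (\<Gamma>s ! Suc i) (as ! i) (qs ! i) (qs' ! i)"
      show "eqv A C (LApp P' Q') n \<Delta> a (appmap \<phi> \<chi> \<Delta> a (EA as \<Gamma>s p qs h)) (appmap \<phi> \<chi> \<Delta> a (EA as \<Gamma>s p' qs' h))"
        unfolding appmap_EA
        by (rule app_cong[OF i i]) (use typd[OF x(1)] r\<phi>[OF x(2)] r\<chi> x(4) in \<open>auto simp: appmap_EA simp del: sem.simps\<close>)
    next
      fix as :: "'o ty list" and \<Gamma>s \<Gamma>s' vs p qs h
      assume l: "length \<Gamma>s = Suc (length as)" "length \<Gamma>s' = Suc (length as)" "length vs = Suc (length as)"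
      and L: "lens n \<Gamma>s" "lens n \<Gamma>s'" and v: "\<And>j. j < Suc (length as) \<Longrightarrow> ctxhom A C (\<Gamma>s ! j) (\<Gamma>s' ! j) (vs ! j)"
      and p: "sem A C P n (\<Gamma>s' ! 0) (Fn as a) p" and q: "length qs = length as"
        "\<And>i. i < length as \<Longrightarrow> sem A C Q n (\<Gamma>s' ! Suc i) (as ! i) (qs ! i)"
      and h: "ctxhom A C \<Delta> (ctensor n \<Gamma>s) h"
      show "eqv A C (LApp P' Q') n \<Delta> a
        (appmap \<phi> \<chi> \<Delta> a (EA as \<Gamma>s (act A P (vs ! 0) (did A (Fn as a)) p)
          (map (\<lambda>i. act A Q (vs ! Suc i) (did A (as ! i)) (qs ! i)) [0..<length as]) h))
        (appmap \<phi> \<chi> \<Delta> a (EA as \<Gamma>s' p qs (h \<odot> ctensor_mor n \<Gamma>s vs)))"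
        unfolding appmap_EA
        by (rule app_ctx[OF i i l L v t\<phi>[OF p] _ _ h n\<phi>[OF p v dhom_did]])
          (use q n\<chi>[OF q(2) v dhom_did] t\<chi> in auto)
    next
      fix as bs :: "'o ty list" and \<alpha> fs \<Gamma>s p qs h
      assume s: "shom A C as bs (\<alpha>, fs)" and l: "length \<Gamma>s = Suc (length as)" and L: "lens n \<Gamma>s"
      and p: "sem A C P n (\<Gamma>s ! 0) (Fn bs a) p" and q: "length qs = length as"
        "\<And>i. i < length as \<Longrightarrow> sem A C Q n (\<Gamma>s ! Suc i) (as ! i) (qs ! i)"
      and h: "ctxhom A C \<Delta> (ctensor n \<Gamma>s) h"
      have la: "length \<alpha> = length bs" "length fs = length bs" "\<And>i. i < length bs \<Longrightarrow> \<alpha> ! i < length as"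
        "\<And>i. i < length bs \<Longrightarrow> dhom A C (as ! (\<alpha> ! i)) (bs ! i) (fs ! i)"
        using shom_shomw[OF s] by (auto simp: shomw_def)
      have z: "(map ((!) \<Gamma>s) (0 # map Suc \<alpha>)) ! 0 = \<Gamma>s ! 0" by simp
      show "eqv A C (LApp P' Q') n \<Delta> a
       (appmap \<phi> \<chi> \<Delta> a (EA as \<Gamma>s (act A P (cidc A (\<Gamma>s ! 0)) (FM \<alpha> fs (did A a)) p) qs h))
       (appmap \<phi> \<chi> \<Delta> a (EA bs (map ((!) \<Gamma>s) (0 # map Suc \<alpha>)) p
         (map2 (\<lambda>j g. act A Q (cidc A (\<Gamma>s ! Suc j)) g (qs ! j)) \<alpha> fs) (h \<odot> cblock A n \<Gamma>s (0 # map Suc \<alpha>))))"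
        unfolding appmap_EA z
        by (rule app_arg[OF i i s l L t\<phi>[OF p] _ _ h n\<phi>[OF p ctxhom_cidc dhom_Fn_fst[OF s]]])
          (use q n\<chi>[OF q(2)[OF la(3)] ctxhom_cidc la(4)] t\<chi> la in auto)
    qed (blast intro: eqvApp_sym eqvApp_trans)+
  next
    fix \<Delta> a \<Delta>' a' u f x
    assume x: "sem A C (LApp P Q) n \<Delta> a x" and u: "ctxhom A C \<Delta>' \<Delta> u" and f: "dhom A C a a' f"
    have y: "sem A C (LApp P' Q') n \<Delta>' a' (appmap \<phi> \<chi> \<Delta>' a' (act A (LApp P Q) u f x))"
      by (rule typd[OF sem_act[OF x u f]])
    from x show "eqv A C (LApp P' Q') n \<Delta>' a' (appmap \<phi> \<chi> \<Delta>' a' (act A (LApp P Q) u f x))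
        (act A (LApp P' Q') u f (appmap \<phi> \<chi> \<Delta> a x))"
    proof (rule semApp_cases)
      fix as \<Gamma>s p qs h assume e: "x = EA as \<Gamma>s p qs h" and p: "sem A C P n (\<Gamma>s ! 0) (Fn as a) p"
        and q: "\<And>i. i < length as \<Longrightarrow> sem A C Q n (\<Gamma>s ! Suc i) (as ! i) (qs ! i)"
      show ?thesis using y unfolding e appmap_EA act_EA
        by (rule app_cong[OF i i _ n\<phi>[OF p ctxhom_cidc dhom_Fn_snd[OF f]]]) (use eqv_refl[OF t\<chi>[OF q]] in auto)
    qed
  qed
qed

lemma iso_App:
  assumes "isom (den P n) (den P' n)" "isom (den Q n) (den Q' n)"
  shows "isom (den (LApp P Q) n) (den (LApp P' Q') n)"
proof -
  have inv: "eqv A C (LApp P Q) n \<Delta> a (appmap \<phi>' \<chi>' \<Delta> a (appmap \<phi> \<chi> \<Delta> a x)) x"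
    if x: "sem A C (LApp P Q) n \<Delta> a x"
      and "\<And>\<Delta> a x. sem A C P n \<Delta> a x \<Longrightarrow> eqv A C P n \<Delta> a (\<phi>' \<Delta> a (\<phi> \<Delta> a x)) x"
      and "\<And>\<Delta> a x. sem A C Q n \<Delta> a x \<Longrightarrow> eqv A C Q n \<Delta> a (\<chi>' \<Delta> a (\<chi> \<Delta> a x)) x"
    for \<Delta> a P Q and x :: "('o, 'm) el" and \<phi> \<phi>' \<chi> \<chi>'
    using x
  proof (rule semApp_cases)
    fix as \<Gamma>s p qs h assume e: "x = EA as \<Gamma>s p qs h" and p: "sem A C P n (\<Gamma>s ! 0) (Fn as a) p"
        and l: "length qs = length as"
        and q: "\<And>i. i < length as \<Longrightarrow> sem A C Q n (\<Gamma>s ! Suc i) (as ! i) (qs ! i)"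
    show ?thesis unfolding e appmap_EA
      by (rule eqv_sym, rule app_cong[OF isf_den isf_den])
        (use x e l eqv_sym[OF that(2)[OF p]] eqv_sym[OF that(3)[OF q]] in auto)
  qed
  obtain \<phi> \<psi> where a: "iso_by (den P n) (den P' n) \<phi> \<psi>" using assms(1) unfolding isom_def by blast
  obtain \<phi>' \<psi>' where b: "iso_by (den Q n) (den Q' n) \<phi>' \<psi>'" using assms(2) unfolding isom_def by blast
  have "iso_by (den (LApp P Q) n) (den (LApp P' Q') n) (appmap \<phi> \<phi>') (appmap \<psi> \<psi>')"
    unfolding iso_by_def den_simps
  proof (intro conjI allI impI)
    show "nat_trans (den (LApp P Q) n) (den (LApp P' Q') n) (appmap \<phi> \<phi>')"
      "nat_trans (den (LApp P' Q') n) (den (LApp P Q) n) (appmap \<psi> \<psi>')"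
      using a b by (auto simp: iso_by_def intro: nat_App)
    show "eqv A C (LApp P Q) n \<Delta> a (appmap \<psi> \<psi>' \<Delta> a (appmap \<phi> \<phi>' \<Delta> a x)) x" if "sem A C (LApp P Q) n \<Delta> a x" for \<Delta> a x
      by (rule inv[OF that]) (use a b in \<open>simp_all add: iso_by_def\<close>)
    show "eqv A C (LApp P' Q') n \<Delta> a (appmap \<phi> \<phi>' \<Delta> a (appmap \<psi> \<psi>' \<Delta> a x)) x" if "sem A C (LApp P' Q') n \<Delta> a x" for \<Delta> a x
      by (rule inv[OF that]) (use a b in \<open>simp_all add: iso_by_def\<close>)
  qed
  then show ?thesis unfolding isom_def by blast
qed

lemma semLam_cases:
  assumes "sem A C (LLam P) n \<Delta> a x"
  obtains as b x' where "a = Fn as b" "x = EL x'" "sem A C P (Suc n) (\<Delta> @ [as]) b x'"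
  using assms by (auto split: ty.splits)

lemma eqvLam_cases:
  assumes "eqv A C (LLam P) n \<Delta> a x y"
  obtains as b x' y' where "a = Fn as b" "x = EL x'" "y = EL y'" "eqv A C P (Suc n) (\<Delta> @ [as]) b x' y'"
  using assms by (auto split: ty.splits el.splits)

definition lammap where
  "lammap \<phi> \<Delta> a x = (case (a, x) of (Fn as b, EL x') \<Rightarrow> EL (\<phi> (\<Delta> @ [as]) b x') | _ \<Rightarrow> undefined)"

lemma lammap_EL [simp]: "lammap \<phi> \<Delta> (Fn as b) (EL x) = EL (\<phi> (\<Delta> @ [as]) b x)"
  by (simp add: lammap_def)

lemma dhom_Fn_cases:
  assumes "dhom A C (Fn as b) a' f"
  obtains as' b' \<alpha> fs f' where "a' = Fn as' b'" "f = FM \<alpha> fs f'" "shom A C as' as (\<alpha>, fs)" "dhom A C b b' f'"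
  using assms by (metis dhom_FnE dhom_Fn_iff)

lemma nat_Lam:
  assumes \<phi>: "nat_trans (den P (Suc n)) (den P' (Suc n)) \<phi>"
  shows "nat_trans (den (LLam P) n) (den (LLam P') n) (lammap \<phi>)"
  unfolding nat_trans_def den_simps
proof (intro conjI allI impI)
  show "eqv A C (LLam P') n \<Delta> a (lammap \<phi> \<Delta> a x) (lammap \<phi> \<Delta> a y)" if "eqv A C (LLam P) n \<Delta> a x y" for \<Delta> a x y
    using that by (rule eqvLam_cases) (use nat_trans_resp[OF \<phi>] in auto)
  fix \<Delta> a \<Delta>' a' u f x
  assume x: "sem A C (LLam P) n \<Delta> a x" and u: "ctxhom A C \<Delta>' \<Delta> u" and f: "dhom A C a a' f"
  from x obtain as b x' where e: "a = Fn as b" "x = EL x'" "sem A C P (Suc n) (\<Delta> @ [as]) b x'" by (rule semLam_cases)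
  from f e(1) obtain as' b' \<alpha> fs f' where e': "a' = Fn as' b'" "f = FM \<alpha> fs f'" "shom A C as' as (\<alpha>, fs)" "dhom A C b b' f'"
    by (blast elim: dhom_Fn_cases)
  show "eqv A C (LLam P') n \<Delta>' a' (lammap \<phi> \<Delta>' a' (act A (LLam P) u f x)) (act A (LLam P') u f (lammap \<phi> \<Delta> a x))"
    using nat_trans_natural[OF \<phi>, unfolded den_simps, OF e(3) ctxhom_snocI[OF u e'(3)] e'(4)] e e' by simp
qed

lemma iso_Lam:
  assumes "isom (den P (Suc n)) (den P' (Suc n))"
  shows "isom (den (LLam P) n) (den (LLam P') n)"
proof -
  obtain \<phi> \<psi> where a: "iso_by (den P (Suc n)) (den P' (Suc n)) \<phi> \<psi>" using assms unfolding isom_def by blast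
  have "iso_by (den (LLam P) n) (den (LLam P') n) (lammap \<phi>) (lammap \<psi>)"
    unfolding iso_by_def den_simps
  proof (intro conjI allI impI)
    show "nat_trans (den (LLam P) n) (den (LLam P') n) (lammap \<phi>)" "nat_trans (den (LLam P') n) (den (LLam P) n) (lammap \<psi>)"
      using a by (auto simp: iso_by_def intro: nat_Lam)
    show "eqv A C (LLam P) n \<Delta> a (lammap \<psi> \<Delta> a (lammap \<phi> \<Delta> a x)) x" if "sem A C (LLam P) n \<Delta> a x" for \<Delta> a x
      using that by (rule semLam_cases) (use a in \<open>simp add: iso_by_def\<close>)
    show "eqv A C (LLam P') n \<Delta> a (lammap \<phi> \<Delta> a (lammap \<psi> \<Delta> a x)) x" if "sem A C (LLam P') n \<Delta> a x" for \<Delta> a x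
      using that by (rule semLam_cases) (use a in \<open>simp add: iso_by_def\<close>)
  qed
  then show ?thesis unfolding isom_def by blast
qed

section \<open>Reindexing the components of a context\<close>

text \<open>Together with \<open>kmor\<close> a strict monoidal functor between powers of SD, as
  each component of the result is a component of the argument or the unit \<open>[]\<close>. Hence
  it commutes with \<open>ctensor\<close>, \<open>ctensor_mor\<close> and \<open>cblock\<close> as
  an equality.\<close>

definition kob :: "nat \<Rightarrow> (nat \<Rightarrow> nat option) \<Rightarrow> 'o ctx \<Rightarrow> 'o ctx" where
  "kob m \<kappa> \<Gamma> = map (\<lambda>c. case \<kappa> c of None \<Rightarrow> [] | Some d \<Rightarrow> \<Gamma> ! d) [0..<m]"

definition kmor :: "nat \<Rightarrow> (nat \<Rightarrow> nat option) \<Rightarrow> 'm smor list \<Rightarrow> 'm smor list" where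
  "kmor m \<kappa> us = map (\<lambda>c. case \<kappa> c of None \<Rightarrow> ([], []) | Some d \<Rightarrow> us ! d) [0..<m]"

abbreviation "kval m \<kappa> N \<equiv> (\<forall>c<m. \<forall>d. \<kappa> c = Some d \<longrightarrow> d < N)"

lemma length_kob [simp]: "length (kob m \<kappa> \<Gamma>) = m" and length_kmor [simp]: "length (kmor m \<kappa> us) = m"
  by (simp_all add: kob_def kmor_def)

lemma ctxhom_kmor:
  "ctxhom A C \<Gamma> \<Gamma>' g \<Longrightarrow> kval m \<kappa> (length \<Gamma>) \<Longrightarrow> ctxhom A C (kob m \<kappa> \<Gamma>) (kob m \<kappa> \<Gamma>') (kmor m \<kappa> g)"
  by (auto simp: ctxhom_def kob_def kmor_def split: option.split)

lemma kmor_id: "kval m \<kappa> (length \<Gamma>) \<Longrightarrow> kmor m \<kappa> (cidc A \<Gamma>) = cidc A (kob m \<kappa> \<Gamma>)"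
  by (auto simp: kob_def kmor_def cidc_def sid_Nil intro!: nth_equalityI split: option.split)

lemma kmor_comp:
  "length u = N \<Longrightarrow> length v = N \<Longrightarrow> kval m \<kappa> N \<Longrightarrow> kmor m \<kappa> (u \<odot> v) = kmor m \<kappa> u \<odot> kmor m \<kappa> v"
  by (auto simp: kmor_def scomp_eq intro!: nth_equalityI split: option.split)

lemma kob_ctensor: "kval m \<kappa> N \<Longrightarrow> kob m \<kappa> (ctensor N \<Gamma>s) = ctensor m (map (kob m \<kappa>) \<Gamma>s)"
  by (auto simp: kob_def comp_def intro!: nth_equalityI split: option.split)

lemma kmor_ctensor_mor:
  assumes "kval m \<kappa> N" "length vs = length \<Gamma>s"
  shows "kmor m \<kappa> (ctensor_mor N \<Gamma>s vs) = ctensor_mor m (map (kob m \<kappa>) \<Gamma>s) (map (kmor m \<kappa>) vs)"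
proof (rule nth_equalityI)
  fix c assume c: "c < length (kmor m \<kappa> (ctensor_mor N \<Gamma>s vs))"
  show "kmor m \<kappa> (ctensor_mor N \<Gamma>s vs) ! c = ctensor_mor m (map (kob m \<kappa>) \<Gamma>s) (map (kmor m \<kappa>) vs) ! c"
    using assms c by (cases "\<kappa> c") (auto simp: kmor_def kob_def ctensor_mor_def coff_off comp_def intro!: arg_cong[of _ _ concat])
qed simp

lemma kmor_cblock:
  assumes "kval m \<kappa> N" "\<forall>j\<in>set \<beta>. j < length \<Gamma>s"
  shows "kmor m \<kappa> (cblock A N \<Gamma>s \<beta>) = cblock A m (map (kob m \<kappa>) \<Gamma>s) \<beta>"
proof (rule nth_equalityI)
  fix c assume c: "c < length (kmor m \<kappa> (cblock A N \<Gamma>s \<beta>))"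
  show "kmor m \<kappa> (cblock A N \<Gamma>s \<beta>) ! c = cblock A m (map (kob m \<kappa>) \<Gamma>s) \<beta> ! c"
    using assms c by (cases "\<kappa> c")
      (auto simp: kmor_def kob_def cblock_def coff_off comp_def map_concat intro!: arg_cong[of _ _ concat])
qed simp

end

section \<open>Environments\<close>

text \<open>The context of length \<open>N0 + k\<close> of a term is simulated in a context of length \<open>m0 + k\<close>, where the last \<open>k\<close> components
  belong to binders met on the way: \<open>\<kappa>\<close> says which old component feeds a new one (\<open>None\<close> stands for the empty list), and the
  old component \<open>p0\<close>, if any, is fed by elements of the denotation of \<open>Q\<close>, whose own \<open>nq\<close> components are placed by \<open>\<iota>\<close>.
  Weakening is the case \<open>p0 = None\<close>, substitution the case \<open>p0 = Some n\<close>.\<close>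

locale env = dcat A C for A :: "('o, 'm) cat" and C :: fclass +
  fixes m0 N0 nq :: nat and \<kappa> \<iota> :: "nat \<Rightarrow> nat option" and p0 :: "nat option" and Q :: lterm
  assumes \<kappa>: "kval m0 \<kappa> N0" and \<iota>: "kval m0 \<iota> nq" and p0: "p0 = Some d \<Longrightarrow> d < N0"
begin

definition kap :: "nat \<Rightarrow> nat option" where
  "kap c = (if c < m0 then \<kappa> c else Some (N0 + (c - m0)))"

text \<open>Under binders \<open>Q\<close> is weakened, so the binder positions receive nothing from
  its contexts.\<close>

definition iot :: "nat \<Rightarrow> nat option" where
  "iot c = (if c < m0 then \<iota> c else None)"

lemma kval_kap: "kval (m0 + k) kap (N0 + k)"
  using \<kappa> by (auto simp: kap_def)

lemma kval_iot: "kval (m0 + k) iot nq"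
  using \<iota> by (auto simp: iot_def)

abbreviation "K k \<equiv> kob (m0 + k) kap"
abbreviation "Km k \<equiv> kmor (m0 + k) kap"
abbreviation "J k \<equiv> kob (m0 + k) iot"
abbreviation "Jm k \<equiv> kmor (m0 + k) iot"

text \<open>The types at which \<open>Q\<close> is demanded. Without a position \<open>p0\<close>
  there are none, the bags below are empty, and environments become plain context morphisms.\<close>

definition pco :: "'o ctx \<Rightarrow> 'o ty list" where
  "pco \<Gamma> = (case p0 of None \<Rightarrow> [] | Some d \<Rightarrow> \<Gamma> ! d)"

definition pcm :: "'m smor list \<Rightarrow> 'm smor" where
  "pcm g = (case p0 of None \<Rightarrow> ([], []) | Some d \<Rightarrow> g ! d)"

lemma shom_pcm: "ctxhom A C \<Gamma> \<Gamma>' g \<Longrightarrow> length \<Gamma> = N0 + k \<Longrightarrow> shom A C (pco \<Gamma>) (pco \<Gamma>') (pcm g)"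
  using p0 by (fastforce simp: pco_def pcm_def ctxhom_def split: option.split)

lemma pcm_id: "length \<Gamma> = N0 + k \<Longrightarrow> pcm (cidc A \<Gamma>) = sid A (pco \<Gamma>)"
  using p0 by (auto simp: pco_def pcm_def sid_Nil split: option.split)

lemma pcm_comp: "length g = N0 + k \<Longrightarrow> length g' = N0 + k \<Longrightarrow> pcm (g \<odot> g') = scomp A (pcm g) (pcm g')"
  using p0 by (auto simp: pcm_def scomp_eq split: option.split)


definition bagok :: "'o ty list \<Rightarrow> ('o ctx \<times> ('o, 'm) el) list \<Rightarrow> bool" where
  "bagok as b \<longleftrightarrow> length b = length as \<and> (\<forall>i<length as. sem A C Q nq (fst (b ! i)) (as ! i) (snd (b ! i)))"

definition bagE :: "'o ty list \<Rightarrow> ('o ctx \<times> ('o, 'm) el) list \<Rightarrow> ('o ctx \<times> ('o, 'm) el) list \<Rightarrow> bool" where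
  "bagE as b b' \<longleftrightarrow> length b = length as \<and> length b' = length as \<and>
     (\<forall>i<length as. fst (b ! i) = fst (b' ! i) \<and> eqv A C Q nq (fst (b ! i)) (as ! i) (snd (b ! i)) (snd (b' ! i)))"

text \<open>The action of SD on bags: entries are copied, dropped or permuted together with their
  contexts, and the arrows act on the types only. Since \<open>act\<close> is functorial up to
  equivalence, so is this.\<close>

definition bagact :: "'m smor \<Rightarrow> ('o ctx \<times> ('o, 'm) el) list \<Rightarrow> ('o ctx \<times> ('o, 'm) el) list" where
  "bagact s b = map2 (\<lambda>j f. (fst (b ! j), act A Q (cidc A (fst (b ! j))) f (snd (b ! j)))) (fst s) (snd s)"

definition objs :: "nat \<Rightarrow> 'o ctx \<Rightarrow> ('o ctx \<times> ('o, 'm) el) list \<Rightarrow> 'o ctx list" where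
  "objs k \<Gamma> b = K k \<Gamma> # map (\<lambda>x. J k (fst x)) b"

abbreviation "tgt k \<Gamma> b \<equiv> ctensor (m0 + k) (objs k \<Gamma> b)"

lemma lens_objs [simp]: "lens (m0 + k) (objs k \<Gamma> b)"
  by (auto simp: objs_def)

lemma length_objs [simp]: "length (objs k \<Gamma> b) = Suc (length b)"
  by (simp add: objs_def)

lemma objs_0 [simp]: "objs k \<Gamma> b ! 0 = K k \<Gamma>"
  and objs_Suc [simp]: "j < length b \<Longrightarrow> objs k \<Gamma> b ! Suc j = J k (fst (b ! j))"
  by (simp_all add: objs_def)

text \<open>An environment from \<open>\<Delta>\<close> to \<open>\<Gamma>\<close>: a bag with one element of \<open>Q\<close>, at a context \<open>\<Gamma>\<^sub>i\<close>, for every entry of the component \<open>p0\<close> of \<open>\<Gamma>\<close>,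
  and a morphism from \<open>\<Delta>\<close> to the tensor of \<open>K \<Gamma>\<close> and all \<open>J \<Gamma>\<^sub>i\<close>. The \<open>\<Gamma>\<^sub>i\<close> are coend variables, which \<open>bE\<close> identifies.\<close>

definition bS :: "nat \<Rightarrow> 'o ctx \<Rightarrow> 'o ctx \<Rightarrow> ('o ctx \<times> ('o, 'm) el) list \<times> 'm smor list \<Rightarrow> bool" where
  "bS k \<Delta> \<Gamma> \<theta> \<longleftrightarrow> length \<Gamma> = N0 + k \<and> bagok (pco \<Gamma>) (fst \<theta>) \<and> ctxhom A C \<Delta> (tgt k \<Gamma> (fst \<theta>)) (snd \<theta>)"

text \<open>Working up to \<open>eqv\<close> merges the componentwise equivalence and the coend over
  the contexts of the entries into a single kind of generator.\<close>

definition bagto :: "'o ty list \<Rightarrow> ('o ctx \<times> ('o, 'm) el) list \<Rightarrow> 'm smor list list \<Rightarrow> ('o ctx \<times> ('o, 'm) el) list \<Rightarrow> bool" where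
  "bagto as b vs b' \<longleftrightarrow> bagok as b \<and> bagok as b' \<and> length vs = length as \<and>
     (\<forall>i<length as. ctxhom A C (fst (b ! i)) (fst (b' ! i)) (vs ! i) \<and>
       eqv A C Q nq (fst (b ! i)) (as ! i) (snd (b ! i)) (act A Q (vs ! i) (did A (as ! i)) (snd (b' ! i))))"

definition wmor :: "nat \<Rightarrow> 'o ctx \<Rightarrow> ('o ctx \<times> ('o, 'm) el) list \<Rightarrow> 'm smor list list \<Rightarrow> 'm smor list" where
  "wmor k \<Gamma> b vs = ctensor_mor (m0 + k) (objs k \<Gamma> b) (cidc A (K k \<Gamma>) # map (Jm k) vs)"

definition bgen where
  "bgen k \<Gamma> \<theta> \<theta>' \<longleftrightarrow> (\<exists>vs. bagto (pco \<Gamma>) (fst \<theta>) vs (fst \<theta>') \<and> snd \<theta>' = snd \<theta> \<odot> wmor k \<Gamma> (fst \<theta>) vs)"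

definition bE where
  "bE k \<Delta> \<Gamma> = equivclose (bS k \<Delta> \<Gamma>) (bgen k \<Gamma>)"

lemma bE_refl: "bS k \<Delta> \<Gamma> \<theta> \<Longrightarrow> bE k \<Delta> \<Gamma> \<theta> \<theta>" unfolding bE_def by (rule ec_refl)
lemma bE_sym: "bE k \<Delta> \<Gamma> \<theta> \<theta>' \<Longrightarrow> bE k \<Delta> \<Gamma> \<theta>' \<theta>" unfolding bE_def by (rule ec_sym)
lemma bE_trans: "bE k \<Delta> \<Gamma> \<theta> \<theta>' \<Longrightarrow> bE k \<Delta> \<Gamma> \<theta>' \<theta>'' \<Longrightarrow> bE k \<Delta> \<Gamma> \<theta> \<theta>''" unfolding bE_def by (rule ec_trans)
lemma bE_dom: "bE k \<Delta> \<Gamma> \<theta> \<theta>' \<Longrightarrow> bS k \<Delta> \<Gamma> \<theta>" "bE k \<Delta> \<Gamma> \<theta> \<theta>' \<Longrightarrow> bS k \<Delta> \<Gamma> \<theta>'"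
  unfolding bE_def by (auto dest: equivclose_dom)
lemma bE_gen: "bS k \<Delta> \<Gamma> \<theta> \<Longrightarrow> bS k \<Delta> \<Gamma> \<theta>' \<Longrightarrow> bgen k \<Gamma> \<theta> \<theta>' \<Longrightarrow> bE k \<Delta> \<Gamma> \<theta> \<theta>'" unfolding bE_def by (rule ec_gen)

lemma bagok_len: "bagok as b \<Longrightarrow> i < length as \<Longrightarrow> length (fst (b ! i)) = nq"
  by (auto simp: bagok_def dest: sem_len)

lemma ctxhom_Jm: "length \<Gamma> = nq \<Longrightarrow> ctxhom A C \<Gamma> \<Gamma>' v \<Longrightarrow> ctxhom A C (J k \<Gamma>) (J k \<Gamma>') (Jm k v)"
  by (intro ctxhom_kmor) (use kval_iot in auto)

lemma ctxhom_Km: "length \<Gamma> = N0 + k \<Longrightarrow> ctxhom A C \<Gamma> \<Gamma>' v \<Longrightarrow> ctxhom A C (K k \<Gamma>) (K k \<Gamma>') (Km k v)"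
  by (intro ctxhom_kmor) (use kval_kap in auto)

lemma bagto_homs:
  assumes "bagto (pco \<Gamma>) b vs b'" "j < length (objs k \<Gamma> b)"
  shows "ctxhom A C (objs k \<Gamma> b ! j) (objs k \<Gamma> b' ! j) ((cidc A (K k \<Gamma>) # map (Jm k) vs) ! j)"
proof (cases j)
  case 0
  then show ?thesis by (simp add: ctxhom_cidc)
next
  case (Suc i)
  have ok: "bagok (pco \<Gamma>) b" "bagok (pco \<Gamma>) b'" using assms(1) by (auto simp: bagto_def)
  have i: "i < length (pco \<Gamma>)" "i < length b" "i < length b'" "i < length vs"
    using assms Suc by (auto simp: bagto_def bagok_def)
  show ?thesis using ctxhom_Jm[OF bagok_len[OF ok(1) i(1)], of "fst (b' ! i)" "vs ! i" k] assms(1) i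
    by (simp add: Suc bagto_def)
qed

text \<open>The projection equations are the form in which \<open>tgt_ext\<close> can compare this
  morphism with others.\<close>

lemma wmor:
  assumes b: "bagto (pco \<Gamma>) b vs b'"
  shows ctxhom_wmor: "ctxhom A C (tgt k \<Gamma> b) (tgt k \<Gamma> b') (wmor k \<Gamma> b vs)"
    and wmor_0: "wmor k \<Gamma> b vs \<odot> cprj (m0 + k) (objs k \<Gamma> b') 0 = cprj (m0 + k) (objs k \<Gamma> b) 0"
    and wmor_Suc: "j < length (pco \<Gamma>) \<Longrightarrow> wmor k \<Gamma> b vs \<odot> cprj (m0 + k) (objs k \<Gamma> b') (Suc j) =
      cprj (m0 + k) (objs k \<Gamma> b) (Suc j) \<odot> Jm k (vs ! j)"
proof -
  have l: "length b = length (pco \<Gamma>)" "length b' = length (pco \<Gamma>)" "length vs = length (pco \<Gamma>)"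
    using b by (auto simp: bagto_def bagok_def)
  show "ctxhom A C (tgt k \<Gamma> b) (tgt k \<Gamma> b') (wmor k \<Gamma> b vs)"
    unfolding wmor_def using l bagto_homs[OF b] by (intro ctxhom_ctensor_mor) auto
  have *: "wmor k \<Gamma> b vs \<odot> cprj (m0 + k) (objs k \<Gamma> b') j =
     cprj (m0 + k) (objs k \<Gamma> b) j \<odot> (cidc A (K k \<Gamma>) # map (Jm k) vs) ! j" if "j < length (objs k \<Gamma> b)" for j
    unfolding wmor_def using l bagto_homs[OF b, THEN ctxhom_ctxw] that by (intro ctensor_mor_cprj) auto
  show "wmor k \<Gamma> b vs \<odot> cprj (m0 + k) (objs k \<Gamma> b') 0 = cprj (m0 + k) (objs k \<Gamma> b) 0"
    using *[of 0] ctxw_cprj[of 0 "objs k \<Gamma> b" "m0 + k"] by (simp add: ccompc_idr)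
  show "wmor k \<Gamma> b vs \<odot> cprj (m0 + k) (objs k \<Gamma> b') (Suc j) =
      cprj (m0 + k) (objs k \<Gamma> b) (Suc j) \<odot> Jm k (vs ! j)" if "j < length (pco \<Gamma>)"
    using *[of "Suc j"] that l by simp
qed

lemma tgt_ext:
  assumes "ctxw \<Delta> (tgt k \<Gamma> b) u" "ctxw \<Delta> (tgt k \<Gamma> b) v"
    "u \<odot> cprj (m0 + k) (objs k \<Gamma> b) 0 = v \<odot> cprj (m0 + k) (objs k \<Gamma> b) 0"
    "\<And>j. j < length b \<Longrightarrow> u \<odot> cprj (m0 + k) (objs k \<Gamma> b) (Suc j) = v \<odot> cprj (m0 + k) (objs k \<Gamma> b) (Suc j)"
  shows "u = v"
proof (rule ctxw_ext[OF assms(1,2)])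
  fix j assume "j < length (objs k \<Gamma> b)"
  then show "u \<odot> cprj (m0 + k) (objs k \<Gamma> b) j = v \<odot> cprj (m0 + k) (objs k \<Gamma> b) j"
    using assms(3,4) by (cases j) auto
qed

lemma ctxw_cprj_objs:
  "ctxw (tgt k \<Gamma> b) (K k \<Gamma>) (cprj (m0 + k) (objs k \<Gamma> b) 0)"
  "j < length b \<Longrightarrow> ctxw (tgt k \<Gamma> b) (J k (fst (b ! j))) (cprj (m0 + k) (objs k \<Gamma> b) (Suc j))"
  using ctxw_cprj[of 0 "objs k \<Gamma> b" "m0 + k"] ctxw_cprj[of "Suc j" "objs k \<Gamma> b" "m0 + k"] by auto

text \<open>A generator whose morphisms are identities: equivalent entries at the same contexts may
  be exchanged while the morphism part stays as it is.\<close>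

lemma bagE_bE:
  assumes "bS k \<Delta> \<Gamma> (b, h)" "bagE (pco \<Gamma>) b b'"
  shows "bE k \<Delta> \<Gamma> (b, h) (b', h)"
proof (rule bE_gen[OF assms(1)])
  have f: "map fst b = map fst b'" using assms(2) by (auto simp: bagE_def intro!: nth_equalityI)
  have o: "objs k \<Gamma> b = objs k \<Gamma> b'"
    using arg_cong[OF f, of "map (J k)"] by (simp add: objs_def comp_def)
  have ok: "bagok (pco \<Gamma>) b'" using assms(2) unfolding bagE_def bagok_def by (metis eqv_sem(2))
  show "bS k \<Delta> \<Gamma> (b', h)" using assms(1) ok o by (simp add: bS_def)
  let ?vs = "map (\<lambda>x. cidc A (fst x)) b"
  have t: "bagto (pco \<Gamma>) b ?vs b'"
    unfolding bagto_def
  proof (intro conjI allI impI)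
    fix i assume i: "i < length (pco \<Gamma>)"
    show "ctxhom A C (fst (b ! i)) (fst (b' ! i)) (?vs ! i)"
      using assms(2) i by (simp add: bagE_def ctxhom_cidc)
    have "eqv A C Q nq (fst (b ! i)) (pco \<Gamma> ! i) (snd (b ! i)) (snd (b' ! i))" "fst (b ! i) = fst (b' ! i)" "i < length b"
      using assms(2) i by (auto simp: bagE_def)
    then show "eqv A C Q nq (fst (b ! i)) (pco \<Gamma> ! i) (snd (b ! i)) (act A Q (?vs ! i) (did A (pco \<Gamma> ! i)) (snd (b' ! i)))"
      using eqv_trans[OF _ eqv_sym[OF isf_id[OF isf_den, of Q nq, unfolded den_simps]]] eqv_sem(2) by fastforce
  qed (use assms ok in \<open>auto simp: bS_def bagE_def\<close>)
  have l: "length (fst x) = nq" if "x \<in> set b" for x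
    using that assms(1) bagok_len[of "pco \<Gamma>" b] by (auto simp: bS_def in_set_conv_nth bagok_def)
  have "wmor k \<Gamma> b ?vs = cidc A (tgt k \<Gamma> b)"
    unfolding wmor_def ctensor_mor_id[OF lens_objs, symmetric]
    using l kval_iot by (auto simp: objs_def comp_def kmor_id intro!: arg_cong[of _ _ "ctensor_mor _ _"])
  moreover have "h \<odot> cidc A (tgt k \<Gamma> b) = h" using assms(1) by (intro ccompc_idr[OF ctxhom_ctxw[of \<Delta>]]) (simp add: bS_def)
  ultimately have "h = h \<odot> wmor k \<Gamma> b ?vs" by simp
  then show "bgen k \<Gamma> (b, h) (b', h)" using t by (auto simp: bgen_def)
qed

section \<open>The actions of context morphisms on environments\<close>

text \<open>Environments are a profunctor. \<open>BL\<close> acts in the source by precomposition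
  and is strictly functorial; \<open>BR\<close> acts in the target and changes the bag as well, so
  its identity and composition laws hold only up to \<open>bE\<close>.\<close>

definition BL :: "'m smor list \<Rightarrow> 'b \<times> 'm smor list \<Rightarrow> 'b \<times> 'm smor list" where
  "BL u \<theta> = (fst \<theta>, u \<odot> snd \<theta>)"

text \<open>Two stages: first the entries of the bag are copied or moved as \<open>pcm g\<close>
  prescribes, with the block of \<open>\<Gamma>\<close> kept in front; then \<open>g\<close> acts on
  that block and identities act elsewhere.\<close>

definition rmap where
  "rmap k \<Gamma> b g = cblock A (m0 + k) (objs k \<Gamma> b) (0 # map Suc (fst (pcm g))) \<odot>
     ctensor_mor (m0 + k) (objs k \<Gamma> (bagact (pcm g) b))
       (Km k g # map (\<lambda>x. cidc A (J k (fst x))) (bagact (pcm g) b))"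

definition BR where
  "BR k \<Gamma> g \<theta> = (bagact (pcm g) (fst \<theta>), snd \<theta> \<odot> rmap k \<Gamma> (fst \<theta>) g)"

lemma bagact_nth:
  assumes "shomw as bs s"
  shows "length (bagact s b) = length bs"
    "i < length bs \<Longrightarrow> bagact s b ! i = (fst (b ! (fst s ! i)), act A Q (cidc A (fst (b ! (fst s ! i)))) (snd s ! i) (snd (b ! (fst s ! i))))"
  using assms by (auto simp: bagact_def shomw_def)

lemma bagok_bagact:
  assumes s: "shomw as bs s" and b: "bagok as b"
  shows "bagok bs (bagact s b)"
  unfolding bagok_def
proof (intro conjI allI impI)
  show "length (bagact s b) = length bs" by (rule bagact_nth[OF s])
  fix i assume i: "i < length bs"
  then have "fst s ! i < length as" "dhom A C (as ! (fst s ! i)) (bs ! i) (snd s ! i)" using s by (auto simp: shomw_def)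
  then show "sem A C Q nq (fst (bagact s b ! i)) (bs ! i) (snd (bagact s b ! i))"
    using b unfolding bagact_nth(2)[OF s i] bagok_def by (auto intro: sem_act[OF _ ctxhom_cidc])
qed

lemma rmap:
  assumes g: "ctxhom A C \<Gamma> \<Gamma>' g" and N: "length \<Gamma> = N0 + k" and b: "bagok (pco \<Gamma>) b"
  shows ctxhom_rmap: "ctxhom A C (tgt k \<Gamma> b) (tgt k \<Gamma>' (bagact (pcm g) b)) (rmap k \<Gamma> b g)"
    and rmap_0: "rmap k \<Gamma> b g \<odot> cprj (m0 + k) (objs k \<Gamma>' (bagact (pcm g) b)) 0 = cprj (m0 + k) (objs k \<Gamma> b) 0 \<odot> Km k g"
    and rmap_Suc: "j < length (pco \<Gamma>') \<Longrightarrow> rmap k \<Gamma> b g \<odot> cprj (m0 + k) (objs k \<Gamma>' (bagact (pcm g) b)) (Suc j) =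
        cprj (m0 + k) (objs k \<Gamma> b) (Suc (fst (pcm g) ! j))"
proof -
  let ?m = "m0 + k"
  note s = shom_pcm[OF g N] and sw = shom_shomw[OF shom_pcm[OF g N]]
  let ?\<alpha> = "fst (pcm g)" and ?b = "bagact (pcm g) b"
  have la: "length ?\<alpha> = length (pco \<Gamma>')" "\<And>i. i < length (pco \<Gamma>') \<Longrightarrow> ?\<alpha> ! i < length b"
    using sw b by (auto simp: shomw_def bagok_def)
  have lb: "length ?b = length (pco \<Gamma>')" by (rule bagact_nth[OF sw])
  have mid: "map ((!) (objs k \<Gamma> b)) (0 # map Suc ?\<alpha>) = objs k \<Gamma> ?b"
  proof (rule nth_equalityI)
    fix i assume "i < length (map ((!) (objs k \<Gamma> b)) (0 # map Suc ?\<alpha>))"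
    then show "map ((!) (objs k \<Gamma> b)) (0 # map Suc ?\<alpha>) ! i = objs k \<Gamma> ?b ! i"
      using la lb bagact_nth(2)[OF sw] by (cases i) auto
  qed (simp add: la lb)
  have inb: "\<forall>j\<in>set (0 # map Suc ?\<alpha>). j < length (objs k \<Gamma> b)"
    using la by (auto simp: in_set_conv_nth)
  have cl: "in_class C (length (0 # map Suc ?\<alpha>)) (length (objs k \<Gamma> b)) (0 # map Suc ?\<alpha>)"
    using in_class_Suc[of "length (pco \<Gamma>')" "length (pco \<Gamma>)" ?\<alpha>] shom_in_class[of _ _ ?\<alpha> "snd (pcm g)"] s b la
    by (simp add: bagok_def)
  let ?ws = "Km k g # map (\<lambda>x. cidc A (J k (fst x))) ?b"
  have w: "ctxhom A C (objs k \<Gamma> ?b ! j) (objs k \<Gamma>' ?b ! j) (?ws ! j)" if "j < length (objs k \<Gamma> ?b)" for j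
    using that by (cases j) (auto simp: ctxhom_cidc ctxhom_Km[OF N g])
  have c: "ctxhom A C (tgt k \<Gamma> b) (tgt k \<Gamma> ?b) (cblock A ?m (objs k \<Gamma> b) (0 # map Suc ?\<alpha>))"
    using ctxhom_cblock[OF cl lens_objs] unfolding mid .
  have t: "ctxhom A C (tgt k \<Gamma> ?b) (tgt k \<Gamma>' ?b) (ctensor_mor ?m (objs k \<Gamma> ?b) ?ws)"
    using w by (intro ctxhom_ctensor_mor) auto
  show "ctxhom A C (tgt k \<Gamma> b) (tgt k \<Gamma>' ?b) (rmap k \<Gamma> b g)"
    unfolding rmap_def by (rule ctxhom_comp[OF c t])
  have e: "rmap k \<Gamma> b g \<odot> cprj ?m (objs k \<Gamma>' ?b) j = cprj ?m (objs k \<Gamma> b) ((0 # map Suc ?\<alpha>) ! j) \<odot> ?ws ! j"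
    if j: "j < length (objs k \<Gamma> ?b)" for j
  proof -
    have "rmap k \<Gamma> b g \<odot> cprj ?m (objs k \<Gamma>' ?b) j = cblock A ?m (objs k \<Gamma> b) (0 # map Suc ?\<alpha>) \<odot>
      (ctensor_mor ?m (objs k \<Gamma> ?b) ?ws \<odot> cprj ?m (objs k \<Gamma>' ?b) j)"
      unfolding rmap_def using j by (intro ccompc_assoc[OF ctxhom_ctxw[OF c] ctxhom_ctxw[OF t] ctxw_cprj]) auto
    also have "ctensor_mor ?m (objs k \<Gamma> ?b) ?ws \<odot> cprj ?m (objs k \<Gamma>' ?b) j = cprj ?m (objs k \<Gamma> ?b) j \<odot> ?ws ! j"
      using j w by (intro ctensor_mor_cprj) (auto intro: ctxhom_ctxw)
    also have "cblock A ?m (objs k \<Gamma> b) (0 # map Suc ?\<alpha>) \<odot> (cprj ?m (objs k \<Gamma> ?b) j \<odot> ?ws ! j) =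
       cblock A ?m (objs k \<Gamma> b) (0 # map Suc ?\<alpha>) \<odot> cprj ?m (objs k \<Gamma> ?b) j \<odot> ?ws ! j"
      using j by (intro ccompc_assoc[symmetric, OF ctxhom_ctxw[OF c] ctxw_cprj ctxhom_ctxw[OF w]]) auto
    also have "cblock A ?m (objs k \<Gamma> b) (0 # map Suc ?\<alpha>) \<odot> cprj ?m (objs k \<Gamma> ?b) j =
        cprj ?m (objs k \<Gamma> b) ((0 # map Suc ?\<alpha>) ! j)"
      using cblock_cprj[OF inb lens_objs, of j] j la lb unfolding mid by simp
    finally show ?thesis .
  qed
  show "rmap k \<Gamma> b g \<odot> cprj ?m (objs k \<Gamma>' ?b) 0 = cprj ?m (objs k \<Gamma> b) 0 \<odot> Km k g"
    using e[of 0] by simp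
  show "rmap k \<Gamma> b g \<odot> cprj ?m (objs k \<Gamma>' ?b) (Suc j) = cprj ?m (objs k \<Gamma> b) (Suc (?\<alpha> ! j))"
    if j: "j < length (pco \<Gamma>')"
    using e[of "Suc j"] j la lb bagact_nth(2)[OF sw j] ccompc_idr[OF ctxw_cprj_objs(2)[OF la(2)[OF j]]] by simp
qed

lemma bS_BL: "bS k \<Delta> \<Gamma> \<theta> \<Longrightarrow> ctxhom A C \<Delta>' \<Delta> u \<Longrightarrow> bS k \<Delta>' \<Gamma> (BL u \<theta>)"
  by (auto simp: bS_def BL_def intro: ctxhom_comp)

lemma bS_BR: "bS k \<Delta> \<Gamma> \<theta> \<Longrightarrow> ctxhom A C \<Gamma> \<Gamma>' g \<Longrightarrow> bS k \<Delta> \<Gamma>' (BR k \<Gamma> g \<theta>)"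
  by (auto simp: bS_def BR_def ctxhom_len intro: ctxhom_comp ctxhom_rmap bagok_bagact[OF shom_shomw[OF shom_pcm]])

lemma BL_id: "bS k \<Delta> \<Gamma> \<theta> \<Longrightarrow> BL (cidc A \<Delta>) \<theta> = \<theta>"
  by (auto simp: bS_def BL_def ccompc_idl[OF ctxhom_ctxw] intro: prod_eqI)

lemma BL_comp: "bS k \<Delta> \<Gamma> \<theta> \<Longrightarrow> ctxhom A C \<Delta>' \<Delta> u \<Longrightarrow> ctxhom A C \<Delta>'' \<Delta>' u' \<Longrightarrow> BL (u' \<odot> u) \<theta> = BL u' (BL u \<theta>)"
  by (auto simp: bS_def BL_def intro!: ccompc_assoc[OF ctxhom_ctxw ctxhom_ctxw ctxhom_ctxw])

lemma BR_BL: "bS k \<Delta> \<Gamma> \<theta> \<Longrightarrow> ctxhom A C \<Delta>' \<Delta> u \<Longrightarrow> ctxhom A C \<Gamma> \<Gamma>' g \<Longrightarrow> BR k \<Gamma> g (BL u \<theta>) = BL u (BR k \<Gamma> g \<theta>)"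
  by (auto simp: bS_def BL_def BR_def intro!: ccompc_assoc[OF ctxhom_ctxw ctxhom_ctxw ctxhom_ctxw[OF ctxhom_rmap]])

lemma BL_cong:
  assumes "bE k \<Delta> \<Gamma> \<theta> \<theta>'" and u: "ctxhom A C \<Delta>' \<Delta> u"
  shows "bE k \<Delta>' \<Gamma> (BL u \<theta>) (BL u \<theta>')"
proof (rule equivclose_map[OF assms(1)[unfolded bE_def], where f="BL u"])
  fix x y assume x: "bS k \<Delta> \<Gamma> x" "bS k \<Delta> \<Gamma> y" "bgen k \<Gamma> x y"
  then obtain vs where v: "bagto (pco \<Gamma>) (fst x) vs (fst y)" "snd y = snd x \<odot> wmor k \<Gamma> (fst x) vs"
    by (auto simp: bgen_def)
  have "u \<odot> snd y = u \<odot> snd x \<odot> wmor k \<Gamma> (fst x) vs"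
    using x(1) unfolding v(2) bS_def by (intro ccompc_assoc[symmetric, OF ctxhom_ctxw[OF u] ctxhom_ctxw ctxhom_ctxw[OF ctxhom_wmor[OF v(1)]]]) auto
  then have "bgen k \<Gamma> (BL u x) (BL u y)" using v(1) by (auto simp: bgen_def BL_def)
  then show "bE k \<Delta>' \<Gamma> (BL u x) (BL u y)" using bS_BL[OF x(1) u] bS_BL[OF x(2) u] by (intro bE_gen)
qed (blast intro: bE_refl bE_sym bE_trans bS_BL[OF _ u])+

text \<open>A generator \<open>vs\<close> is sent to the generator reindexed along
  \<open>pcm g\<close>. The entries match by \<open>isf_swap\<close>, and the square formed by
  \<open>wmor\<close> and \<open>rmap\<close> commutes because it does so after each
  projection.\<close>

lemma BR_cong:
  assumes "bE k \<Delta> \<Gamma> \<theta> \<theta>'" and g: "ctxhom A C \<Gamma> \<Gamma>' g"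
  shows "bE k \<Delta> \<Gamma>' (BR k \<Gamma> g \<theta>) (BR k \<Gamma> g \<theta>')"
proof (rule equivclose_map[OF assms(1)[unfolded bE_def], where f="BR k \<Gamma> g"])
  fix x y assume x: "bS k \<Delta> \<Gamma> x" "bS k \<Delta> \<Gamma> y" "bgen k \<Gamma> x y"
  then obtain vs where v: "bagto (pco \<Gamma>) (fst x) vs (fst y)" "snd y = snd x \<odot> wmor k \<Gamma> (fst x) vs"
    by (auto simp: bgen_def)
  have N: "length \<Gamma> = N0 + k" and ok: "bagok (pco \<Gamma>) (fst x)" "bagok (pco \<Gamma>) (fst y)"
    and h: "ctxhom A C \<Delta> (tgt k \<Gamma> (fst x)) (snd x)"
    using x by (auto simp: bS_def)
  note s = shom_shomw[OF shom_pcm[OF g N]]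
  have la: "length (fst (pcm g)) = length (pco \<Gamma>')" "\<And>i. i < length (pco \<Gamma>') \<Longrightarrow> fst (pcm g) ! i < length (pco \<Gamma>)"
    "\<And>i. i < length (pco \<Gamma>') \<Longrightarrow> dhom A C (pco \<Gamma> ! (fst (pcm g) ! i)) (pco \<Gamma>' ! i) (snd (pcm g) ! i)"
    using s by (auto simp: shomw_def)
  let ?vs = "map ((!) vs) (fst (pcm g))"
  let ?b = "bagact (pcm g) (fst x)" and ?b' = "bagact (pcm g) (fst y)"
  have lb: "length ?b = length (pco \<Gamma>')" "length ?b' = length (pco \<Gamma>')" "length (fst x) = length (pco \<Gamma>)" "length (fst y) = length (pco \<Gamma>)"
    using bagact_nth(1)[OF s] ok by (auto simp: bagok_def)
  have t: "bagto (pco \<Gamma>') ?b ?vs ?b'"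
    unfolding bagto_def
  proof (intro conjI allI impI bagok_bagact[OF s] ok)
    fix i assume i: "i < length (pco \<Gamma>')"
    let ?j = "fst (pcm g) ! i"
    have vj: "ctxhom A C (fst (fst x ! ?j)) (fst (fst y ! ?j)) (vs ! ?j)"
      "eqv A C Q nq (fst (fst x ! ?j)) (pco \<Gamma> ! ?j) (snd (fst x ! ?j)) (act A Q (vs ! ?j) (did A (pco \<Gamma> ! ?j)) (snd (fst y ! ?j)))"
      using v(1) la(2)[OF i] by (auto simp: bagto_def)
    show "ctxhom A C (fst (?b ! i)) (fst (?b' ! i)) (?vs ! i)"
      unfolding bagact_nth(2)[OF s i] using vj(1) la i by simp
    have q: "sem A C Q nq (fst (fst y ! ?j)) (pco \<Gamma> ! ?j) (snd (fst y ! ?j))" using ok(2) la(2)[OF i] by (simp add: bagok_def)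
    have "eqv A C Q nq (fst (fst x ! ?j)) (pco \<Gamma>' ! i) (act A Q (cidc A (fst (fst x ! ?j))) (snd (pcm g) ! i) (snd (fst x ! ?j)))
      (act A Q (vs ! ?j) (did A (pco \<Gamma>' ! i)) (act A Q (cidc A (fst (fst y ! ?j))) (snd (pcm g) ! i) (snd (fst y ! ?j))))"
      using isf_cong[OF isf_den _ ctxhom_cidc la(3)[OF i], of Q nq, unfolded den_simps, OF vj(2)]
        isf_swap[OF isf_den _ vj(1) la(3)[OF i], of Q nq, unfolded den_simps, OF q]
      by (rule eqv_trans)
    then show "eqv A C Q nq (fst (?b ! i)) (pco \<Gamma>' ! i) (snd (?b ! i)) (act A Q (?vs ! i) (did A (pco \<Gamma>' ! i)) (snd (?b' ! i)))"
      unfolding bagact_nth(2)[OF s i] using la i by simp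
  qed (use la in simp)
  note r = rmap[OF g N ok(1)] and r' = rmap[OF g N ok(2)] and w = wmor[where k=k, OF v(1)] and w' = wmor[where k=k, OF t]
  let ?m = "m0 + k"
  have "wmor k \<Gamma> (fst x) vs \<odot> rmap k \<Gamma> (fst y) g = rmap k \<Gamma> (fst x) g \<odot> wmor k \<Gamma>' ?b ?vs"
  proof (rule tgt_ext)
    note c1 = ctxhom_comp[OF w(1) r'(1)] and c2 = ctxhom_comp[OF r(1) w'(1)]
    show "ctxw (tgt k \<Gamma> (fst x)) (tgt k \<Gamma>' ?b') (wmor k \<Gamma> (fst x) vs \<odot> rmap k \<Gamma> (fst y) g)" by (rule ctxhom_ctxw[OF c1])
    show "ctxw (tgt k \<Gamma> (fst x)) (tgt k \<Gamma>' ?b') (rmap k \<Gamma> (fst x) g \<odot> wmor k \<Gamma>' ?b ?vs)" by (rule ctxhom_ctxw[OF c2])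
    note kg = ctxhom_ctxw[OF ctxhom_Km[OF N g]]
    show "wmor k \<Gamma> (fst x) vs \<odot> rmap k \<Gamma> (fst y) g \<odot> cprj ?m (objs k \<Gamma>' ?b') 0 =
        rmap k \<Gamma> (fst x) g \<odot> wmor k \<Gamma>' ?b ?vs \<odot> cprj ?m (objs k \<Gamma>' ?b') 0"
      by (simp only: ccompc_assoc[OF w(1)[THEN ctxhom_ctxw] r'(1)[THEN ctxhom_ctxw] ctxw_cprj_objs(1)]
        ccompc_assoc[OF r(1)[THEN ctxhom_ctxw] w'(1)[THEN ctxhom_ctxw] ctxw_cprj_objs(1)]
        r'(2) r(2) w(2) w'(2) ccompc_assoc[symmetric, OF w(1)[THEN ctxhom_ctxw] ctxw_cprj_objs(1) kg])
    fix j assume "j < length ?b'"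
    then have j: "j < length (pco \<Gamma>')" "j < length ?b" "j < length ?b'" "fst (pcm g) ! j < length (fst y)"
       "fst (pcm g) ! j < length (fst x)" "fst (pcm g) ! j < length (pco \<Gamma>)" using lb la by auto
    show "wmor k \<Gamma> (fst x) vs \<odot> rmap k \<Gamma> (fst y) g \<odot> cprj ?m (objs k \<Gamma>' ?b') (Suc j) =
        rmap k \<Gamma> (fst x) g \<odot> wmor k \<Gamma>' ?b ?vs \<odot> cprj ?m (objs k \<Gamma>' ?b') (Suc j)"
    proof -
      have "ctxw (J k (fst (?b ! j))) (J k (fst (?b' ! j))) (Jm k (?vs ! j))"
        using t j by (intro ctxhom_ctxw[OF ctxhom_Jm]) (auto simp: bagto_def bagok_len)
      then have vw: "ctxw (J k (fst (?b ! j))) (J k (fst (?b' ! j))) (Jm k (vs ! (fst (pcm g) ! j)))"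
        using j la by simp
      show ?thesis using j la
      by (simp only: ccompc_assoc[OF w(1)[THEN ctxhom_ctxw] r'(1)[THEN ctxhom_ctxw] ctxw_cprj_objs(2)]
        ccompc_assoc[OF r(1)[THEN ctxhom_ctxw] w'(1)[THEN ctxhom_ctxw] ctxw_cprj_objs(2)]
        r'(3) r(3) w(3) w'(3) ccompc_assoc[symmetric, OF r(1)[THEN ctxhom_ctxw] ctxw_cprj_objs(2) vw] nth_map)
    qed
  qed
  then have "snd y \<odot> rmap k \<Gamma> (fst y) g = snd x \<odot> rmap k \<Gamma> (fst x) g \<odot> wmor k \<Gamma>' ?b ?vs"
    unfolding v(2) using ccompc_assoc[OF h[THEN ctxhom_ctxw] w(1)[THEN ctxhom_ctxw] r'(1)[THEN ctxhom_ctxw]]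
      ccompc_assoc[OF h[THEN ctxhom_ctxw] r(1)[THEN ctxhom_ctxw] w'(1)[THEN ctxhom_ctxw]] by simp
  then have "bgen k \<Gamma>' (BR k \<Gamma> g x) (BR k \<Gamma> g y)" using t by (auto simp: bgen_def BR_def)
  then show "bE k \<Delta> \<Gamma>' (BR k \<Gamma> g x) (BR k \<Gamma> g y)" using bS_BR[OF x(1) g] bS_BR[OF x(2) g] by (intro bE_gen)
qed (blast intro: bE_refl bE_sym bE_trans bS_BR[OF _ g])+

text \<open>\<open>rmap\<close> of an identity is an identity, but identities have acted on the bag,
  which is neutral only up to equivalence; \<open>bagE_bE\<close> closes this gap.\<close>

lemma BR_id:
  assumes t: "bS k \<Delta> \<Gamma> \<theta>"
  shows "bE k \<Delta> \<Gamma> (BR k \<Gamma> (cidc A \<Gamma>) \<theta>) \<theta>"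
proof -
  obtain b h where \<theta>: "\<theta> = (b, h)" by fastforce
  have N: "length \<Gamma> = N0 + k" and ok: "bagok (pco \<Gamma>) b" and h: "ctxhom A C \<Delta> (tgt k \<Gamma> b) h"
    using t by (auto simp: bS_def \<theta>)
  note s = shom_shomw[OF shom_sid, of "pco \<Gamma>"]
  note r = rmap[OF ctxhom_cidc N ok]
  let ?b = "bagact (sid A (pco \<Gamma>)) b"
  have lb: "length b = length (pco \<Gamma>)" "length ?b = length (pco \<Gamma>)" using ok bagact_nth(1)[OF s] by (auto simp: bagok_def)
  have e: "bagE (pco \<Gamma>) ?b b"
    unfolding bagE_def
  proof (intro conjI allI impI lb)
    fix i assume i: "i < length (pco \<Gamma>)"
    show "fst (?b ! i) = fst (b ! i)" unfolding bagact_nth(2)[OF s i] using i by simp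
    show "eqv A C Q nq (fst (?b ! i)) (pco \<Gamma> ! i) (snd (?b ! i)) (snd (b ! i))"
      unfolding bagact_nth(2)[OF s i] using i ok isf_id[OF isf_den, of Q nq, unfolded den_simps] by (simp add: snd_sid bagok_def)
  qed
  have o: "objs k \<Gamma> ?b = objs k \<Gamma> b"
    using e lb by (auto simp: objs_def bagE_def intro!: nth_equalityI)
  have "rmap k \<Gamma> b (cidc A \<Gamma>) = cidc A (tgt k \<Gamma> b)"
  proof (rule tgt_ext)
    show "ctxw (tgt k \<Gamma> b) (tgt k \<Gamma> b) (rmap k \<Gamma> b (cidc A \<Gamma>))"
      using r(1)[THEN ctxhom_ctxw] unfolding pcm_id[OF N] o .
    show "ctxw (tgt k \<Gamma> b) (tgt k \<Gamma> b) (cidc A (tgt k \<Gamma> b))" by (rule ctxw_cidc)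
    have ki: "Km k (cidc A \<Gamma>) = cidc A (K k \<Gamma>)" by (rule kmor_id) (use kval_kap N in auto)
    show "rmap k \<Gamma> b (cidc A \<Gamma>) \<odot> cprj (m0 + k) (objs k \<Gamma> b) 0 = cidc A (tgt k \<Gamma> b) \<odot> cprj (m0 + k) (objs k \<Gamma> b) 0"
      using r(2) unfolding pcm_id[OF N] o ki ccompc_idr[OF ctxw_cprj_objs(1)] ccompc_idl[OF ctxw_cprj_objs(1)] .
    fix j assume j: "j < length b"
    show "rmap k \<Gamma> b (cidc A \<Gamma>) \<odot> cprj (m0 + k) (objs k \<Gamma> b) (Suc j) = cidc A (tgt k \<Gamma> b) \<odot> cprj (m0 + k) (objs k \<Gamma> b) (Suc j)"
      using r(3)[of j] j lb unfolding pcm_id[OF N] o ccompc_idl[OF ctxw_cprj_objs(2)[OF j]] by simp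
  qed
  then have "BR k \<Gamma> (cidc A \<Gamma>) \<theta> = (?b, h)"
    by (simp add: BR_def \<theta> pcm_id[OF N] ccompc_idr[OF ctxhom_ctxw[OF h]])
  moreover have "bE k \<Delta> \<Gamma> (?b, h) (b, h)"
  proof (rule bagE_bE[OF _ e])
    show "bS k \<Delta> \<Gamma> (?b, h)" unfolding bS_def fst_conv snd_conv o using N h bagok_bagact[OF s ok] by blast
  qed
  ultimately show ?thesis by (simp add: \<theta>)
qed

text \<open>The bags obtained in one step and in two steps have the same contexts and equivalent
  elements. Hence their targets coincide, and the \<open>rmap\<close> composites can be compared by
  projections.\<close>

lemma BR_comp:
  assumes t: "bS k \<Delta> \<Gamma> \<theta>" and g: "ctxhom A C \<Gamma> \<Gamma>' g" and g': "ctxhom A C \<Gamma>' \<Gamma>'' g'"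
  shows "bE k \<Delta> \<Gamma>'' (BR k \<Gamma> (g \<odot> g') \<theta>) (BR k \<Gamma>' g' (BR k \<Gamma> g \<theta>))"
proof -
  obtain b h where \<theta>: "\<theta> = (b, h)" by fastforce
  have N: "length \<Gamma> = N0 + k" and ok: "bagok (pco \<Gamma>) b" and h: "ctxhom A C \<Delta> (tgt k \<Gamma> b) h"
    using t by (auto simp: bS_def \<theta>)
  have N': "length \<Gamma>' = N0 + k" using ctxhom_len(1)[OF g] N by simp
  let ?m = "m0 + k"
  let ?s = "pcm g" and ?s' = "pcm g'"
  note s = shom_shomw[OF shom_pcm[OF g N]] and s' = shom_shomw[OF shom_pcm[OF g' N']]
  note gg = ctxhom_comp[OF g g']
  have sc: "pcm (g \<odot> g') = scomp A ?s ?s'" using N ctxhom_len(2)[OF g] ctxhom_len(2)[OF g'] N' by (intro pcm_comp) auto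
  note ss = shomw_scomp[OF s s']
  let ?b = "bagact ?s b" and ?b' = "bagact ?s' (bagact ?s b)" and ?c = "bagact (scomp A ?s ?s') b"
  note ok' = bagok_bagact[OF s ok]
  have la: "\<And>i. i < length (pco \<Gamma>'') \<Longrightarrow> fst ?s' ! i < length (pco \<Gamma>')" "\<And>i. i < length (pco \<Gamma>') \<Longrightarrow> fst ?s ! i < length (pco \<Gamma>)"
    "length (fst ?s') = length (pco \<Gamma>'')" "length (snd ?s') = length (pco \<Gamma>'')"
    "\<And>i. i < length (pco \<Gamma>'') \<Longrightarrow> dhom A C (pco \<Gamma>' ! (fst ?s' ! i)) (pco \<Gamma>'' ! i) (snd ?s' ! i)"
    "\<And>i. i < length (pco \<Gamma>') \<Longrightarrow> dhom A C (pco \<Gamma> ! (fst ?s ! i)) (pco \<Gamma>' ! i) (snd ?s ! i)"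
    using s s' by (auto simp: shomw_def)
  have e: "bagE (pco \<Gamma>'') ?c ?b'"
    unfolding bagE_def
  proof (intro conjI allI impI)
    show "length ?c = length (pco \<Gamma>'')" "length ?b' = length (pco \<Gamma>'')" using bagact_nth(1)[OF ss] bagact_nth(1)[OF s'] by auto
    fix i assume i: "i < length (pco \<Gamma>'')"
    let ?j = "fst ?s ! (fst ?s' ! i)"
    show "fst (?c ! i) = fst (?b' ! i)"
      unfolding bagact_nth(2)[OF ss i] bagact_nth(2)[OF s' i] fst_conv bagact_nth(2)[OF s la(1)[OF i]] using i la by simp
    have q: "sem A C Q nq (fst (b ! ?j)) (pco \<Gamma> ! ?j) (snd (b ! ?j))" using ok la(1,2) i by (auto simp: bagok_def)
    have ci: "cidc A (fst (b ! ?j)) \<odot> cidc A (fst (b ! ?j)) = cidc A (fst (b ! ?j))" by (rule ccompc_idl[OF ctxw_cidc])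
    show "eqv A C Q nq (fst (?c ! i)) (pco \<Gamma>'' ! i) (snd (?c ! i)) (snd (?b' ! i))"
      unfolding bagact_nth(2)[OF ss i] bagact_nth(2)[OF s' i] fst_conv snd_conv bagact_nth(2)[OF s la(1)[OF i]]
      using isf_comp[OF isf_den _ ctxhom_cidc la(6)[OF la(1)[OF i]] ctxhom_cidc la(5)[OF i], of Q nq, unfolded den_simps, OF q] i la
      by (simp add: snd_scomp ci)
  qed
  have o: "objs k \<Gamma>'' ?c = objs k \<Gamma>'' ?b'" using e by (auto simp: objs_def bagE_def intro!: nth_equalityI)
  note r = rmap[OF g N ok] and r' = rmap[OF g' N' ok'] and rr = rmap[OF gg N ok, unfolded sc o]
  note rw = r(1)[THEN ctxhom_ctxw] and r'w = r'(1)[THEN ctxhom_ctxw]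
  have lb: "length ?b' = length (pco \<Gamma>'')" "length ?b = length (pco \<Gamma>')" using bagact_nth(1)[OF s'] bagact_nth(1)[OF s] by auto
  have "rmap k \<Gamma> b (g \<odot> g') = rmap k \<Gamma> b g \<odot> rmap k \<Gamma>' ?b g'"
  proof (rule tgt_ext)
    show "ctxw (tgt k \<Gamma> b) (tgt k \<Gamma>'' ?b') (rmap k \<Gamma> b (g \<odot> g'))" by (rule rr(1)[THEN ctxhom_ctxw])
    show "ctxw (tgt k \<Gamma> b) (tgt k \<Gamma>'' ?b') (rmap k \<Gamma> b g \<odot> rmap k \<Gamma>' ?b g')" by (rule ctxw_comp[OF rw r'w])
    have kc: "Km k (g \<odot> g') = Km k g \<odot> Km k g'" by (rule kmor_comp[OF _ _ kval_kap]) (use N N' g g' in \<open>auto simp: ctxhom_len\<close>)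
    note kg = ctxhom_ctxw[OF ctxhom_Km[OF N g]] and kg' = ctxhom_ctxw[OF ctxhom_Km[OF N' g']]
    show "rmap k \<Gamma> b (g \<odot> g') \<odot> cprj ?m (objs k \<Gamma>'' ?b') 0 = rmap k \<Gamma> b g \<odot> rmap k \<Gamma>' ?b g' \<odot> cprj ?m (objs k \<Gamma>'' ?b') 0"
      by (simp only: rr(2) kc ccompc_assoc[OF rw r'w ctxw_cprj_objs(1)] r'(2) r(2)
         ccompc_assoc[symmetric, OF rw ctxw_cprj_objs(1) kg'] ccompc_assoc[symmetric, OF ctxw_cprj_objs(1) kg kg'])
    fix j assume "j < length ?b'"
    then have j: "j < length ?b'" "j < length (pco \<Gamma>'')" "fst ?s' ! j < length (pco \<Gamma>')" "fst ?s' ! j < length ?b" "j < length (fst ?s')"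
      using la lb by auto
    show "rmap k \<Gamma> b (g \<odot> g') \<odot> cprj ?m (objs k \<Gamma>'' ?b') (Suc j) = rmap k \<Gamma> b g \<odot> rmap k \<Gamma>' ?b g' \<odot> cprj ?m (objs k \<Gamma>'' ?b') (Suc j)"
      using j by (simp only: rr(3) ccompc_assoc[OF rw r'w ctxw_cprj_objs(2)] r'(3) r(3) fst_scomp nth_map)
  qed
  then have "BR k \<Gamma>' g' (BR k \<Gamma> g \<theta>) = (?b', snd (BR k \<Gamma> (g \<odot> g') \<theta>))"
    by (simp add: BR_def \<theta> ccompc_assoc[OF ctxhom_ctxw[OF h] rw r'w])
  moreover have "BR k \<Gamma> (g \<odot> g') \<theta> = (?c, snd (BR k \<Gamma> (g \<odot> g') \<theta>))" by (simp add: BR_def \<theta> sc)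
  ultimately show ?thesis using bagE_bE[OF _ e] bS_BR[OF t gg] by metis
qed

end

section \<open>Environments over a tensor of contexts\<close>

text \<open>A left inverse of \<open>concat\<close> for prescribed block lengths, to cut a bag over
  a tensor back into bags over the factors.\<close>

primrec chop :: "nat list \<Rightarrow> 'a list \<Rightarrow> 'a list list" where
  "chop [] xs = []"
| "chop (n # ns) xs = take n xs # chop ns (drop n xs)"

lemma length_chop [simp]: "length (chop ns xs) = length ns"
  by (induction ns arbitrary: xs) auto

lemma concat_chop: "sum_list ns = length xs \<Longrightarrow> concat (chop ns xs) = xs"
  by (induction ns arbitrary: xs) auto

lemma map_length_chop: "sum_list ns = length xs \<Longrightarrow> map length (chop ns xs) = ns"
  by (induction ns arbitrary: xs) auto

lemma chop_concat: "chop (map length xss) (concat xss) = xss"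
  by (induction xss) auto

lemma off_eq:
  "length xss = length yss \<Longrightarrow> (\<And>i. i < length xss \<Longrightarrow> length (xss ! i) = length (yss ! i)) \<Longrightarrow> off xss = off yss"
  by (rule ext, rule off_cong) (auto intro: nth_equalityI)

lemma length_concat_eq:
  "length xss = length yss \<Longrightarrow> (\<And>i. i < length xss \<Longrightarrow> length (xss ! i) = length (yss ! i)) \<Longrightarrow>
   length (concat xss) = length (concat yss)"
  unfolding length_concat by (rule arg_cong[of _ _ sum_list]) (auto intro: nth_equalityI)

context env
begin

abbreviation "ten k \<equiv> ctensor (m0 + k)"
abbreviation "tenN k \<equiv> ctensor (N0 + k)"

text \<open>Tensoring is componentwise concatenation, so a bag over a tensor is a concatenation of
  bags. The splitting of environments rests on this.\<close>

lemma pco_tenN: "pco (tenN k \<Gamma>s) = concat (map pco \<Gamma>s)"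
proof (cases p0)
  case None
  then have "pco = (\<lambda>_. [])" unfolding pco_def by simp
  then show ?thesis by simp
next
  case (Some d)
  then have "pco = (\<lambda>\<Gamma>. \<Gamma> ! d)" unfolding pco_def by simp
  then show ?thesis using p0[OF Some] by simp
qed

lemma K_tenN: "K k (tenN k \<Gamma>s) = ten k (map (K k) \<Gamma>s)"
  by (rule kob_ctensor[OF kval_kap])

definition bagsok :: "'o ctx list \<Rightarrow> ('o ctx \<times> ('o, 'm) el) list list \<Rightarrow> bool" where
  "bagsok \<Gamma>s bs \<longleftrightarrow> length bs = length \<Gamma>s \<and> (\<forall>i<length \<Gamma>s. bagok (pco (\<Gamma>s ! i)) (bs ! i))"

lemma bagsok_len:
  assumes "bagsok \<Gamma>s bs"
  shows "length bs = length \<Gamma>s" "i < length \<Gamma>s \<Longrightarrow> length (bs ! i) = length (pco (\<Gamma>s ! i))"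
    "off bs = off (map pco \<Gamma>s)" "length (concat bs) = length (concat (map pco \<Gamma>s))"
  using assms by (auto simp: bagsok_def bagok_def intro!: off_eq length_concat_eq simp del: length_concat)

lemma all_off:
  assumes "\<And>i j. i < length xss \<Longrightarrow> j < length (xss ! i) \<Longrightarrow> P (off xss i + j)" "p < length (concat xss)"
  shows "P p"
  using ex_off[OF assms(2)] assms(1) by blast

lemma bagok_concat: "bagsok \<Gamma>s bs \<Longrightarrow> bagok (concat (map pco \<Gamma>s)) (concat bs)"
  unfolding bagok_def
proof (intro conjI allI impI)
  assume b: "bagsok \<Gamma>s bs"
  note l = bagsok_len[OF b]
  show "length (concat bs) = length (concat (map pco \<Gamma>s))" by (rule l)
  fix p assume "p < length (concat (map pco \<Gamma>s))"
  then show "sem A C Q nq (fst (concat bs ! p)) (concat (map pco \<Gamma>s) ! p) (snd (concat bs ! p))"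
  proof (rule all_off[rotated])
    fix i j assume ij: "i < length (map pco \<Gamma>s)" "j < length (map pco \<Gamma>s ! i)"
    then have "concat bs ! (off (map pco \<Gamma>s) i + j) = bs ! i ! j"
      unfolding l(3)[symmetric] using l by (intro nth_concat_off) auto
    then show "sem A C Q nq (fst (concat bs ! (off (map pco \<Gamma>s) i + j))) (concat (map pco \<Gamma>s) ! (off (map pco \<Gamma>s) i + j))
        (snd (concat bs ! (off (map pco \<Gamma>s) i + j)))"
      using b ij unfolding nth_concat_off[OF ij] by (auto simp: bagsok_def bagok_def)
  qed
qed

abbreviation "big k \<Gamma>s bs \<equiv> objs k (tenN k \<Gamma>s) (concat bs)"
abbreviation "tgts k \<Gamma>s bs \<equiv> map (\<lambda>i. tgt k (\<Gamma>s ! i) (bs ! i)) [0..<length \<Gamma>s]"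
abbreviation "Pj k \<equiv> cprj (m0 + k)"

text \<open>\<open>sig\<close> and \<open>sigi\<close> are the symmetry between the target of an environment over a tensor and the tensor of the targets.\<close>

definition sig where
  "sig k \<Gamma>s bs = ctup (m0 + k) (map (\<lambda>i. ctup (m0 + k)
     ((Pj k (big k \<Gamma>s bs) 0 \<odot> Pj k (map (K k) \<Gamma>s) i) #
       map (\<lambda>j. Pj k (big k \<Gamma>s bs) (Suc (off bs i + j))) [0..<length (bs ! i)])) [0..<length \<Gamma>s])"

definition sigi where
  "sigi k \<Gamma>s bs = ctup (m0 + k)
     (ctup (m0 + k) (map (\<lambda>i. Pj k (tgts k \<Gamma>s bs) i \<odot> Pj k (objs k (\<Gamma>s ! i) (bs ! i)) 0) [0..<length \<Gamma>s]) #
      concat (map (\<lambda>i. map (\<lambda>j. Pj k (tgts k \<Gamma>s bs) i \<odot> Pj k (objs k (\<Gamma>s ! i) (bs ! i)) (Suc j)) [0..<length (bs ! i)])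
        [0..<length \<Gamma>s]))"

lemma big_prj:
  assumes l: "length bs = length \<Gamma>s"
  shows big_prj0: "ctxw (ten k (big k \<Gamma>s bs)) (ten k (map (K k) \<Gamma>s)) (Pj k (big k \<Gamma>s bs) 0)"
    and big_prjK: "i < length \<Gamma>s \<Longrightarrow> ctxw (ten k (map (K k) \<Gamma>s)) (K k (\<Gamma>s ! i)) (Pj k (map (K k) \<Gamma>s) i)"
    and big_prjS: "i < length \<Gamma>s \<Longrightarrow> j < length (bs ! i) \<Longrightarrow>
      ctxw (ten k (big k \<Gamma>s bs)) (J k (fst (bs ! i ! j))) (Pj k (big k \<Gamma>s bs) (Suc (off bs i + j)))"
proof -
  show "ctxw (ten k (big k \<Gamma>s bs)) (ten k (map (K k) \<Gamma>s)) (Pj k (big k \<Gamma>s bs) 0)"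
    using ctxw_cprj_objs(1)[of k "tenN k \<Gamma>s" "concat bs"] unfolding K_tenN .
  show "i < length \<Gamma>s \<Longrightarrow> ctxw (ten k (map (K k) \<Gamma>s)) (K k (\<Gamma>s ! i)) (Pj k (map (K k) \<Gamma>s) i)"
    using ctxw_cprj[of i "map (K k) \<Gamma>s" "m0 + k"] by auto
  show "ctxw (ten k (big k \<Gamma>s bs)) (J k (fst (bs ! i ! j))) (Pj k (big k \<Gamma>s bs) (Suc (off bs i + j)))"
    if "i < length \<Gamma>s" "j < length (bs ! i)"
    using ctxw_cprj_objs(2)[of "off bs i + j" "concat bs" k "tenN k \<Gamma>s"] off_bound[of i bs j] nth_concat_off[of i bs j] that l by simp
qed

lemma tgts_prj: "i < length \<Gamma>s \<Longrightarrow> ctxw (ten k (tgts k \<Gamma>s bs)) (tgt k (\<Gamma>s ! i) (bs ! i)) (Pj k (tgts k \<Gamma>s bs) i)"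
  using ctxw_cprj[of i "tgts k \<Gamma>s bs" "m0 + k"] by auto

lemma lens_tgts: "lens (m0 + k) (tgts k \<Gamma>s bs)"
  by auto

lemma sig_facts:
  assumes l: "length bs = length \<Gamma>s"
  shows ctxw_sig: "ctxw (ten k (big k \<Gamma>s bs)) (ten k (tgts k \<Gamma>s bs)) (sig k \<Gamma>s bs)"
    and sig_0: "i < length \<Gamma>s \<Longrightarrow> sig k \<Gamma>s bs \<odot> Pj k (tgts k \<Gamma>s bs) i \<odot> Pj k (objs k (\<Gamma>s ! i) (bs ! i)) 0
       = Pj k (big k \<Gamma>s bs) 0 \<odot> Pj k (map (K k) \<Gamma>s) i"
    and sig_Suc: "i < length \<Gamma>s \<Longrightarrow> j < length (bs ! i) \<Longrightarrow>
       sig k \<Gamma>s bs \<odot> Pj k (tgts k \<Gamma>s bs) i \<odot> Pj k (objs k (\<Gamma>s ! i) (bs ! i)) (Suc j) = Pj k (big k \<Gamma>s bs) (Suc (off bs i + j))"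
proof -
  let ?m = "m0 + k"
  let ?in = "\<lambda>i. (Pj k (big k \<Gamma>s bs) 0 \<odot> Pj k (map (K k) \<Gamma>s) i) #
       map (\<lambda>j. Pj k (big k \<Gamma>s bs) (Suc (off bs i + j))) [0..<length (bs ! i)]"
  have t: "ctxw (ten k (big k \<Gamma>s bs)) (objs k (\<Gamma>s ! i) (bs ! i) ! j) (?in i ! j)"
    if "i < length \<Gamma>s" "j < length (objs k (\<Gamma>s ! i) (bs ! i))" for i j
    using that by (cases j) (auto intro: ctxw_comp[OF big_prj0[OF l] big_prjK[OF l]] big_prjS[OF l])
  have in1: "ctxw (ten k (big k \<Gamma>s bs)) (tgt k (\<Gamma>s ! i) (bs ! i)) (ctup ?m (?in i))" if "i < length \<Gamma>s" for i
    using t[OF that] by (intro ctxw_ctup) auto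
  have in2: "ctup ?m (?in i) \<odot> Pj k (objs k (\<Gamma>s ! i) (bs ! i)) j = ?in i ! j"
    if "i < length \<Gamma>s" "j < length (objs k (\<Gamma>s ! i) (bs ! i))" for i j
    using t[OF that(1)] that(2) by (intro ctup_cprj) auto
  show "ctxw (ten k (big k \<Gamma>s bs)) (ten k (tgts k \<Gamma>s bs)) (sig k \<Gamma>s bs)"
    unfolding sig_def using in1 by (intro ctxw_ctup) auto
  have o: "sig k \<Gamma>s bs \<odot> Pj k (tgts k \<Gamma>s bs) i = ctup ?m (?in i)" if "i < length \<Gamma>s" for i
    unfolding sig_def using in1 that by (subst ctup_cprj[of _ _ "ten k (big k \<Gamma>s bs)"]) auto
  show "i < length \<Gamma>s \<Longrightarrow> sig k \<Gamma>s bs \<odot> Pj k (tgts k \<Gamma>s bs) i \<odot> Pj k (objs k (\<Gamma>s ! i) (bs ! i)) 0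
       = Pj k (big k \<Gamma>s bs) 0 \<odot> Pj k (map (K k) \<Gamma>s) i"
    using in2[of i 0] by (simp add: o)
  show "i < length \<Gamma>s \<Longrightarrow> j < length (bs ! i) \<Longrightarrow>
       sig k \<Gamma>s bs \<odot> Pj k (tgts k \<Gamma>s bs) i \<odot> Pj k (objs k (\<Gamma>s ! i) (bs ! i)) (Suc j) = Pj k (big k \<Gamma>s bs) (Suc (off bs i + j))"
    using in2[of i "Suc j"] by (simp add: o)
qed

lemma sigi_facts:
  assumes l: "length bs = length \<Gamma>s"
  shows ctxw_sigi: "ctxw (ten k (tgts k \<Gamma>s bs)) (ten k (big k \<Gamma>s bs)) (sigi k \<Gamma>s bs)"
    and sigi_0: "i < length \<Gamma>s \<Longrightarrow> sigi k \<Gamma>s bs \<odot> Pj k (big k \<Gamma>s bs) 0 \<odot> Pj k (map (K k) \<Gamma>s) i =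
        Pj k (tgts k \<Gamma>s bs) i \<odot> Pj k (objs k (\<Gamma>s ! i) (bs ! i)) 0"
    and sigi_Suc: "i < length \<Gamma>s \<Longrightarrow> j < length (bs ! i) \<Longrightarrow>
       sigi k \<Gamma>s bs \<odot> Pj k (big k \<Gamma>s bs) (Suc (off bs i + j)) =
        Pj k (tgts k \<Gamma>s bs) i \<odot> Pj k (objs k (\<Gamma>s ! i) (bs ! i)) (Suc j)"
proof -
  let ?m = "m0 + k"
  let ?a = "map (\<lambda>i. Pj k (tgts k \<Gamma>s bs) i \<odot> Pj k (objs k (\<Gamma>s ! i) (bs ! i)) 0) [0..<length \<Gamma>s]"
  let ?b = "map (\<lambda>i. map (\<lambda>j. Pj k (tgts k \<Gamma>s bs) i \<odot> Pj k (objs k (\<Gamma>s ! i) (bs ! i)) (Suc j)) [0..<length (bs ! i)]) [0..<length \<Gamma>s]"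
  have a: "ctxw (ten k (tgts k \<Gamma>s bs)) (map (K k) \<Gamma>s ! i) (?a ! i)" if "i < length \<Gamma>s" for i
    using that by (auto intro!: ctxw_comp[OF tgts_prj ctxw_cprj_objs(1)])
  have a1: "ctxw (ten k (tgts k \<Gamma>s bs)) (ten k (map (K k) \<Gamma>s)) (ctup ?m ?a)"
    using a by (intro ctxw_ctup) auto
  have a2: "ctup ?m ?a \<odot> Pj k (map (K k) \<Gamma>s) i = ?a ! i" if "i < length \<Gamma>s" for i
    using a that by (intro ctup_cprj) auto
  have lb: "off ?b = off bs" "length (concat ?b) = length (concat bs)"
    using l by (auto intro!: off_eq length_concat_eq simp del: length_concat)
  have nb: "concat ?b ! (off bs i + j) = Pj k (tgts k \<Gamma>s bs) i \<odot> Pj k (objs k (\<Gamma>s ! i) (bs ! i)) (Suc j)"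
    if "i < length \<Gamma>s" "j < length (bs ! i)" for i j
    using nth_concat_off[of i ?b j] that unfolding lb by simp
  have b: "ctxw (ten k (tgts k \<Gamma>s bs)) (J k (fst (concat bs ! p))) (concat ?b ! p)" if "p < length (concat bs)" for p
  proof (rule all_off[OF _ that, where P="\<lambda>p. ctxw (ten k (tgts k \<Gamma>s bs)) (J k (fst (concat bs ! p))) (concat ?b ! p)"])
    fix i j assume "i < length bs" "j < length (bs ! i)"
    then have ij: "i < length \<Gamma>s" "j < length (bs ! i)" "i < length bs" using l by auto
    show "ctxw (ten k (tgts k \<Gamma>s bs)) (J k (fst (concat bs ! (off bs i + j)))) (concat ?b ! (off bs i + j))"
      unfolding nb[OF ij(1,2)] nth_concat_off[OF ij(3,2)] using ij by (intro ctxw_comp[OF tgts_prj ctxw_cprj_objs(2)])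
  qed
  have t: "ctxw (ten k (tgts k \<Gamma>s bs)) (big k \<Gamma>s bs ! p) ((ctup ?m ?a # concat ?b) ! p)" if "p < length (big k \<Gamma>s bs)" for p
    using that a1 b by (cases p) (auto simp: K_tenN simp del: length_concat)
  have len: "length (ctup ?m ?a # concat ?b) = length (big k \<Gamma>s bs)" using lb by simp
  show "ctxw (ten k (tgts k \<Gamma>s bs)) (ten k (big k \<Gamma>s bs)) (sigi k \<Gamma>s bs)"
    unfolding sigi_def using t len by (intro ctxw_ctup) auto
  have o: "sigi k \<Gamma>s bs \<odot> Pj k (big k \<Gamma>s bs) p = (ctup ?m ?a # concat ?b) ! p" if "p < length (big k \<Gamma>s bs)" for p
    unfolding sigi_def using t len that by (intro ctup_cprj) auto
  show "i < length \<Gamma>s \<Longrightarrow> sigi k \<Gamma>s bs \<odot> Pj k (big k \<Gamma>s bs) 0 \<odot> Pj k (map (K k) \<Gamma>s) i =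
        Pj k (tgts k \<Gamma>s bs) i \<odot> Pj k (objs k (\<Gamma>s ! i) (bs ! i)) 0"
    using o[of 0] a2[of i] by simp
  show "sigi k \<Gamma>s bs \<odot> Pj k (big k \<Gamma>s bs) (Suc (off bs i + j)) =
        Pj k (tgts k \<Gamma>s bs) i \<odot> Pj k (objs k (\<Gamma>s ! i) (bs ! i)) (Suc j)" if "i < length \<Gamma>s" "j < length (bs ! i)"
    using o[of "Suc (off bs i + j)"] nb[OF that] off_bound[of i bs j] that l by simp
qed

lemma tgts_ext:
  assumes "ctxw \<Delta> (ten k (tgts k \<Gamma>s bs)) u" "ctxw \<Delta> (ten k (tgts k \<Gamma>s bs)) v"
    "\<And>i. i < length \<Gamma>s \<Longrightarrow> u \<odot> Pj k (tgts k \<Gamma>s bs) i \<odot> Pj k (objs k (\<Gamma>s ! i) (bs ! i)) 0 =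
       v \<odot> Pj k (tgts k \<Gamma>s bs) i \<odot> Pj k (objs k (\<Gamma>s ! i) (bs ! i)) 0"
    "\<And>i j. i < length \<Gamma>s \<Longrightarrow> j < length (bs ! i) \<Longrightarrow> u \<odot> Pj k (tgts k \<Gamma>s bs) i \<odot> Pj k (objs k (\<Gamma>s ! i) (bs ! i)) (Suc j) =
       v \<odot> Pj k (tgts k \<Gamma>s bs) i \<odot> Pj k (objs k (\<Gamma>s ! i) (bs ! i)) (Suc j)"
  shows "u = v"
proof (rule ctxw_ext[OF assms(1,2)])
  fix i assume "i < length (tgts k \<Gamma>s bs)"
  then have i: "i < length \<Gamma>s" by simp
  show "u \<odot> Pj k (tgts k \<Gamma>s bs) i = v \<odot> Pj k (tgts k \<Gamma>s bs) i"
    by (rule tgt_ext[OF ctxw_comp[OF assms(1) tgts_prj[OF i]] ctxw_comp[OF assms(2) tgts_prj[OF i]]])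
      (use assms(3,4) i in auto)
qed

lemma big_ext:
  assumes "ctxw \<Delta> (ten k (big k \<Gamma>s bs)) u" "ctxw \<Delta> (ten k (big k \<Gamma>s bs)) v" and l: "length bs = length \<Gamma>s"
    and 0: "\<And>i. i < length \<Gamma>s \<Longrightarrow> u \<odot> Pj k (big k \<Gamma>s bs) 0 \<odot> Pj k (map (K k) \<Gamma>s) i =
       v \<odot> Pj k (big k \<Gamma>s bs) 0 \<odot> Pj k (map (K k) \<Gamma>s) i"
    and S: "\<And>i j. i < length \<Gamma>s \<Longrightarrow> j < length (bs ! i) \<Longrightarrow> u \<odot> Pj k (big k \<Gamma>s bs) (Suc (off bs i + j)) =
       v \<odot> Pj k (big k \<Gamma>s bs) (Suc (off bs i + j))"
  shows "u = v"
proof (rule tgt_ext[OF assms(1,2)])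
  show "u \<odot> Pj k (big k \<Gamma>s bs) 0 = v \<odot> Pj k (big k \<Gamma>s bs) 0"
    by (rule ctxw_ext[OF ctxw_comp[OF assms(1) big_prj0[OF l]] ctxw_comp[OF assms(2) big_prj0[OF l]]]) (use 0 in simp)
  fix p assume "p < length (concat bs)"
  then show "u \<odot> Pj k (big k \<Gamma>s bs) (Suc p) = v \<odot> Pj k (big k \<Gamma>s bs) (Suc p)"
    by (rule all_off[rotated]) (use S l in auto)
qed

text \<open>Both maps only permute the blocks made by \<open>K\<close> and \<open>J\<close>, so each
  composite has the projections of an identity.\<close>

lemma sig_inverse:
  assumes l: "length bs = length \<Gamma>s"
  shows sig_sigi: "sig k \<Gamma>s bs \<odot> sigi k \<Gamma>s bs = cidc A (ten k (big k \<Gamma>s bs))"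
    and sigi_sig: "sigi k \<Gamma>s bs \<odot> sig k \<Gamma>s bs = cidc A (ten k (tgts k \<Gamma>s bs))"
proof -
  note s = ctxw_sig[OF l, of k] and s' = ctxw_sigi[OF l, of k]
  show "sig k \<Gamma>s bs \<odot> sigi k \<Gamma>s bs = cidc A (ten k (big k \<Gamma>s bs))"
  proof (rule big_ext[OF ctxw_comp[OF s s'] ctxw_cidc l])
    fix i assume i: "i < length \<Gamma>s"
    show "sig k \<Gamma>s bs \<odot> sigi k \<Gamma>s bs \<odot> Pj k (big k \<Gamma>s bs) 0 \<odot> Pj k (map (K k) \<Gamma>s) i =
      cidc A (ten k (big k \<Gamma>s bs)) \<odot> Pj k (big k \<Gamma>s bs) 0 \<odot> Pj k (map (K k) \<Gamma>s) i"
      by (simp only: ccompc_idl[OF big_prj0[OF l]] ccompc_assoc[OF s s' big_prj0[OF l]]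
        ccompc_assoc[OF s ctxw_comp[OF s' big_prj0[OF l]] big_prjK[OF l i]] sigi_0[OF l i]
        ccompc_assoc[symmetric, OF s tgts_prj[OF i] ctxw_cprj_objs(1)] sig_0[OF l i])
    fix j assume j: "j < length (bs ! i)"
    show "sig k \<Gamma>s bs \<odot> sigi k \<Gamma>s bs \<odot> Pj k (big k \<Gamma>s bs) (Suc (off bs i + j)) =
       cidc A (ten k (big k \<Gamma>s bs)) \<odot> Pj k (big k \<Gamma>s bs) (Suc (off bs i + j))"
      by (simp only: ccompc_idl[OF big_prjS[OF l i j]] ccompc_assoc[OF s s' big_prjS[OF l i j]] sigi_Suc[OF l i j]
        ccompc_assoc[symmetric, OF s tgts_prj[OF i] ctxw_cprj_objs(2)[OF j]] sig_Suc[OF l i j])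
  qed
  show "sigi k \<Gamma>s bs \<odot> sig k \<Gamma>s bs = cidc A (ten k (tgts k \<Gamma>s bs))"
  proof (rule tgts_ext[OF ctxw_comp[OF s' s] ctxw_cidc])
    fix i assume i: "i < length \<Gamma>s"
    have e: "sigi k \<Gamma>s bs \<odot> sig k \<Gamma>s bs \<odot> Pj k (tgts k \<Gamma>s bs) i = sigi k \<Gamma>s bs \<odot> (sig k \<Gamma>s bs \<odot> Pj k (tgts k \<Gamma>s bs) i)"
      by (rule ccompc_assoc[OF s' s tgts_prj[OF i]])
    note sp = ctxw_comp[OF s tgts_prj[OF i]]
    show "sigi k \<Gamma>s bs \<odot> sig k \<Gamma>s bs \<odot> Pj k (tgts k \<Gamma>s bs) i \<odot> Pj k (objs k (\<Gamma>s ! i) (bs ! i)) 0 =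
      cidc A (ten k (tgts k \<Gamma>s bs)) \<odot> Pj k (tgts k \<Gamma>s bs) i \<odot> Pj k (objs k (\<Gamma>s ! i) (bs ! i)) 0"
      by (simp only: e ccompc_idl[OF tgts_prj[OF i]] ccompc_assoc[OF s' sp ctxw_cprj_objs(1)] sig_0[OF l i]
        ccompc_assoc[symmetric, OF s' big_prj0[OF l] big_prjK[OF l i]] sigi_0[OF l i])
    fix j assume j: "j < length (bs ! i)"
    show "sigi k \<Gamma>s bs \<odot> sig k \<Gamma>s bs \<odot> Pj k (tgts k \<Gamma>s bs) i \<odot> Pj k (objs k (\<Gamma>s ! i) (bs ! i)) (Suc j) =
      cidc A (ten k (tgts k \<Gamma>s bs)) \<odot> Pj k (tgts k \<Gamma>s bs) i \<odot> Pj k (objs k (\<Gamma>s ! i) (bs ! i)) (Suc j)"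
      by (simp only: e ccompc_idl[OF tgts_prj[OF i]] ccompc_assoc[OF s' sp ctxw_cprj_objs(2)[OF j]] sig_Suc[OF l i j] sigi_Suc[OF l i j])
  qed
qed

text \<open>The shuffle is assembled from projections, which need not lie in the class; it is
  invertible in the completion, and that puts it into the class.\<close>

lemma ctxhom_sig: "length bs = length \<Gamma>s \<Longrightarrow> ctxhom A C (ten k (big k \<Gamma>s bs)) (ten k (tgts k \<Gamma>s bs)) (sig k \<Gamma>s bs)"
  by (rule ctxw_inverse_ctxhom[OF ctxw_sig ctxw_sigi sig_sigi sigi_sig])

lemma ctxhom_sigi: "length bs = length \<Gamma>s \<Longrightarrow> ctxhom A C (ten k (tgts k \<Gamma>s bs)) (ten k (big k \<Gamma>s bs)) (sigi k \<Gamma>s bs)"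
  by (rule ctxw_inverse_ctxhom[OF ctxw_sigi ctxw_sig sigi_sig sig_sigi])

text \<open>The hypotheses compare \<open>U\<close> and \<open>V\<close> on the elementary blocks,
  so that each application is a calculation with projections. The second conclusion follows from the
  first by cancelling the inverses.\<close>

lemma sig_natural:
  assumes l: "length bs = length \<Gamma>s" and l': "length bs' = length \<Gamma>s'"
    and U: "ctxw (ten k (big k \<Gamma>s bs)) (ten k (big k \<Gamma>s' bs')) U"
    and V: "ctxw (ten k (tgts k \<Gamma>s bs)) (ten k (tgts k \<Gamma>s' bs')) V"
    and 0: "\<And>i. i < length \<Gamma>s' \<Longrightarrow> U \<odot> Pj k (big k \<Gamma>s' bs') 0 \<odot> Pj k (map (K k) \<Gamma>s') i =
      sig k \<Gamma>s bs \<odot> (V \<odot> Pj k (tgts k \<Gamma>s' bs') i \<odot> Pj k (objs k (\<Gamma>s' ! i) (bs' ! i)) 0)"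
    and S: "\<And>i j. i < length \<Gamma>s' \<Longrightarrow> j < length (bs' ! i) \<Longrightarrow> U \<odot> Pj k (big k \<Gamma>s' bs') (Suc (off bs' i + j)) =
      sig k \<Gamma>s bs \<odot> (V \<odot> Pj k (tgts k \<Gamma>s' bs') i \<odot> Pj k (objs k (\<Gamma>s' ! i) (bs' ! i)) (Suc j))"
  shows sig_nat: "U \<odot> sig k \<Gamma>s' bs' = sig k \<Gamma>s bs \<odot> V"
    and sigi_nat: "V \<odot> sigi k \<Gamma>s' bs' = sigi k \<Gamma>s bs \<odot> U"
proof -
  note s = ctxw_sig[OF l, of k] and s' = ctxw_sig[OF l', of k] and t = ctxw_sigi[OF l, of k] and t' = ctxw_sigi[OF l', of k]
  show *: "U \<odot> sig k \<Gamma>s' bs' = sig k \<Gamma>s bs \<odot> V"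
  proof (rule tgts_ext[OF ctxw_comp[OF U s'] ctxw_comp[OF s V]])
    fix i assume i: "i < length \<Gamma>s'"
    note p = tgts_prj[OF i, of k bs']
    show "U \<odot> sig k \<Gamma>s' bs' \<odot> Pj k (tgts k \<Gamma>s' bs') i \<odot> Pj k (objs k (\<Gamma>s' ! i) (bs' ! i)) 0 =
      sig k \<Gamma>s bs \<odot> V \<odot> Pj k (tgts k \<Gamma>s' bs') i \<odot> Pj k (objs k (\<Gamma>s' ! i) (bs' ! i)) 0"
      by (simp only: ccompc_assoc[OF U s' p] ccompc_assoc[OF U ctxw_comp[OF s' p] ctxw_cprj_objs(1)] sig_0[OF l' i]
        ccompc_assoc[symmetric, OF U big_prj0[OF l'] big_prjK[OF l' i]] 0[OF i]
        ccompc_assoc[OF s V p] ccompc_assoc[OF s ctxw_comp[OF V p] ctxw_cprj_objs(1)])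
    fix j assume j: "j < length (bs' ! i)"
    show "U \<odot> sig k \<Gamma>s' bs' \<odot> Pj k (tgts k \<Gamma>s' bs') i \<odot> Pj k (objs k (\<Gamma>s' ! i) (bs' ! i)) (Suc j) =
      sig k \<Gamma>s bs \<odot> V \<odot> Pj k (tgts k \<Gamma>s' bs') i \<odot> Pj k (objs k (\<Gamma>s' ! i) (bs' ! i)) (Suc j)"
      by (simp only: ccompc_assoc[OF U s' p] ccompc_assoc[OF U ctxw_comp[OF s' p] ctxw_cprj_objs(2)[OF j]] sig_Suc[OF l' i j]
        S[OF i j] ccompc_assoc[OF s V p] ccompc_assoc[OF s ctxw_comp[OF V p] ctxw_cprj_objs(2)[OF j]])
  qed
  have "V \<odot> sigi k \<Gamma>s' bs' = sigi k \<Gamma>s bs \<odot> sig k \<Gamma>s bs \<odot> V \<odot> sigi k \<Gamma>s' bs'"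
    by (simp only: sigi_sig[OF l] ccompc_idl[OF V])
  also have "\<dots> = sigi k \<Gamma>s bs \<odot> (U \<odot> sig k \<Gamma>s' bs' \<odot> sigi k \<Gamma>s' bs')"
    by (simp only: ccompc_assoc[OF t s V] ccompc_assoc[OF t ctxw_comp[OF s V] t'] *)
  also have "\<dots> = sigi k \<Gamma>s bs \<odot> U"
    by (simp only: ccompc_assoc[OF U s' t'] sig_sigi[OF l'] ccompc_idr[OF U])
  finally show "V \<odot> sigi k \<Gamma>s' bs' = sigi k \<Gamma>s bs \<odot> U" .
qed

end

section \<open>Changing several coend variables\<close>

text \<open>Chains of generators in different slots may differ in length and direction and cannot be
  followed simultaneously. Replacing the slots from left to right reduces the claim to one generator
  in one slot.\<close>

lemma multi_slot:
  assumes eq: "\<And>i. i < n \<Longrightarrow> equivclose (S i) (R i) (xs ! i) (ys ! i)"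
    and l: "length xs = n" "length ys = n"
    and refl: "\<And>xs. length xs = n \<Longrightarrow> (\<And>i. i < n \<Longrightarrow> S i (xs ! i)) \<Longrightarrow> T (f xs) (f xs)"
    and gen: "\<And>xs i y. length xs = n \<Longrightarrow> (\<And>j. j < n \<Longrightarrow> S j (xs ! j)) \<Longrightarrow> i < n \<Longrightarrow> S i y \<Longrightarrow> R i (xs ! i) y \<Longrightarrow>
        T (f xs) (f (xs[i := y]))"
    and sym: "\<And>x y. T x y \<Longrightarrow> T y x" and trans: "\<And>x y z. T x y \<Longrightarrow> T y z \<Longrightarrow> T x z"
  shows "T (f xs) (f ys)"
proof -
  have Sx: "S i (xs ! i)" "S i (ys ! i)" if "i < n" for i using equivclose_dom[OF eq[OF that]] by auto
  have one: "T (f (zs[i := x])) (f (zs[i := y]))"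
    if z: "length zs = n" "\<And>j. j < n \<Longrightarrow> S j (zs ! j)" and i: "i < n" and xy: "equivclose (S i) (R i) x y" for zs i x y
  proof (rule equivclose_map[OF xy, of T "\<lambda>x. f (zs[i := x])"])
    show "T (f (zs[i := x])) (f (zs[i := x]))" if "S i x" for x
      by (rule refl) (use z that i in \<open>auto simp: nth_list_update\<close>)
    show "T (f (zs[i := x])) (f (zs[i := y]))" if "S i x" "S i y" "R i x y" for x y
    proof -
      have "T (f (zs[i := x])) (f (zs[i := x, i := y]))"
        by (rule gen) (use z i that in \<open>auto simp: nth_list_update\<close>)
      then show ?thesis by simp
    qed
  qed (blast intro: sym trans)+
  have "T (f xs) (f (take k ys @ drop k xs))" if "k \<le> n" for k
    using that
  proof (induction k)
    case 0
    then show ?case using refl[of xs] l Sx by simp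
  next
    case (Suc k)
    let ?z = "take k ys @ drop k xs"
    have z: "length ?z = n" "\<And>j. j < n \<Longrightarrow> S j (?z ! j)" using l Sx Suc.prems by (auto simp: nth_append)
    have "?z[k := xs ! k] = ?z" using l Suc.prems by (intro list_update_same_conv[THEN iffD2]) (auto simp: nth_append)
    moreover have "?z[k := ys ! k] = take (Suc k) ys @ drop (Suc k) xs"
      using l Suc.prems by (auto simp: list_update_append take_Suc_conv_app_nth Cons_nth_drop_Suc[symmetric])
    ultimately have "T (f ?z) (f (take (Suc k) ys @ drop (Suc k) xs))"
      using one[OF z, of k "xs ! k" "ys ! k"] eq Suc.prems by simp
    then show ?case using Suc trans by simp
  qed
  from this[of n] show ?thesis using l by simp
qed

section \<open>The tensor product of environments\<close>

context env
begin

text \<open>Monoidality of environments: the parallel composite keeps the blocks of each factor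
  together, and \<open>sigi\<close> sorts them into one block for the tensor followed by the entries
  of all bags.\<close>

definition BT where
  "BT k \<Delta>s \<Gamma>s \<theta>s = (concat (map fst \<theta>s), ctensor_mor (m0 + k) \<Delta>s (map snd \<theta>s) \<odot> sigi k \<Gamma>s (map fst \<theta>s))"

definition BTok where
  "BTok k \<Delta>s \<Gamma>s \<theta>s \<longleftrightarrow> length \<Delta>s = length \<Gamma>s \<and> length \<theta>s = length \<Gamma>s \<and>
     (\<forall>i<length \<Gamma>s. bS k (\<Delta>s ! i) (\<Gamma>s ! i) (\<theta>s ! i))"

lemma bS_len: "bS k \<Delta> \<Gamma> \<theta> \<Longrightarrow> length \<Delta> = m0 + k" "bS k \<Delta> \<Gamma> \<theta> \<Longrightarrow> length \<Gamma> = N0 + k"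
  using ctxhom_len(1)[of \<Delta> "tgt k \<Gamma> (fst \<theta>)"] by (auto simp: bS_def)

lemma BTok_facts:
  assumes "BTok k \<Delta>s \<Gamma>s \<theta>s"
  shows "lens (m0 + k) \<Delta>s" "lens (N0 + k) \<Gamma>s" "bagsok \<Gamma>s (map fst \<theta>s)" "length \<Delta>s = length \<Gamma>s" "length \<theta>s = length \<Gamma>s"
    "\<And>i. i < length \<Gamma>s \<Longrightarrow> ctxhom A C (\<Delta>s ! i) (tgt k (\<Gamma>s ! i) (fst (\<theta>s ! i))) (snd (\<theta>s ! i))"
proof -
  have l: "length \<Delta>s = length \<Gamma>s" "length \<theta>s = length \<Gamma>s" and b: "\<And>i. i < length \<Gamma>s \<Longrightarrow> bS k (\<Delta>s ! i) (\<Gamma>s ! i) (\<theta>s ! i)"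
    using assms by (auto simp: BTok_def)
  show "length \<Delta>s = length \<Gamma>s" "length \<theta>s = length \<Gamma>s" by (fact l)+
  show "lens (m0 + k) \<Delta>s" using bS_len(1)[OF b] l by (simp add: all_set_conv_all_nth)
  show "lens (N0 + k) \<Gamma>s" using bS_len(2)[OF b] by (simp add: all_set_conv_all_nth)
  show "bagsok \<Gamma>s (map fst \<theta>s)" using b l by (simp add: bagsok_def bS_def)
  show "ctxhom A C (\<Delta>s ! i) (tgt k (\<Gamma>s ! i) (fst (\<theta>s ! i))) (snd (\<theta>s ! i))" if "i < length \<Gamma>s" for i
    using b[OF that] by (simp add: bS_def)
qed

lemma BT_hom:
  assumes "BTok k \<Delta>s \<Gamma>s \<theta>s"
  shows "ctxhom A C (ten k \<Delta>s) (ten k (tgts k \<Gamma>s (map fst \<theta>s))) (ctensor_mor (m0 + k) \<Delta>s (map snd \<theta>s))"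
  using BTok_facts[OF assms] by (intro ctxhom_ctensor_mor) auto

lemma bS_BT:
  assumes "BTok k \<Delta>s \<Gamma>s \<theta>s"
  shows "bS k (ten k \<Delta>s) (tenN k \<Gamma>s) (BT k \<Delta>s \<Gamma>s \<theta>s)"
  unfolding bS_def BT_def fst_conv snd_conv pco_tenN
  using BTok_facts[OF assms] by (intro conjI bagok_concat ctxhom_comp[OF BT_hom[OF assms] ctxhom_sigi]) auto

lemma BTok_BL:
  assumes "BTok k \<Delta>s \<Gamma>s \<theta>s" "length \<Delta>s' = length \<Gamma>s" "length vs = length \<Gamma>s"
    "\<forall>i<length \<Gamma>s. ctxhom A C (\<Delta>s' ! i) (\<Delta>s ! i) (vs ! i)"
  shows "BTok k \<Delta>s' \<Gamma>s (map2 BL vs \<theta>s)"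
  using assms by (auto simp: BTok_def intro: bS_BL)

lemma BT_BL:
  assumes ok: "BTok k \<Delta>s \<Gamma>s \<theta>s" and l: "length \<Delta>s' = length \<Gamma>s" "length vs = length \<Gamma>s"
    and v: "\<forall>i<length \<Gamma>s. ctxhom A C (\<Delta>s' ! i) (\<Delta>s ! i) (vs ! i)"
  shows "BT k \<Delta>s' \<Gamma>s (map2 BL vs \<theta>s) = BL (ctensor_mor (m0 + k) \<Delta>s' vs) (BT k \<Delta>s \<Gamma>s \<theta>s)"
proof -
  note f = BTok_facts[OF ok] and f' = BTok_facts[OF BTok_BL[OF ok l v]]
  have 1: "map fst (map2 BL vs \<theta>s) = map fst \<theta>s" "map snd (map2 BL vs \<theta>s) = map2 (ccompc A) vs (map snd \<theta>s)"
    using l f(5) by (auto simp: BL_def intro!: nth_equalityI)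
  have 2: "ctensor_mor (m0 + k) \<Delta>s' (map2 (ccompc A) vs (map snd \<theta>s)) =
     ctensor_mor (m0 + k) \<Delta>s' vs \<odot> ctensor_mor (m0 + k) \<Delta>s (map snd \<theta>s)"
    using f f' l v[rule_format, THEN ctxhom_ctxw] f(6)[THEN ctxhom_ctxw] by (intro ctensor_mor_comp[symmetric, where \<Gamma>s''="tgts k \<Gamma>s (map fst \<theta>s)"]) auto
  have 3: "ctxhom A C (ten k \<Delta>s') (ten k \<Delta>s) (ctensor_mor (m0 + k) \<Delta>s' vs)"
    using l f f' v by (intro ctxhom_ctensor_mor) auto
  show ?thesis unfolding BT_def 1 2 unfolding BL_def using f
    by (simp add: ccompc_assoc[OF ctxhom_ctxw[OF 3] ctxhom_ctxw[OF BT_hom[OF ok]] ctxw_sigi])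
qed

text \<open>The position \<open>p0\<close> selects one component, so this is the explicit formula
  for \<open>ctensor_mor\<close> there; for \<open>p0 = None\<close> both lists are empty on either
  side.\<close>

lemma pcm_ctensor_mor:
  assumes "length gs = length \<Gamma>s"
  shows "pcm (ctensor_mor (N0 + k) \<Gamma>s gs) =
   (concat (map (\<lambda>i. map ((+) (off (map pco \<Gamma>s) i)) (fst (pcm (gs ! i)))) [0..<length \<Gamma>s]),
    concat (map (\<lambda>i. snd (pcm (gs ! i))) [0..<length \<Gamma>s]))"
proof (cases p0)
  case None
  then show ?thesis unfolding pcm_def by simp
next
  case (Some d)
  have "pco = (\<lambda>\<Gamma>. \<Gamma> ! d)" "pcm = (\<lambda>\<Gamma>. \<Gamma> ! d)" unfolding pco_def pcm_def unfolding Some by simp_all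
  then show ?thesis using p0[OF Some] assms by (simp add: ctensor_mor_def coff_off)
qed

lemma pcm_cblock:
  "pcm (cblock A (N0 + k) \<Gamma>s \<beta>) =
   (concat (map (\<lambda>j. map ((+) (off (map pco \<Gamma>s) j)) [0..<length (pco (\<Gamma>s ! j))]) \<beta>),
    concat (map (\<lambda>j. map (did A) (pco (\<Gamma>s ! j))) \<beta>))"
proof (cases p0)
  case None
  then show ?thesis unfolding pcm_def pco_def by simp
next
  case (Some d)
  have "pco = (\<lambda>\<Gamma>. \<Gamma> ! d)" "pcm = (\<lambda>\<Gamma>. \<Gamma> ! d)" unfolding pco_def pcm_def unfolding Some by simp_all
  then show ?thesis using p0[OF Some] by (simp add: cblock_def coff_off map_concat comp_def)
qed

lemma concat_nth_eq:
  assumes "length xss = length yss" "\<And>i. i < length xss \<Longrightarrow> length (xss ! i) = length (yss ! i)"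
    "i < length yss" "j < length (yss ! i)"
  shows "concat xss ! (off yss i + j) = xss ! i ! j"
proof -
  have "off xss = off yss" using assms(1,2) by (rule off_eq)
  then show ?thesis using nth_concat_off[of i xss j] assms by simp
qed

lemma pcm_ctensor_mor_nth:
  assumes "length gs = length \<Gamma>s" "length \<Gamma>s' = length \<Gamma>s" "lens (N0 + k) \<Gamma>s"
    "\<forall>i<length \<Gamma>s. ctxhom A C (\<Gamma>s ! i) (\<Gamma>s' ! i) (gs ! i)"
    "i < length \<Gamma>s" "j < length (pco (\<Gamma>s' ! i))"
  shows "fst (pcm (ctensor_mor (N0 + k) \<Gamma>s gs)) ! (off (map pco \<Gamma>s') i + j) = off (map pco \<Gamma>s) i + fst (pcm (gs ! i)) ! j"
    "snd (pcm (ctensor_mor (N0 + k) \<Gamma>s gs)) ! (off (map pco \<Gamma>s') i + j) = snd (pcm (gs ! i)) ! j"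
proof -
  have s: "shomw (pco (\<Gamma>s ! i)) (pco (\<Gamma>s' ! i)) (pcm (gs ! i))" if "i < length \<Gamma>s" for i
    using shom_shomw[OF shom_pcm[OF assms(4)[rule_format, OF that]]] assms(3) that by simp
  show "fst (pcm (ctensor_mor (N0 + k) \<Gamma>s gs)) ! (off (map pco \<Gamma>s') i + j) = off (map pco \<Gamma>s) i + fst (pcm (gs ! i)) ! j"
    unfolding pcm_ctensor_mor[OF assms(1)] fst_conv using s assms
    by (subst concat_nth_eq) (auto simp: shomw_def)
  show "snd (pcm (ctensor_mor (N0 + k) \<Gamma>s gs)) ! (off (map pco \<Gamma>s') i + j) = snd (pcm (gs ! i)) ! j"
    unfolding pcm_ctensor_mor[OF assms(1)] snd_conv using s assms
    by (subst concat_nth_eq) (auto simp: shomw_def)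
qed

lemma pcm_cblock_nth:
  assumes "\<forall>j\<in>set \<beta>. j < length \<Gamma>s" "i < length \<beta>" "j < length (pco (\<Gamma>s ! (\<beta> ! i)))"
  shows "fst (pcm (cblock A (N0 + k) \<Gamma>s \<beta>)) ! (off (map pco (map ((!) \<Gamma>s) \<beta>)) i + j) = off (map pco \<Gamma>s) (\<beta> ! i) + j"
    "snd (pcm (cblock A (N0 + k) \<Gamma>s \<beta>)) ! (off (map pco (map ((!) \<Gamma>s) \<beta>)) i + j) = did A (pco (\<Gamma>s ! (\<beta> ! i)) ! j)"
  unfolding pcm_cblock fst_conv snd_conv using assms
  by (subst concat_nth_eq; simp)+

lemma hom_tenN:
  assumes "length gs = length \<Gamma>s" "length \<Gamma>s' = length \<Gamma>s" "lens (N0 + k) \<Gamma>s"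
    "\<forall>i<length \<Gamma>s. ctxhom A C (\<Gamma>s ! i) (\<Gamma>s' ! i) (gs ! i)"
  shows "ctxhom A C (tenN k \<Gamma>s) (tenN k \<Gamma>s') (ctensor_mor (N0 + k) \<Gamma>s gs)"
  using assms by (intro ctxhom_ctensor_mor) auto

text \<open>\<open>bagact\<close> looks up entries by index, and an index shifted by the offset of
  its block finds the same entry in the concatenation. Hence the bags are equal, not just
  equivalent.\<close>

lemma bagact_tensor:
  assumes l: "length gs = length \<Gamma>s" "length \<Gamma>s' = length \<Gamma>s" and L: "lens (N0 + k) \<Gamma>s"
    and g: "\<forall>i<length \<Gamma>s. ctxhom A C (\<Gamma>s ! i) (\<Gamma>s' ! i) (gs ! i)" and b: "bagsok \<Gamma>s bs"
  shows "bagact (pcm (ctensor_mor (N0 + k) \<Gamma>s gs)) (concat bs) = concat (map2 (\<lambda>g b. bagact (pcm g) b) gs bs)"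
    and "bagsok \<Gamma>s' (map2 (\<lambda>g b. bagact (pcm g) b) gs bs)"
proof -
  note lb = bagsok_len[OF b]
  have s: "shomw (pco (\<Gamma>s ! i)) (pco (\<Gamma>s' ! i)) (pcm (gs ! i))" if "i < length \<Gamma>s" for i
    using shom_shomw[OF shom_pcm[OF g[rule_format, OF that]]] L that by simp
  show b': "bagsok \<Gamma>s' (map2 (\<lambda>g b. bagact (pcm g) b) gs bs)"
    using b l s by (auto simp: bagsok_def intro: bagok_bagact)
  note lb' = bagsok_len[OF b']
  let ?G = "ctensor_mor (N0 + k) \<Gamma>s gs"
  have S: "shomw (concat (map pco \<Gamma>s)) (concat (map pco \<Gamma>s')) (pcm ?G)"
    using shom_shomw[OF shom_pcm[OF hom_tenN[OF l L g], of k]] by (simp add: pco_tenN)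
  show "bagact (pcm ?G) (concat bs) = concat (map2 (\<lambda>g b. bagact (pcm g) b) gs bs)"
  proof (rule nth_equalityI)
    show "length (bagact (pcm ?G) (concat bs)) = length (concat (map2 (\<lambda>g b. bagact (pcm g) b) gs bs))"
      unfolding bagact_nth(1)[OF S] lb'(4) ..
    fix p assume "p < length (bagact (pcm ?G) (concat bs))"
    then have "p < length (concat (map pco \<Gamma>s'))" unfolding bagact_nth(1)[OF S] .
    then show "bagact (pcm ?G) (concat bs) ! p = concat (map2 (\<lambda>g b. bagact (pcm g) b) gs bs) ! p"
    proof (rule all_off[rotated])
      fix i j assume ij: "i < length (map pco \<Gamma>s')" "j < length (map pco \<Gamma>s' ! i)"
      then have i: "i < length \<Gamma>s" "i < length \<Gamma>s'" "j < length (pco (\<Gamma>s' ! i))" using l by auto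
      have q: "fst (pcm (gs ! i)) ! j < length (bs ! i)" using s[OF i(1)] i lb(2) by (auto simp: shomw_def)
      have e: "concat bs ! (off (map pco \<Gamma>s) i + fst (pcm (gs ! i)) ! j) = bs ! i ! (fst (pcm (gs ! i)) ! j)"
        unfolding lb(3)[symmetric] using q i lb(1) by (intro nth_concat_off) auto
      have "concat (map2 (\<lambda>g b. bagact (pcm g) b) gs bs) ! (off (map pco \<Gamma>s') i + j) = bagact (pcm (gs ! i)) (bs ! i) ! j"
        unfolding lb'(3)[symmetric] using i l lb(1) lb'(2)[of i] by (subst nth_concat_off) auto
      then show "bagact (pcm ?G) (concat bs) ! (off (map pco \<Gamma>s') i + j) = concat (map2 (\<lambda>g b. bagact (pcm g) b) gs bs) ! (off (map pco \<Gamma>s') i + j)"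
        using bagact_nth(2)[OF S off_bound[OF ij]] bagact_nth(2)[OF s[OF i(1)] i(3)]
          pcm_ctensor_mor_nth[OF l L g i(1,3)] e by simp
    qed
  qed
qed

lemma BTok_BR:
  assumes "BTok k \<Delta>s \<Gamma>s \<theta>s" "length gs = length \<Gamma>s" "length \<Gamma>s' = length \<Gamma>s"
    "\<forall>i<length \<Gamma>s. ctxhom A C (\<Gamma>s ! i) (\<Gamma>s' ! i) (gs ! i)"
  shows "BTok k \<Delta>s \<Gamma>s' (map (\<lambda>i. BR k (\<Gamma>s ! i) (gs ! i) (\<theta>s ! i)) [0..<length \<Gamma>s])"
  using assms by (auto simp: BTok_def intro: bS_BR)

text \<open>Up to the shuffle, acting on a tensor is the tensor of the actions;
  \<open>sigi_nat\<close> asks for this only on elementary blocks, where both sides are known from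
  \<open>rmap\<close>.\<close>

lemma rmap_sig:
  assumes l: "length gs = length \<Gamma>s" "length \<Gamma>s' = length \<Gamma>s" and L: "lens (N0 + k) \<Gamma>s"
    and g: "\<forall>i<length \<Gamma>s. ctxhom A C (\<Gamma>s ! i) (\<Gamma>s' ! i) (gs ! i)" and b: "bagsok \<Gamma>s bs"
  defines "bs' \<equiv> map2 (\<lambda>g b. bagact (pcm g) b) gs bs"
  shows "ctensor_mor (m0 + k) (tgts k \<Gamma>s bs) (map (\<lambda>i. rmap k (\<Gamma>s ! i) (bs ! i) (gs ! i)) [0..<length \<Gamma>s]) \<odot> sigi k \<Gamma>s' bs'
     = sigi k \<Gamma>s bs \<odot> rmap k (tenN k \<Gamma>s) (concat bs) (ctensor_mor (N0 + k) \<Gamma>s gs)"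
    (is "?V \<odot> _ = _ \<odot> ?U")
proof -
  let ?m = "m0 + k"
  let ?G = "ctensor_mor (N0 + k) \<Gamma>s gs"
  note bt = bagact_tensor[OF l L g b, folded bs'_def]
  note lb = bagsok_len[OF b] and lb' = bagsok_len[OF bt(2)]
  have bc: "bagok (pco (tenN k \<Gamma>s)) (concat bs)" unfolding pco_tenN by (rule bagok_concat[OF b])
  have N: "length (tenN k \<Gamma>s) = N0 + k" by simp
  note r = rmap[OF hom_tenN[OF l L g] N bc, unfolded bt(1)]
  have ri: "ctxhom A C (tgt k (\<Gamma>s ! i) (bs ! i)) (tgt k (\<Gamma>s' ! i) (bs' ! i)) (rmap k (\<Gamma>s ! i) (bs ! i) (gs ! i))"
    "rmap k (\<Gamma>s ! i) (bs ! i) (gs ! i) \<odot> Pj k (objs k (\<Gamma>s' ! i) (bs' ! i)) 0 = Pj k (objs k (\<Gamma>s ! i) (bs ! i)) 0 \<odot> Km k (gs ! i)"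
    "\<And>j. j < length (pco (\<Gamma>s' ! i)) \<Longrightarrow> rmap k (\<Gamma>s ! i) (bs ! i) (gs ! i) \<odot> Pj k (objs k (\<Gamma>s' ! i) (bs' ! i)) (Suc j) =
       Pj k (objs k (\<Gamma>s ! i) (bs ! i)) (Suc (fst (pcm (gs ! i)) ! j))"
    if "i < length \<Gamma>s" for i
  proof -
    have "length (\<Gamma>s ! i) = N0 + k" "bagok (pco (\<Gamma>s ! i)) (bs ! i)" "bs' ! i = bagact (pcm (gs ! i)) (bs ! i)"
      using that L b l by (auto simp: bagsok_def bs'_def)
    with rmap[OF g[rule_format, OF that], of k "bs ! i"] show
     "ctxhom A C (tgt k (\<Gamma>s ! i) (bs ! i)) (tgt k (\<Gamma>s' ! i) (bs' ! i)) (rmap k (\<Gamma>s ! i) (bs ! i) (gs ! i))"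
    "rmap k (\<Gamma>s ! i) (bs ! i) (gs ! i) \<odot> Pj k (objs k (\<Gamma>s' ! i) (bs' ! i)) 0 = Pj k (objs k (\<Gamma>s ! i) (bs ! i)) 0 \<odot> Km k (gs ! i)"
    "\<And>j. j < length (pco (\<Gamma>s' ! i)) \<Longrightarrow> rmap k (\<Gamma>s ! i) (bs ! i) (gs ! i) \<odot> Pj k (objs k (\<Gamma>s' ! i) (bs' ! i)) (Suc j) =
       Pj k (objs k (\<Gamma>s ! i) (bs ! i)) (Suc (fst (pcm (gs ! i)) ! j))" by simp_all
  qed
  have V: "ctxhom A C (ten k (tgts k \<Gamma>s bs)) (ten k (tgts k \<Gamma>s' bs')) ?V"
    using ri(1) l by (intro ctxhom_ctensor_mor) auto
  have Vp: "?V \<odot> Pj k (tgts k \<Gamma>s' bs') i = Pj k (tgts k \<Gamma>s bs) i \<odot> rmap k (\<Gamma>s ! i) (bs ! i) (gs ! i)" if "i < length \<Gamma>s" for i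
    using ri(1)[THEN ctxhom_ctxw] l that by (subst ctensor_mor_cprj) auto
  note U = r(1)[THEN ctxhom_ctxw]
  note s = ctxw_sig[rule_format, OF lb(1), of k]
  show ?thesis
  proof (rule sigi_nat[OF lb(1) lb'(1) U ctxhom_ctxw[OF V]])
    fix i assume i': "i < length \<Gamma>s'"
    then have i: "i < length \<Gamma>s" using l by simp
    have kg: "ctxw (K k (\<Gamma>s ! i)) (K k (\<Gamma>s' ! i)) (Km k (gs ! i))" using ctxhom_ctxw[OF ctxhom_Km[OF _ g[rule_format, OF i]]] L i by simp
    have KG: "Km k ?G = ctensor_mor ?m (map (K k) \<Gamma>s) (map (Km k) gs)" by (rule kmor_ctensor_mor[OF kval_kap l(1)])
    have kgp: "Km k ?G \<odot> Pj k (map (K k) \<Gamma>s') i = Pj k (map (K k) \<Gamma>s) i \<odot> Km k (gs ! i)"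
      unfolding KG using i l ctxhom_ctxw[OF ctxhom_Km[OF _ g[rule_format]]] L by (subst ctensor_mor_cprj) auto
    have KG': "ctxw (ten k (map (K k) \<Gamma>s)) (ten k (map (K k) \<Gamma>s')) (Km k ?G)"
      using ctxhom_ctxw[OF ctxhom_Km[OF N hom_tenN[OF l L g]]] by (simp add: K_tenN)
    note ti = tgts_prj[OF i, of k bs] and riw = ri(1)[OF i, THEN ctxhom_ctxw]
    show "?U \<odot> Pj k (big k \<Gamma>s' bs') 0 \<odot> Pj k (map (K k) \<Gamma>s') i =
      sig k \<Gamma>s bs \<odot> (?V \<odot> Pj k (tgts k \<Gamma>s' bs') i \<odot> Pj k (objs k (\<Gamma>s' ! i) (bs' ! i)) 0)"
      by (simp only: Vp[OF i] r(2) ccompc_assoc[OF big_prj0[OF lb(1)] KG' big_prjK[OF lb'(1) i']] kgp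
        ccompc_assoc[symmetric, OF big_prj0[OF lb(1)] big_prjK[OF lb(1) i] kg] sig_0[OF lb(1) i, symmetric]
        ccompc_assoc[OF ti riw ctxw_cprj_objs(1)] ri(2)[OF i]
        ccompc_assoc[OF s ti ctxw_cprj_objs(1)] ccompc_assoc[OF s ctxw_comp[OF ti ctxw_cprj_objs(1)] kg]
        ccompc_assoc[OF ti ctxw_cprj_objs(1) kg])
    fix j assume "j < length (bs' ! i)"
    then have j: "j < length (pco (\<Gamma>s' ! i))" "j < length (bs' ! i)" using lb'(2)[OF i'] by simp_all
    have q: "fst (pcm (gs ! i)) ! j < length (bs ! i)"
      using shom_shomw[OF shom_pcm[OF g[rule_format, OF i], of k]] i L j lb(2)[OF i] by (auto simp: shomw_def)
    have jj: "off bs' i + j < length (pco (tenN k \<Gamma>s'))" unfolding pco_tenN lb'(3) using off_bound[of i "map pco \<Gamma>s'" j] i' j by simp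
    show "?U \<odot> Pj k (big k \<Gamma>s' bs') (Suc (off bs' i + j)) =
      sig k \<Gamma>s bs \<odot> (?V \<odot> Pj k (tgts k \<Gamma>s' bs') i \<odot> Pj k (objs k (\<Gamma>s' ! i) (bs' ! i)) (Suc j))"
      by (simp only: Vp[OF i] r(3)[OF jj, unfolded lb'(3)] ccompc_assoc[OF ti riw ctxw_cprj_objs(2)[OF j(2)]] ri(3)[OF i j(1)]
        ccompc_assoc[symmetric, OF s ti ctxw_cprj_objs(2)[OF q]] sig_Suc[OF lb(1) i q]
        lb'(3) lb(3) pcm_ctensor_mor_nth(1)[OF l L g i j(1)])
  qed
qed

lemma BT_BR:
  assumes ok: "BTok k \<Delta>s \<Gamma>s \<theta>s" and l: "length gs = length \<Gamma>s" "length \<Gamma>s' = length \<Gamma>s"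
    and g: "\<forall>i<length \<Gamma>s. ctxhom A C (\<Gamma>s ! i) (\<Gamma>s' ! i) (gs ! i)"
  shows "BT k \<Delta>s \<Gamma>s' (map (\<lambda>i. BR k (\<Gamma>s ! i) (gs ! i) (\<theta>s ! i)) [0..<length \<Gamma>s]) =
    BR k (tenN k \<Gamma>s) (ctensor_mor (N0 + k) \<Gamma>s gs) (BT k \<Delta>s \<Gamma>s \<theta>s)"
proof -
  let ?m = "m0 + k"
  note f = BTok_facts[OF ok]
  let ?bs = "map fst \<theta>s" and ?\<theta>s = "map (\<lambda>i. BR k (\<Gamma>s ! i) (gs ! i) (\<theta>s ! i)) [0..<length \<Gamma>s]"
  let ?rs = "map (\<lambda>i. rmap k (\<Gamma>s ! i) (?bs ! i) (gs ! i)) [0..<length \<Gamma>s]"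
  note bt = bagact_tensor[OF l f(2) g f(3)]
  have 1: "map fst ?\<theta>s = map2 (\<lambda>g b. bagact (pcm g) b) gs ?bs"
    using l f(5) by (auto simp: BR_def intro!: nth_equalityI)
  have 2: "map snd ?\<theta>s = map2 (ccompc A) (map snd \<theta>s) ?rs"
    using l f(5) by (auto simp: BR_def intro!: nth_equalityI)
  note f' = BTok_facts[OF BTok_BR[OF ok l g]]
  have ri: "ctxhom A C (tgts k \<Gamma>s ?bs ! i) (tgts k \<Gamma>s' (map fst ?\<theta>s) ! i) (?rs ! i)" if i: "i < length \<Gamma>s" for i
  proof -
    have "length (\<Gamma>s ! i) = N0 + k" "bagok (pco (\<Gamma>s ! i)) (?bs ! i)" using i f(2,3) by (auto simp: bagsok_def)
    from ctxhom_rmap[OF g[rule_format, OF i] this] show ?thesis unfolding 1 using i l f(5) by simp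
  qed
  have V: "ctxhom A C (ten k (tgts k \<Gamma>s ?bs)) (ten k (tgts k \<Gamma>s' (map fst ?\<theta>s))) (ctensor_mor ?m (tgts k \<Gamma>s ?bs) ?rs)"
    using ri l by (intro ctxhom_ctensor_mor) auto
  have 3: "ctensor_mor ?m \<Delta>s (map2 (ccompc A) (map snd \<theta>s) ?rs) =
     ctensor_mor ?m \<Delta>s (map snd \<theta>s) \<odot> ctensor_mor ?m (tgts k \<Gamma>s ?bs) ?rs"
    using f l f(6)[THEN ctxhom_ctxw] ri[THEN ctxhom_ctxw] by (intro ctensor_mor_comp[symmetric, where \<Gamma>s''="tgts k \<Gamma>s' (map fst ?\<theta>s)"]) auto
  note h = ctxhom_ctxw[OF BT_hom[OF ok]]
  have N: "length (tenN k \<Gamma>s) = N0 + k" by simp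
  have bc: "bagok (pco (tenN k \<Gamma>s)) (concat ?bs)" unfolding pco_tenN by (rule bagok_concat[OF f(3)])
  note r = rmap[OF hom_tenN[OF l f(2) g] N bc]
  have l1: "length (map fst ?\<theta>s) = length \<Gamma>s'" "length ?bs = length \<Gamma>s" using l f(5) by simp_all
  have rs: "ctensor_mor ?m (tgts k \<Gamma>s ?bs) ?rs \<odot> sigi k \<Gamma>s' (map fst ?\<theta>s) =
    sigi k \<Gamma>s ?bs \<odot> rmap k (tenN k \<Gamma>s) (concat ?bs) (ctensor_mor (N0 + k) \<Gamma>s gs)"
    unfolding 1 by (rule rmap_sig) (use l f g in auto)
  have "ctensor_mor ?m \<Delta>s (map snd ?\<theta>s) \<odot> sigi k \<Gamma>s' (map fst ?\<theta>s) =
    ctensor_mor ?m \<Delta>s (map snd \<theta>s) \<odot> sigi k \<Gamma>s ?bs \<odot> rmap k (tenN k \<Gamma>s) (concat ?bs) (ctensor_mor (N0 + k) \<Gamma>s gs)"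
    using rs
    by (simp only: 2 3 ccompc_assoc[OF h ctxhom_ctxw[OF V] ctxw_sigi[OF l1(1)]]
       ccompc_assoc[OF h ctxw_sigi[OF l1(2)] ctxhom_ctxw[OF r(1)]])
  then show ?thesis unfolding BT_def 1 unfolding BR_def fst_conv snd_conv bt(1) by simp
qed

lemma BTok_block: "BTok k \<Delta>s \<Gamma>s \<theta>s \<Longrightarrow> \<forall>j\<in>set \<beta>. j < length \<Gamma>s \<Longrightarrow>
   BTok k (map ((!) \<Delta>s) \<beta>) (map ((!) \<Gamma>s) \<beta>) (map ((!) \<theta>s) \<beta>)"
  by (auto simp: BTok_def)

text \<open>Copying, dropping or permuting factors may happen before or after tensoring. The two
  results are only related by \<open>bE\<close>, because \<open>cblock\<close> lets identities act
  on the entries of the bag. The coend over argument types of an application needs this.\<close>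

lemma BT_block:
  assumes ok: "BTok k \<Delta>s \<Gamma>s \<theta>s" and \<beta>: "in_class C (length \<beta>) (length \<Gamma>s) \<beta>"
  shows "bE k (ten k \<Delta>s) (tenN k (map ((!) \<Gamma>s) \<beta>)) (BR k (tenN k \<Gamma>s) (cblock A (N0 + k) \<Gamma>s \<beta>) (BT k \<Delta>s \<Gamma>s \<theta>s))
    (BL (cblock A (m0 + k) \<Delta>s \<beta>) (BT k (map ((!) \<Delta>s) \<beta>) (map ((!) \<Gamma>s) \<beta>) (map ((!) \<theta>s) \<beta>)))"
proof -
  let ?m = "m0 + k" and ?G = "cblock A (N0 + k) \<Gamma>s \<beta>" and ?\<Gamma>s = "map ((!) \<Gamma>s) \<beta>"
  let ?bs = "map fst \<theta>s"
  let ?cs = "map ((!) ?bs) \<beta>"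
  have \<beta>': "\<forall>j\<in>set \<beta>. j < length \<Gamma>s" using \<beta> by (simp add: in_class_iff)
  then have \<beta>i: "\<And>i. i < length \<beta> \<Longrightarrow> \<beta> ! i < length \<Gamma>s" by simp
  note f = BTok_facts[OF ok] and f' = BTok_facts[OF BTok_block[OF ok \<beta>']]
  note lb = bagsok_len[OF f(3)]
  have cs: "map fst (map ((!) \<theta>s) \<beta>) = ?cs" using \<beta>' f(5) by auto
  note lc = bagsok_len[OF f'(3), unfolded cs]
  have lc1: "length ?cs = length ?\<Gamma>s" by simp
  have N: "length (tenN k \<Gamma>s) = N0 + k" by simp
  have bc: "bagok (pco (tenN k \<Gamma>s)) (concat ?bs)" unfolding pco_tenN by (rule bagok_concat[OF f(3)])
  have G: "ctxhom A C (tenN k \<Gamma>s) (tenN k ?\<Gamma>s) ?G" by (rule ctxhom_cblock[OF \<beta> f(2)])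
  have S: "shomw (concat (map pco \<Gamma>s)) (concat (map pco ?\<Gamma>s)) (pcm ?G)"
    using shom_shomw[OF shom_pcm[OF G N]] by (simp add: pco_tenN)
  let ?b = "bagact (pcm ?G) (concat ?bs)"
  have e: "bagE (pco (tenN k ?\<Gamma>s)) ?b (concat ?cs)"
    unfolding bagE_def pco_tenN
  proof (intro conjI allI impI)
    show "length ?b = length (concat (map pco ?\<Gamma>s))" by (rule bagact_nth(1)[OF S])
    show "length (concat ?cs) = length (concat (map pco ?\<Gamma>s))" by (rule lc)
    fix p assume p: "p < length (concat (map pco ?\<Gamma>s))"
    have "fst (?b ! p) = fst (concat ?cs ! p) \<and>
       eqv A C Q nq (fst (?b ! p)) (concat (map pco ?\<Gamma>s) ! p) (snd (?b ! p)) (snd (concat ?cs ! p))"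
    proof (rule all_off[OF _ p])
      fix i j assume ij: "i < length (map pco ?\<Gamma>s)" "j < length (map pco ?\<Gamma>s ! i)"
      then have i: "i < length \<beta>" "j < length (pco (\<Gamma>s ! (\<beta> ! i)))" by auto
      have j: "j < length (?bs ! (\<beta> ! i))" using i \<beta>i[OF i(1)] lb(2) by simp
      have 1: "concat ?bs ! (off (map pco \<Gamma>s) (\<beta> ! i) + j) = ?bs ! (\<beta> ! i) ! j"
        unfolding lb(3)[symmetric] using j \<beta>i[OF i(1)] lb(1) by (intro nth_concat_off) auto
      have 2: "concat ?cs ! (off (map pco ?\<Gamma>s) i + j) = ?bs ! (\<beta> ! i) ! j"
        unfolding lc(3)[symmetric] using j i by (subst nth_concat_off) auto
      have 3: "concat (map pco ?\<Gamma>s) ! (off (map pco ?\<Gamma>s) i + j) = pco (\<Gamma>s ! (\<beta> ! i)) ! j"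
        unfolding nth_concat_off[OF ij] using i by simp
      have q: "sem A C Q nq (fst (?bs ! (\<beta> ! i) ! j)) (pco (\<Gamma>s ! (\<beta> ! i)) ! j) (snd (?bs ! (\<beta> ! i) ! j))"
        using f(3) \<beta>i[OF i(1)] i(2) by (auto simp: bagsok_def bagok_def)
      show "fst (?b ! (off (map pco ?\<Gamma>s) i + j)) = fst (concat ?cs ! (off (map pco ?\<Gamma>s) i + j)) \<and>
       eqv A C Q nq (fst (?b ! (off (map pco ?\<Gamma>s) i + j))) (concat (map pco ?\<Gamma>s) ! (off (map pco ?\<Gamma>s) i + j)) (snd (?b ! (off (map pco ?\<Gamma>s) i + j)))
        (snd (concat ?cs ! (off (map pco ?\<Gamma>s) i + j)))"
        unfolding bagact_nth(2)[OF S off_bound[OF ij]] pcm_cblock_nth[OF \<beta>' i] 1 2 3 fst_conv snd_conv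
        using isf_id[OF isf_den, of Q nq, unfolded den_simps, OF q] by simp
    qed
    then show "fst (?b ! p) = fst (concat ?cs ! p)"
      "eqv A C Q nq (fst (?b ! p)) (concat (map pco ?\<Gamma>s) ! p) (snd (?b ! p)) (snd (concat ?cs ! p))" by auto
  qed
  have o: "objs k (tenN k ?\<Gamma>s) ?b = big k ?\<Gamma>s ?cs" using e by (auto simp: objs_def bagE_def intro!: nth_equalityI simp del: length_concat)
  note r = rmap[OF G N bc, unfolded o]
  let ?U = "rmap k (tenN k \<Gamma>s) (concat ?bs) ?G" and ?V = "cblock A ?m (tgts k \<Gamma>s ?bs) \<beta>"
  have tt: "map ((!) (tgts k \<Gamma>s ?bs)) \<beta> = tgts k ?\<Gamma>s ?cs" using \<beta>' lb(1) by (auto intro!: nth_equalityI)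
  have V: "ctxw (ten k (tgts k \<Gamma>s ?bs)) (ten k (tgts k ?\<Gamma>s ?cs)) ?V"
    using ctxw_cblock[of \<beta> "tgts k \<Gamma>s ?bs" ?m] \<beta>' unfolding tt by auto
  have Vp: "?V \<odot> Pj k (tgts k ?\<Gamma>s ?cs) i = Pj k (tgts k \<Gamma>s ?bs) (\<beta> ! i)" if "i < length \<beta>" for i
    using cblock_cprj[of \<beta> "tgts k \<Gamma>s ?bs" ?m i] \<beta>' that unfolding tt by auto
  note s = ctxw_sig[rule_format, OF lb(1), of k]
  have sn: "?V \<odot> sigi k ?\<Gamma>s ?cs = sigi k \<Gamma>s ?bs \<odot> ?U"
  proof (rule sigi_nat[OF lb(1) lc1 ctxhom_ctxw[OF r(1)] V])
    fix i assume "i < length ?\<Gamma>s"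
    then have i: "i < length \<beta>" "i < length ?\<Gamma>s" "\<beta> ! i < length \<Gamma>s" using \<beta>i by auto
    have ei: "?\<Gamma>s ! i = \<Gamma>s ! (\<beta> ! i)" "?cs ! i = ?bs ! (\<beta> ! i)" using i by simp_all
    have KG: "Km k ?G = cblock A ?m (map (K k) \<Gamma>s) \<beta>" by (rule kmor_cblock[OF kval_kap \<beta>'])
    have KG': "ctxw (ten k (map (K k) \<Gamma>s)) (ten k (map (K k) ?\<Gamma>s)) (Km k ?G)"
      using ctxhom_ctxw[OF ctxhom_Km[OF N G]] by (simp only: K_tenN)
    have mm: "map ((!) (map (K k) \<Gamma>s)) \<beta> = map (K k) ?\<Gamma>s" using \<beta>' by auto
    have kgp: "Km k ?G \<odot> Pj k (map (K k) ?\<Gamma>s) i = Pj k (map (K k) \<Gamma>s) (\<beta> ! i)"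
      using cblock_cprj[of \<beta> "map (K k) \<Gamma>s" ?m i] \<beta>' i(1) unfolding KG mm by auto
    show "?U \<odot> Pj k (big k ?\<Gamma>s ?cs) 0 \<odot> Pj k (map (K k) ?\<Gamma>s) i =
      sig k \<Gamma>s ?bs \<odot> (?V \<odot> Pj k (tgts k ?\<Gamma>s ?cs) i \<odot> Pj k (objs k (?\<Gamma>s ! i) (?cs ! i)) 0)"
      by (simp only: Vp[OF i(1)] ei r(2) ccompc_assoc[OF big_prj0[OF lb(1)] KG' big_prjK[OF lc1 i(2)]] kgp
        sig_0[OF lb(1) i(3), symmetric] ccompc_assoc[OF s tgts_prj[OF i(3)] ctxw_cprj_objs(1)])
    fix j assume "j < length (?cs ! i)"
    then have j: "j < length (?bs ! (\<beta> ! i))" "j < length (pco (\<Gamma>s ! (\<beta> ! i)))" using i lb(2) by auto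
    have jj: "off ?cs i + j < length (pco (tenN k ?\<Gamma>s))" unfolding pco_tenN lc(3) using off_bound[of i "map pco ?\<Gamma>s" j] i j by simp
    show "?U \<odot> Pj k (big k ?\<Gamma>s ?cs) (Suc (off ?cs i + j)) =
      sig k \<Gamma>s ?bs \<odot> (?V \<odot> Pj k (tgts k ?\<Gamma>s ?cs) i \<odot> Pj k (objs k (?\<Gamma>s ! i) (?cs ! i)) (Suc j))"
      by (simp only: Vp[OF i(1)] ei r(3)[OF jj, unfolded lc(3)] ccompc_assoc[symmetric, OF s tgts_prj[OF i(3)] ctxw_cprj_objs(2)[OF j(1)]]
         sig_Suc[OF lb(1) i(3) j(1)] lc(3) lb(3) pcm_cblock_nth(1)[OF \<beta>' i(1) j(2)])
  qed
  let ?H = "ctensor_mor ?m \<Delta>s (map snd \<theta>s)" and ?D = "cblock A ?m \<Delta>s \<beta>"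
  let ?H' = "ctensor_mor ?m (map ((!) \<Delta>s) \<beta>) (map snd (map ((!) \<theta>s) \<beta>))"
  note h = ctxhom_ctxw[OF BT_hom[OF ok]] and h' = ctxhom_ctxw[OF BT_hom[OF BTok_block[OF ok \<beta>']], unfolded cs]
  have \<beta>'': "\<forall>j\<in>set \<beta>. j < length \<Delta>s" using \<beta>' f(4) by simp
  note d = ctxw_cblock[OF \<beta>'' f(1)]
  \<comment> \<open>Naturality of the reindexing in the factors; together with \<open>sn\<close> it
    carries \<open>cblock\<close> across both parts of \<open>BT\<close>.\<close>
  have nat: "?D \<odot> ?H' = ?H \<odot> ?V"
  proof (rule ctxw_ext[OF ctxw_comp[OF d h'] ctxw_comp[OF h V]])
    fix i assume "i < length (tgts k ?\<Gamma>s ?cs)"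
    then have i: "i < length \<beta>" "\<beta> ! i < length \<Gamma>s" "i < length ?\<Gamma>s" using \<beta>i by auto
    have di: "ctxw (ten k (map ((!) \<Delta>s) \<beta>)) (\<Delta>s ! (\<beta> ! i)) (Pj k (map ((!) \<Delta>s) \<beta>) i)"
      using ctxw_cprj[of i "map ((!) \<Delta>s) \<beta>" ?m] f'(1) i by simp
    have 1: "?H' \<odot> Pj k (tgts k ?\<Gamma>s ?cs) i = Pj k (map ((!) \<Delta>s) \<beta>) i \<odot> snd (\<theta>s ! (\<beta> ! i))"
      using f' f i \<beta>i f(6)[THEN ctxhom_ctxw] by (subst ctensor_mor_cprj) auto
    have 2: "?H \<odot> Pj k (tgts k \<Gamma>s ?bs) (\<beta> ! i) = Pj k \<Delta>s (\<beta> ! i) \<odot> snd (\<theta>s ! (\<beta> ! i))"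
      using f i f(6)[THEN ctxhom_ctxw] by (subst ctensor_mor_cprj) auto
    show "?D \<odot> ?H' \<odot> Pj k (tgts k ?\<Gamma>s ?cs) i = ?H \<odot> ?V \<odot> Pj k (tgts k ?\<Gamma>s ?cs) i"
      by (simp only: ccompc_assoc[OF d h' tgts_prj[OF i(3)]] 1 ccompc_assoc[symmetric, OF d di ctxhom_ctxw[OF f(6)[OF i(2)]]]
        cblock_cprj[OF \<beta>'' f(1) i(1)] ccompc_assoc[OF h V tgts_prj[OF i(3)]] Vp[OF i(1)] 2)
  qed
  have eq: "?H \<odot> sigi k \<Gamma>s ?bs \<odot> ?U = ?D \<odot> (?H' \<odot> sigi k ?\<Gamma>s ?cs)"
    by (simp only: ccompc_assoc[symmetric, OF d h' ctxw_sigi[OF lc1]] nat ccompc_assoc[OF h V ctxw_sigi[OF lc1]] sn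
      ccompc_assoc[OF h ctxw_sigi[OF lb(1)] ctxhom_ctxw[OF r(1)]])
  have "bE k (ten k \<Delta>s) (tenN k ?\<Gamma>s) (?b, ?H \<odot> sigi k \<Gamma>s ?bs \<odot> ?U) (concat ?cs, ?H \<odot> sigi k \<Gamma>s ?bs \<odot> ?U)"
    using bagE_bE[OF _ e, of k] bS_BR[OF bS_BT[OF ok] G] by (simp add: BR_def BT_def)
  then show ?thesis by (simp only: BR_def BT_def BL_def fst_conv snd_conv eq cs)
qed

definition bids :: "('o ctx \<times> ('o, 'm) el) list \<Rightarrow> 'm smor list list" where
  "bids b = map (\<lambda>x. cidc A (fst x)) b"

lemma bagto_refl: "bagok as b \<Longrightarrow> bagto as b (bids b) b"
  unfolding bagto_def bids_def bagok_def
  using eqv_sym[OF isf_id[OF isf_den, of Q nq, unfolded den_simps]] by (auto simp: ctxhom_cidc)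

lemma wmor_bids: "bagok as b \<Longrightarrow> wmor k \<Gamma> b (bids b) = cidc A (tgt k \<Gamma> b)"
proof -
  assume ok: "bagok as b"
  have "length (fst x) = nq" if "x \<in> set b" for x
    using that bagok_len[OF ok] ok by (auto simp: in_set_conv_nth bagok_def)
  then show ?thesis
    unfolding wmor_def ctensor_mor_id[OF lens_objs, symmetric] bids_def
    using kval_iot by (auto simp: objs_def comp_def kmor_id intro!: arg_cong[of _ _ "ctensor_mor _ _"])
qed

text \<open>Both sides speak of the same single entries. From right to left this merges generators
  over the factors, from left to right it splits a generator over the tensor.\<close>

lemma bagto_concat_iff:
  assumes l: "length bs = length \<Gamma>s" "length bs' = length \<Gamma>s" "length vss = length \<Gamma>s"
    and L: "\<And>i. i < length \<Gamma>s \<Longrightarrow> length (bs ! i) = length (pco (\<Gamma>s ! i)) \<and> length (bs' ! i) = length (pco (\<Gamma>s ! i))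
        \<and> length (vss ! i) = length (pco (\<Gamma>s ! i))"
  shows "bagto (concat (map pco \<Gamma>s)) (concat bs) (concat vss) (concat bs') \<longleftrightarrow>
    (\<forall>i<length \<Gamma>s. bagto (pco (\<Gamma>s ! i)) (bs ! i) (vss ! i) (bs' ! i))"
proof -
  let ?a = "map pco \<Gamma>s"
  have len: "length (concat bs) = length (concat ?a)" "length (concat bs') = length (concat ?a)" "length (concat vss) = length (concat ?a)"
    using l L by (auto intro!: length_concat_eq simp del: length_concat)
  have n: "concat bs ! (off ?a i + j) = bs ! i ! j" "concat bs' ! (off ?a i + j) = bs' ! i ! j"
     "concat vss ! (off ?a i + j) = vss ! i ! j" "concat ?a ! (off ?a i + j) = pco (\<Gamma>s ! i) ! j"
    if "i < length \<Gamma>s" "j < length (pco (\<Gamma>s ! i))" for i j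
    using that l L by (auto intro!: concat_nth_eq simp: nth_concat_off)
  let ?P = "\<lambda>b b' v a. sem A C Q nq (fst b) a (snd b) \<and> sem A C Q nq (fst b') a (snd b') \<and> ctxhom A C (fst b) (fst b') v \<and>
      eqv A C Q nq (fst b) a (snd b) (act A Q v (did A a) (snd b'))"
  have "bagto (concat ?a) (concat bs) (concat vss) (concat bs') \<longleftrightarrow>
     (\<forall>p<length (concat ?a). ?P (concat bs ! p) (concat bs' ! p) (concat vss ! p) (concat ?a ! p))"
    unfolding bagto_def bagok_def len by blast
  also have "\<dots> \<longleftrightarrow> (\<forall>i<length \<Gamma>s. \<forall>j<length (pco (\<Gamma>s ! i)). ?P (bs ! i ! j) (bs' ! i ! j) (vss ! i ! j) (pco (\<Gamma>s ! i) ! j))"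
  proof (intro iffI allI impI)
    fix i j assume h: "\<forall>p<length (concat ?a). ?P (concat bs ! p) (concat bs' ! p) (concat vss ! p) (concat ?a ! p)"
      and ij: "i < length \<Gamma>s" "j < length (pco (\<Gamma>s ! i))"
    have "off ?a i + j < length (concat ?a)" using off_bound[of i ?a j] ij by simp
    from h[rule_format, OF this] show "?P (bs ! i ! j) (bs' ! i ! j) (vss ! i ! j) (pco (\<Gamma>s ! i) ! j)"
      unfolding n[OF ij] .
  next
    fix p assume h: "\<forall>i<length \<Gamma>s. \<forall>j<length (pco (\<Gamma>s ! i)). ?P (bs ! i ! j) (bs' ! i ! j) (vss ! i ! j) (pco (\<Gamma>s ! i) ! j)"
      and "p < length (concat ?a)"
    then obtain i j where ij: "i < length \<Gamma>s" "j < length (pco (\<Gamma>s ! i))" "p = off ?a i + j"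
      using ex_off[of p ?a] by auto
    show "?P (concat bs ! p) (concat bs' ! p) (concat vss ! p) (concat ?a ! p)"
      unfolding ij(3) n[OF ij(1,2)] using h ij by blast
  qed
  also have "\<dots> \<longleftrightarrow> (\<forall>i<length \<Gamma>s. bagto (pco (\<Gamma>s ! i)) (bs ! i) (vss ! i) (bs' ! i))"
    unfolding bagto_def bagok_def using L by blast
  finally show ?thesis .
qed

lemma bagto_len: "bagto as b vs b' \<Longrightarrow> length b = length as \<and> length b' = length as \<and> length vs = length as"
  by (simp add: bagto_def bagok_def)

text \<open>\<open>bagok\<close> is read off from \<open>bagto\<close> with identities, for which
  the splitting is already known.\<close>

lemma bagok_concat_conv:
  assumes "length bs = length \<Gamma>s" "\<And>i. i < length \<Gamma>s \<Longrightarrow> length (bs ! i) = length (pco (\<Gamma>s ! i))"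
    and b: "bagok (concat (map pco \<Gamma>s)) (concat bs)"
  shows "bagsok \<Gamma>s bs"
proof -
  have "bids (concat bs) = concat (map bids bs)" unfolding bids_def by (simp add: map_concat)
  with bagto_refl[OF b] have "bagto (concat (map pco \<Gamma>s)) (concat bs) (concat (map bids bs)) (concat bs)" by simp
  then have "\<forall>i<length \<Gamma>s. bagto (pco (\<Gamma>s ! i)) (bs ! i) (map bids bs ! i) (bs ! i)"
    by (subst (asm) bagto_concat_iff) (use assms in \<open>auto simp: bids_def\<close>)
  then show ?thesis using assms(1) by (auto simp: bagsok_def bagto_def)
qed

text \<open>The counterpart of \<open>rmap_sig\<close> for the coend generators: the shuffle matches
  a generator over the tensor with a family of generators over the factors.\<close>

lemma wmor_sig:
  assumes l: "length bs = length \<Gamma>s" "length bs' = length \<Gamma>s" "length vss = length \<Gamma>s"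
    and t: "\<forall>i<length \<Gamma>s. bagto (pco (\<Gamma>s ! i)) (bs ! i) (vss ! i) (bs' ! i)"
  shows ctxhom_wmors: "ctxhom A C (ten k (tgts k \<Gamma>s bs)) (ten k (tgts k \<Gamma>s bs'))
      (ctensor_mor (m0 + k) (tgts k \<Gamma>s bs) (map (\<lambda>i. wmor k (\<Gamma>s ! i) (bs ! i) (vss ! i)) [0..<length \<Gamma>s]))"
    and ctxhom_wmor_big: "ctxhom A C (ten k (big k \<Gamma>s bs)) (ten k (big k \<Gamma>s bs')) (wmor k (tenN k \<Gamma>s) (concat bs) (concat vss))"
    and wmor_sig_nat: "wmor k (tenN k \<Gamma>s) (concat bs) (concat vss) \<odot> sig k \<Gamma>s bs' =
      sig k \<Gamma>s bs \<odot> ctensor_mor (m0 + k) (tgts k \<Gamma>s bs) (map (\<lambda>i. wmor k (\<Gamma>s ! i) (bs ! i) (vss ! i)) [0..<length \<Gamma>s])"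
    and wmor_sigi_nat: "ctensor_mor (m0 + k) (tgts k \<Gamma>s bs) (map (\<lambda>i. wmor k (\<Gamma>s ! i) (bs ! i) (vss ! i)) [0..<length \<Gamma>s]) \<odot> sigi k \<Gamma>s bs'
      = sigi k \<Gamma>s bs \<odot> wmor k (tenN k \<Gamma>s) (concat bs) (concat vss)"
proof -
  let ?m = "m0 + k"
  let ?ws = "map (\<lambda>i. wmor k (\<Gamma>s ! i) (bs ! i) (vss ! i)) [0..<length \<Gamma>s]"
  let ?V = "ctensor_mor ?m (tgts k \<Gamma>s bs) ?ws" and ?U = "wmor k (tenN k \<Gamma>s) (concat bs) (concat vss)"
  have L: "length (bs ! i) = length (pco (\<Gamma>s ! i)) \<and> length (bs' ! i) = length (pco (\<Gamma>s ! i)) \<and> length (vss ! i) = length (pco (\<Gamma>s ! i))"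
    if "i < length \<Gamma>s" for i using t that by (auto dest!: bagto_len)
  have T: "bagto (pco (tenN k \<Gamma>s)) (concat bs) (concat vss) (concat bs')"
    unfolding pco_tenN using bagto_concat_iff[OF l L] t by simp
  note ti = t[rule_format]
  note w = wmor[where k=k, OF ti] and W = wmor[where k=k, OF T]
  have o: "off bs = off (map pco \<Gamma>s)" "off bs' = off (map pco \<Gamma>s)" using l L by (auto intro!: off_eq)
  show V: "ctxhom A C (ten k (tgts k \<Gamma>s bs)) (ten k (tgts k \<Gamma>s bs')) ?V"
    using w(1) by (intro ctxhom_ctensor_mor) auto
  show "ctxhom A C (ten k (big k \<Gamma>s bs)) (ten k (big k \<Gamma>s bs')) ?U" by (rule W(1))
  have Vp: "?V \<odot> Pj k (tgts k \<Gamma>s bs') i = Pj k (tgts k \<Gamma>s bs) i \<odot> wmor k (\<Gamma>s ! i) (bs ! i) (vss ! i)" if "i < length \<Gamma>s" for i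
    using w(1)[THEN ctxhom_ctxw] that by (subst ctensor_mor_cprj) auto
  note s = ctxw_sig[OF l(1), of k]
  have 0: "?U \<odot> Pj k (big k \<Gamma>s bs') 0 \<odot> Pj k (map (K k) \<Gamma>s) i =
      sig k \<Gamma>s bs \<odot> (?V \<odot> Pj k (tgts k \<Gamma>s bs') i \<odot> Pj k (objs k (\<Gamma>s ! i) (bs' ! i)) 0)" if i: "i < length \<Gamma>s" for i
    by (simp only: W(2) Vp[OF i] ccompc_assoc[OF tgts_prj[OF i] w(1)[OF i, THEN ctxhom_ctxw] ctxw_cprj_objs(1)] w(2)[OF i]
      ccompc_assoc[symmetric, OF s tgts_prj[OF i] ctxw_cprj_objs(1)] sig_0[OF l(1) i])
  have S: "?U \<odot> Pj k (big k \<Gamma>s bs') (Suc (off bs' i + j)) =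
      sig k \<Gamma>s bs \<odot> (?V \<odot> Pj k (tgts k \<Gamma>s bs') i \<odot> Pj k (objs k (\<Gamma>s ! i) (bs' ! i)) (Suc j))"
    if i: "i < length \<Gamma>s" and j: "j < length (bs' ! i)" for i j
  proof -
    have j': "j < length (pco (\<Gamma>s ! i))" "j < length (bs ! i)" using L[OF i] j by auto
    have jj: "off bs' i + j < length (pco (tenN k \<Gamma>s))" unfolding pco_tenN o using off_bound[of i "map pco \<Gamma>s" j] i j' by simp
    have vn: "concat vss ! (off bs' i + j) = vss ! i ! j" unfolding o using l L i j' by (intro concat_nth_eq) auto
    have v: "ctxw (J k (fst (bs ! i ! j))) (J k (fst (bs' ! i ! j))) (Jm k (vss ! i ! j))"
      using ti[OF i] j' by (intro ctxhom_ctxw[OF ctxhom_Jm]) (auto simp: bagto_def intro: bagok_len)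
    show ?thesis
      by (simp only: W(3)[OF jj] vn Vp[OF i] ccompc_assoc[OF tgts_prj[OF i] w(1)[OF i, THEN ctxhom_ctxw] ctxw_cprj_objs(2)[OF j]] w(3)[OF i j'(1)]
        ccompc_assoc[symmetric, OF tgts_prj[OF i] ctxw_cprj_objs(2)[OF j'(2)] v]
        ccompc_assoc[symmetric, OF s ctxw_comp[OF tgts_prj[OF i] ctxw_cprj_objs(2)[OF j'(2)]] v]
        ccompc_assoc[symmetric, OF s tgts_prj[OF i] ctxw_cprj_objs(2)[OF j'(2)]] sig_Suc[OF l(1) i j'(2)])
        (simp only: o)
  qed
  show "?U \<odot> sig k \<Gamma>s bs' = sig k \<Gamma>s bs \<odot> ?V"
    by (rule sig_nat[OF l(1,2) ctxhom_ctxw[OF W(1)] ctxhom_ctxw[OF V] 0 S])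
  show "?V \<odot> sigi k \<Gamma>s bs' = sigi k \<Gamma>s bs \<odot> ?U"
    by (rule sigi_nat[OF l(1,2) ctxhom_ctxw[OF W(1)] ctxhom_ctxw[OF V] 0 S])
qed

text \<open>Generators in all factors merge into one generator over the tensor; its morphism part is
  moved past the shuffle by \<open>wmor_sig\<close>.\<close>

lemma BT_gen:
  assumes ok: "BTok k \<Delta>s \<Gamma>s \<theta>s" and ok': "BTok k \<Delta>s \<Gamma>s \<theta>s'" and lv: "length vss = length \<Gamma>s"
    and t: "\<forall>i<length \<Gamma>s. bagto (pco (\<Gamma>s ! i)) (fst (\<theta>s ! i)) (vss ! i) (fst (\<theta>s' ! i))"
    and h: "\<And>i. i < length \<Gamma>s \<Longrightarrow> snd (\<theta>s' ! i) = snd (\<theta>s ! i) \<odot> wmor k (\<Gamma>s ! i) (fst (\<theta>s ! i)) (vss ! i)"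
  shows "bE k (ten k \<Delta>s) (tenN k \<Gamma>s) (BT k \<Delta>s \<Gamma>s \<theta>s) (BT k \<Delta>s \<Gamma>s \<theta>s')"
proof (rule bE_gen[OF bS_BT[OF ok] bS_BT[OF ok']])
  let ?m = "m0 + k"
  note f = BTok_facts[OF ok] and f' = BTok_facts[OF ok']
  let ?bs = "map fst \<theta>s" and ?bs' = "map fst \<theta>s'"
  have l: "length ?bs = length \<Gamma>s" "length ?bs' = length \<Gamma>s" using f(5) f'(5) by simp_all
  have T: "\<forall>i<length \<Gamma>s. bagto (pco (\<Gamma>s ! i)) (?bs ! i) (vss ! i) (?bs' ! i)" using t l by simp
  let ?ws = "map (\<lambda>i. wmor k (\<Gamma>s ! i) (?bs ! i) (vss ! i)) [0..<length \<Gamma>s]"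
  note w = wmor_sig[OF l lv T, where k=k]
  have L: "length (?bs ! i) = length (pco (\<Gamma>s ! i)) \<and> length (?bs' ! i) = length (pco (\<Gamma>s ! i)) \<and> length (vss ! i) = length (pco (\<Gamma>s ! i))"
    if "i < length \<Gamma>s" for i using T that by (auto dest!: bagto_len)
  have B: "bagto (pco (tenN k \<Gamma>s)) (concat ?bs) (concat vss) (concat ?bs')"
    unfolding pco_tenN using bagto_concat_iff[OF l lv L] T by simp
  have 1: "map snd \<theta>s' = map2 (ccompc A) (map snd \<theta>s) ?ws" using f(5) f'(5) h by (auto intro!: nth_equalityI)
  have 2: "ctensor_mor ?m \<Delta>s (map2 (ccompc A) (map snd \<theta>s) ?ws) = ctensor_mor ?m \<Delta>s (map snd \<theta>s) \<odot> ctensor_mor ?m (tgts k \<Gamma>s ?bs) ?ws"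
    using f f(6)[THEN ctxhom_ctxw] l wmor(1)[OF T[rule_format], THEN ctxhom_ctxw, of _ k]
    by (intro ctensor_mor_comp[symmetric, where \<Gamma>s''="tgts k \<Gamma>s ?bs'"]) auto
  note H = ctxhom_ctxw[OF BT_hom[OF ok]]
  have "snd (BT k \<Delta>s \<Gamma>s \<theta>s') = snd (BT k \<Delta>s \<Gamma>s \<theta>s) \<odot> wmor k (tenN k \<Gamma>s) (concat ?bs) (concat vss)"
    unfolding BT_def snd_conv 1
    by (simp only: 2 ccompc_assoc[OF H ctxhom_ctxw[OF w(1)] ctxw_sigi[OF l(2)]] w(4) ccompc_assoc[OF H ctxw_sigi[OF l(1)] ctxhom_ctxw[OF w(2)]])
  then show "bgen k (tenN k \<Gamma>s) (BT k \<Delta>s \<Gamma>s \<theta>s) (BT k \<Delta>s \<Gamma>s \<theta>s')"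
    using B unfolding bgen_def by (intro exI[of _ "concat vss"]) (simp add: BT_def)
qed

lemma BT_cong:
  assumes l: "length \<Delta>s = length \<Gamma>s" "length \<theta>s = length \<Gamma>s" "length \<theta>s' = length \<Gamma>s"
    and e: "\<And>i. i < length \<Gamma>s \<Longrightarrow> bE k (\<Delta>s ! i) (\<Gamma>s ! i) (\<theta>s ! i) (\<theta>s' ! i)"
  shows "bE k (ten k \<Delta>s) (tenN k \<Gamma>s) (BT k \<Delta>s \<Gamma>s \<theta>s) (BT k \<Delta>s \<Gamma>s \<theta>s')"
proof (rule multi_slot[where n="length \<Gamma>s" and f="BT k \<Delta>s \<Gamma>s" and S="\<lambda>i. bS k (\<Delta>s ! i) (\<Gamma>s ! i)" and R="\<lambda>i. bgen k (\<Gamma>s ! i)"])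
  show "bE k (ten k \<Delta>s) (tenN k \<Gamma>s) (BT k \<Delta>s \<Gamma>s xs) (BT k \<Delta>s \<Gamma>s xs)"
    if "length xs = length \<Gamma>s" "\<And>i. i < length \<Gamma>s \<Longrightarrow> bS k (\<Delta>s ! i) (\<Gamma>s ! i) (xs ! i)" for xs
    using that l by (intro bE_refl bS_BT) (auto simp: BTok_def)
  fix xs i y assume x: "length xs = length \<Gamma>s" "\<And>i. i < length \<Gamma>s \<Longrightarrow> bS k (\<Delta>s ! i) (\<Gamma>s ! i) (xs ! i)"
    and i: "i < length \<Gamma>s" and y: "bS k (\<Delta>s ! i) (\<Gamma>s ! i) y" "bgen k (\<Gamma>s ! i) (xs ! i) y"
  from y(2) obtain vs where v: "bagto (pco (\<Gamma>s ! i)) (fst (xs ! i)) vs (fst y)" "snd y = snd (xs ! i) \<odot> wmor k (\<Gamma>s ! i) (fst (xs ! i)) vs"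
    by (auto simp: bgen_def)
  \<comment> \<open>A generator in slot \<open>i\<close> alone: the other slots receive identities,
    for which \<open>wmor_bids\<close> yields an identity.\<close>
  let ?vss = "(map (\<lambda>x. bids (fst x)) xs)[i := vs]"
  have ok: "bagok (pco (\<Gamma>s ! j)) (fst (xs ! j))" "snd (xs ! j) = snd (xs ! j) \<odot> cidc A (tgt k (\<Gamma>s ! j) (fst (xs ! j)))" if "j < length \<Gamma>s" for j
    using x(2)[OF that] by (auto simp: bS_def ccompc_idr[OF ctxhom_ctxw])
  show "bE k (ten k \<Delta>s) (tenN k \<Gamma>s) (BT k \<Delta>s \<Gamma>s xs) (BT k \<Delta>s \<Gamma>s (xs[i := y]))"
  proof (rule BT_gen[where vss="?vss"])
    show "BTok k \<Delta>s \<Gamma>s xs" using x l by (auto simp: BTok_def)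
    show "BTok k \<Delta>s \<Gamma>s (xs[i := y])" using x l y i by (auto simp: BTok_def nth_list_update)
    show "\<forall>j<length \<Gamma>s. bagto (pco (\<Gamma>s ! j)) (fst (xs ! j)) (?vss ! j) (fst (xs[i := y] ! j))"
    proof (intro allI impI)
      fix j assume j: "j < length \<Gamma>s"
      show "bagto (pco (\<Gamma>s ! j)) (fst (xs ! j)) (?vss ! j) (fst (xs[i := y] ! j))"
        using bagto_refl[OF ok(1)[OF j]] v(1) x(1) j by (cases "j = i") simp_all
    qed
    show "snd (xs[i := y] ! j) = snd (xs ! j) \<odot> wmor k (\<Gamma>s ! j) (fst (xs ! j)) (?vss ! j)" if "j < length \<Gamma>s" for j
      using x(1) v(2) ok[OF that] that by (cases "j = i") (simp_all add: wmor_bids)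
  qed (use x in simp)
qed (use l e in \<open>auto simp: bE_def[symmetric] intro: bE_sym bE_trans\<close>)

section \<open>Splitting an environment over a tensor\<close>

definition chp where "chp \<Gamma>s b = chop (map (\<lambda>\<Gamma>. length (pco \<Gamma>)) \<Gamma>s) b"

text \<open>Each factor receives its part of the bag with an identity as morphism, the universal
  environment for that bag, and all of \<open>snd \<theta>\<close> goes into the outer morphism. In
  this way \<open>glue\<close> inverts it strictly on one side.\<close>

definition split where
  "split k \<Gamma>s \<theta> = (tgts k \<Gamma>s (chp \<Gamma>s (fst \<theta>)),
     map (\<lambda>i. (chp \<Gamma>s (fst \<theta>) ! i, cidc A (tgt k (\<Gamma>s ! i) (chp \<Gamma>s (fst \<theta>) ! i)))) [0..<length \<Gamma>s],
     snd \<theta> \<odot> sig k \<Gamma>s (chp \<Gamma>s (fst \<theta>)))"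

definition glue where
  "glue k \<Gamma>s d = (case d of (\<Delta>s, \<theta>s, h) \<Rightarrow> BL h (BT k \<Delta>s \<Gamma>s \<theta>s))"

text \<open>Environments over a tensor as a Day convolution of environments over the factors.\<close>

definition dS where
  "dS k \<Delta> \<Gamma>s d = (case d of (\<Delta>s, \<theta>s, h) \<Rightarrow> BTok k \<Delta>s \<Gamma>s \<theta>s \<and> ctxhom A C \<Delta> (ten k \<Delta>s) h)"

definition dgen where
  "dgen k \<Gamma>s d d' = (case (d, d') of ((\<Delta>s, \<theta>s, h), (\<Delta>s', \<theta>s', h')) \<Rightarrow> \<exists>vs. length vs = length \<Gamma>s \<and>
     (\<forall>i<length \<Gamma>s. ctxhom A C (\<Delta>s ! i) (\<Delta>s' ! i) (vs ! i) \<and> bE k (\<Delta>s ! i) (\<Gamma>s ! i) (\<theta>s ! i) (BL (vs ! i) (\<theta>s' ! i))) \<and>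
     h' = h \<odot> ctensor_mor (m0 + k) \<Delta>s vs)"

definition dE where "dE k \<Delta> \<Gamma>s = equivclose (dS k \<Delta> \<Gamma>s) (dgen k \<Gamma>s)"

lemma dE_sym: "dE k \<Delta> \<Gamma>s d d' \<Longrightarrow> dE k \<Delta> \<Gamma>s d' d" unfolding dE_def by (rule ec_sym)
lemma dE_trans: "dE k \<Delta> \<Gamma>s d d' \<Longrightarrow> dE k \<Delta> \<Gamma>s d' d'' \<Longrightarrow> dE k \<Delta> \<Gamma>s d d''" unfolding dE_def by (rule ec_trans)

lemma concat_chp: "length b = length (concat (map pco \<Gamma>s)) \<Longrightarrow> concat (chp \<Gamma>s b) = b"
  unfolding chp_def by (rule concat_chop) (simp add: length_concat comp_def)

lemma length_chp [simp]: "length (chp \<Gamma>s b) = length \<Gamma>s"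
  by (simp add: chp_def)

lemma length_chp_nth: "length b = length (concat (map pco \<Gamma>s)) \<Longrightarrow> i < length \<Gamma>s \<Longrightarrow> length (chp \<Gamma>s b ! i) = length (pco (\<Gamma>s ! i))"
proof -
  assume "length b = length (concat (map pco \<Gamma>s))" and i: "i < length \<Gamma>s"
  then have "map length (chp \<Gamma>s b) = map (\<lambda>\<Gamma>. length (pco \<Gamma>)) \<Gamma>s"
    unfolding chp_def by (intro map_length_chop) (simp add: length_concat comp_def)
  from arg_cong[OF this, of "\<lambda>x. x ! i"] i show ?thesis by simp
qed

lemma chp_concat: "bagsok \<Gamma>s bs \<Longrightarrow> chp \<Gamma>s (concat bs) = bs"
proof -
  assume b: "bagsok \<Gamma>s bs"
  then have "map (\<lambda>\<Gamma>. length (pco \<Gamma>)) \<Gamma>s = map length bs" using bagsok_len[OF b] by (auto intro!: nth_equalityI)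
  then show ?thesis unfolding chp_def by (simp add: chop_concat)
qed

lemma bagsok_chp: "bagok (pco (tenN k \<Gamma>s)) b \<Longrightarrow> bagsok \<Gamma>s (chp \<Gamma>s b)"
proof -
  assume b: "bagok (pco (tenN k \<Gamma>s)) b"
  then have l: "length b = length (concat (map pco \<Gamma>s))" by (simp only: bagok_def pco_tenN)
  show ?thesis using b unfolding pco_tenN by (intro bagok_concat_conv) (simp_all only: length_chp_nth[OF l] concat_chp[OF l] length_chp)
qed

lemma split_typed:
  assumes t: "bS k \<Delta> (tenN k \<Gamma>s) \<theta>" and L: "lens (N0 + k) \<Gamma>s"
  shows dS_split: "dS k \<Delta> \<Gamma>s (split k \<Gamma>s \<theta>)" and glue_split: "glue k \<Gamma>s (split k \<Gamma>s \<theta>) = \<theta>"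
proof -
  obtain b h where \<theta>: "\<theta> = (b, h)" by fastforce
  have ok: "bagok (pco (tenN k \<Gamma>s)) b" and h: "ctxhom A C \<Delta> (tgt k (tenN k \<Gamma>s) b) h" using t by (auto simp: bS_def \<theta>)
  let ?bs = "chp \<Gamma>s b"
  have l: "length ?bs = length \<Gamma>s" by simp
  have cb: "concat ?bs = b" using ok by (intro concat_chp) (simp only: bagok_def pco_tenN)
  note bok = bagsok_chp[OF ok]
  note s = ctxhom_sig[OF l, of k, unfolded cb]
  let ?\<theta>s = "map (\<lambda>i. (?bs ! i, cidc A (tgt k (\<Gamma>s ! i) (?bs ! i)))) [0..<length \<Gamma>s]"
  have B: "BTok k (tgts k \<Gamma>s ?bs) \<Gamma>s ?\<theta>s"
    using bok L by (auto simp: BTok_def bS_def bagsok_def ctxhom_cidc)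
  show "dS k \<Delta> \<Gamma>s (split k \<Gamma>s \<theta>)"
    using B ctxhom_comp[OF h s] by (simp add: dS_def split_def \<theta>)
  have 1: "map fst ?\<theta>s = ?bs" using l by (auto intro!: nth_equalityI)
  have 2: "map snd ?\<theta>s = map (cidc A) (tgts k \<Gamma>s ?bs)" by simp
  have "BT k (tgts k \<Gamma>s ?bs) \<Gamma>s ?\<theta>s = (b, sigi k \<Gamma>s ?bs)"
    unfolding BT_def 1 2 cb ctensor_mor_id[OF lens_tgts] by (simp only: ccompc_idl[OF ctxw_sigi[OF l]])
  then show "glue k \<Gamma>s (split k \<Gamma>s \<theta>) = \<theta>"
    using ccompc_assoc[OF ctxhom_ctxw[OF h] ctxhom_ctxw[OF s] ctxw_sigi[OF l, of k, unfolded cb]] sig_sigi[OF l, of k, unfolded cb]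
      ccompc_idr[OF ctxhom_ctxw[OF h]]
    by (simp add: glue_def split_def \<theta> BL_def)
qed

text \<open>A generator over the tensor splits into generators over the factors, and their
  \<open>wmor\<close> are the morphisms between the intermediate contexts of the two
  decompositions.\<close>

lemma split_resp:
  assumes "bE k \<Delta> (tenN k \<Gamma>s) \<theta> \<theta>'" and L: "lens (N0 + k) \<Gamma>s"
  shows "dE k \<Delta> \<Gamma>s (split k \<Gamma>s \<theta>) (split k \<Gamma>s \<theta>')"
proof (rule equivclose_map[OF assms(1)[unfolded bE_def], where f="split k \<Gamma>s"])
  show "dE k \<Delta> \<Gamma>s (split k \<Gamma>s x) (split k \<Gamma>s x)" if "bS k \<Delta> (tenN k \<Gamma>s) x" for x
    unfolding dE_def using dS_split[OF that L] by (rule ec_refl)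
  fix x y assume x: "bS k \<Delta> (tenN k \<Gamma>s) x" and y: "bS k \<Delta> (tenN k \<Gamma>s) y" and g: "bgen k (tenN k \<Gamma>s) x y"
  obtain b h b' h' where e: "x = (b, h)" "y = (b', h')" by fastforce
  from g obtain vs where v: "bagto (pco (tenN k \<Gamma>s)) b vs b'" "h' = h \<odot> wmor k (tenN k \<Gamma>s) b vs" by (auto simp: bgen_def e)
  have ok: "bagok (pco (tenN k \<Gamma>s)) b" "bagok (pco (tenN k \<Gamma>s)) b'" and h: "ctxhom A C \<Delta> (tgt k (tenN k \<Gamma>s) b) h"
    using x y by (auto simp: bS_def e)
  let ?bs = "chp \<Gamma>s b" and ?bs' = "chp \<Gamma>s b'" and ?vss = "chp \<Gamma>s vs"
  have ll: "length b = length (concat (map pco \<Gamma>s))" "length b' = length (concat (map pco \<Gamma>s))" "length vs = length (concat (map pco \<Gamma>s))"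
    using bagto_len[OF v(1)] by (simp_all only: pco_tenN)
  note cb = ll[THEN concat_chp]
  have l: "length ?bs = length \<Gamma>s" "length ?bs' = length \<Gamma>s" "length ?vss = length \<Gamma>s" by simp_all
  have T: "\<forall>i<length \<Gamma>s. bagto (pco (\<Gamma>s ! i)) (?bs ! i) (?vss ! i) (?bs' ! i)"
    using bagto_concat_iff[OF l] v(1) length_chp_nth[OF ll(1)] length_chp_nth[OF ll(2)] length_chp_nth[OF ll(3)]
    unfolding cb pco_tenN by blast
  note w = wmor_sig[OF l T, where k=k, unfolded cb]
  let ?ws = "map (\<lambda>i. wmor k (\<Gamma>s ! i) (?bs ! i) (?vss ! i)) [0..<length \<Gamma>s]"
  have "dgen k \<Gamma>s (split k \<Gamma>s x) (split k \<Gamma>s y)"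
    unfolding dgen_def split_def e prod.case fst_conv snd_conv
  proof (intro exI[of _ ?ws] conjI allI impI)
    fix i assume i: "i < length \<Gamma>s"
    note wi = wmor(1)[OF T[rule_format, OF i], of k]
    have bi: "bagok (pco (\<Gamma>s ! i)) (?bs ! i)" "bagok (pco (\<Gamma>s ! i)) (?bs' ! i)" using T i by (auto simp: bagto_def)
    show "ctxhom A C (tgts k \<Gamma>s ?bs ! i) (tgts k \<Gamma>s ?bs' ! i) (?ws ! i)" using wi i by simp
    have "bE k (tgt k (\<Gamma>s ! i) (?bs ! i)) (\<Gamma>s ! i) (?bs ! i, cidc A (tgt k (\<Gamma>s ! i) (?bs ! i))) (?bs' ! i, wmor k (\<Gamma>s ! i) (?bs ! i) (?vss ! i))"
    proof (rule bE_gen)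
      show "bgen k (\<Gamma>s ! i) (?bs ! i, cidc A (tgt k (\<Gamma>s ! i) (?bs ! i))) (?bs' ! i, wmor k (\<Gamma>s ! i) (?bs ! i) (?vss ! i))"
        unfolding bgen_def using T i ccompc_idl[OF ctxhom_ctxw[OF wi]] by auto
    qed (use bi wi L i in \<open>auto simp: bS_def ctxhom_cidc\<close>)
    then show "bE k (tgts k \<Gamma>s ?bs ! i) (\<Gamma>s ! i) (map (\<lambda>i. (?bs ! i, cidc A (tgt k (\<Gamma>s ! i) (?bs ! i)))) [0..<length \<Gamma>s] ! i)
      (BL (?ws ! i) (map (\<lambda>i. (?bs' ! i, cidc A (tgt k (\<Gamma>s ! i) (?bs' ! i)))) [0..<length \<Gamma>s] ! i))"
      using i ccompc_idr[OF ctxhom_ctxw[OF wi]] by (simp add: BL_def)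
  next
    show "h' \<odot> sig k \<Gamma>s ?bs' = h \<odot> sig k \<Gamma>s ?bs \<odot> ctensor_mor (m0 + k) (tgts k \<Gamma>s ?bs) ?ws"
      unfolding v(2) using ctxhom_ctxw[OF h] ctxw_sig[OF l(1), of k, unfolded cb] ctxw_sig[OF l(2), of k, unfolded cb] w(1,2)[THEN ctxhom_ctxw]
      by (simp only: ccompc_assoc w(3))
  qed simp
  then show "dE k \<Delta> \<Gamma>s (split k \<Gamma>s x) (split k \<Gamma>s y)"
    unfolding dE_def using dS_split[OF x L] dS_split[OF y L] by (intro ec_gen)
qed (blast intro: dE_sym dE_trans)+

lemma split_glue:
  assumes d: "dS k \<Delta> \<Gamma>s d"
  shows "dE k \<Delta> \<Gamma>s (split k \<Gamma>s (glue k \<Gamma>s d)) d"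
proof -
  obtain \<Delta>s \<theta>s h where e: "d = (\<Delta>s, \<theta>s, h)" by (cases d)
  have ok: "BTok k \<Delta>s \<Gamma>s \<theta>s" and h: "ctxhom A C \<Delta> (ten k \<Delta>s) h" using d by (auto simp: dS_def e)
  note f = BTok_facts[OF ok]
  let ?bs = "map fst \<theta>s" and ?H = "ctensor_mor (m0 + k) \<Delta>s (map snd \<theta>s)"
  have l: "length ?bs = length \<Gamma>s" using f by simp
  have c: "chp \<Gamma>s (concat ?bs) = ?bs" by (rule chp_concat[OF f(3)])
  have t: "bS k \<Delta> (tenN k \<Gamma>s) (glue k \<Gamma>s d)" unfolding e glue_def prod.case by (rule bS_BL[OF bS_BT[OF ok] h])
  have sp: "split k \<Gamma>s (glue k \<Gamma>s d) = (tgts k \<Gamma>s ?bs, map (\<lambda>i. (?bs ! i, cidc A (tgt k (\<Gamma>s ! i) (?bs ! i)))) [0..<length \<Gamma>s], h \<odot> ?H)"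
  proof -
    have "h \<odot> (?H \<odot> sigi k \<Gamma>s ?bs) \<odot> sig k \<Gamma>s ?bs = h \<odot> ?H"
      by (simp only: ccompc_assoc[OF ctxhom_ctxw[OF h] ctxw_comp[OF ctxhom_ctxw[OF BT_hom[OF ok]] ctxw_sigi[OF l]] ctxw_sig[OF l]]
         ccompc_assoc[OF ctxhom_ctxw[OF BT_hom[OF ok]] ctxw_sigi[OF l] ctxw_sig[OF l]] sigi_sig[OF l] ccompc_idr[OF ctxhom_ctxw[OF BT_hom[OF ok]]])
    then show ?thesis by (simp add: e glue_def split_def BL_def BT_def c)
  qed
  have "dgen k \<Gamma>s d (split k \<Gamma>s (glue k \<Gamma>s d))"
    unfolding sp unfolding dgen_def e prod.case
  \<comment> \<open>The morphism parts of the environments are the witness: pulling the universal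
    environment back along \<open>snd (\<theta>s ! i)\<close> gives
    \<open>\<theta>s ! i\<close>.\<close>
  proof (intro exI[of _ "map snd \<theta>s"] conjI allI impI)
    fix i assume i: "i < length \<Gamma>s"
    show "ctxhom A C (\<Delta>s ! i) (tgts k \<Gamma>s ?bs ! i) (map snd \<theta>s ! i)" using f i by simp
    have "bS k (\<Delta>s ! i) (\<Gamma>s ! i) (\<theta>s ! i)" using ok i by (simp add: BTok_def)
    moreover have "BL (map snd \<theta>s ! i) (map (\<lambda>i. (?bs ! i, cidc A (tgt k (\<Gamma>s ! i) (?bs ! i)))) [0..<length \<Gamma>s] ! i) = \<theta>s ! i"
      using i f ccompc_idr[OF ctxhom_ctxw[OF f(6)[OF i]]] by (simp add: BL_def)
    ultimately show "bE k (\<Delta>s ! i) (\<Gamma>s ! i) (\<theta>s ! i) (BL (map snd \<theta>s ! i) (map (\<lambda>i. (?bs ! i, cidc A (tgt k (\<Gamma>s ! i) (?bs ! i)))) [0..<length \<Gamma>s] ! i))"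
      by (simp add: bE_refl)
  qed (use f in auto)
  then have "dE k \<Delta> \<Gamma>s d (split k \<Gamma>s (glue k \<Gamma>s d))"
    unfolding dE_def using d dS_split[OF t f(2)] by (intro ec_gen)
  then show ?thesis by (rule dE_sym)
qed

text \<open>This avoids computing \<open>split\<close>: any decomposition that glues to an
  equivalent environment may take its place.\<close>

lemma split_eqI:
  assumes "dS k \<Delta> \<Gamma>s d" "bE k \<Delta> (tenN k \<Gamma>s) \<theta> (glue k \<Gamma>s d)" "lens (N0 + k) \<Gamma>s"
  shows "dE k \<Delta> \<Gamma>s (split k \<Gamma>s \<theta>) d"
  by (rule dE_trans[OF split_resp[OF assms(2,3)] split_glue[OF assms(1)]])

section \<open>Composing a denotation with environments\<close>

text \<open>\<open>cmp P k\<close> is the coend over \<open>\<Gamma>\<close> of \<open>P(\<Gamma>, a)\<close> times the environments from \<open>\<Delta>\<close> to \<open>\<Gamma>\<close>.\<close>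

definition cS where
  "cS P k \<Delta> a x = (case x of (\<Gamma>, p, \<theta>) \<Rightarrow> sem A C P (N0 + k) \<Gamma> a p \<and> bS k \<Delta> \<Gamma> \<theta>)"

text \<open>As for bags, \<open>eqv\<close> and \<open>bE\<close> are built into the generator,
  which combines congruence in both factors with the sliding of \<open>g\<close> from the element to
  the environment.\<close>

definition cgen where
  "cgen P k \<Delta> a x y = (case (x, y) of ((\<Gamma>, p', \<theta>), (\<Gamma>', p, \<theta>')) \<Rightarrow> \<exists>g. ctxhom A C \<Gamma> \<Gamma>' g \<and>
     eqv A C P (N0 + k) \<Gamma> a p' (act A P g (did A a) p) \<and> bE k \<Delta> \<Gamma>' \<theta>' (BR k \<Gamma> g \<theta>))"

text \<open>The context \<open>\<Gamma>\<close> is bound by the coend, so a change of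
  \<open>\<Delta>\<close> affects only \<open>\<theta>\<close>, and \<open>p\<close> is acted on
  with the identity of its context.\<close>

definition cA where
  "cA P u f x = (case x of (\<Gamma>, p, \<theta>) \<Rightarrow> (\<Gamma>, act A P (cidc A \<Gamma>) f p, BL u \<theta>))"

definition cE where "cE P k \<Delta> a = equivclose (cS P k \<Delta> a) (cgen P k \<Delta> a)"

definition cmp where "cmp P k = \<lparr>fS = cS P k, fE = cE P k, fA = cA P\<rparr>"

lemma cmp_simps [simp]: "fS (cmp P k) = cS P k" "fE (cmp P k) = cE P k" "fA (cmp P k) = cA P"
  by (simp_all add: cmp_def)

lemma cE_refl: "cS P k \<Delta> a x \<Longrightarrow> cE P k \<Delta> a x x" unfolding cE_def by (rule ec_refl)
lemma cE_sym: "cE P k \<Delta> a x y \<Longrightarrow> cE P k \<Delta> a y x" unfolding cE_def by (rule ec_sym)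
lemma cE_trans: "cE P k \<Delta> a x y \<Longrightarrow> cE P k \<Delta> a y z \<Longrightarrow> cE P k \<Delta> a x z" unfolding cE_def by (rule ec_trans)
lemma cE_dom: "cE P k \<Delta> a x y \<Longrightarrow> cS P k \<Delta> a x" "cE P k \<Delta> a x y \<Longrightarrow> cS P k \<Delta> a y"
  unfolding cE_def by (auto dest: equivclose_dom)

lemma cS_iff [simp]: "cS P k \<Delta> a (\<Gamma>, p, \<theta>) \<longleftrightarrow> sem A C P (N0 + k) \<Gamma> a p \<and> bS k \<Delta> \<Gamma> \<theta>"
  by (simp add: cS_def)

lemma cE_gen:
  assumes "bS k \<Delta> \<Gamma> \<theta>" "sem A C P (N0 + k) \<Gamma>' a p" "ctxhom A C \<Gamma> \<Gamma>' g"
    "eqv A C P (N0 + k) \<Gamma> a p' (act A P g (did A a) p)" "bE k \<Delta> \<Gamma>' \<theta>' (BR k \<Gamma> g \<theta>)"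
  shows "cE P k \<Delta> a (\<Gamma>, p', \<theta>) (\<Gamma>', p, \<theta>')"
  unfolding cE_def
proof (rule ec_gen)
  show "cgen P k \<Delta> a (\<Gamma>, p', \<theta>) (\<Gamma>', p, \<theta>')" unfolding cgen_def using assms by blast
qed (use assms bE_dom eqv_sem in auto)

lemma act_id: "sem A C P n \<Gamma> a p \<Longrightarrow> eqv A C P n \<Gamma> a (act A P (cidc A \<Gamma>) (did A a) p) p"
  using isf_id[OF isf_den, of P n] unfolding den_simps .

lemma cE_cong:
  assumes "eqv A C P (N0 + k) \<Gamma> a p p'" "bE k \<Delta> \<Gamma> \<theta> \<theta>'"
  shows "cE P k \<Delta> a (\<Gamma>, p, \<theta>) (\<Gamma>, p', \<theta>')"
proof (rule cE_gen[OF bE_dom(1)[OF assms(2)] eqv_sem(2)[OF assms(1)] ctxhom_cidc])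
  show "eqv A C P (N0 + k) \<Gamma> a p (act A P (cidc A \<Gamma>) (did A a) p')"
    by (rule eqv_trans[OF assms(1) eqv_sym[OF act_id[OF eqv_sem(2)[OF assms(1)]]]])
  show "bE k \<Delta> \<Gamma> \<theta>' (BR k \<Gamma> (cidc A \<Gamma>) \<theta>)"
    by (rule bE_trans[OF bE_sym[OF assms(2)] bE_sym[OF BR_id[OF bE_dom(1)[OF assms(2)]]]])
qed

lemma cE_map:
  assumes "cE P k \<Delta> a x y"
    and 0: "\<And>x. cS P k \<Delta> a x \<Longrightarrow> T (f x) (f x)"
    and 1: "\<And>\<Gamma> p' \<theta> \<Gamma>' p \<theta>' g. bS k \<Delta> \<Gamma> \<theta> \<Longrightarrow> sem A C P (N0 + k) \<Gamma>' a p \<Longrightarrow> ctxhom A C \<Gamma> \<Gamma>' g \<Longrightarrow>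
      eqv A C P (N0 + k) \<Gamma> a p' (act A P g (did A a) p) \<Longrightarrow> bE k \<Delta> \<Gamma>' \<theta>' (BR k \<Gamma> g \<theta>) \<Longrightarrow>
      T (f (\<Gamma>, p', \<theta>)) (f (\<Gamma>', p, \<theta>'))"
    and 2: "\<And>x y. T x y \<Longrightarrow> T y x" and 3: "\<And>x y z. T x y \<Longrightarrow> T y z \<Longrightarrow> T x z"
  shows "T (f x) (f y)"
proof (rule equivclose_map[OF assms(1)[unfolded cE_def], of T f])
  fix x y assume x: "cS P k \<Delta> a x" "cS P k \<Delta> a y" "cgen P k \<Delta> a x y"
  obtain \<Gamma> p' \<theta> \<Gamma>' p \<theta>' where e: "x = (\<Gamma>, p', \<theta>)" "y = (\<Gamma>', p, \<theta>')" by (metis prod_cases3)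
  show "T (f x) (f y)" using x unfolding e cgen_def prod.case cS_iff by (elim exE conjE) (rule 1)
qed (fact 0 2 3)+

lemma isf_cmp: "isf (m0 + k) (cmp P k)"
proof -
  note D = isf_D[OF isf_den, unfolded den_simps]
  have act: "cS P k \<Delta>' a' (cA P u f x)" if "cS P k \<Delta> a x" "ctxhom A C \<Delta>' \<Delta> u" "dhom A C a a' f" for \<Delta> \<Delta>' a a' u f x
  proof -
    obtain \<Gamma> p \<theta> where e: "x = (\<Gamma>, p, \<theta>)" by (cases x)
    show ?thesis using sem_act[OF _ ctxhom_cidc that(3)] bS_BL[OF _ that(2)] that(1) by (simp add: e cA_def)
  qed
  show ?thesis unfolding isf_def cmp_simps
  proof (intro conjI allI impI act cE_refl)
    fix \<Delta> a x assume x: "cS P k \<Delta> a x"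
    obtain \<Gamma> p \<theta> where e: "x = (\<Gamma>, p, \<theta>)" by (cases x)
    have s: "sem A C P (N0 + k) \<Gamma> a p" "bS k \<Delta> \<Gamma> \<theta>" using x by (auto simp: e)
    show "length \<Delta> = m0 + k" using bS_len[OF s(2)] by simp
    show "cE P k \<Delta> a (cA P (cidc A \<Delta>) (did A a) x) x"
      using cE_cong[OF act_id[OF s(1)] bE_refl[OF s(2)]] by (simp add: cA_def e BL_id[OF s(2)])
    fix \<Delta>' a' \<Delta>'' a'' u f u' f'
    assume u: "ctxhom A C \<Delta>' \<Delta> u" and f: "dhom A C a a' f" and u': "ctxhom A C \<Delta>'' \<Delta>' u'" and f': "dhom A C a' a'' f'"
    have "eqv A C P (N0 + k) \<Gamma> a'' (act A P (cidc A \<Gamma>) (dcomp A f f') p) (act A P (cidc A \<Gamma>) f' (act A P (cidc A \<Gamma>) f p))"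
      using D(10)[OF s(1) ctxhom_cidc f ctxhom_cidc f'] by (simp add: ccompc_idl[OF ctxw_cidc])
    then show "cE P k \<Delta>'' a'' (cA P (u' \<odot> u) (dcomp A f f') x) (cA P u' f' (cA P u f x))"
      using cE_cong[OF _ bE_refl[OF bS_BL[OF bS_BL[OF s(2) u] u']]] by (simp add: cA_def e BL_comp[OF s(2) u u'])
  next
    fix \<Delta> a \<Delta>' a' u f x y assume xy: "cE P k \<Delta> a x y" and u: "ctxhom A C \<Delta>' \<Delta> u" and f: "dhom A C a a' f"
    show "cE P k \<Delta>' a' (cA P u f x) (cA P u f y)"
    proof (rule cE_map[OF xy, where f="cA P u f"])
      fix \<Gamma> p' \<theta> \<Gamma>' p \<theta>' g assume a: "bS k \<Delta> \<Gamma> \<theta>" "sem A C P (N0 + k) \<Gamma>' a p" and g: "ctxhom A C \<Gamma> \<Gamma>' g" and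
        b: "eqv A C P (N0 + k) \<Gamma> a p' (act A P g (did A a) p)" "bE k \<Delta> \<Gamma>' \<theta>' (BR k \<Gamma> g \<theta>)"
      show "cE P k \<Delta>' a' (cA P u f (\<Gamma>, p', \<theta>)) (cA P u f (\<Gamma>', p, \<theta>'))"
        unfolding cA_def prod.case
      proof (rule cE_gen[OF bS_BL[OF a(1) u] sem_act[OF a(2) ctxhom_cidc f] g])
        show "eqv A C P (N0 + k) \<Gamma> a' (act A P (cidc A \<Gamma>) f p') (act A P g (did A a') (act A P (cidc A \<Gamma>') f p))"
          by (rule eqv_trans[OF D(8)[OF b(1) ctxhom_cidc f] isf_swap[OF isf_den _ g f, unfolded den_simps, OF a(2)]])
        show "bE k \<Delta>' \<Gamma>' (BL u \<theta>') (BR k \<Gamma> g (BL u \<theta>))"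
          unfolding BR_BL[OF a(1) u g] by (rule BL_cong[OF b(2) u])
      qed
    qed (blast intro: cE_refl cE_sym cE_trans act[OF _ u f])+
  qed (blast intro: cE_sym cE_trans dest: cE_dom)+
qed

end

section \<open>Application\<close>

text \<open>The induction hypotheses for function and argument, as chosen pairs of maps: the
  isomorphism for the application is built from them on representatives.\<close>

locale env_app = env A C m0 N0 nq \<kappa> \<iota> p0 Q
  for A :: "('o, 'm) cat" and C m0 N0 nq \<kappa> \<iota> p0 Q +
  fixes k :: nat and P P' M M' :: lterm and \<phi> \<psi> \<chi> \<xi>
  assumes iP: "iso_by (cmp P k) (den P' (m0 + k)) \<phi> \<psi>"
    and iM: "iso_by (cmp M k) (den M' (m0 + k)) \<chi> \<xi>"
begin

abbreviation "n \<equiv> m0 + k"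
abbreviation "N \<equiv> N0 + k"

lemmas nat\<phi> = iP[unfolded iso_by_def, THEN conjunct1]
  and nat\<psi> = iP[unfolded iso_by_def, THEN conjunct2, THEN conjunct1]
  and nat\<chi> = iM[unfolded iso_by_def, THEN conjunct1]
  and nat\<xi> = iM[unfolded iso_by_def, THEN conjunct2, THEN conjunct1]

lemmas r\<phi> = nat_trans_resp[OF nat\<phi>, unfolded den_simps cmp_simps]
  and r\<psi> = nat_trans_resp[OF nat\<psi>, unfolded den_simps cmp_simps]
  and r\<chi> = nat_trans_resp[OF nat\<chi>, unfolded den_simps cmp_simps]
  and r\<xi> = nat_trans_resp[OF nat\<xi>, unfolded den_simps cmp_simps]

lemmas n\<phi> = nat_trans_natural[OF nat\<phi>, unfolded den_simps cmp_simps]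
  and n\<psi> = nat_trans_natural[OF nat\<psi>, unfolded den_simps cmp_simps]
  and n\<chi> = nat_trans_natural[OF nat\<chi>, unfolded den_simps cmp_simps]
  and n\<xi> = nat_trans_natural[OF nat\<xi>, unfolded den_simps cmp_simps]

lemma typed: "cS P k \<Delta> a x \<Longrightarrow> sem A C P' n \<Delta> a (\<phi> \<Delta> a x)"
  "cS M k \<Delta> a x \<Longrightarrow> sem A C M' n \<Delta> a (\<chi> \<Delta> a x)"
  "sem A C P' n \<Delta> a p \<Longrightarrow> cS P k \<Delta> a (\<psi> \<Delta> a p)"
  "sem A C M' n \<Delta> a p \<Longrightarrow> cS M k \<Delta> a (\<xi> \<Delta> a p)"
  by (rule eqv_sem(1)[OF r\<phi>[OF cE_refl]] eqv_sem(1)[OF r\<chi>[OF cE_refl]] cE_dom(1)[OF r\<psi>[OF eqv_refl]]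
    cE_dom(1)[OF r\<xi>[OF eqv_refl]]; assumption)+

lemma inv: "cS P k \<Delta> a x \<Longrightarrow> cE P k \<Delta> a (\<psi> \<Delta> a (\<phi> \<Delta> a x)) x"
  "cS M k \<Delta> a x \<Longrightarrow> cE M k \<Delta> a (\<xi> \<Delta> a (\<chi> \<Delta> a x)) x"
  "sem A C P' n \<Delta> a p \<Longrightarrow> eqv A C P' n \<Delta> a (\<phi> \<Delta> a (\<psi> \<Delta> a p)) p"
  "sem A C M' n \<Delta> a p \<Longrightarrow> eqv A C M' n \<Delta> a (\<chi> \<Delta> a (\<xi> \<Delta> a p)) p"
  by (rule iP[unfolded iso_by_def den_simps cmp_simps, THEN conjunct2, THEN conjunct2, THEN conjunct1, rule_format]
    iM[unfolded iso_by_def den_simps cmp_simps, THEN conjunct2, THEN conjunct2, THEN conjunct1, rule_format]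
    iP[unfolded iso_by_def den_simps cmp_simps, THEN conjunct2, THEN conjunct2, THEN conjunct2, rule_format]
    iM[unfolded iso_by_def den_simps cmp_simps, THEN conjunct2, THEN conjunct2, THEN conjunct2, rule_format]; assumption)+

section \<open>From the composite of an application to the application of the results\<close>

text \<open>\<open>d\<close> decomposes an environment over the tensor of \<open>\<Theta>s\<close>;
  its factors pair up with \<open>p\<close> and \<open>ps\<close> to elements of composites, to
  which the induction hypotheses apply.\<close>

definition Phi where
  "Phi a bs \<Theta>s p ps d = (case d of (\<Delta>s, \<theta>s, h) \<Rightarrow>
     EA bs \<Delta>s (\<phi> (\<Delta>s ! 0) (Fn bs a) (\<Theta>s ! 0, p, \<theta>s ! 0))
       (map (\<lambda>i. \<chi> (\<Delta>s ! Suc i) (bs ! i) (\<Theta>s ! Suc i, ps ! i, \<theta>s ! Suc i)) [0..<length bs]) h)"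

text \<open>The part of \<open>sem\<close> for an application that is independent of the morphism
  into the tensor; that morphism is absorbed by the environment.\<close>

definition ok where
  "ok a bs \<Theta>s p ps \<longleftrightarrow> length \<Theta>s = Suc (length bs) \<and> lens N \<Theta>s \<and> sem A C P N (\<Theta>s ! 0) (Fn bs a) p \<and>
     length ps = length bs \<and> (\<forall>i<length bs. sem A C M N (\<Theta>s ! Suc i) (bs ! i) (ps ! i))"

lemma sem_ok: "sem A C (LApp P M) N \<Gamma> a (EA bs \<Theta>s p ps g) \<longleftrightarrow> ok a bs \<Theta>s p ps \<and> ctxhom A C \<Gamma> (tenN k \<Theta>s) g"
  unfolding semApp ok_def by blast

lemma dS_iff: "dS k \<Delta> \<Gamma>s (\<Delta>s, \<theta>s, h) \<longleftrightarrow> BTok k \<Delta>s \<Gamma>s \<theta>s \<and> ctxhom A C \<Delta> (ten k \<Delta>s) h"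
  by (simp add: dS_def)

lemma slots:
  assumes "ok a bs \<Theta>s p ps" "BTok k \<Delta>s \<Theta>s \<theta>s"
  shows "cS P k (\<Delta>s ! 0) (Fn bs a) (\<Theta>s ! 0, p, \<theta>s ! 0)"
    "i < length bs \<Longrightarrow> cS M k (\<Delta>s ! Suc i) (bs ! i) (\<Theta>s ! Suc i, ps ! i, \<theta>s ! Suc i)"
    "length \<Delta>s = Suc (length bs)" "length \<theta>s = Suc (length bs)" "length \<Theta>s = Suc (length bs)" "lens n \<Delta>s" "lens N \<Theta>s"
    "\<And>j. j < Suc (length bs) \<Longrightarrow> bS k (\<Delta>s ! j) (\<Theta>s ! j) (\<theta>s ! j)"
  using assms BTok_facts[OF assms(2)] by (auto simp: ok_def BTok_def)

lemma Phi_typed: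
  assumes o: "ok a bs \<Theta>s p ps" and d: "dS k \<Delta> \<Theta>s d"
  shows "sem A C (LApp P' M') n \<Delta> a (Phi a bs \<Theta>s p ps d)"
proof -
  obtain \<Delta>s \<theta>s h where e: "d = (\<Delta>s, \<theta>s, h)" by (cases d)
  have B: "BTok k \<Delta>s \<Theta>s \<theta>s" and h: "ctxhom A C \<Delta> (ten k \<Delta>s) h" using d by (auto simp: e dS_iff)
  show ?thesis using slots[OF o B] typed(1,2) h unfolding e Phi_def prod.case semApp by auto
qed

lemma Phi_cong:
  assumes o: "ok a bs \<Theta>s p ps" and d: "dS k \<Delta> \<Theta>s d"
    and p: "eqv A C P N (\<Theta>s ! 0) (Fn bs a) p p'"
    and ps: "\<And>i. i < length bs \<Longrightarrow> eqv A C M N (\<Theta>s ! Suc i) (bs ! i) (ps ! i) (ps' ! i)"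
  shows "eqv A C (LApp P' M') n \<Delta> a (Phi a bs \<Theta>s p ps d) (Phi a bs \<Theta>s p' ps' d)"
proof -
  obtain \<Delta>s \<theta>s h where e: "d = (\<Delta>s, \<theta>s, h)" by (cases d)
  have B: "BTok k \<Delta>s \<Theta>s \<theta>s" using d by (auto simp: e dS_iff)
  note s = slots[OF o B]
  show ?thesis using Phi_typed[OF o d] unfolding e Phi_def prod.case
  proof (rule app_cong[OF isf_den isf_den])
    show "eqv A C P' n (\<Delta>s ! 0) (Fn bs a) (\<phi> (\<Delta>s ! 0) (Fn bs a) (\<Theta>s ! 0, p, \<theta>s ! 0)) (\<phi> (\<Delta>s ! 0) (Fn bs a) (\<Theta>s ! 0, p', \<theta>s ! 0))"
      by (rule r\<phi>[OF cE_cong[OF p bE_refl[OF s(8)]]]) simp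
    fix i assume i: "i < length bs"
    then have "eqv A C M' n (\<Delta>s ! Suc i) (bs ! i) (\<chi> (\<Delta>s ! Suc i) (bs ! i) (\<Theta>s ! Suc i, ps ! i, \<theta>s ! Suc i))
       (\<chi> (\<Delta>s ! Suc i) (bs ! i) (\<Theta>s ! Suc i, ps' ! i, \<theta>s ! Suc i))"
      by (intro r\<chi>[OF cE_cong[OF ps[OF i] bE_refl[OF s(8)]]]) simp
    then show "eqv A C M' n (\<Delta>s ! Suc i) (bs ! i) (map (\<lambda>i. \<chi> (\<Delta>s ! Suc i) (bs ! i) (\<Theta>s ! Suc i, ps ! i, \<theta>s ! Suc i)) [0..<length bs] ! i)
       (map (\<lambda>i. \<chi> (\<Delta>s ! Suc i) (bs ! i) (\<Theta>s ! Suc i, ps' ! i, \<theta>s ! Suc i)) [0..<length bs] ! i)" using i by simp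
  qed simp
qed

text \<open>The Day convolution relation slides morphisms between the contexts of the factors, just
  as the second coend relation of the application does.\<close>

lemma Phi_dE:
  assumes o: "ok a bs \<Theta>s p ps" and dd: "dE k \<Delta> \<Theta>s d d'"
  shows "eqv A C (LApp P' M') n \<Delta> a (Phi a bs \<Theta>s p ps d) (Phi a bs \<Theta>s p ps d')"
proof (rule equivclose_map[OF dd[unfolded dE_def], where f="Phi a bs \<Theta>s p ps" and T="eqv A C (LApp P' M') n \<Delta> a"])
  show "eqv A C (LApp P' M') n \<Delta> a (Phi a bs \<Theta>s p ps d) (Phi a bs \<Theta>s p ps d)" if "dS k \<Delta> \<Theta>s d" for d
    by (rule eqv_refl[OF Phi_typed[OF o that]])
  fix d d' assume d: "dS k \<Delta> \<Theta>s d" "dS k \<Delta> \<Theta>s d'" "dgen k \<Theta>s d d'"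
  obtain \<Delta>s \<theta>s h \<Delta>s' \<theta>s' h' where e: "d = (\<Delta>s, \<theta>s, h)" "d' = (\<Delta>s', \<theta>s', h')" by (metis prod_cases3)
  have B: "BTok k \<Delta>s \<Theta>s \<theta>s" "BTok k \<Delta>s' \<Theta>s \<theta>s'" and h: "ctxhom A C \<Delta> (ten k \<Delta>s) h" using d by (auto simp: e dS_iff)
  obtain vs where vs: "length vs = length \<Theta>s" "h' = h \<odot> ctensor_mor n \<Delta>s vs"
    and v: "\<And>i. i < length \<Theta>s \<Longrightarrow> ctxhom A C (\<Delta>s ! i) (\<Delta>s' ! i) (vs ! i) \<and> bE k (\<Delta>s ! i) (\<Theta>s ! i) (\<theta>s ! i) (BL (vs ! i) (\<theta>s' ! i))"
    using d(3) by (auto simp: dgen_def e)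
  note s = slots[OF o B(1)] and s' = slots[OF o B(2)]
  have vh: "\<And>j. j < Suc (length bs) \<Longrightarrow> ctxhom A C (\<Delta>s ! j) (\<Delta>s' ! j) (vs ! j)" using v s(5) by simp
  show "eqv A C (LApp P' M') n \<Delta> a (Phi a bs \<Theta>s p ps d) (Phi a bs \<Theta>s p ps d')"
    unfolding e Phi_def prod.case vs(2)
  proof (rule app_ctx[OF isf_den isf_den s(3) s'(3) _ s(6) s'(6) vh])
    show "length vs = Suc (length bs)" using vs s(5) by simp
    show "sem A C P' n (\<Delta>s' ! 0) (Fn bs a) (\<phi> (\<Delta>s' ! 0) (Fn bs a) (\<Theta>s ! 0, p, \<theta>s' ! 0))" by (rule typed(1)[OF s'(1)])
    show "sem A C M' n (\<Delta>s' ! Suc i) (bs ! i) (map (\<lambda>i. \<chi> (\<Delta>s' ! Suc i) (bs ! i) (\<Theta>s ! Suc i, ps ! i, \<theta>s' ! Suc i)) [0..<length bs] ! i)"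
      if "i < length bs" for i using typed(2)[OF s'(2)[OF that]] that by simp
    have p: "sem A C P N (\<Theta>s ! 0) (Fn bs a) p" using o by (simp add: ok_def)
    have "cE P k (\<Delta>s ! 0) (Fn bs a) (\<Theta>s ! 0, p, \<theta>s ! 0) (cA P (vs ! 0) (did A (Fn bs a)) (\<Theta>s ! 0, p, \<theta>s' ! 0))"
      unfolding cA_def prod.case by (rule cE_cong[OF eqv_sym[OF act_id[OF p]]]) (use v s(5) in simp)
    from eqv_trans[OF r\<phi>[OF this] n\<phi>[OF s'(1) vh dhom_did]]
    show "eqv A C P' n (\<Delta>s ! 0) (Fn bs a) (\<phi> (\<Delta>s ! 0) (Fn bs a) (\<Theta>s ! 0, p, \<theta>s ! 0))
       (act A P' (vs ! 0) (did A (Fn bs a)) (\<phi> (\<Delta>s' ! 0) (Fn bs a) (\<Theta>s ! 0, p, \<theta>s' ! 0)))" by simp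
    fix i assume i: "i < length bs"
    have q: "sem A C M N (\<Theta>s ! Suc i) (bs ! i) (ps ! i)" using o i by (simp add: ok_def)
    have "cE M k (\<Delta>s ! Suc i) (bs ! i) (\<Theta>s ! Suc i, ps ! i, \<theta>s ! Suc i) (cA M (vs ! Suc i) (did A (bs ! i)) (\<Theta>s ! Suc i, ps ! i, \<theta>s' ! Suc i))"
      unfolding cA_def prod.case by (rule cE_cong[OF eqv_sym[OF act_id[OF q]]]) (use v s(5) i in simp)
    from eqv_trans[OF r\<chi>[OF this] n\<chi>[OF s'(2)[OF i] vh dhom_did]]
    show "eqv A C M' n (\<Delta>s ! Suc i) (bs ! i) (map (\<lambda>i. \<chi> (\<Delta>s ! Suc i) (bs ! i) (\<Theta>s ! Suc i, ps ! i, \<theta>s ! Suc i)) [0..<length bs] ! i)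
       (act A M' (vs ! Suc i) (did A (bs ! i)) (map (\<lambda>i. \<chi> (\<Delta>s' ! Suc i) (bs ! i) (\<Theta>s ! Suc i, ps ! i, \<theta>s' ! Suc i)) [0..<length bs] ! i))"
      using i by simp
  qed (simp_all add: h)
qed (blast intro: eqvApp_sym eqvApp_trans)+

text \<open>The morphism \<open>g\<close> is pushed into the environment, which then lives over a
  tensor and can be split.\<close>

definition ph where
  "ph \<Delta> a x = (case x of (\<Gamma>, EA bs \<Theta>s p ps g, \<theta>) \<Rightarrow> Phi a bs \<Theta>s p ps (split k \<Theta>s (BR k \<Gamma> g \<theta>)) | _ \<Rightarrow> undefined)"

lemma ph_EA: "ph \<Delta> a (\<Gamma>, EA bs \<Theta>s p ps g, \<theta>) = Phi a bs \<Theta>s p ps (split k \<Theta>s (BR k \<Gamma> g \<theta>))"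
  by (simp add: ph_def)

lemma ok_lens: "ok a bs \<Theta>s p ps \<Longrightarrow> lens N \<Theta>s"
  by (simp add: ok_def)

lemma ph_typed:
  assumes "cS (LApp P M) k \<Delta> a x"
  shows "sem A C (LApp P' M') n \<Delta> a (ph \<Delta> a x)"
proof -
  obtain \<Gamma> y \<theta> where e: "x = (\<Gamma>, y, \<theta>)" by (cases x)
  have y: "sem A C (LApp P M) N \<Gamma> a y" and t: "bS k \<Delta> \<Gamma> \<theta>" using assms by (auto simp: e simp del: sem.simps)
  obtain bs \<Theta>s p ps g where y': "y = EA bs \<Theta>s p ps g" using y by (rule semApp_cases)
  have o: "ok a bs \<Theta>s p ps" "ctxhom A C \<Gamma> (tenN k \<Theta>s) g" using y unfolding y' sem_ok by auto
  show ?thesis unfolding e y' ph_EA by (rule Phi_typed[OF o(1) dS_split[OF bS_BR[OF t o(2)] ok_lens[OF o(1)]]])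
qed

text \<open>The relations of the coend for \<open>LApp P M\<close> with the environment fixed. The
  second slides \<open>ws\<close> from the elements into the environments of the factors, by
  \<open>BT_BR\<close>; the third reindexes the factors, by \<open>BT_block\<close>. In both,
  \<open>split_eqI\<close> replaces the split environment by the transformed decomposition.\<close>

lemma ph_fst:
  assumes xy: "eqv A C (LApp P M) N \<Gamma> a x y" and t: "bS k \<Delta> \<Gamma> \<theta>"
  shows "eqv A C (LApp P' M') n \<Delta> a (ph \<Delta> a (\<Gamma>, x, \<theta>)) (ph \<Delta> a (\<Gamma>, y, \<theta>))"
proof (rule eqvApp_map[OF xy, where f="\<lambda>x. ph \<Delta> a (\<Gamma>, x, \<theta>)" and T="eqv A C (LApp P' M') n \<Delta> a"])
  show "eqv A C (LApp P' M') n \<Delta> a (ph \<Delta> a (\<Gamma>, x, \<theta>)) (ph \<Delta> a (\<Gamma>, x, \<theta>))" if "sem A C (LApp P M) N \<Gamma> a x" for x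
    by (rule eqv_refl[OF ph_typed]) (use that t in \<open>simp del: sem.simps\<close>)
next
  fix bs \<Theta>s p ps p' ps' h
  assume x: "sem A C (LApp P M) N \<Gamma> a (EA bs \<Theta>s p ps h)"
    and q: "eqv A C P N (\<Theta>s ! 0) (Fn bs a) p p'" "\<And>i. i < length bs \<Longrightarrow> eqv A C M N (\<Theta>s ! Suc i) (bs ! i) (ps ! i) (ps' ! i)"
  have o: "ok a bs \<Theta>s p ps" and h: "ctxhom A C \<Gamma> (tenN k \<Theta>s) h" using x by (auto simp: sem_ok simp del: sem.simps)
  show "eqv A C (LApp P' M') n \<Delta> a (ph \<Delta> a (\<Gamma>, EA bs \<Theta>s p ps h, \<theta>)) (ph \<Delta> a (\<Gamma>, EA bs \<Theta>s p' ps' h, \<theta>))"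
    unfolding ph_EA by (rule Phi_cong[OF o dS_split[OF bS_BR[OF t h] ok_lens[OF o]] q])
next
  fix bs :: "'o ty list" and \<Theta>s \<Theta>s' ws p ps g
  assume l: "length \<Theta>s = Suc (length bs)" "length \<Theta>s' = Suc (length bs)" "length ws = Suc (length bs)"
      and L: "lens N \<Theta>s" "lens N \<Theta>s'" and w: "\<And>j. j < Suc (length bs) \<Longrightarrow> ctxhom A C (\<Theta>s ! j) (\<Theta>s' ! j) (ws ! j)"
      and p: "sem A C P N (\<Theta>s' ! 0) (Fn bs a) p" and q: "length ps = length bs"
        "\<And>i. i < length bs \<Longrightarrow> sem A C M N (\<Theta>s' ! Suc i) (bs ! i) (ps ! i)"
      and g: "ctxhom A C \<Gamma> (tenN k \<Theta>s) g"
  let ?p = "act A P (ws ! 0) (did A (Fn bs a)) p" and ?ps = "map (\<lambda>i. act A M (ws ! Suc i) (did A (bs ! i)) (ps ! i)) [0..<length bs]"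
  let ?W = "ctensor_mor N \<Theta>s ws"
  have o: "ok a bs \<Theta>s ?p ?ps" and o': "ok a bs \<Theta>s' p ps"
    using l L p q sem_act[OF p w dhom_did] sem_act[OF q(2) w dhom_did] by (auto simp: ok_def)
  have w': "\<forall>i<length \<Theta>s. ctxhom A C (\<Theta>s ! i) (\<Theta>s' ! i) (ws ! i)" and l': "length ws = length \<Theta>s" "length \<Theta>s' = length \<Theta>s"
    using w l by simp_all
  have W: "ctxhom A C (tenN k \<Theta>s) (tenN k \<Theta>s') ?W" by (rule hom_tenN[OF l' L(1) w'])
  note t' = bS_BR[OF t g]
  obtain \<Delta>s \<theta>s h where d: "split k \<Theta>s (BR k \<Gamma> g \<theta>) = (\<Delta>s, \<theta>s, h)" by (metis prod_cases3)
  have B: "BTok k \<Delta>s \<Theta>s \<theta>s" and h: "ctxhom A C \<Delta> (ten k \<Delta>s) h" using dS_split[OF t' L(1)] by (auto simp: d dS_iff)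
  have gl: "BL h (BT k \<Delta>s \<Theta>s \<theta>s) = BR k \<Gamma> g \<theta>" using glue_split[OF t' L(1)] by (simp add: d glue_def)
  let ?\<theta>s = "map (\<lambda>i. BR k (\<Theta>s ! i) (ws ! i) (\<theta>s ! i)) [0..<length \<Theta>s]"
  note B' = BTok_BR[OF B l' w']
  note s = slots[OF o B] and s' = slots[OF o' B']
  have "eqv A C (LApp P' M') n \<Delta> a (Phi a bs \<Theta>s ?p ?ps (\<Delta>s, \<theta>s, h)) (Phi a bs \<Theta>s' p ps (\<Delta>s, ?\<theta>s, h))"
    unfolding Phi_def prod.case
  proof (rule app_cong[OF isf_den isf_den])
    show "sem A C (LApp P' M') n \<Delta> a (EA bs \<Delta>s (\<phi> (\<Delta>s ! 0) (Fn bs a) (\<Theta>s ! 0, ?p, \<theta>s ! 0))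
       (map (\<lambda>i. \<chi> (\<Delta>s ! Suc i) (bs ! i) (\<Theta>s ! Suc i, ?ps ! i, \<theta>s ! Suc i)) [0..<length bs]) h)"
      using Phi_typed[OF o, of \<Delta> "(\<Delta>s, \<theta>s, h)"] B h unfolding Phi_def dS_def prod.case by blast
    \<comment> \<open>One generator of the composite: \<open>ws ! 0\<close> leaves the element and
      enters the environment.\<close>
    have "cE P k (\<Delta>s ! 0) (Fn bs a) (\<Theta>s ! 0, ?p, \<theta>s ! 0) (\<Theta>s' ! 0, p, ?\<theta>s ! 0)"
      by (rule cE_gen[OF s(8) p w eqv_refl[OF sem_act[OF p w dhom_did]] ]) (use bE_refl[OF bS_BR[OF s(8) w]] l in \<open>simp_all del: upt_Suc\<close>)
    from r\<phi>[OF this] show "eqv A C P' n (\<Delta>s ! 0) (Fn bs a) (\<phi> (\<Delta>s ! 0) (Fn bs a) (\<Theta>s ! 0, ?p, \<theta>s ! 0)) (\<phi> (\<Delta>s ! 0) (Fn bs a) (\<Theta>s' ! 0, p, ?\<theta>s ! 0))" .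
    fix i assume i: "i < length bs"
    have "cE M k (\<Delta>s ! Suc i) (bs ! i) (\<Theta>s ! Suc i, act A M (ws ! Suc i) (did A (bs ! i)) (ps ! i), \<theta>s ! Suc i) (\<Theta>s' ! Suc i, ps ! i, ?\<theta>s ! Suc i)"
      by (rule cE_gen[OF s(8) q(2)[OF i] w eqv_refl[OF sem_act[OF q(2)[OF i] w dhom_did]] ])
        (use bE_refl[OF bS_BR[OF s(8) w]] l i in \<open>simp_all del: upt_Suc\<close>)
    from r\<chi>[OF this] show "eqv A C M' n (\<Delta>s ! Suc i) (bs ! i) (map (\<lambda>i. \<chi> (\<Delta>s ! Suc i) (bs ! i) (\<Theta>s ! Suc i, ?ps ! i, \<theta>s ! Suc i)) [0..<length bs] ! i)
      (map (\<lambda>i. \<chi> (\<Delta>s ! Suc i) (bs ! i) (\<Theta>s' ! Suc i, ps ! i, ?\<theta>s ! Suc i)) [0..<length bs] ! i)" using i by (simp del: upt_Suc)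
  qed simp
  moreover have "eqv A C (LApp P' M') n \<Delta> a (Phi a bs \<Theta>s' p ps (split k \<Theta>s' (BR k \<Gamma> (g \<odot> ?W) \<theta>))) (Phi a bs \<Theta>s' p ps (\<Delta>s, ?\<theta>s, h))"
  proof (rule Phi_dE[OF o'], rule split_eqI)
    show "dS k \<Delta> \<Theta>s' (\<Delta>s, ?\<theta>s, h)" unfolding dS_iff using B' h by blast
    show "bE k \<Delta> (tenN k \<Theta>s') (BR k \<Gamma> (g \<odot> ?W) \<theta>) (glue k \<Theta>s' (\<Delta>s, ?\<theta>s, h))"
      unfolding glue_def prod.case BT_BR[OF B l' w'] BR_BL[OF bS_BT[OF B] h W, symmetric] gl
      by (rule BR_comp[OF t g W])
  qed (rule L)
  ultimately show "eqv A C (LApp P' M') n \<Delta> a (ph \<Delta> a (\<Gamma>, EA bs \<Theta>s ?p ?ps g, \<theta>)) (ph \<Delta> a (\<Gamma>, EA bs \<Theta>s' p ps (g \<odot> ?W), \<theta>))"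
    unfolding ph_EA d by (blast intro: eqvApp_sym eqvApp_trans)
next
  fix as bs :: "'o ty list" and \<alpha> fs \<Theta>s p ps g
  assume s: "shom A C as bs (\<alpha>, fs)" and l: "length \<Theta>s = Suc (length as)" and L: "lens N \<Theta>s"
      and p: "sem A C P N (\<Theta>s ! 0) (Fn bs a) p" and q: "length ps = length as"
        "\<And>i. i < length as \<Longrightarrow> sem A C M N (\<Theta>s ! Suc i) (as ! i) (ps ! i)"
      and g: "ctxhom A C \<Gamma> (tenN k \<Theta>s) g"
  let ?\<beta> = "0 # map Suc \<alpha>"
  let ?p = "act A P (cidc A (\<Theta>s ! 0)) (FM \<alpha> fs (did A a)) p" and ?ps = "map2 (\<lambda>j g. act A M (cidc A (\<Theta>s ! Suc j)) g (ps ! j)) \<alpha> fs"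
  let ?\<Theta>s = "map ((!) \<Theta>s) ?\<beta>" and ?W = "cblock A N \<Theta>s ?\<beta>"
  have la: "length \<alpha> = length bs" "length fs = length bs" "\<And>i. i < length bs \<Longrightarrow> \<alpha> ! i < length as"
        "\<And>i. i < length bs \<Longrightarrow> dhom A C (as ! (\<alpha> ! i)) (bs ! i) (fs ! i)"
        using shom_shomw[OF s] by (auto simp: shomw_def)
  have cl: "in_class C (length ?\<beta>) (length \<Theta>s) ?\<beta>" using in_class_Suc[OF shom_in_class[OF s]] l la by simp
  have \<beta>: "\<forall>j\<in>set ?\<beta>. j < length \<Theta>s" by (rule cl[unfolded in_class_iff, THEN conjunct2, THEN conjunct1])
  have o: "ok a as \<Theta>s ?p ps" unfolding ok_def using l L q sem_act[OF p ctxhom_cidc dhom_Fn_fst[OF s]] by blast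
  have L': "lens N ?\<Theta>s" by (rule lens_block[OF L l]) (use la in \<open>auto simp: in_set_conv_nth\<close>)
  have o': "ok a bs ?\<Theta>s p ?ps" unfolding ok_def using L' p la sem_act[OF q(2)[OF la(3)] ctxhom_cidc la(4)] by simp
  have W: "ctxhom A C (tenN k \<Theta>s) (tenN k ?\<Theta>s) ?W" by (rule ctxhom_cblock[OF cl L])
  note t' = bS_BR[OF t g]
  obtain \<Delta>s \<theta>s h where d: "split k \<Theta>s (BR k \<Gamma> g \<theta>) = (\<Delta>s, \<theta>s, h)" by (metis prod_cases3)
  have B: "BTok k \<Delta>s \<Theta>s \<theta>s" and h: "ctxhom A C \<Delta> (ten k \<Delta>s) h" using dS_split[OF t' L] by (auto simp: d dS_iff)
  have gl: "BL h (BT k \<Delta>s \<Theta>s \<theta>s) = BR k \<Gamma> g \<theta>" using glue_split[OF t' L] by (simp add: d glue_def)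
  note B' = BTok_block[OF B \<beta>]
  note S = slots[OF o B]
  let ?d = "(map ((!) \<Delta>s) ?\<beta>, map ((!) \<theta>s) ?\<beta>, h \<odot> cblock A n \<Delta>s ?\<beta>)"
  have c: "ctxhom A C (ten k \<Delta>s) (ten k (map ((!) \<Delta>s) ?\<beta>)) (cblock A n \<Delta>s ?\<beta>)"
    by (rule ctxhom_cblock) (use cl S l in auto)
  have z: "P0 = P0" for P0 :: nat by simp
  have c0: "cS P k (\<Delta>s ! 0) (Fn bs a) (\<Theta>s ! 0, p, \<theta>s ! 0)" using p S(8)[of 0] by simp
  have ci: "cS M k (\<Delta>s ! Suc i) (as ! i) (\<Theta>s ! Suc i, ps ! i, \<theta>s ! Suc i)" if "i < length as" for i
    using S(2)[OF that] .
  have "eqv A C (LApp P' M') n \<Delta> a (Phi a as \<Theta>s ?p ps (\<Delta>s, \<theta>s, h)) (Phi a bs ?\<Theta>s p ?ps ?d)"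
    unfolding Phi_def prod.case list.map nth_Cons_0
  proof (rule app_arg[OF isf_den isf_den s S(3,6), unfolded list.map])
    show "sem A C P' n (\<Delta>s ! 0) (Fn bs a) (\<phi> (\<Delta>s ! 0) (Fn bs a) (\<Theta>s ! 0, p, \<theta>s ! 0))" by (rule typed(1)[OF c0])
    show "sem A C M' n (\<Delta>s ! Suc i) (as ! i) (map (\<lambda>i. \<chi> (\<Delta>s ! Suc i) (as ! i) (\<Theta>s ! Suc i, ps ! i, \<theta>s ! Suc i)) [0..<length as] ! i)"
      if "i < length as" for i using typed(2)[OF ci[OF that]] that by simp
    have "(\<Theta>s ! 0, ?p, \<theta>s ! 0) = cA P (cidc A (\<Delta>s ! 0)) (FM \<alpha> fs (did A a)) (\<Theta>s ! 0, p, \<theta>s ! 0)"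
      using BL_id[OF S(8)[of 0]] by (simp add: cA_def)
    then show "eqv A C P' n (\<Delta>s ! 0) (Fn as a) (\<phi> (\<Delta>s ! 0) (Fn as a) (\<Theta>s ! 0, ?p, \<theta>s ! 0))
       (act A P' (cidc A (\<Delta>s ! 0)) (FM \<alpha> fs (did A a)) (\<phi> (\<Delta>s ! 0) (Fn bs a) (\<Theta>s ! 0, p, \<theta>s ! 0)))"
      using n\<phi>[OF c0 ctxhom_cidc dhom_Fn_fst[OF s]] by simp
    fix i assume i: "i < length bs"
    let ?j = "\<alpha> ! i"
    have j: "?j < length as" by (rule la(3)[OF i])
    have "(\<Theta>s ! Suc ?j, act A M (cidc A (\<Theta>s ! Suc ?j)) (fs ! i) (ps ! ?j), \<theta>s ! Suc ?j) = cA M (cidc A (\<Delta>s ! Suc ?j)) (fs ! i) (\<Theta>s ! Suc ?j, ps ! ?j, \<theta>s ! Suc ?j)"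
      using BL_id[OF S(8)[of "Suc ?j"]] j by (simp add: cA_def)
    then show "eqv A C M' n (\<Delta>s ! Suc ?j) (bs ! i)
       (map (\<lambda>i. \<chi> (((\<Delta>s ! 0) # map ((!) \<Delta>s) (map Suc \<alpha>)) ! Suc i) (bs ! i) (((\<Theta>s ! 0) # map ((!) \<Theta>s) (map Suc \<alpha>)) ! Suc i, ?ps ! i,
           ((\<theta>s ! 0) # map ((!) \<theta>s) (map Suc \<alpha>)) ! Suc i)) [0..<length bs] ! i)
       (act A M' (cidc A (\<Delta>s ! Suc ?j)) (fs ! i) (map (\<lambda>i. \<chi> (\<Delta>s ! Suc i) (as ! i) (\<Theta>s ! Suc i, ps ! i, \<theta>s ! Suc i)) [0..<length as] ! ?j))"
      using n\<chi>[OF ci[OF j] ctxhom_cidc la(4)[OF i]] i j la by simp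
  qed (use h in auto)
  moreover have "eqv A C (LApp P' M') n \<Delta> a (Phi a bs ?\<Theta>s p ?ps (split k ?\<Theta>s (BR k \<Gamma> (g \<odot> ?W) \<theta>))) (Phi a bs ?\<Theta>s p ?ps ?d)"
  proof (rule Phi_dE[OF o'], rule split_eqI)
    show "dS k \<Delta> ?\<Theta>s ?d" unfolding dS_iff using B' ctxhom_comp[OF h c] by blast
    have "bE k \<Delta> (tenN k ?\<Theta>s) (BR k (tenN k \<Theta>s) ?W (BL h (BT k \<Delta>s \<Theta>s \<theta>s)))
       (BL h (BL (cblock A n \<Delta>s ?\<beta>) (BT k (map ((!) \<Delta>s) ?\<beta>) ?\<Theta>s (map ((!) \<theta>s) ?\<beta>))))"
      unfolding BR_BL[OF bS_BT[OF B] h W] by (rule BL_cong[OF BT_block[OF B cl] h])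
    then show "bE k \<Delta> (tenN k ?\<Theta>s) (BR k \<Gamma> (g \<odot> ?W) \<theta>) (glue k ?\<Theta>s ?d)"
      unfolding glue_def prod.case gl BL_comp[OF bS_BT[OF B'] c h] by (rule bE_trans[OF BR_comp[OF t g W]])
  qed (rule L')
  ultimately show "eqv A C (LApp P' M') n \<Delta> a (ph \<Delta> a (\<Gamma>, EA as \<Theta>s ?p ps g, \<theta>)) (ph \<Delta> a (\<Gamma>, EA bs ?\<Theta>s p ?ps (g \<odot> ?W), \<theta>))"
    unfolding ph_EA d by (blast intro: eqvApp_sym eqvApp_trans)
qed (blast intro: eqvApp_sym eqvApp_trans)+

text \<open>The relation of the outer coend: \<open>g\<close> may be absorbed by the morphism
  \<open>h\<close> of the representative or by the environment, and \<open>BR_comp\<close> says that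
  both lead to the same environment over the tensor.\<close>

lemma ph_resp:
  assumes xy: "cE (LApp P M) k \<Delta> a x y"
  shows "eqv A C (LApp P' M') n \<Delta> a (ph \<Delta> a x) (ph \<Delta> a y)"
proof (rule cE_map[OF xy, where f="ph \<Delta> a" and T="eqv A C (LApp P' M') n \<Delta> a"])
  show "eqv A C (LApp P' M') n \<Delta> a (ph \<Delta> a x) (ph \<Delta> a x)" if "cS (LApp P M) k \<Delta> a x" for x
    by (rule eqv_refl[OF ph_typed[OF that]])
  fix \<Gamma> x' \<theta> \<Gamma>' x \<theta>' g
  assume t: "bS k \<Delta> \<Gamma> \<theta>" and x: "sem A C (LApp P M) N \<Gamma>' a x" and g: "ctxhom A C \<Gamma> \<Gamma>' g"
    and x': "eqv A C (LApp P M) N \<Gamma> a x' (act A (LApp P M) g (did A a) x)" and t': "bE k \<Delta> \<Gamma>' \<theta>' (BR k \<Gamma> g \<theta>)"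
  obtain bs \<Theta>s p ps h where e: "x = EA bs \<Theta>s p ps h" using x by (rule semApp_cases)
  have o: "ok a bs \<Theta>s p ps" and h: "ctxhom A C \<Gamma>' (tenN k \<Theta>s) h" using x unfolding e sem_ok by auto
  let ?p = "act A P (cidc A (\<Theta>s ! 0)) (FM [0..<length bs] (map (did A) bs) (did A a)) p"
  have p: "eqv A C P N (\<Theta>s ! 0) (Fn bs a) ?p p"
    using act_id[of P N "\<Theta>s ! 0" "Fn bs a" p] o by (simp add: ok_def)
  have ps: "eqv A C M N (\<Theta>s ! Suc i) (bs ! i) (ps ! i) (ps ! i)" if "i < length bs" for i
    using o that by (simp add: ok_def eqv_refl)
  have o2: "ok a bs \<Theta>s ?p ps" using o eqv_sem(1)[OF p] by (simp add: ok_def)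
  note gh = ctxhom_comp[OF g h] and L = ok_lens[OF o]
  have 1: "eqv A C (LApp P' M') n \<Delta> a (ph \<Delta> a (\<Gamma>, x', \<theta>)) (Phi a bs \<Theta>s ?p ps (split k \<Theta>s (BR k \<Gamma> (g \<odot> h) \<theta>)))"
    using ph_fst[OF x' t] unfolding e act_EA ph_EA .
  have 2: "eqv A C (LApp P' M') n \<Delta> a (Phi a bs \<Theta>s ?p ps (split k \<Theta>s (BR k \<Gamma> (g \<odot> h) \<theta>))) (Phi a bs \<Theta>s p ps (split k \<Theta>s (BR k \<Gamma> (g \<odot> h) \<theta>)))"
    by (rule Phi_cong[OF o2 dS_split[OF bS_BR[OF t gh] L] p ps])
  have "bE k \<Delta> (tenN k \<Theta>s) (BR k \<Gamma> (g \<odot> h) \<theta>) (BR k \<Gamma>' h \<theta>')"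
    by (rule bE_trans[OF BR_comp[OF t g h] BR_cong[OF bE_sym[OF t'] h]])
  then have 3: "eqv A C (LApp P' M') n \<Delta> a (Phi a bs \<Theta>s p ps (split k \<Theta>s (BR k \<Gamma> (g \<odot> h) \<theta>))) (ph \<Delta> a (\<Gamma>', x, \<theta>'))"
    unfolding e ph_EA by (rule Phi_dE[OF o split_resp[OF _ L]])
  show "eqv A C (LApp P' M') n \<Delta> a (ph \<Delta> a (\<Gamma>, x', \<theta>)) (ph \<Delta> a (\<Gamma>', x, \<theta>'))"
    by (rule eqvApp_trans[OF 1 eqvApp_trans[OF 2 3]])
qed (blast intro: eqvApp_sym eqvApp_trans)+

lemma ph_natural:
  assumes x: "cS (LApp P M) k \<Delta> a x" and u: "ctxhom A C \<Delta>' \<Delta> u" and f: "dhom A C a a' f"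
  shows "eqv A C (LApp P' M') n \<Delta>' a' (ph \<Delta>' a' (cA (LApp P M) u f x)) (act A (LApp P' M') u f (ph \<Delta> a x))"
proof -
  obtain \<Gamma> y \<theta> where ex: "x = (\<Gamma>, y, \<theta>)" by (cases x)
  have y: "sem A C (LApp P M) N \<Gamma> a y" and t: "bS k \<Delta> \<Gamma> \<theta>" using x by (auto simp: ex simp del: sem.simps)
  obtain bs \<Theta>s p ps g where e: "y = EA bs \<Theta>s p ps g" using y by (rule semApp_cases)
  have o: "ok a bs \<Theta>s p ps" and g: "ctxhom A C \<Gamma> (tenN k \<Theta>s) g" using y unfolding e sem_ok by auto
  note L = ok_lens[OF o]
  let ?F = "FM [0..<length bs] (map (did A) bs) f"
  let ?p = "act A P (cidc A (\<Theta>s ! 0)) ?F p"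
  have p: "sem A C P N (\<Theta>s ! 0) (Fn bs a) p" using o by (simp add: ok_def)
  note F = dhom_Fn_snd[OF f, of bs]
  have o': "ok a' bs \<Theta>s ?p ps" using o sem_act[OF p ctxhom_cidc F] by (simp add: ok_def)
  note t' = bS_BR[OF t g]
  obtain \<Delta>s \<theta>s h where d: "split k \<Theta>s (BR k \<Gamma> g \<theta>) = (\<Delta>s, \<theta>s, h)" by (metis prod_cases3)
  have B: "BTok k \<Delta>s \<Theta>s \<theta>s" and h: "ctxhom A C \<Delta> (ten k \<Delta>s) h" using dS_split[OF t' L] by (auto simp: d dS_iff)
  have gl: "BL h (BT k \<Delta>s \<Theta>s \<theta>s) = BR k \<Gamma> g \<theta>" using glue_split[OF t' L] by (simp add: d glue_def)
  note s = slots[OF o B]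
  have dd: "dS k \<Delta>' \<Theta>s (\<Delta>s, \<theta>s, u \<odot> h)" unfolding dS_iff using B ctxhom_comp[OF u h] by blast
  have "ph \<Delta>' a' (cA (LApp P M) u f x) = Phi a' bs \<Theta>s ?p ps (split k \<Theta>s (BR k \<Gamma> g (BL u \<theta>)))"
    unfolding ex e cA_def prod.case act_EA ph_EA ccompc_idl[OF ctxhom_ctxw[OF g]] ..
  moreover have "eqv A C (LApp P' M') n \<Delta>' a' (Phi a' bs \<Theta>s ?p ps (split k \<Theta>s (BR k \<Gamma> g (BL u \<theta>)))) (Phi a' bs \<Theta>s ?p ps (\<Delta>s, \<theta>s, u \<odot> h))"
  proof (rule Phi_dE[OF o'], rule split_eqI[OF dd _ L])
    show "bE k \<Delta>' (tenN k \<Theta>s) (BR k \<Gamma> g (BL u \<theta>)) (glue k \<Theta>s (\<Delta>s, \<theta>s, u \<odot> h))"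
      unfolding glue_def prod.case BL_comp[OF bS_BT[OF B] h u] gl BR_BL[OF t u g] by (rule bE_refl[OF bS_BL[OF t' u]])
  qed
  moreover have "eqv A C (LApp P' M') n \<Delta>' a' (Phi a' bs \<Theta>s ?p ps (\<Delta>s, \<theta>s, u \<odot> h)) (act A (LApp P' M') u f (ph \<Delta> a x))"
    unfolding ex e ph_EA d unfolding Phi_def prod.case act_EA
  proof (rule app_cong[OF isf_den isf_den])
    show "sem A C (LApp P' M') n \<Delta>' a' (EA bs \<Delta>s (\<phi> (\<Delta>s ! 0) (Fn bs a') (\<Theta>s ! 0, ?p, \<theta>s ! 0))
         (map (\<lambda>i. \<chi> (\<Delta>s ! Suc i) (bs ! i) (\<Theta>s ! Suc i, ps ! i, \<theta>s ! Suc i)) [0..<length bs]) (u \<odot> h))"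
      using Phi_typed[OF o' dd] unfolding Phi_def prod.case .
    have "(\<Theta>s ! 0, ?p, \<theta>s ! 0) = cA P (cidc A (\<Delta>s ! 0)) ?F (\<Theta>s ! 0, p, \<theta>s ! 0)"
      using BL_id[OF s(8)[of 0]] by (simp add: cA_def)
    then show "eqv A C P' n (\<Delta>s ! 0) (Fn bs a') (\<phi> (\<Delta>s ! 0) (Fn bs a') (\<Theta>s ! 0, ?p, \<theta>s ! 0))
       (act A P' (cidc A (\<Delta>s ! 0)) ?F (\<phi> (\<Delta>s ! 0) (Fn bs a) (\<Theta>s ! 0, p, \<theta>s ! 0)))"
      using n\<phi>[OF s(1) ctxhom_cidc F] by simp
  qed (use typed(2)[OF s(2)] in \<open>auto intro: eqv_refl\<close>)
  ultimately show ?thesis by (metis eqvApp_trans)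
qed

section \<open>From the application back to the composite\<close>

text \<open>One element of a composite per slot is packed into a single one: the tensor of the
  contexts with an identity as morphism, and the tensor of the environments pulled back along
  \<open>h\<close>. As a function of the list of slots it is open to
  \<open>multi_slot\<close>.\<close>

definition Psi where
  "Psi \<Xi>s bs h zs = (tenN k (map fst zs), EA bs (map fst zs) (fst (snd (zs ! 0))) (map (\<lambda>z. fst (snd z)) (tl zs)) (cidc A (tenN k (map fst zs))),
     BL h (BT k \<Xi>s (map fst zs) (map (\<lambda>z. snd (snd z)) zs)))"

text \<open>Uniform indexing for function and arguments: slot 0 is the function and slot
  \<open>Suc i\<close> the argument \<open>i\<close>, whence the \<open>i - 1\<close> in
  \<open>slotA\<close>.\<close>

definition slotP where "slotP i = (if i = 0 then P else M)"
definition slotA where "slotA bs a i = (if i = 0 then Fn bs a else bs ! (i - 1))"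

lemma slot_simps [simp]: "slotP 0 = P" "slotP (Suc i) = M" "slotA bs a 0 = Fn bs a" "slotA bs a (Suc i) = bs ! i"
  by (simp_all add: slotP_def slotA_def)

text \<open>Generators in all slots tensor to one generator along \<open>ctensor_mor\<close>: on the
  element it is the second coend relation, on the environment it is \<open>BT_BR\<close> with
  \<open>BT_cong\<close>.\<close>

lemma Psi_gen:
  assumes l: "length \<Xi>s = Suc (length bs)" "length zs = Suc (length bs)" "length zs' = Suc (length bs)"
    and h: "ctxhom A C \<Delta> (ten k \<Xi>s) h"
    and lg: "length gs = Suc (length bs)"
    and t: "\<And>i. i < Suc (length bs) \<Longrightarrow> bS k (\<Xi>s ! i) (fst (zs ! i)) (snd (snd (zs ! i)))"
    and p: "\<And>i. i < Suc (length bs) \<Longrightarrow> sem A C (slotP i) N (fst (zs' ! i)) (slotA bs a i) (fst (snd (zs' ! i)))"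
    and g: "\<And>i. i < Suc (length bs) \<Longrightarrow> ctxhom A C (fst (zs ! i)) (fst (zs' ! i)) (gs ! i)"
    and p': "\<And>i. i < Suc (length bs) \<Longrightarrow> eqv A C (slotP i) N (fst (zs ! i)) (slotA bs a i) (fst (snd (zs ! i)))
       (act A (slotP i) (gs ! i) (did A (slotA bs a i)) (fst (snd (zs' ! i))))"
    and t': "\<And>i. i < Suc (length bs) \<Longrightarrow> bE k (\<Xi>s ! i) (fst (zs' ! i)) (snd (snd (zs' ! i))) (BR k (fst (zs ! i)) (gs ! i) (snd (snd (zs ! i))))"
  shows "cE (LApp P M) k \<Delta> a (Psi \<Xi>s bs h zs) (Psi \<Xi>s bs h zs')"
proof -
  let ?\<Gamma>s = "map fst zs" and ?\<Gamma>s' = "map fst zs'" and ?\<theta>s = "map (\<lambda>z. snd (snd z)) zs" and ?\<theta>s' = "map (\<lambda>z. snd (snd z)) zs'"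
  let ?G = "ctensor_mor N ?\<Gamma>s gs"
  have B: "BTok k \<Xi>s ?\<Gamma>s ?\<theta>s" using l t by (simp add: BTok_def)
  have B': "BTok k \<Xi>s ?\<Gamma>s' ?\<theta>s'" using l bE_dom(1)[OF t'] by (simp add: BTok_def)
  note f = BTok_facts[OF B] and f' = BTok_facts[OF B']
  have ll: "length gs = length ?\<Gamma>s" "length ?\<Gamma>s' = length ?\<Gamma>s" using l lg by simp_all
  have g': "\<forall>i<length ?\<Gamma>s. ctxhom A C (?\<Gamma>s ! i) (?\<Gamma>s' ! i) (gs ! i)" using l g by simp
  note G = hom_tenN[OF ll f(2) g']
  show ?thesis unfolding Psi_def
  proof (rule cE_gen[OF bS_BL[OF bS_BT[OF B] h] _ G])
    have ok': "ok a bs ?\<Gamma>s' (fst (snd (zs' ! 0))) (map (\<lambda>z. fst (snd z)) (tl zs'))"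
      unfolding ok_def using l f'(2) p[of 0] p[of "Suc _"] by (auto simp: nth_tl)
    show "sem A C (LApp P M) N (tenN k ?\<Gamma>s') a (EA bs ?\<Gamma>s' (fst (snd (zs' ! 0))) (map (\<lambda>z. fst (snd z)) (tl zs')) (cidc A (tenN k ?\<Gamma>s')))"
      unfolding sem_ok using ok' ctxhom_cidc by blast
    let ?p = "fst (snd (zs' ! 0))"
    have sp: "sem A C P N (fst (zs' ! 0)) (Fn bs a) ?p" using p[of 0] by simp
    let ?q = "act A P (cidc A (?\<Gamma>s' ! 0)) (FM [0..<length bs] (map (did A) bs) (did A a)) ?p"
    have q: "eqv A C P N (fst (zs' ! 0)) (Fn bs a) ?q ?p" using act_id[OF sp] l by simp
    have e: "?G \<odot> cidc A (tenN k ?\<Gamma>s') = cidc A (tenN k ?\<Gamma>s) \<odot> ?G"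
      using ccompc_idl[OF ctxhom_ctxw[OF G]] ccompc_idr[OF ctxhom_ctxw[OF G]] by simp
    show "eqv A C (LApp P M) N (tenN k ?\<Gamma>s) a
        (EA bs ?\<Gamma>s (fst (snd (zs ! 0))) (map (\<lambda>z. fst (snd z)) (tl zs)) (cidc A (tenN k ?\<Gamma>s)))
        (act A (LApp P M) ?G (did A a) (EA bs ?\<Gamma>s' ?p (map (\<lambda>z. fst (snd z)) (tl zs')) (cidc A (tenN k ?\<Gamma>s'))))"
      unfolding act_EA e
    proof (rule app_ctx[OF isf_den isf_den _ _ lg f(2) f'(2)])
      show "sem A C P N (?\<Gamma>s' ! 0) (Fn bs a) ?q" using eqv_sem(1)[OF q] l by simp
      have e1: "eqv A C P N (fst (zs ! 0)) (Fn bs a) (fst (snd (zs ! 0))) (act A P (gs ! 0) (did A (Fn bs a)) ?p)"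
        using p'[of 0] by simp
      have e2: "eqv A C P N (fst (zs ! 0)) (Fn bs a) (act A P (gs ! 0) (did A (Fn bs a)) ?q) (act A P (gs ! 0) (did A (Fn bs a)) ?p)"
        using isf_cong[OF isf_den _ g[of 0] dhom_did, of P, unfolded den_simps, OF q] by simp
      show "eqv A C P N (?\<Gamma>s ! 0) (Fn bs a) (fst (snd (zs ! 0))) (act A P (gs ! 0) (did A (Fn bs a)) ?q)"
        using l eqv_trans[OF e1 eqv_sym[OF e2]] by simp
      show "eqv A C M N (?\<Gamma>s ! Suc i) (bs ! i) (map (\<lambda>z. fst (snd z)) (tl zs) ! i)
          (act A M (gs ! Suc i) (did A (bs ! i)) (map (\<lambda>z. fst (snd z)) (tl zs') ! i))" if "i < length bs" for i
        using p'[of "Suc i"] that l by (simp add: nth_tl)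
      show "sem A C M N (?\<Gamma>s' ! Suc i) (bs ! i) (map (\<lambda>z. fst (snd z)) (tl zs') ! i)" if "i < length bs" for i
        using p[of "Suc i"] that l by (simp add: nth_tl)
    qed (use l g ctxhom_cidc in auto)
    have "bE k (ten k \<Xi>s) (tenN k ?\<Gamma>s') (BT k \<Xi>s ?\<Gamma>s' ?\<theta>s') (BT k \<Xi>s ?\<Gamma>s' (map (\<lambda>i. BR k (?\<Gamma>s ! i) (gs ! i) (?\<theta>s ! i)) [0..<length ?\<Gamma>s]))"
      using l t' by (intro BT_cong) (auto simp del: upt_Suc)
    then show "bE k \<Delta> (tenN k ?\<Gamma>s') (BL h (BT k \<Xi>s ?\<Gamma>s' ?\<theta>s')) (BR k (tenN k ?\<Gamma>s) ?G (BL h (BT k \<Xi>s ?\<Gamma>s ?\<theta>s)))"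
      unfolding BT_BR[OF B ll g'] BR_BL[OF bS_BT[OF B] h G] by (rule BL_cong[OF _ h])
  qed
qed

text \<open>One slot changes at a time, by \<open>multi_slot\<close>; identities fill the other
  slots, where \<open>act_id\<close> and \<open>BR_id\<close> make them generators.\<close>

lemma Psi_cong:
  assumes l: "length \<Xi>s = Suc (length bs)" "length zs = Suc (length bs)" "length zs' = Suc (length bs)"
    and h: "ctxhom A C \<Delta> (ten k \<Xi>s) h"
    and e: "\<And>i. i < Suc (length bs) \<Longrightarrow> cE (slotP i) k (\<Xi>s ! i) (slotA bs a i) (zs ! i) (zs' ! i)"
  shows "cE (LApp P M) k \<Delta> a (Psi \<Xi>s bs h zs) (Psi \<Xi>s bs h zs')"
proof (rule multi_slot[where n="Suc (length bs)" and f="Psi \<Xi>s bs h" and S="\<lambda>i. cS (slotP i) k (\<Xi>s ! i) (slotA bs a i)"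
      and R="\<lambda>i. cgen (slotP i) k (\<Xi>s ! i) (slotA bs a i)"])
  have gid: "eqv A C (slotP i) N (fst x) b (fst (snd x)) (act A (slotP i) (cidc A (fst x)) (did A b) (fst (snd x)))"
    "bE k \<Delta>' (fst x) (snd (snd x)) (BR k (fst x) (cidc A (fst x)) (snd (snd x)))"
    "sem A C (slotP i) N (fst x) b (fst (snd x))" "bS k \<Delta>' (fst x) (snd (snd x))"
    if "cS (slotP i) k \<Delta>' b x" for i \<Delta>' b x
    using that by (cases x; auto intro: eqv_sym[OF act_id] bE_sym[OF BR_id])+
  fix xs assume x: "length xs = Suc (length bs)" "\<And>i. i < Suc (length bs) \<Longrightarrow> cS (slotP i) k (\<Xi>s ! i) (slotA bs a i) (xs ! i)"
  show "cE (LApp P M) k \<Delta> a (Psi \<Xi>s bs h xs) (Psi \<Xi>s bs h xs)"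
    by (rule Psi_gen[OF l(1) x(1) x(1) h, where gs="map (\<lambda>x. cidc A (fst x)) xs"])
      (use x(1) gid[OF x(2)] ctxhom_cidc in \<open>auto simp del: upt_Suc\<close>)
  fix i y assume i: "i < Suc (length bs)" and y: "cS (slotP i) k (\<Xi>s ! i) (slotA bs a i) y"
    and r: "cgen (slotP i) k (\<Xi>s ! i) (slotA bs a i) (xs ! i) y"
  obtain \<Gamma> p \<theta> \<Gamma>' p' \<theta>' where xy: "xs ! i = (\<Gamma>, p, \<theta>)" "y = (\<Gamma>', p', \<theta>')" by (metis prod_cases3)
  obtain g where g: "ctxhom A C \<Gamma> \<Gamma>' g" "eqv A C (slotP i) N \<Gamma> (slotA bs a i) p (act A (slotP i) g (did A (slotA bs a i)) p')"
    "bE k (\<Xi>s ! i) \<Gamma>' \<theta>' (BR k \<Gamma> g \<theta>)" using r unfolding cgen_def xy by auto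
  let ?gs = "(map (\<lambda>x. cidc A (fst x)) xs)[i := g]"
  have j: "ctxhom A C (fst (xs ! j)) (fst (xs[i := y] ! j)) (?gs ! j) \<and>
     sem A C (slotP j) N (fst (xs[i := y] ! j)) (slotA bs a j) (fst (snd (xs[i := y] ! j))) \<and>
     eqv A C (slotP j) N (fst (xs ! j)) (slotA bs a j) (fst (snd (xs ! j)))
       (act A (slotP j) (?gs ! j) (did A (slotA bs a j)) (fst (snd (xs[i := y] ! j)))) \<and>
     bE k (\<Xi>s ! j) (fst (xs[i := y] ! j)) (snd (snd (xs[i := y] ! j))) (BR k (fst (xs ! j)) (?gs ! j) (snd (snd (xs ! j))))"
    if j: "j < Suc (length bs)" for j
  proof (cases "j = i")
    case True
    then show ?thesis using x(1) i g xy gid(3)[OF y] by simp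
  next
    case False
    then show ?thesis using x(1) j gid[OF x(2)[OF j]] ctxhom_cidc by simp
  qed
  show "cE (LApp P M) k \<Delta> a (Psi \<Xi>s bs h xs) (Psi \<Xi>s bs h (xs[i := y]))"
    by (rule Psi_gen[OF l(1) x(1) _ h, where gs="?gs"]) (use x(1) j gid(4)[OF x(2)] in \<open>auto simp del: upt_Suc\<close>)
qed (use l e in \<open>auto simp: cE_def[symmetric] intro: cE_sym cE_trans\<close>)

definition slz where
  "slz bs a \<Xi>s p' qs' = \<psi> (\<Xi>s ! 0) (Fn bs a) p' # map (\<lambda>i. \<xi> (\<Xi>s ! Suc i) (bs ! i) (qs' ! i)) [0..<length bs]"

definition ps where
  "ps \<Delta> a x = (case x of EA bs \<Xi>s p' qs' h \<Rightarrow> Psi \<Xi>s bs h (slz bs a \<Xi>s p' qs') | _ \<Rightarrow> undefined)"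

lemma ps_EA: "ps \<Delta> a (EA bs \<Xi>s p' qs' h) = Psi \<Xi>s bs h (slz bs a \<Xi>s p' qs')"
  by (simp add: ps_def)

lemma length_slz [simp]: "length (slz bs a \<Xi>s p' qs') = Suc (length bs)"
  by (simp add: slz_def)

lemma slz_nth [simp]: "slz bs a \<Xi>s p' qs' ! 0 = \<psi> (\<Xi>s ! 0) (Fn bs a) p'"
  "i < length bs \<Longrightarrow> slz bs a \<Xi>s p' qs' ! Suc i = \<xi> (\<Xi>s ! Suc i) (bs ! i) (qs' ! i)"
  by (simp_all add: slz_def)

lemma ps_typed_slots:
  assumes "sem A C (LApp P' M') n \<Delta> a (EA bs \<Xi>s p' qs' h)"
  shows "i < Suc (length bs) \<Longrightarrow> cS (slotP i) k (\<Xi>s ! i) (slotA bs a i) (slz bs a \<Xi>s p' qs' ! i)"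
  using assms typed(3,4) unfolding semApp by (cases i) auto

text \<open>In the second relation, naturality of \<open>\<psi>\<close> and \<open>\<xi>\<close>
  turns \<open>vs\<close> into an action on the environments, which \<open>BT_BL\<close> moves into
  \<open>h\<close>. In the third, the reindexing of the slots is absorbed inside the
  composite.\<close>

lemma ps_resp:
  assumes xy: "eqv A C (LApp P' M') n \<Delta> a x y"
  shows "cE (LApp P M) k \<Delta> a (ps \<Delta> a x) (ps \<Delta> a y)"
proof (rule eqvApp_map[OF xy, where f="ps \<Delta> a" and T="cE (LApp P M) k \<Delta> a"])
  fix x assume x: "sem A C (LApp P' M') n \<Delta> a x"
  then show "cE (LApp P M) k \<Delta> a (ps \<Delta> a x) (ps \<Delta> a x)"
  proof (rule semApp_cases)
    fix bs \<Xi>s p' qs' h assume e: "x = EA bs \<Xi>s p' qs' h" and h: "ctxhom A C \<Delta> (ten k \<Xi>s) h" "length \<Xi>s = Suc (length bs)"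
    show ?thesis unfolding e ps_EA by (rule Psi_cong[OF h(2) _ _ h(1)]) (use cE_refl[OF ps_typed_slots[OF x[unfolded e]]] in auto)
  qed
next
  fix bs \<Xi>s p qs p' qs' h
  assume x: "sem A C (LApp P' M') n \<Delta> a (EA bs \<Xi>s p qs h)" and p: "eqv A C P' n (\<Xi>s ! 0) (Fn bs a) p p'"
    and q: "\<And>i. i < length bs \<Longrightarrow> eqv A C M' n (\<Xi>s ! Suc i) (bs ! i) (qs ! i) (qs' ! i)"
  show "cE (LApp P M) k \<Delta> a (ps \<Delta> a (EA bs \<Xi>s p qs h)) (ps \<Delta> a (EA bs \<Xi>s p' qs' h))"
    unfolding ps_EA
  proof (rule Psi_cong)
    show "cE (slotP i) k (\<Xi>s ! i) (slotA bs a i) (slz bs a \<Xi>s p qs ! i) (slz bs a \<Xi>s p' qs' ! i)" if "i < Suc (length bs)" for i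
      using that r\<psi>[OF p] r\<xi>[OF q] by (cases i) auto
  qed (use x in \<open>auto simp: semApp simp del: sem.simps\<close>)
next
  fix bs :: "'o ty list" and \<Xi>s \<Xi>s' vs p qs h
  assume l: "length \<Xi>s = Suc (length bs)" "length \<Xi>s' = Suc (length bs)" "length vs = Suc (length bs)"
      and L: "lens n \<Xi>s" "lens n \<Xi>s'" and v: "\<And>j. j < Suc (length bs) \<Longrightarrow> ctxhom A C (\<Xi>s ! j) (\<Xi>s' ! j) (vs ! j)"
      and p: "sem A C P' n (\<Xi>s' ! 0) (Fn bs a) p" and q: "length qs = length bs"
        "\<And>i. i < length bs \<Longrightarrow> sem A C M' n (\<Xi>s' ! Suc i) (bs ! i) (qs ! i)"
      and h: "ctxhom A C \<Delta> (ten k \<Xi>s) h"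
  let ?p = "act A P' (vs ! 0) (did A (Fn bs a)) p" and ?qs = "map (\<lambda>i. act A M' (vs ! Suc i) (did A (bs ! i)) (qs ! i)) [0..<length bs]"
  let ?zs = "slz bs a \<Xi>s' p qs"
  \<comment> \<open>The slots of the right-hand side, with \<open>vs\<close> acting on the
    environments alone.\<close>
  let ?ys = "map2 (\<lambda>v z. (fst z, fst (snd z), BL v (snd (snd z)))) vs ?zs"
  have z: "cS (slotP i) k (\<Xi>s' ! i) (slotA bs a i) (?zs ! i)" if "i < Suc (length bs)" for i
    using that typed(3)[OF p] typed(4)[OF q(2)] by (cases i) auto
  have cid: "cE R k \<Delta>'' b (cA R v (did A b) z) (fst z, fst (snd z), BL v (snd (snd z)))"
    if "cS R k \<Delta>' b z" "ctxhom A C \<Delta>'' \<Delta>' v" for R \<Delta>' \<Delta>'' b z v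
  proof -
    obtain \<Gamma> r \<theta> where e: "z = (\<Gamma>, r, \<theta>)" by (cases z)
    have s: "sem A C R N \<Gamma> b r" "bS k \<Delta>' \<Gamma> \<theta>" using that by (auto simp: e)
    show ?thesis unfolding e cA_def prod.case fst_conv snd_conv by (rule cE_cong[OF act_id[OF s(1)] bE_refl[OF bS_BL[OF s(2) that(2)]]])
  qed
  have 1: "cE (LApp P M) k \<Delta> a (ps \<Delta> a (EA bs \<Xi>s ?p ?qs h)) (Psi \<Xi>s bs h ?ys)"
    unfolding ps_EA
  proof (rule Psi_cong[OF l(1) _ _ h])
    fix i assume i: "i < Suc (length bs)"
    have ys: "?ys ! i = (fst (?zs ! i), fst (snd (?zs ! i)), BL (vs ! i) (snd (snd (?zs ! i))))" using i l by simp
    have "cE (slotP i) k (\<Xi>s ! i) (slotA bs a i) (slz bs a \<Xi>s ?p ?qs ! i) (cA (slotP i) (vs ! i) (did A (slotA bs a i)) (?zs ! i))"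
      using i n\<psi>[OF p v dhom_did] n\<xi>[OF q(2) v dhom_did] by (cases i) auto
    from cE_trans[OF this cid[OF z[OF i] v[OF i]]]
    show "cE (slotP i) k (\<Xi>s ! i) (slotA bs a i) (slz bs a \<Xi>s ?p ?qs ! i) (?ys ! i)" unfolding ys .
  qed (use l in auto)
  have B: "BTok k \<Xi>s' (map fst ?zs) (map (\<lambda>z. snd (snd z)) ?zs)"
    unfolding BTok_def
  proof (intro conjI allI impI)
    fix i assume "i < length (map fst ?zs)"
    then have i: "i < Suc (length bs)" by simp
    obtain \<Gamma> r \<theta> where e: "?zs ! i = (\<Gamma>, r, \<theta>)" by (metis prod_cases3)
    show "bS k (\<Xi>s' ! i) (map fst ?zs ! i) (map (\<lambda>z. snd (snd z)) ?zs ! i)" using z[OF i] i e by simp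
  qed (use l in simp_all)
  have V: "ctxhom A C (ten k \<Xi>s) (ten k \<Xi>s') (ctensor_mor n \<Xi>s vs)" using l v L by (intro ctxhom_ctensor_mor) auto
  have y: "map fst ?ys = map fst ?zs" "map (\<lambda>z. snd (snd z)) ?ys = map2 BL vs (map (\<lambda>z. snd (snd z)) ?zs)"
    "map (\<lambda>z. fst (snd z)) (tl ?ys) = map (\<lambda>z. fst (snd z)) (tl ?zs)" "fst (snd (?ys ! 0)) = fst (snd (?zs ! 0))"
    using l by (auto intro!: nth_equalityI simp: nth_tl)
  have "Psi \<Xi>s bs h ?ys = Psi \<Xi>s' bs (h \<odot> ctensor_mor n \<Xi>s vs) ?zs"
    unfolding Psi_def y using BT_BL[OF B, of \<Xi>s vs] l v BL_comp[OF bS_BT[OF B] V h] by simp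
  then show "cE (LApp P M) k \<Delta> a (ps \<Delta> a (EA bs \<Xi>s ?p ?qs h)) (ps \<Delta> a (EA bs \<Xi>s' p qs (h \<odot> ctensor_mor n \<Xi>s vs)))"
    using 1 by (simp only: ps_EA)
next
  fix as bs :: "'o ty list" and \<alpha> fs \<Xi>s p qs h
  assume s: "shom A C as bs (\<alpha>, fs)" and l: "length \<Xi>s = Suc (length as)" and L: "lens n \<Xi>s"
      and p: "sem A C P' n (\<Xi>s ! 0) (Fn bs a) p" and q: "length qs = length as"
        "\<And>i. i < length as \<Longrightarrow> sem A C M' n (\<Xi>s ! Suc i) (as ! i) (qs ! i)"
      and h: "ctxhom A C \<Delta> (ten k \<Xi>s) h"
  let ?\<beta> = "0 # map Suc \<alpha>"
  let ?F = "FM \<alpha> fs (did A a)"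
  let ?p = "act A P' (cidc A (\<Xi>s ! 0)) ?F p" and ?qs = "map2 (\<lambda>j g. act A M' (cidc A (\<Xi>s ! Suc j)) g (qs ! j)) \<alpha> fs"
  let ?\<Xi>s = "map ((!) \<Xi>s) ?\<beta>" and ?W = "cblock A n \<Xi>s ?\<beta>"
  have la: "length \<alpha> = length bs" "length fs = length bs" "\<And>i. i < length bs \<Longrightarrow> \<alpha> ! i < length as"
        "\<And>i. i < length bs \<Longrightarrow> dhom A C (as ! (\<alpha> ! i)) (bs ! i) (fs ! i)"
        using shom_shomw[OF s] by (auto simp: shomw_def)
  have cl: "in_class C (length ?\<beta>) (length \<Xi>s) ?\<beta>" using in_class_Suc[OF shom_in_class[OF s]] l la by simp
  obtain \<Gamma>0 p0' \<theta>0 where z0: "\<psi> (\<Xi>s ! 0) (Fn bs a) p = (\<Gamma>0, p0', \<theta>0)" by (metis prod_cases3)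
  define zi where "zi = (\<lambda>i. \<xi> (\<Xi>s ! Suc i) (as ! i) (qs ! i))"
  let ?zs = "(\<Gamma>0, p0', \<theta>0) # map zi [0..<length as]"
  let ?\<Gamma>s = "map fst ?zs" and ?\<theta>s = "map (\<lambda>z. snd (snd z)) ?zs"
  have s0: "sem A C P N \<Gamma>0 (Fn bs a) p0'" "bS k (\<Xi>s ! 0) \<Gamma>0 \<theta>0" using typed(3)[OF p] by (auto simp: z0)
  have si: "sem A C M N (fst (zi i)) (as ! i) (fst (snd (zi i)))" "bS k (\<Xi>s ! Suc i) (fst (zi i)) (snd (snd (zi i)))" if "i < length as" for i
    using typed(4)[OF q(2)[OF that]] by (cases "zi i"; simp add: zi_def)+
  have B: "BTok k \<Xi>s ?\<Gamma>s ?\<theta>s" unfolding BTok_def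
  proof (intro conjI allI impI)
    fix i assume "i < length ?\<Gamma>s"
    then show "bS k (\<Xi>s ! i) (?\<Gamma>s ! i) (?\<theta>s ! i)" using s0 si by (cases i) (auto simp del: upt_Suc)
  qed (use l in simp_all)
  note f = BTok_facts[OF B]
  let ?ys = "(\<Gamma>0, act A P (cidc A \<Gamma>0) ?F p0', \<theta>0) # map zi [0..<length as]"
  have 1: "cE (LApp P M) k \<Delta> a (ps \<Delta> a (EA as \<Xi>s ?p qs h)) (Psi \<Xi>s as h ?ys)"
    unfolding ps_EA
  proof (rule Psi_cong[OF l _ _ h])
    fix i assume i: "i < Suc (length as)"
    show "cE (slotP i) k (\<Xi>s ! i) (slotA as a i) (slz as a \<Xi>s ?p qs ! i) (?ys ! i)"
    proof (cases i)
      case 0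
      have "cA P (cidc A (\<Xi>s ! 0)) ?F (\<psi> (\<Xi>s ! 0) (Fn bs a) p) = (\<Gamma>0, act A P (cidc A \<Gamma>0) ?F p0', \<theta>0)"
        using BL_id[OF s0(2)] by (simp add: cA_def z0)
      then show ?thesis using n\<psi>[OF p ctxhom_cidc dhom_Fn_fst[OF s]] by (simp add: 0)
    next
      case (Suc j)
      then show ?thesis using i cE_refl[OF typed(4)[OF q(2)]] by (simp add: zi_def)
    qed
  qed auto
  have pi: "map (\<lambda>z. fst (snd z)) (tl ?zs) = map (\<lambda>i. fst (snd (zi i))) [0..<length as]" by simp
  let ?ps = "map (\<lambda>i. fst (snd (zi i))) [0..<length as]"
  let ?\<Gamma>b = "map ((!) ?\<Gamma>s) ?\<beta>"
  let ?ps' = "map (\<lambda>i. act A M (cidc A (fst (zi (\<alpha> ! i)))) (fs ! i) (fst (snd (zi (\<alpha> ! i))))) [0..<length bs]"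
  let ?G = "cblock A N ?\<Gamma>s ?\<beta>"
  have lG: "length ?\<Gamma>s = Suc (length as)" by simp
  have clG: "in_class C (length ?\<beta>) (length ?\<Gamma>s) ?\<beta>" using cl l by simp
  have \<beta>G: "\<forall>j\<in>set ?\<beta>. j < length ?\<Gamma>s" by (rule clG[unfolded in_class_iff, THEN conjunct2, THEN conjunct1])
  have G: "ctxhom A C (tenN k ?\<Gamma>s) (tenN k ?\<Gamma>b) ?G" by (rule ctxhom_cblock[OF clG f(2)])
  have W: "ctxhom A C (ten k \<Xi>s) (ten k ?\<Xi>s) ?W" by (rule ctxhom_cblock[OF cl L])
  have eG: "cidc A (tenN k ?\<Gamma>s) \<odot> ?G = ?G" by (rule ccompc_idl[OF ctxhom_ctxw[OF G]])
  have G0: "?\<Gamma>s ! 0 = \<Gamma>0" "\<And>i. i < length as \<Longrightarrow> ?\<Gamma>s ! Suc i = fst (zi i)" by simp_all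
  note a0 = sem_act[OF s0(1) ctxhom_cidc dhom_Fn_fst[OF s]]
  have 2: "eqv A C (LApp P M) N (tenN k ?\<Gamma>s) a (EA as ?\<Gamma>s (act A P (cidc A \<Gamma>0) ?F p0') ?ps (cidc A (tenN k ?\<Gamma>s)))
      (EA bs ?\<Gamma>b p0' ?ps' (cidc A (tenN k ?\<Gamma>s) \<odot> ?G))"
    by (rule app_arg[OF isf_den isf_den s lG f(2)])
      (use s0 si la ctxhom_cidc eqv_refl[OF a0] eqv_refl[OF sem_act[OF si(1)[OF la(3)] ctxhom_cidc la(4)]] in auto)
  note B' = BTok_block[OF B \<beta>G]
  let ?\<theta>b = "map ((!) ?\<theta>s) ?\<beta>"
  have xb: "sem A C (LApp P M) N (tenN k ?\<Gamma>b) a (EA bs ?\<Gamma>b p0' ?ps' (cidc A (tenN k ?\<Gamma>b)))"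
    using eqv_sem(2)[OF 2] ctxhom_cidc[of "tenN k ?\<Gamma>b"] unfolding semApp by blast
  have y1: "map fst ?ys = ?\<Gamma>s" "map (\<lambda>z. snd (snd z)) ?ys = ?\<theta>s" "map (\<lambda>z. fst (snd z)) (tl ?ys) = ?ps"
    "fst (snd (?ys ! 0)) = act A P (cidc A \<Gamma>0) ?F p0'" by simp_all
  \<comment> \<open>The composite absorbs the reindexing: on the element through the third relation
    of the application, on the environment through \<open>BT_block\<close>.\<close>
  have 3: "cE (LApp P M) k \<Delta> a (Psi \<Xi>s as h ?ys) (tenN k ?\<Gamma>b, EA bs ?\<Gamma>b p0' ?ps' (cidc A (tenN k ?\<Gamma>b)),
     BL (h \<odot> ?W) (BT k ?\<Xi>s ?\<Gamma>b ?\<theta>b))"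
    unfolding Psi_def y1
  proof (rule cE_gen[OF bS_BL[OF bS_BT[OF B] h] xb G])
    have "eqv A C (LApp P M) N (tenN k ?\<Gamma>s) a (EA bs ?\<Gamma>b p0' ?ps' (cidc A (tenN k ?\<Gamma>s) \<odot> ?G))
       (act A (LApp P M) ?G (did A a) (EA bs ?\<Gamma>b p0' ?ps' (cidc A (tenN k ?\<Gamma>b))))"
      unfolding act_EA eG ccompc_idr[OF ctxhom_ctxw[OF G]]
    proof (rule app_cong[OF isf_den isf_den eqv_sem(2)[OF 2, unfolded eG]])
      have "?\<Gamma>b ! 0 = \<Gamma>0" by simp
      then show "eqv A C P N (?\<Gamma>b ! 0) (Fn bs a) p0' (act A P (cidc A (?\<Gamma>b ! 0)) (FM [0..<length bs] (map (did A) bs) (did A a)) p0')"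
        using eqv_sym[OF act_id[OF s0(1)]] by simp
      show "eqv A C M N (?\<Gamma>b ! Suc i) (bs ! i) (?ps' ! i) (?ps' ! i)" if "i < length bs" for i
        using eqv_refl[OF sem_act[OF si(1)[OF la(3)[OF that]] ctxhom_cidc la(4)[OF that]]] that la(1) la(3)[OF that] by simp
    qed simp
    from eqv_trans[OF 2 this]
    show "eqv A C (LApp P M) N (tenN k ?\<Gamma>s) a (EA as ?\<Gamma>s (act A P (cidc A \<Gamma>0) ?F p0') ?ps (cidc A (tenN k ?\<Gamma>s)))
       (act A (LApp P M) ?G (did A a) (EA bs ?\<Gamma>b p0' ?ps' (cidc A (tenN k ?\<Gamma>b))))" .
    show "bE k \<Delta> (tenN k ?\<Gamma>b) (BL (h \<odot> ?W) (BT k ?\<Xi>s ?\<Gamma>b ?\<theta>b)) (BR k (tenN k ?\<Gamma>s) ?G (BL h (BT k \<Xi>s ?\<Gamma>s ?\<theta>s)))"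
      unfolding BL_comp[OF bS_BT[OF B'] W h] BR_BL[OF bS_BT[OF B] h G] by (rule BL_cong[OF bE_sym[OF BT_block[OF B clG]] h])
  qed
  let ?xs = "(\<Gamma>0, p0', \<theta>0) # map (\<lambda>i. (fst (zi (\<alpha> ! i)), ?ps' ! i, snd (snd (zi (\<alpha> ! i))))) [0..<length bs]"
  have lb: "length ?\<Xi>s = Suc (length bs)" using la by simp
  have x1: "map fst ?xs = ?\<Gamma>b" "map (\<lambda>z. snd (snd z)) ?xs = ?\<theta>b" "map (\<lambda>z. fst (snd z)) (tl ?xs) = ?ps'" "fst (snd (?xs ! 0)) = p0'"
    using la by (auto intro!: nth_equalityI)
  have 4: "cE (LApp P M) k \<Delta> a (ps \<Delta> a (EA bs ?\<Xi>s p ?qs (h \<odot> ?W))) (Psi ?\<Xi>s bs (h \<odot> ?W) ?xs)"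
    unfolding ps_EA
  proof (rule Psi_cong[OF lb _ _ ctxhom_comp[OF h W]])
    fix i assume i: "i < Suc (length bs)"
    show "cE (slotP i) k (?\<Xi>s ! i) (slotA bs a i) (slz bs a ?\<Xi>s p ?qs ! i) (?xs ! i)"
    proof (cases i)
      case 0
      then show ?thesis using cE_refl[OF typed(3)[OF p]] by (simp add: z0)
    next
      case (Suc j)
      then have j: "j < length bs" "\<alpha> ! j < length as" using i la by auto
      have "cA M (cidc A (\<Xi>s ! Suc (\<alpha> ! j))) (fs ! j) (zi (\<alpha> ! j)) = (fst (zi (\<alpha> ! j)), ?ps' ! j, snd (snd (zi (\<alpha> ! j))))"
        using BL_id[OF si(2)[OF j(2)]] j by (cases "zi (\<alpha> ! j)") (simp add: cA_def)
      then show ?thesis using n\<xi>[OF q(2)[OF j(2)] ctxhom_cidc la(4)[OF j(1)]] j la by (simp add: Suc zi_def)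
    qed
  qed auto
  have 5: "Psi ?\<Xi>s bs (h \<odot> ?W) ?xs = (tenN k ?\<Gamma>b, EA bs ?\<Gamma>b p0' ?ps' (cidc A (tenN k ?\<Gamma>b)), BL (h \<odot> ?W) (BT k ?\<Xi>s ?\<Gamma>b ?\<theta>b))"
    unfolding Psi_def x1 ..
  show "cE (LApp P M) k \<Delta> a (ps \<Delta> a (EA as \<Xi>s ?p qs h)) (ps \<Delta> a (EA bs ?\<Xi>s p ?qs (h \<odot> ?W)))"
    by (rule cE_trans[OF 1 cE_trans[OF 3 cE_sym[OF 4[unfolded 5]]]])
qed (blast intro: cE_sym cE_trans)+

lemma ps_ph:
  assumes x: "cS (LApp P M) k \<Delta> a x"
  shows "cE (LApp P M) k \<Delta> a (ps \<Delta> a (ph \<Delta> a x)) x"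
proof -
  obtain \<Gamma> y \<theta> where ex: "x = (\<Gamma>, y, \<theta>)" by (cases x)
  have y: "sem A C (LApp P M) N \<Gamma> a y" and t: "bS k \<Delta> \<Gamma> \<theta>" using x by (auto simp: ex simp del: sem.simps)
  obtain bs \<Theta>s p qs g where e: "y = EA bs \<Theta>s p qs g" using y by (rule semApp_cases)
  have o: "ok a bs \<Theta>s p qs" and g: "ctxhom A C \<Gamma> (tenN k \<Theta>s) g" using y unfolding e sem_ok by auto
  note L = ok_lens[OF o] and t' = bS_BR[OF t g]
  obtain \<Delta>s \<theta>s h where d: "split k \<Theta>s (BR k \<Gamma> g \<theta>) = (\<Delta>s, \<theta>s, h)" by (metis prod_cases3)
  have B: "BTok k \<Delta>s \<Theta>s \<theta>s" and h: "ctxhom A C \<Delta> (ten k \<Delta>s) h" using dS_split[OF t' L] by (auto simp: d dS_iff)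
  have gl: "BL h (BT k \<Delta>s \<Theta>s \<theta>s) = BR k \<Gamma> g \<theta>" using glue_split[OF t' L] by (simp add: d glue_def)
  note s = slots[OF o B]
  let ?zs = "(\<Theta>s ! 0, p, \<theta>s ! 0) # map (\<lambda>i. (\<Theta>s ! Suc i, qs ! i, \<theta>s ! Suc i)) [0..<length bs]"
  have 1: "cE (LApp P M) k \<Delta> a (ps \<Delta> a (ph \<Delta> a x)) (Psi \<Delta>s bs h ?zs)"
    unfolding ex e ph_EA d Phi_def prod.case ps_EA
  proof (rule Psi_cong[OF s(3) _ _ h])
    show "cE (slotP i) k (\<Delta>s ! i) (slotA bs a i) (slz bs a \<Delta>s (\<phi> (\<Delta>s ! 0) (Fn bs a) (\<Theta>s ! 0, p, \<theta>s ! 0))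
        (map (\<lambda>i. \<chi> (\<Delta>s ! Suc i) (bs ! i) (\<Theta>s ! Suc i, qs ! i, \<theta>s ! Suc i)) [0..<length bs]) ! i) (?zs ! i)" if "i < Suc (length bs)" for i
      using that inv(1)[OF s(1)] inv(2)[OF s(2)] by (cases i) auto
  qed auto
  have z: "map fst ?zs = \<Theta>s" "map (\<lambda>z. snd (snd z)) ?zs = \<theta>s" "map (\<lambda>z. fst (snd z)) (tl ?zs) = qs" "fst (snd (?zs ! 0)) = p"
    using s(3,4,5) o by (auto intro!: nth_equalityI simp: ok_def nth_Cons split: nat.split)
  have Z: "Psi \<Delta>s bs h ?zs = (tenN k \<Theta>s, EA bs \<Theta>s p qs (cidc A (tenN k \<Theta>s)), BR k \<Gamma> g \<theta>)"
    unfolding Psi_def z gl ..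
  have sp: "sem A C P N (\<Theta>s ! 0) (Fn bs a) p" using o by (simp add: ok_def)
  \<comment> \<open>Sliding \<open>g\<close> out of the representative leaves an identity as its
    morphism, the shape that \<open>Psi\<close> produces.\<close>
  have "cE (LApp P M) k \<Delta> a x (tenN k \<Theta>s, EA bs \<Theta>s p qs (cidc A (tenN k \<Theta>s)), BR k \<Gamma> g \<theta>)"
    unfolding ex e
  proof (rule cE_gen[OF t _ g])
    show "sem A C (LApp P M) N (tenN k \<Theta>s) a (EA bs \<Theta>s p qs (cidc A (tenN k \<Theta>s)))" unfolding sem_ok using o ctxhom_cidc by blast
    show "eqv A C (LApp P M) N \<Gamma> a (EA bs \<Theta>s p qs g) (act A (LApp P M) g (did A a) (EA bs \<Theta>s p qs (cidc A (tenN k \<Theta>s))))"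
      unfolding act_EA ccompc_idr[OF ctxhom_ctxw[OF g]]
      by (rule app_cong[OF isf_den isf_den y[unfolded e]])
        (use eqv_sym[OF act_id[OF sp]] o in \<open>auto simp: ok_def intro: eqv_refl\<close>)
  qed (rule bE_refl[OF t'])
  from cE_trans[OF 1[unfolded Z] cE_sym[OF this]] show ?thesis .
qed

text \<open>The environment made by \<open>ps\<close> is glued from known pieces, which
  \<open>split_eqI\<close> recovers; then the inverse laws apply slot by slot.\<close>

lemma ph_ps:
  assumes x: "sem A C (LApp P' M') n \<Delta> a x"
  shows "eqv A C (LApp P' M') n \<Delta> a (ph \<Delta> a (ps \<Delta> a x)) x"
proof -
  obtain bs \<Xi>s p qs h where e: "x = EA bs \<Xi>s p qs h" using x by (rule semApp_cases)
  note x' = x[unfolded e semApp]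
  let ?zs = "slz bs a \<Xi>s p qs"
  let ?\<Gamma>s = "map fst ?zs" and ?\<theta>s = "map (\<lambda>z. snd (snd z)) ?zs"
  have cz: "sem A C (slotP i) N (fst (?zs ! i)) (slotA bs a i) (fst (snd (?zs ! i)))" "bS k (\<Xi>s ! i) (fst (?zs ! i)) (snd (snd (?zs ! i)))"
    if "i < Suc (length bs)" for i
    using ps_typed_slots[OF x[unfolded e] that] by (cases "?zs ! i"; simp)+
  have B: "BTok k \<Xi>s ?\<Gamma>s ?\<theta>s" using x' cz by (auto simp: BTok_def)
  note f = BTok_facts[OF B]
  have h: "ctxhom A C \<Delta> (ten k \<Xi>s) h" using x' by blast
  have o: "ok a bs ?\<Gamma>s (fst (snd (?zs ! 0))) (map (\<lambda>z. fst (snd z)) (tl ?zs))"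
    unfolding ok_def using f(2) cz(1)[of 0] cz(1)[of "Suc _"] by (auto simp: nth_tl simp del: slz_nth)
  let ?\<theta> = "BL h (BT k \<Xi>s ?\<Gamma>s ?\<theta>s)"
  have d: "dS k \<Delta> ?\<Gamma>s (\<Xi>s, ?\<theta>s, h)" unfolding dS_iff using B h by blast
  have "eqv A C (LApp P' M') n \<Delta> a (ph \<Delta> a (ps \<Delta> a x)) (Phi a bs ?\<Gamma>s (fst (snd (?zs ! 0))) (map (\<lambda>z. fst (snd z)) (tl ?zs)) (\<Xi>s, ?\<theta>s, h))"
    unfolding e ps_EA Psi_def ph_EA
    by (rule Phi_dE[OF o], rule split_eqI[OF d _ f(2)]) (simp only: glue_def prod.case, rule BR_id[OF bS_BL[OF bS_BT[OF B] h]])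
  moreover have "eqv A C (LApp P' M') n \<Delta> a (Phi a bs ?\<Gamma>s (fst (snd (?zs ! 0))) (map (\<lambda>z. fst (snd z)) (tl ?zs)) (\<Xi>s, ?\<theta>s, h)) x"
    unfolding e
  proof (rule eqv_sym, unfold Phi_def prod.case, rule app_cong[OF isf_den isf_den x[unfolded e]])
    show "eqv A C P' n (\<Xi>s ! 0) (Fn bs a) p (\<phi> (\<Xi>s ! 0) (Fn bs a) (?\<Gamma>s ! 0, fst (snd (?zs ! 0)), ?\<theta>s ! 0))"
      using eqv_sym[OF inv(3), of "\<Xi>s ! 0" "Fn bs a" p] x' by simp
    show "eqv A C M' n (\<Xi>s ! Suc i) (bs ! i) (qs ! i)
       (map (\<lambda>i. \<chi> (\<Xi>s ! Suc i) (bs ! i) (?\<Gamma>s ! Suc i, map (\<lambda>z. fst (snd z)) (tl ?zs) ! i, ?\<theta>s ! Suc i)) [0..<length bs] ! i)" if "i < length bs" for i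
      using eqv_sym[OF inv(4), of "\<Xi>s ! Suc i" "bs ! i" "qs ! i"] x' that by (simp add: nth_tl)
  qed simp
  ultimately show ?thesis by (rule eqvApp_trans)
qed

lemma iso_LApp: "isom (cmp (LApp P M) k) (den (LApp P' M') n)"
proof -
  have nt: "nat_trans (cmp (LApp P M) k) (den (LApp P' M') n) ph"
    unfolding nat_trans_def den_simps cmp_simps using ph_resp ph_natural by blast
  have "iso_by (cmp (LApp P M) k) (den (LApp P' M') n) ph ps"
    by (rule iso_byI[OF isf_cmp isf_den nt]) (simp_all only: den_simps cmp_simps ps_resp ps_ph ph_ps)
  then show ?thesis unfolding isom_def by blast
qed

end

lemma (in env) cmp_LApp:
  assumes "isom (cmp P k) (den P' (m0 + k))" "isom (cmp M k) (den M' (m0 + k))"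
  shows "isom (cmp (LApp P M) k) (den (LApp P' M') (m0 + k))"
proof -
  obtain \<phi> \<psi> where 1: "iso_by (cmp P k) (den P' (m0 + k)) \<phi> \<psi>" using assms(1) unfolding isom_def by blast
  obtain \<chi> \<xi> where 2: "iso_by (cmp M k) (den M' (m0 + k)) \<chi> \<xi>" using assms(2) unfolding isom_def by blast
  interpret env_app A C m0 N0 nq \<kappa> \<iota> p0 Q k P P' M M' \<phi> \<psi> \<chi> \<xi>
    by unfold_locales (fact 1 2)+
  show ?thesis by (rule iso_LApp)
qed

section \<open>Abstraction\<close>

context env
begin

lemma kob_Suc: "kob (Suc m) \<kappa>' \<Gamma> = kob m \<kappa>' \<Gamma> @ [case \<kappa>' m of None \<Rightarrow> [] | Some d \<Rightarrow> \<Gamma> ! d]"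
  by (simp add: kob_def)

lemma kmor_Suc: "kmor (Suc m) \<kappa>' g = kmor m \<kappa>' g @ [case \<kappa>' m of None \<Rightarrow> ([], []) | Some d \<Rightarrow> g ! d]"
  by (simp add: kmor_def)

lemma kob_append: "kval m \<kappa>' (length \<Gamma>) \<Longrightarrow> kob m \<kappa>' (\<Gamma> @ \<Gamma>') = kob m \<kappa>' \<Gamma>"
  by (auto simp: kob_def nth_append split: option.split)

lemma kmor_append: "kval m \<kappa>' (length g) \<Longrightarrow> kmor m \<kappa>' (g @ g') = kmor m \<kappa>' g"
  by (auto simp: kmor_def nth_append split: option.split)

lemma K_snoc: "length \<Gamma> = N0 + k \<Longrightarrow> K (Suc k) (\<Gamma> @ [bs]) = K k \<Gamma> @ [bs]"
  using kob_append[of "m0 + k" kap \<Gamma> "[bs]"] kval_kap[of k] by (simp add: kob_Suc) (simp add: kap_def nth_append)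

lemma Km_snoc: "length g = N0 + k \<Longrightarrow> Km (Suc k) (g @ [s]) = Km k g @ [s]"
  using kmor_append[of "m0 + k" kap g "[s]"] kval_kap[of k] by (simp add: kmor_Suc) (simp add: kap_def nth_append)

lemma J_Suc: "J (Suc k) \<Gamma> = J k \<Gamma> @ [[]]"
  by (simp add: kob_Suc) (simp add: iot_def)

lemma Jm_Suc: "Jm (Suc k) v = Jm k v @ [([], [])]"
  by (simp add: kmor_Suc) (simp add: iot_def)

lemmas snoc_Suc = K_snoc[unfolded add_Suc_right] J_Suc[unfolded add_Suc_right]

lemma pco_snoc: "length \<Gamma> = N0 + k \<Longrightarrow> pco (\<Gamma> @ [bs]) = pco \<Gamma>"
  using p0 by (force simp: pco_def nth_append split: option.split)

lemma pcm_snoc: "length g = N0 + k \<Longrightarrow> pcm (g @ [s]) = pcm g"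
  using p0 by (force simp: pcm_def nth_append split: option.split)

text \<open>\<open>J\<close> is empty at the new position and \<open>kap\<close> copies it, so the
  tensor there consists of the bound list alone.\<close>

lemma tgt_snoc:
  assumes "length \<Gamma> = N0 + k"
  shows "tgt (Suc k) (\<Gamma> @ [bs]) b = tgt k \<Gamma> b @ [bs]"
  by (rule nth_equalityI) (auto simp: objs_def snoc_Suc assms nth_append less_Suc_eq comp_def)

lemma cprj_snoc:
  assumes "length \<Gamma> = N0 + k"
  shows cprj_snoc_0: "Pj (Suc k) (objs (Suc k) (\<Gamma> @ [bs]) b) 0 = Pj k (objs k \<Gamma> b) 0 @ [sid A bs]"
    and cprj_snoc_Suc: "j < length b \<Longrightarrow> Pj (Suc k) (objs (Suc k) (\<Gamma> @ [bs]) b) (Suc j) = Pj k (objs k \<Gamma> b) (Suc j) @ [([], [])]"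
proof -
  have c: "comp_at c (objs (Suc k) (\<Gamma> @ [bs]) b) = comp_at c (objs k \<Gamma> b)" if "c < m0 + k" for c
    using that by (simp add: objs_def snoc_Suc assms nth_append comp_def)
  have m: "comp_at (m0 + k) (objs (Suc k) (\<Gamma> @ [bs]) b) = bs # map (\<lambda>_. []) b"
    by (simp add: objs_def snoc_Suc assms nth_append comp_def)
  show "Pj (Suc k) (objs (Suc k) (\<Gamma> @ [bs]) b) 0 = Pj k (objs k \<Gamma> b) 0 @ [sid A bs]"
  proof (rule nth_equalityI)
    fix i assume "i < length (Pj (Suc k) (objs (Suc k) (\<Gamma> @ [bs]) b) 0)"
    then have "i < Suc (m0 + k)" by simp
    then show "Pj (Suc k) (objs (Suc k) (\<Gamma> @ [bs]) b) 0 ! i = (Pj k (objs k \<Gamma> b) 0 @ [sid A bs]) ! i"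
      by (cases "i = m0 + k") (auto simp: nth_cprj c m nth_append prj_def sid_def map_idI)
  qed simp
  show "Pj (Suc k) (objs (Suc k) (\<Gamma> @ [bs]) b) (Suc j) = Pj k (objs k \<Gamma> b) (Suc j) @ [([], [])]" if j: "j < length b"
  proof (rule nth_equalityI)
    fix i assume "i < length (Pj (Suc k) (objs (Suc k) (\<Gamma> @ [bs]) b) (Suc j))"
    then have "i < Suc (m0 + k)" by simp
    then show "Pj (Suc k) (objs (Suc k) (\<Gamma> @ [bs]) b) (Suc j) ! i = (Pj k (objs k \<Gamma> b) (Suc j) @ [([], [])]) ! i"
      using j by (cases "i = m0 + k") (auto simp: nth_cprj c m nth_append prj_def)
  qed simp
qed

lemmas tgt_snoc_Suc = tgt_snoc[unfolded add_Suc_right] and cprj_snoc_Suc_Suc = cprj_snoc_Suc[unfolded add_Suc_right]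

lemma length_Suc_snoc: "length xs = Suc n \<Longrightarrow> \<exists>ys y. xs = ys @ [y] \<and> length ys = n"
  by (metis append_butlast_last_id diff_Suc_1 length_butlast list.size(3) nat.distinct(1))

lemma ctxw_snocI: "ctxw \<Delta> \<Gamma> u \<Longrightarrow> shomw x y s \<Longrightarrow> ctxw (\<Delta> @ [x]) (\<Gamma> @ [y]) (u @ [s])"
  by (auto simp: ctxw_def nth_append less_Suc_eq)

text \<open>The new component splits off when projections are compared: projection 0 is an identity
  there and the others are empty.\<close>

lemma tgt_ext_snoc:
  assumes N: "length \<Gamma>' = N0 + k"
    and U: "ctxw (\<Delta> @ [xs]) (tgt (Suc k) (\<Gamma>' @ [bs']) b) U"
    and u: "ctxw \<Delta> (tgt k \<Gamma>' b) u" and s: "shomw xs bs' s"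
    and 0: "U \<odot> Pj (Suc k) (objs (Suc k) (\<Gamma>' @ [bs']) b) 0 = (u \<odot> Pj k (objs k \<Gamma>' b) 0) @ [s]"
    and S: "\<And>j. j < length b \<Longrightarrow> U \<odot> Pj (Suc k) (objs (Suc k) (\<Gamma>' @ [bs']) b) (Suc j) = (u \<odot> Pj k (objs k \<Gamma>' b) (Suc j)) @ [([], [])]"
  shows "U = u @ [s]"
proof (rule tgt_ext[OF U])
  have l: "length u = m0 + k" using u by (simp add: ctxw_def)
  show "ctxw (\<Delta> @ [xs]) (tgt (Suc k) (\<Gamma>' @ [bs']) b) (u @ [s])" unfolding tgt_snoc[OF N] by (rule ctxw_snocI[OF u s])
  show "U \<odot> Pj (Suc k) (objs (Suc k) (\<Gamma>' @ [bs']) b) 0 = (u @ [s]) \<odot> Pj (Suc k) (objs (Suc k) (\<Gamma>' @ [bs']) b) 0"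
    unfolding 0 unfolding cprj_snoc_0[OF N] using l by (simp add: ccompc_snoc scomp_idr[OF s])
  show "U \<odot> Pj (Suc k) (objs (Suc k) (\<Gamma>' @ [bs']) b) (Suc j) = (u @ [s]) \<odot> Pj (Suc k) (objs (Suc k) (\<Gamma>' @ [bs']) b) (Suc j)" if j: "j < length b" for j
    unfolding S[OF j] unfolding cprj_snoc_Suc[OF N j] using l by (simp add: ccompc_snoc scomp_eq)
qed

lemma rmap_snoc:
  assumes g: "ctxhom A C \<Gamma> \<Gamma>' g" and N: "length \<Gamma> = N0 + k" and b: "bagok (pco \<Gamma>) b" and t: "shom A C bs bs' t"
  shows "rmap (Suc k) (\<Gamma> @ [bs]) b (g @ [t]) = rmap k \<Gamma> b g @ [t]"
proof -
  have N': "length \<Gamma>' = N0 + k" "length g = N0 + k" using ctxhom_len[OF g] N by simp_all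
  have gt: "ctxhom A C (\<Gamma> @ [bs]) (\<Gamma>' @ [bs']) (g @ [t])" by (rule ctxhom_snocI[OF g t])
  have b': "bagok (pco (\<Gamma> @ [bs])) b" using b by (simp add: pco_snoc[OF N])
  have N1: "length (\<Gamma> @ [bs]) = N0 + Suc k" using N by simp
  note r = rmap[OF g N b] and R = rmap[OF gt N1 b', unfolded pcm_snoc[OF N'(2)] pco_snoc[OF N'(1)]]
  let ?b = "bagact (pcm g) b"
  have lb: "length ?b = length (pco \<Gamma>')" by (rule bagact_nth(1)[OF shom_shomw[OF shom_pcm[OF g N]]])
  have lr: "length (Pj k (objs k \<Gamma> b) 0) = m0 + k" by simp
  show ?thesis
  proof (rule tgt_ext_snoc[OF N'(1) ctxhom_ctxw[OF R(1), unfolded tgt_snoc[OF N]] ctxhom_ctxw[OF r(1)] shom_shomw[OF t]])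
    show "rmap (Suc k) (\<Gamma> @ [bs]) b (g @ [t]) \<odot> Pj (Suc k) (objs (Suc k) (\<Gamma>' @ [bs']) ?b) 0 = (rmap k \<Gamma> b g \<odot> Pj k (objs k \<Gamma>' ?b) 0) @ [t]"
      unfolding R(2) r(2) unfolding cprj_snoc_0[OF N] Km_snoc[OF N'(2)]
      by (simp add: ccompc_snoc scomp_idl[OF shom_shomw[OF t]])
    fix j assume j: "j < length ?b"
    have "fst (pcm g) ! j < length b"
      using shom_shomw[OF shom_pcm[OF g N]] j lb b by (auto simp: shomw_def bagok_def)
    then show "rmap (Suc k) (\<Gamma> @ [bs]) b (g @ [t]) \<odot> Pj (Suc k) (objs (Suc k) (\<Gamma>' @ [bs']) ?b) (Suc j) = (rmap k \<Gamma> b g \<odot> Pj k (objs k \<Gamma>' ?b) (Suc j)) @ [([], [])]"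
      using R(3)[of j] r(3)[of j] j lb by (simp add: cprj_snoc_Suc_Suc[OF N])
  qed
qed

lemma wmor_snoc:
  assumes v: "bagto (pco \<Gamma>) b vs b'" and N: "length \<Gamma> = N0 + k"
  shows "wmor (Suc k) (\<Gamma> @ [bs]) b vs = wmor k \<Gamma> b vs @ [sid A bs]"
proof -
  have v': "bagto (pco (\<Gamma> @ [bs])) b vs b'" using v by (simp add: pco_snoc[OF N])
  note w = wmor[where k=k, OF v] and W = wmor[where k="Suc k", OF v']
  have l: "length b = length (pco \<Gamma>)" "length b' = length (pco \<Gamma>)" using bagto_len[OF v] by auto
  show ?thesis
  proof (rule tgt_ext_snoc[OF N ctxhom_ctxw[OF W(1), unfolded tgt_snoc[OF N, of bs b]] ctxhom_ctxw[OF w(1)] shom_shomw[OF shom_sid]])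
    show "wmor (Suc k) (\<Gamma> @ [bs]) b vs \<odot> Pj (Suc k) (objs (Suc k) (\<Gamma> @ [bs]) b') 0 = (wmor k \<Gamma> b vs \<odot> Pj k (objs k \<Gamma> b') 0) @ [sid A bs]"
      unfolding W(2) w(2) unfolding cprj_snoc_0[OF N] ..
    fix j assume "j < length b'"
    then have j: "j < length (pco \<Gamma>)" "j < length (pco (\<Gamma> @ [bs]))" "j < length b" using l by (simp_all add: pco_snoc[OF N])
    show "wmor (Suc k) (\<Gamma> @ [bs]) b vs \<odot> Pj (Suc k) (objs (Suc k) (\<Gamma> @ [bs]) b') (Suc j) = (wmor k \<Gamma> b vs \<odot> Pj k (objs k \<Gamma> b') (Suc j)) @ [([], [])]"
      unfolding W(3)[OF j(2)] w(3)[OF j(1)] unfolding cprj_snoc_Suc[OF N j(3)] Jm_Suc by (simp add: ccompc_snoc scomp_eq)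
  qed
qed

text \<open>An environment over a context with one more binder is an environment without it and a
  morphism of SD for the new component, by \<open>bS_Suc_cases\<close>; the bag is the same.\<close>

definition up :: "'b \<times> 'm smor list \<Rightarrow> 'm smor \<Rightarrow> 'b \<times> 'm smor list" where
  "up \<theta> s = (fst \<theta>, snd \<theta> @ [s])"

definition dn :: "'b \<times> 'm smor list \<Rightarrow> 'b \<times> 'm smor list" where
  "dn \<theta> = (fst \<theta>, butlast (snd \<theta>))"

lemma dn_up [simp]: "dn (up \<theta> s) = \<theta>" "last (snd (up \<theta> s)) = s"
  by (simp_all add: dn_def up_def)

lemma bS_up: "bS k \<Delta> \<Gamma> \<theta> \<Longrightarrow> shom A C xs bs s \<Longrightarrow> bS (Suc k) (\<Delta> @ [xs]) (\<Gamma> @ [bs]) (up \<theta> s)"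
  by (auto simp: bS_def up_def tgt_snoc_Suc pco_snoc intro: ctxhom_snocI)

lemma bS_Suc_cases:
  assumes "bS (Suc k) (\<Delta> @ [xs]) \<Gamma>' \<theta>'"
  obtains \<Gamma> bs \<theta> s where "\<Gamma>' = \<Gamma> @ [bs]" "\<theta>' = up \<theta> s" "bS k \<Delta> \<Gamma> \<theta>" "shom A C xs bs s" "length \<Gamma> = N0 + k"
proof -
  have "length \<Gamma>' = Suc (N0 + k)" using assms by (simp add: bS_def)
  then obtain \<Gamma> bs where \<Gamma>: "\<Gamma>' = \<Gamma> @ [bs]" and N: "length \<Gamma> = N0 + k" using length_Suc_snoc by blast
  have h: "ctxhom A C (\<Delta> @ [xs]) (tgt k \<Gamma> (fst \<theta>') @ [bs]) (snd \<theta>')" and ok: "bagok (pco \<Gamma>) (fst \<theta>')"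
    using assms by (simp_all add: bS_def \<Gamma> tgt_snoc_Suc[OF N] pco_snoc[OF N])
  have "length (snd \<theta>') = Suc (m0 + k)" using ctxhom_len[OF h] by simp
  then obtain u s where u: "snd \<theta>' = u @ [s]" "length u = m0 + k" using length_Suc_snoc by blast
  have "length \<Delta> = m0 + k" using ctxhom_len[OF h] by simp
  then have hs: "ctxhom A C \<Delta> (tgt k \<Gamma> (fst \<theta>')) u \<and> shom A C xs bs s"
    using h ctxhom_snoc[of "tgt k \<Gamma> (fst \<theta>')" \<Delta> u xs bs s] u by simp
  show ?thesis by (rule that[of \<Gamma> bs "(fst \<theta>', u)" s]) (use \<Gamma> N u hs ok in \<open>auto simp: up_def bS_def intro: prod_eqI\<close>)
qed

lemma BL_up: "bS k \<Delta> \<Gamma> \<theta> \<Longrightarrow> ctxhom A C \<Delta>' \<Delta> u \<Longrightarrow> BL (u @ [t]) (up \<theta> s) = up (BL u \<theta>) (scomp A t s)"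
  by (auto simp: BL_def up_def bS_def ctxhom_len ccompc_snoc)

lemma BR_up:
  assumes t: "bS k \<Delta> \<Gamma> \<theta>" and g: "ctxhom A C \<Gamma> \<Gamma>' g" and s: "shom A C bs bs' s"
  shows "BR (Suc k) (\<Gamma> @ [bs]) (g @ [s]) (up \<theta> r) = up (BR k \<Gamma> g \<theta>) (scomp A r s)"
proof -
  have N: "length \<Gamma> = N0 + k" and ok: "bagok (pco \<Gamma>) (fst \<theta>)" and h: "ctxhom A C \<Delta> (tgt k \<Gamma> (fst \<theta>)) (snd \<theta>)" using t by (auto simp: bS_def)
  have "length g = N0 + k" "length (snd \<theta>) = length (rmap k \<Gamma> (fst \<theta>) g)"
    using ctxhom_len[OF g] ctxhom_len[OF h] ctxhom_len[OF ctxhom_rmap[OF g N ok]] N by simp_all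
  then show ?thesis by (simp add: BR_def up_def pcm_snoc rmap_snoc[OF g N ok s] ccompc_snoc)
qed

lemma bE_up:
  assumes e: "bE k \<Delta> \<Gamma> \<theta> \<theta>'" and s: "shom A C xs bs s"
  shows "bE (Suc k) (\<Delta> @ [xs]) (\<Gamma> @ [bs]) (up \<theta> s) (up \<theta>' s)"
proof (rule equivclose_map[OF e[unfolded bE_def], where f="\<lambda>\<theta>. up \<theta> s"])
  fix x y assume x: "bS k \<Delta> \<Gamma> x" "bS k \<Delta> \<Gamma> y" "bgen k \<Gamma> x y"
  then obtain vs where v: "bagto (pco \<Gamma>) (fst x) vs (fst y)" "snd y = snd x \<odot> wmor k \<Gamma> (fst x) vs"
    by (auto simp: bgen_def)
  have N: "length \<Gamma> = N0 + k" and h: "ctxhom A C \<Delta> (tgt k \<Gamma> (fst x)) (snd x)" using x by (auto simp: bS_def)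
  have "length (snd x) = length (wmor k \<Gamma> (fst x) vs)" using ctxhom_len[OF h] by (simp add: wmor_def)
  then have "snd (up y s) = snd (up x s) \<odot> wmor (Suc k) (\<Gamma> @ [bs]) (fst x) vs"
    by (simp add: up_def v(2) wmor_snoc[OF v(1) N] ccompc_snoc scomp_idr[OF shom_shomw[OF s]])
  then have "bgen (Suc k) (\<Gamma> @ [bs]) (up x s) (up y s)" using v(1) by (auto simp: bgen_def up_def pco_snoc[OF N])
  then show "bE (Suc k) (\<Delta> @ [xs]) (\<Gamma> @ [bs]) (up x s) (up y s)" using bS_up[OF x(1) s] bS_up[OF x(2) s] by (intro bE_gen)
qed (blast intro: bE_refl bE_sym bE_trans bS_up[OF _ s])+

text \<open>The generators do nothing to the new component, so its morphism is an invariant of the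
  equivalence and can be removed consistently. The proof follows both pieces at once.\<close>

lemma bE_dn:
  assumes e: "bE (Suc k) (\<Delta> @ [xs]) (\<Gamma> @ [bs]) \<theta> \<theta>'"
  shows "last (snd \<theta>) = last (snd \<theta>') \<and> bE k \<Delta> \<Gamma> (dn \<theta>) (dn \<theta>')"
proof -
  let ?T = "\<lambda>x y. fst x = fst y \<and> bE k \<Delta> \<Gamma> (snd x) (snd y)"
  have c: "bS k \<Delta> \<Gamma> (dn x) \<and> (\<exists>s y. x = up y s \<and> shom A C xs bs s \<and> bS k \<Delta> \<Gamma> y)" if "bS (Suc k) (\<Delta> @ [xs]) (\<Gamma> @ [bs]) x" for x
    using that by (rule bS_Suc_cases) auto
  have "?T (last (snd \<theta>), dn \<theta>) (last (snd \<theta>'), dn \<theta>')"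
  proof (rule equivclose_map[OF e[unfolded bE_def], where f="\<lambda>\<theta>. (last (snd \<theta>), dn \<theta>)" and T="?T"])
    show "?T (last (snd x), dn x) (last (snd x), dn x)" if "bS (Suc k) (\<Delta> @ [xs]) (\<Gamma> @ [bs]) x" for x
      using c[OF that] by (simp add: bE_refl)
    fix x y assume x: "bS (Suc k) (\<Delta> @ [xs]) (\<Gamma> @ [bs]) x" "bS (Suc k) (\<Delta> @ [xs]) (\<Gamma> @ [bs]) y" "bgen (Suc k) (\<Gamma> @ [bs]) x y"
    obtain z s where z: "x = up z s" "shom A C xs bs s" "bS k \<Delta> \<Gamma> z" using c[OF x(1)] by blast
    have N: "length \<Gamma> = N0 + k" and h: "ctxhom A C \<Delta> (tgt k \<Gamma> (fst z)) (snd z)" using z(3) by (auto simp: bS_def)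
    obtain vs where v: "bagto (pco \<Gamma>) (fst z) vs (fst y)" "snd y = (snd z @ [s]) \<odot> wmor (Suc k) (\<Gamma> @ [bs]) (fst z) vs"
      using x(3) by (auto simp: bgen_def z up_def pco_snoc[OF N])
    have "length (snd z) = length (wmor k \<Gamma> (fst z) vs)" using ctxhom_len[OF h] by (simp add: wmor_def)
    then have y: "snd y = (snd z \<odot> wmor k \<Gamma> (fst z) vs) @ [s]"
      by (simp add: v(2) wmor_snoc[OF v(1) N] ccompc_snoc scomp_idr[OF shom_shomw[OF z(2)]])
    then have "bgen k \<Gamma> (dn x) (dn y)" using v(1) by (auto simp: bgen_def z dn_def up_def)
    then show "?T (last (snd x), dn x) (last (snd y), dn y)"
      using y c[OF x(1)] c[OF x(2)] by (simp add: z bE_gen)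
  qed (auto intro: bE_sym bE_trans)
  then show ?thesis by simp
qed

text \<open>With \<open>chi\<close> this is co-Yoneda for the bound component: the coend over its
  type is evaluated by letting its morphism act on the body, and \<open>ups\<close> goes back by
  inserting an identity.\<close>

definition ups where
  "ups a x = (case (a, x) of (Fn bs b, (\<Gamma>, EL p, \<theta>)) \<Rightarrow> (\<Gamma> @ [bs], p, up \<theta> (sid A bs)) | _ \<Rightarrow> undefined)"

definition chi where
  "chi P b x = (case x of (\<Gamma>, p, \<theta>) \<Rightarrow>
     (butlast \<Gamma>, EL (act A P (cidc A (butlast \<Gamma>) @ [last (snd \<theta>)]) (did A b) p), dn \<theta>))"

lemma ups_EL [simp]: "ups (Fn bs b) (\<Gamma>, EL p, \<theta>) = (\<Gamma> @ [bs], p, up \<theta> (sid A bs))"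
  by (simp add: ups_def)

lemma chi_up: "chi P b (\<Gamma> @ [bs], p, up \<theta> s) = (\<Gamma>, EL (act A P (cidc A \<Gamma> @ [s]) (did A b) p), \<theta>)"
  by (simp add: chi_def)

lemma act_Lam_id: "act A (LLam P) g (did A (Fn bs b)) (EL p) = EL (act A P (g @ [sid A bs]) (did A b) p)"
  by (simp add: sid_def)

lemma semLam_Fn: "sem A C (LLam P) n \<Gamma> (Fn bs b) x \<longleftrightarrow> (\<exists>p. x = EL p \<and> sem A C P (Suc n) (\<Gamma> @ [bs]) b p)"
  by simp

lemma eqvLam_Fn: "eqv A C (LLam P) n \<Gamma> (Fn bs b) (EL p) (EL q) \<longleftrightarrow> eqv A C P (Suc n) (\<Gamma> @ [bs]) b p q"
  by simp

lemma cS_Lam_cases: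
  assumes "cS (LLam P) k \<Delta> a x"
  obtains bs b \<Gamma> p \<theta> where "a = Fn bs b" "x = (\<Gamma>, EL p, \<theta>)" "sem A C P (N0 + Suc k) (\<Gamma> @ [bs]) b p" "bS k \<Delta> \<Gamma> \<theta>"
proof -
  obtain \<Gamma> y \<theta> where e: "x = (\<Gamma>, y, \<theta>)" by (cases x)
  have "sem A C (LLam P) (N0 + k) \<Gamma> a y" "bS k \<Delta> \<Gamma> \<theta>" using assms by (auto simp: e simp del: sem.simps)
  then show ?thesis using that e by (auto elim!: semLam_cases simp del: sem.simps)
qed

lemma act_comp:
  assumes "sem A C M n \<Delta> a x" "ctxhom A C \<Delta>' \<Delta> u" "dhom A C a a' f" "ctxhom A C \<Delta>'' \<Delta>' u'" "dhom A C a' a'' f'"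
  shows "eqv A C M n \<Delta>'' a'' (act A M (u' \<odot> u) (dcomp A f f') x) (act A M u' f' (act A M u f x))"
  using isf_comp[OF isf_den _ assms(2-5), of M n, unfolded den_simps, OF assms(1)] .

lemma act_comp_id:
  assumes "sem A C M n \<Delta> a x" "ctxhom A C \<Delta>' \<Delta> u" "ctxhom A C \<Delta>'' \<Delta>' u'"
  shows "eqv A C M n \<Delta>'' a (act A M (u' \<odot> u) (did A a) x) (act A M u' (did A a) (act A M u (did A a) x))"
  using act_comp[OF assms(1,2) dhom_did assms(3) dhom_did] by (simp add: dcomp_idl[OF dhom_did])

lemma act_cong: "eqv A C M n \<Delta> a x y \<Longrightarrow> ctxhom A C \<Delta>' \<Delta> u \<Longrightarrow> dhom A C a a' f \<Longrightarrow> eqv A C M n \<Delta>' a' (act A M u f x) (act A M u f y)"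
  using isf_cong[OF isf_den, of M n] unfolding den_simps by blast

lemma chi_resp:
  assumes xy: "cE P (Suc k) (\<Delta> @ [bs]) b x y"
  shows "cE (LLam P) k \<Delta> (Fn bs b) (chi P b x) (chi P b y)"
proof (rule cE_map[OF xy, where f="chi P b" and T="cE (LLam P) k \<Delta> (Fn bs b)"])
  fix x assume x: "cS P (Suc k) (\<Delta> @ [bs]) b x"
  obtain \<Gamma>' p \<theta>' where e: "x = (\<Gamma>', p, \<theta>')" by (cases x)
  have p: "sem A C P (N0 + Suc k) \<Gamma>' b p" and t: "bS (Suc k) (\<Delta> @ [bs]) \<Gamma>' \<theta>'" using x by (auto simp: e)
  from t obtain \<Gamma> cs \<theta> s where c: "\<Gamma>' = \<Gamma> @ [cs]" "\<theta>' = up \<theta> s" "bS k \<Delta> \<Gamma> \<theta>" "shom A C bs cs s"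
    by (rule bS_Suc_cases)
  show "cE (LLam P) k \<Delta> (Fn bs b) (chi P b x) (chi P b x)"
    unfolding e c(1,2) chi_up using sem_act[OF p[unfolded c] ctxhom_snocI[OF ctxhom_cidc c(4)] dhom_did] c(3)
    by (intro cE_refl) simp
next
  fix \<Gamma>' p' \<theta>' \<Gamma>'' p \<theta>'' g'
  assume t: "bS (Suc k) (\<Delta> @ [bs]) \<Gamma>' \<theta>'" and p: "sem A C P (N0 + Suc k) \<Gamma>'' b p" and g': "ctxhom A C \<Gamma>' \<Gamma>'' g'"
    and p': "eqv A C P (N0 + Suc k) \<Gamma>' b p' (act A P g' (did A b) p)" and t'': "bE (Suc k) (\<Delta> @ [bs]) \<Gamma>'' \<theta>'' (BR (Suc k) \<Gamma>' g' \<theta>')"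
  from t obtain \<Gamma> cs \<theta> s where c: "\<Gamma>' = \<Gamma> @ [cs]" "\<theta>' = up \<theta> s" "bS k \<Delta> \<Gamma> \<theta>" "shom A C bs cs s" "length \<Gamma> = N0 + k"
    by (rule bS_Suc_cases)
  from bE_dom(1)[OF t''] obtain \<Gamma>2 ds \<theta>2 r where d: "\<Gamma>'' = \<Gamma>2 @ [ds]" "\<theta>'' = up \<theta>2 r" "bS k \<Delta> \<Gamma>2 \<theta>2" "shom A C bs ds r" "length \<Gamma>2 = N0 + k"
    by (rule bS_Suc_cases)
  have "length g' = Suc (N0 + k)" using ctxhom_len[OF g'] c by simp
  then obtain g w where g: "g' = g @ [w]" "length g = N0 + k" using length_Suc_snoc by blast
  have gw: "ctxhom A C \<Gamma> \<Gamma>2 g" "shom A C cs ds w" using g' ctxhom_snoc[of \<Gamma>2 \<Gamma> g cs ds w] c d g by auto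
  have e: "BR (Suc k) \<Gamma>' g' \<theta>' = up (BR k \<Gamma> g \<theta>) (scomp A s w)" unfolding c g by (rule BR_up[OF c(3) gw])
  have r: "r = scomp A s w" "bE k \<Delta> \<Gamma>2 \<theta>2 (BR k \<Gamma> g \<theta>)" using bE_dn[OF t''[unfolded e d]] by auto
  note p = p[unfolded d] and p' = p'[unfolded c g]
  have sw: "shom A C bs ds (scomp A s w)" by (rule shom_scomp[OF c(4) gw(2)])
  note h1 = ctxhom_snocI[OF ctxhom_cidc c(4), of \<Gamma>] and h2 = ctxhom_snocI[OF gw] and h3 = ctxhom_snocI[OF ctxhom_cidc sw, of \<Gamma>2]
    and h4 = ctxhom_snocI[OF gw(1) shom_sid, of bs]
  \<comment> \<open>The morphism \<open>g @ [scomp A s w]\<close> is factored in two ways, to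
    compare the element after the generator with the element before it.\<close>
  have e1: "(cidc A \<Gamma> @ [s]) \<odot> (g @ [w]) = g @ [scomp A s w]" using ctxhom_len[OF gw(1)] by (simp add: ccompc_snoc ccompc_idl[OF ctxhom_ctxw[OF gw(1)]])
  have e2: "(g @ [sid A bs]) \<odot> (cidc A \<Gamma>2 @ [scomp A s w]) = g @ [scomp A s w]"
    using ctxhom_len[OF gw(1)] by (simp add: ccompc_snoc ccompc_idr[OF ctxhom_ctxw[OF gw(1)]] scomp_idl[OF shom_shomw[OF sw]])
  show "cE (LLam P) k \<Delta> (Fn bs b) (chi P b (\<Gamma>', p', \<theta>')) (chi P b (\<Gamma>'', p, \<theta>''))"
    unfolding c(1,2) d(1,2) chi_up r(1)
  proof (rule cE_gen[OF c(3) _ gw(1) _ r(2)])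
    show "sem A C (LLam P) (N0 + k) \<Gamma>2 (Fn bs b) (EL (act A P (cidc A \<Gamma>2 @ [scomp A s w]) (did A b) p))"
      unfolding semLam_Fn using sem_act[OF p h3 dhom_did] by simp
    have 1: "eqv A C P (Suc (N0 + k)) (\<Gamma> @ [bs]) b (act A P (cidc A \<Gamma> @ [s]) (did A b) p') (act A P (cidc A \<Gamma> @ [s]) (did A b) (act A P (g @ [w]) (did A b) p))"
      using act_cong[OF p' h1 dhom_did] by simp
    have 2: "eqv A C P (Suc (N0 + k)) (\<Gamma> @ [bs]) b (act A P (g @ [scomp A s w]) (did A b) p) (act A P (cidc A \<Gamma> @ [s]) (did A b) (act A P (g @ [w]) (did A b) p))"
      using act_comp_id[OF p h2 h1] unfolding e1 by simp
    have 3: "eqv A C P (Suc (N0 + k)) (\<Gamma> @ [bs]) b (act A P (g @ [scomp A s w]) (did A b) p) (act A P (g @ [sid A bs]) (did A b) (act A P (cidc A \<Gamma>2 @ [scomp A s w]) (did A b) p))"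
      using act_comp_id[OF p h3 h4] unfolding e2 by simp
    show "eqv A C (LLam P) (N0 + k) \<Gamma> (Fn bs b) (EL (act A P (cidc A \<Gamma> @ [s]) (did A b) p'))
       (act A (LLam P) g (did A (Fn bs b)) (EL (act A P (cidc A \<Gamma>2 @ [scomp A s w]) (did A b) p)))"
      unfolding act_Lam_id eqvLam_Fn by (rule eqv_trans[OF 1 eqv_trans[OF eqv_sym[OF 2] 3]])
  qed
qed (blast intro: cE_sym cE_trans)+

lemma ups_resp:
  assumes xy: "cE (LLam P) k \<Delta> (Fn bs b) x y"
  shows "cE P (Suc k) (\<Delta> @ [bs]) b (ups (Fn bs b) x) (ups (Fn bs b) y)"
proof (rule cE_map[OF xy, where f="ups (Fn bs b)" and T="cE P (Suc k) (\<Delta> @ [bs]) b"])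
  fix x assume x: "cS (LLam P) k \<Delta> (Fn bs b) x"
  then show "cE P (Suc k) (\<Delta> @ [bs]) b (ups (Fn bs b) x) (ups (Fn bs b) x)"
    by (rule cS_Lam_cases) (auto intro!: cE_refl bS_up shom_sid)
next
  fix \<Gamma> x' \<theta> \<Gamma>' x \<theta>' g
  assume t: "bS k \<Delta> \<Gamma> \<theta>" and x: "sem A C (LLam P) (N0 + k) \<Gamma>' (Fn bs b) x" and g: "ctxhom A C \<Gamma> \<Gamma>' g"
    and x': "eqv A C (LLam P) (N0 + k) \<Gamma> (Fn bs b) x' (act A (LLam P) g (did A (Fn bs b)) x)" and t': "bE k \<Delta> \<Gamma>' \<theta>' (BR k \<Gamma> g \<theta>)"
  obtain p where p: "x = EL p" "sem A C P (N0 + Suc k) (\<Gamma>' @ [bs]) b p" using x unfolding semLam_Fn by auto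
  obtain p' where p': "x' = EL p'" using eqv_sem(1)[OF x'] unfolding semLam_Fn by auto
  have pp: "eqv A C P (N0 + Suc k) (\<Gamma> @ [bs]) b p' (act A P (g @ [sid A bs]) (did A b) p)"
    using x' unfolding p p' act_Lam_id eqvLam_Fn by simp
  have "bE (Suc k) (\<Delta> @ [bs]) (\<Gamma>' @ [bs]) (up \<theta>' (sid A bs)) (BR (Suc k) (\<Gamma> @ [bs]) (g @ [sid A bs]) (up \<theta> (sid A bs)))"
    unfolding BR_up[OF t g shom_sid] scomp_idl[OF shom_shomw[OF shom_sid]] by (rule bE_up[OF t' shom_sid])
  then show "cE P (Suc k) (\<Delta> @ [bs]) b (ups (Fn bs b) (\<Gamma>, x', \<theta>)) (ups (Fn bs b) (\<Gamma>', x, \<theta>'))"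
    unfolding p(1) p' ups_EL by (intro cE_gen[OF bS_up[OF t shom_sid] p(2) ctxhom_snocI[OF g shom_sid] pp])
qed (blast intro: cE_sym cE_trans)+

lemma chi_ups:
  assumes "cS (LLam P) k \<Delta> (Fn bs b) x"
  shows "cE (LLam P) k \<Delta> (Fn bs b) (chi P b (ups (Fn bs b) x)) x"
  using assms
proof (rule cS_Lam_cases)
  fix bs' b' \<Gamma> p \<theta> assume e: "Fn bs b = Fn bs' b'" "x = (\<Gamma>, EL p, \<theta>)" and p: "sem A C P (N0 + Suc k) (\<Gamma> @ [bs']) b' p" and t: "bS k \<Delta> \<Gamma> \<theta>"
  have p: "sem A C P (N0 + Suc k) (\<Gamma> @ [bs]) b p" using p e by simp
  show ?thesis unfolding e(2) ups_EL chi_up cidc_snoc[symmetric]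
    by (rule cE_cong[OF _ bE_refl[OF t]]) (use act_id[OF p] in simp)
qed

text \<open>The morphism \<open>s\<close> that \<open>chi\<close> lets act on the body is slid back
  into the environment, by the generator along \<open>cidc A \<Gamma> @ [s]\<close>.\<close>

lemma ups_chi:
  assumes x: "cS P (Suc k) (\<Delta> @ [bs]) b x"
  shows "cE P (Suc k) (\<Delta> @ [bs]) b (ups (Fn bs b) (chi P b x)) x"
proof -
  obtain \<Gamma>' p \<theta>' where e: "x = (\<Gamma>', p, \<theta>')" by (cases x)
  have p: "sem A C P (N0 + Suc k) \<Gamma>' b p" and t: "bS (Suc k) (\<Delta> @ [bs]) \<Gamma>' \<theta>'" using x by (auto simp: e)
  from t obtain \<Gamma> cs \<theta> s where c: "\<Gamma>' = \<Gamma> @ [cs]" "\<theta>' = up \<theta> s" "bS k \<Delta> \<Gamma> \<theta>" "shom A C bs cs s"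
    by (rule bS_Suc_cases)
  note h = ctxhom_snocI[OF ctxhom_cidc c(4), of \<Gamma>]
  have "bE (Suc k) (\<Delta> @ [bs]) (\<Gamma> @ [cs]) (up \<theta> s) (BR (Suc k) (\<Gamma> @ [bs]) (cidc A \<Gamma> @ [s]) (up \<theta> (sid A bs)))"
    unfolding BR_up[OF c(3) ctxhom_cidc c(4)] scomp_idl[OF shom_shomw[OF c(4)]] by (rule bE_up[OF bE_sym[OF BR_id[OF c(3)]] c(4)])
  then show ?thesis unfolding e c(1,2) chi_up ups_EL
    by (intro cE_gen[OF bS_up[OF c(3) shom_sid] p[unfolded c] h eqv_refl[OF sem_act[OF p[unfolded c] h dhom_did]]])
qed

lemma cmp_LLam:
  assumes "isom (cmp P (Suc k)) (den P' (m0 + Suc k))"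
  shows "isom (cmp (LLam P) k) (den (LLam P') (m0 + k))"
proof -
  obtain \<phi> \<psi> where iso: "iso_by (cmp P (Suc k)) (den P' (m0 + Suc k)) \<phi> \<psi>" using assms unfolding isom_def by blast
  note nt = iso[unfolded iso_by_def, THEN conjunct1] and nt' = iso[unfolded iso_by_def, THEN conjunct2, THEN conjunct1]
  note r\<phi> = nat_trans_resp[OF nt, unfolded den_simps cmp_simps] and r\<psi> = nat_trans_resp[OF nt', unfolded den_simps cmp_simps]
  note n\<phi> = nat_trans_natural[OF nt, unfolded den_simps cmp_simps]
  note l = iso[unfolded iso_by_def den_simps cmp_simps, THEN conjunct2, THEN conjunct2, THEN conjunct1, rule_format]
  note r = iso[unfolded iso_by_def den_simps cmp_simps, THEN conjunct2, THEN conjunct2, THEN conjunct2, rule_format]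
  define \<Phi> where "\<Phi> = (\<lambda>\<Delta> a x. case a of Fn bs b \<Rightarrow> EL (\<phi> (\<Delta> @ [bs]) b (ups a x)) | _ \<Rightarrow> undefined)"
  define \<Psi> where "\<Psi> = (\<lambda>\<Delta> a x. case (a, x) of (Fn bs b, EL y) \<Rightarrow> chi P b (\<psi> (\<Delta> @ [bs]) b y) | _ \<Rightarrow> undefined)"
  have \<Phi>: "\<Phi> \<Delta> (Fn bs b) x = EL (\<phi> (\<Delta> @ [bs]) b (ups (Fn bs b) x))" for \<Delta> bs b x by (simp add: \<Phi>_def)
  have \<Psi>: "\<Psi> \<Delta> (Fn bs b) (EL y) = chi P b (\<psi> (\<Delta> @ [bs]) b y)" for \<Delta> bs b y by (simp add: \<Psi>_def)
  have S: "m0 + Suc k = Suc (m0 + k)" by simp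
  have "iso_by (cmp (LLam P) k) (den (LLam P') (m0 + k)) \<Phi> \<Psi>"
  proof (rule iso_byI[OF isf_cmp isf_den], unfold den_simps cmp_simps)
    show "nat_trans (cmp (LLam P) k) (den (LLam P') (m0 + k)) \<Phi>"
      unfolding nat_trans_def den_simps cmp_simps
    proof (intro conjI allI impI)
      fix \<Delta> a x y assume xy: "cE (LLam P) k \<Delta> a x y"
      from cE_dom(1)[OF xy] obtain bs b where a: "a = Fn bs b" by (rule cS_Lam_cases)
      show "eqv A C (LLam P') (m0 + k) \<Delta> a (\<Phi> \<Delta> a x) (\<Phi> \<Delta> a y)"
        unfolding a \<Phi> eqvLam_Fn using r\<phi>[OF ups_resp[OF xy[unfolded a]]] by simp
    next
      fix \<Delta> a \<Delta>' a' u f x assume x: "cS (LLam P) k \<Delta> a x" and u: "ctxhom A C \<Delta>' \<Delta> u" and f: "dhom A C a a' f"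
      from x obtain bs b \<Gamma> p \<theta> where e: "a = Fn bs b" "x = (\<Gamma>, EL p, \<theta>)" and p: "sem A C P (N0 + Suc k) (\<Gamma> @ [bs]) b p" and t: "bS k \<Delta> \<Gamma> \<theta>"
        by (rule cS_Lam_cases)
      from f e(1) obtain bs' b' \<alpha> fs f' where e': "a' = Fn bs' b'" "f = FM \<alpha> fs f'" and s: "shom A C bs' bs (\<alpha>, fs)" and f': "dhom A C b b' f'"
        by (blast elim: dhom_Fn_cases)
      let ?s = "(\<alpha>, fs)"
      let ?z = "(\<Gamma> @ [bs], p, up \<theta> (sid A bs))"
      have z: "cS P (Suc k) (\<Delta> @ [bs]) b ?z" using p bS_up[OF t shom_sid] by simp
      note us = ctxhom_snocI[OF u s] and h = ctxhom_snocI[OF ctxhom_cidc s, of \<Gamma>]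
      note p2 = sem_act[OF p ctxhom_cidc f'] and tu = bS_BL[OF t u]
      \<comment> \<open>The list part \<open>?s\<close> of the arrow acts on the body on one side
        and on the environment on the other; the generator along
        \<open>cidc A \<Gamma> @ [?s]\<close> connects them.\<close>
      have "cE P (Suc k) (\<Delta>' @ [bs']) b' (\<Gamma> @ [bs'], act A P (cidc A \<Gamma> @ [?s]) f' p, up (BL u \<theta>) (sid A bs')) (\<Gamma> @ [bs], act A P (cidc A (\<Gamma> @ [bs])) f' p, up (BL u \<theta>) ?s)"
      proof (rule cE_gen[OF bS_up[OF tu shom_sid] p2 h])
        show "eqv A C P (N0 + Suc k) (\<Gamma> @ [bs']) b' (act A P (cidc A \<Gamma> @ [?s]) f' p) (act A P (cidc A \<Gamma> @ [?s]) (did A b') (act A P (cidc A (\<Gamma> @ [bs])) f' p))"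
          using isf_ctx_last[OF isf_den _ h f', of P "N0 + Suc k", unfolded den_simps, OF p] .
        show "bE (Suc k) (\<Delta>' @ [bs']) (\<Gamma> @ [bs]) (up (BL u \<theta>) ?s) (BR (Suc k) (\<Gamma> @ [bs']) (cidc A \<Gamma> @ [?s]) (up (BL u \<theta>) (sid A bs')))"
          unfolding BR_up[OF tu ctxhom_cidc s] scomp_idl[OF shom_shomw[OF s]] by (rule bE_up[OF bE_sym[OF BR_id[OF tu]] s])
      qed
      also have "(\<Gamma> @ [bs], act A P (cidc A (\<Gamma> @ [bs])) f' p, up (BL u \<theta>) ?s) = cA P (u @ [?s]) f' ?z"
        by (simp add: cA_def BL_up[OF t u] scomp_idr[OF shom_shomw[OF s]])
      finally have "eqv A C P' (m0 + Suc k) (\<Delta>' @ [bs']) b' (\<phi> (\<Delta>' @ [bs']) b' (\<Gamma> @ [bs'], act A P (cidc A \<Gamma> @ [?s]) f' p, up (BL u \<theta>) (sid A bs')))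
          (act A P' (u @ [?s]) f' (\<phi> (\<Delta> @ [bs]) b ?z))"
        by (rule eqv_trans[OF r\<phi> n\<phi>[OF z us f']])
      then show "eqv A C (LLam P') (m0 + k) \<Delta>' a' (\<Phi> \<Delta>' a' (cA (LLam P) u f x)) (act A (LLam P') u f (\<Phi> \<Delta> a x))"
        by (simp add: e e' \<Phi> cA_def)
    qed
  next
    fix \<Delta> a x y assume xy: "eqv A C (LLam P') (m0 + k) \<Delta> a x y"
    then obtain bs b x' y' where e: "a = Fn bs b" "x = EL x'" "y = EL y'" "eqv A C P' (Suc (m0 + k)) (\<Delta> @ [bs]) b x' y'" by (rule eqvLam_cases)
    show "cE (LLam P) k \<Delta> a (\<Psi> \<Delta> a x) (\<Psi> \<Delta> a y)" unfolding e(1-3) \<Psi> by (rule chi_resp[OF r\<psi>]) (use e in simp)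
  next
    fix \<Delta> a x assume x: "cS (LLam P) k \<Delta> a x"
    then obtain bs b where e: "a = Fn bs b" by (rule cS_Lam_cases)
    note x = x[unfolded e]
    show "cE (LLam P) k \<Delta> a (\<Psi> \<Delta> a (\<Phi> \<Delta> a x)) x" unfolding e \<Phi> \<Psi>
      by (rule cE_trans[OF chi_resp[OF l[OF cE_dom(1)[OF ups_resp[OF cE_refl[OF x]]]]] chi_ups[OF x]])
  next
    fix \<Delta> a x assume x: "sem A C (LLam P') (m0 + k) \<Delta> a x"
    then obtain bs b x' where e: "a = Fn bs b" "x = EL x'" "sem A C P' (Suc (m0 + k)) (\<Delta> @ [bs]) b x'" by (rule semLam_cases)
    have x': "sem A C P' (m0 + Suc k) (\<Delta> @ [bs]) b x'" using e by simp
    have "eqv A C P' (m0 + Suc k) (\<Delta> @ [bs]) b (\<phi> (\<Delta> @ [bs]) b (ups (Fn bs b) (chi P b (\<psi> (\<Delta> @ [bs]) b x')))) x'"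
      by (rule eqv_trans[OF r\<phi>[OF ups_chi[OF cE_dom(1)[OF r\<psi>[OF eqv_refl[OF x']]]]] r[OF x']])
    then show "eqv A C (LLam P') (m0 + k) \<Delta> a (\<Phi> \<Delta> a (\<Psi> \<Delta> a x)) x" unfolding e(1,2) \<Phi> \<Psi> eqvLam_Fn by simp
  qed
  then show ?thesis unfolding isom_def by blast
qed

section \<open>Variables\<close>

lemma cS_LVar_cases:
  assumes "cS (LVar i) k \<Delta> a x"
  obtains \<Gamma> e \<theta> where "x = (\<Gamma>, EV e, \<theta>)" "ctxhom A C \<Gamma> (vctx (N0 + k) (N0 + k - 1 - i) a) e" "bS k \<Delta> \<Gamma> \<theta>" "i < N0 + k"
proof -
  obtain \<Gamma> y \<theta> where "x = (\<Gamma>, y, \<theta>)" by (cases x)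
  then show ?thesis using assms that by auto
qed

text \<open>The denotation of a variable is representable, so by the co-Yoneda lemma the coend evaluates the environments at the
  representing object.\<close>

lemma cmp_LVar:
  fixes G :: "('o, 'm, 'y) fn"
  assumes i: "i < N0 + k" and G: "isf (m0 + k) G"
  defines "vc \<equiv> vctx (N0 + k) (N0 + k - 1 - i)" and "vm \<equiv> vmor (N0 + k) (N0 + k - 1 - i)"
  assumes 1: "\<And>\<Delta> a \<theta> \<theta>'. bE k \<Delta> (vc a) \<theta> \<theta>' \<Longrightarrow> fE G \<Delta> a (\<rho> \<Delta> a \<theta>) (\<rho> \<Delta> a \<theta>')"
    and 2: "\<And>\<Delta> a y y'. fE G \<Delta> a y y' \<Longrightarrow> bE k \<Delta> (vc a) (\<rho>' \<Delta> a y) (\<rho>' \<Delta> a y')"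
    and 3: "\<And>\<Delta> a \<theta>. bS k \<Delta> (vc a) \<theta> \<Longrightarrow> bE k \<Delta> (vc a) (\<rho>' \<Delta> a (\<rho> \<Delta> a \<theta>)) \<theta>"
    and 4: "\<And>\<Delta> a y. fS G \<Delta> a y \<Longrightarrow> fE G \<Delta> a (\<rho> \<Delta> a (\<rho>' \<Delta> a y)) y"
    and 5: "\<And>\<Delta> a \<Delta>' a' u f \<theta>. bS k \<Delta> (vc a) \<theta> \<Longrightarrow> ctxhom A C \<Delta>' \<Delta> u \<Longrightarrow> dhom A C a a' f \<Longrightarrow>
       fE G \<Delta>' a' (\<rho> \<Delta>' a' (BR k (vc a) (vm f) (BL u \<theta>))) (fA G u f (\<rho> \<Delta> a \<theta>))"
  shows "isom (cmp (LVar i) k) G"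
proof -
  define \<Phi> where "\<Phi> = (\<lambda>\<Delta> a (x :: 'o ctx \<times> ('o, 'm) el \<times> _). case x of (\<Gamma>, EV e, \<theta>) \<Rightarrow> \<rho> \<Delta> a (BR k \<Gamma> e \<theta>) | _ \<Rightarrow> undefined)"
  \<comment> \<open>The identity of \<open>vc a\<close> is the universal element of the
    representable denotation.\<close>
  define \<Psi> where "\<Psi> = (\<lambda>\<Delta> a y. (vc a, EV (cidc A (vc a)), \<rho>' \<Delta> a y) :: 'o ctx \<times> ('o, 'm) el \<times> _)"
  have \<Phi>: "\<Phi> \<Delta> a (\<Gamma>, EV e, \<theta>) = \<rho> \<Delta> a (BR k \<Gamma> e \<theta>)" for \<Delta> a \<Gamma> e \<theta> by (simp add: \<Phi>_def)
  have act: "act A (LVar i) u f (EV h) = EV (u \<odot> h \<odot> vm f)" if "ctxhom A C \<Gamma> (vc a) h" "ctxhom A C \<Gamma>' \<Gamma> u" for u f h \<Gamma> \<Gamma>' a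
    unfolding vm_def by (rule act_LVar) (use that in \<open>simp_all add: vc_def\<close>)
  have vid: "vm (did A a) = cidc A (vc a)" for a unfolding vm_def vc_def by (rule vmor_did)
  have vh: "dhom A C a b f \<Longrightarrow> ctxhom A C (vc a) (vc b) (vm f)" for a b f unfolding vm_def vc_def by (rule ctxhom_vmor)
  have sV: "sem A C (LVar i) (N0 + k) \<Gamma> a x \<longleftrightarrow> (\<exists>e. x = EV e \<and> ctxhom A C \<Gamma> (vc a) e)" for \<Gamma> a x using i by (auto simp: vc_def)
  have "iso_by (cmp (LVar i) k) G \<Phi> \<Psi>"
  proof (rule iso_byI[OF isf_cmp G], unfold cmp_simps)
    show "nat_trans (cmp (LVar i) k) G \<Phi>" unfolding nat_trans_def cmp_simps
    proof (intro conjI allI impI)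
      fix \<Delta> a x y assume xy: "cE (LVar i) k \<Delta> a x y"
      show "fE G \<Delta> a (\<Phi> \<Delta> a x) (\<Phi> \<Delta> a y)"
      proof (rule cE_map[OF xy, where f="\<Phi> \<Delta> a" and T="fE G \<Delta> a"])
        fix x assume "cS (LVar i) k \<Delta> a x"
        then obtain \<Gamma> e \<theta> where e: "x = (\<Gamma>, EV e, \<theta>)" "ctxhom A C \<Gamma> (vc a) e" "bS k \<Delta> \<Gamma> \<theta>"
          unfolding vc_def by (rule cS_LVar_cases)
        show "fE G \<Delta> a (\<Phi> \<Delta> a x) (\<Phi> \<Delta> a x)" unfolding e(1) \<Phi> by (rule 1[OF bE_refl[OF bS_BR[OF e(3,2)]]])
      next
        fix \<Gamma> x' \<theta> \<Gamma>' x \<theta>' g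
        assume t: "bS k \<Delta> \<Gamma> \<theta>" and x: "sem A C (LVar i) (N0 + k) \<Gamma>' a x" and g: "ctxhom A C \<Gamma> \<Gamma>' g"
          and x': "eqv A C (LVar i) (N0 + k) \<Gamma> a x' (act A (LVar i) g (did A a) x)" and t': "bE k \<Delta> \<Gamma>' \<theta>' (BR k \<Gamma> g \<theta>)"
        obtain e where e: "x = EV e" "ctxhom A C \<Gamma>' (vc a) e" using x sV by blast
        have "x' = act A (LVar i) g (did A a) x" using x' by simp
        then have x'e: "x' = EV (g \<odot> e)"
          using ccompc_idr[OF ctxhom_ctxw[OF ctxhom_comp[OF g e(2)]]] by (simp only: e(1) act[OF e(2) g] vid)
        have "bE k \<Delta> (vc a) (BR k \<Gamma> (g \<odot> e) \<theta>) (BR k \<Gamma>' e \<theta>')"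
          by (rule bE_trans[OF BR_comp[OF t g e(2)] BR_cong[OF bE_sym[OF t'] e(2)]])
        then show "fE G \<Delta> a (\<Phi> \<Delta> a (\<Gamma>, x', \<theta>)) (\<Phi> \<Delta> a (\<Gamma>', x, \<theta>'))" unfolding x'e e(1) \<Phi> by (rule 1)
      qed (blast intro: isf_sym[OF G] isf_trans[OF G])+
    next
      fix \<Delta> a \<Delta>' a' u f x assume x: "cS (LVar i) k \<Delta> a x" and u: "ctxhom A C \<Delta>' \<Delta> u" and f: "dhom A C a a' f"
      from x obtain \<Gamma> e \<theta> where e: "x = (\<Gamma>, EV e, \<theta>)" "ctxhom A C \<Gamma> (vc a) e" "bS k \<Delta> \<Gamma> \<theta>"
        unfolding vc_def by (rule cS_LVar_cases)
      have 6: "cA (LVar i) u f x = (\<Gamma>, EV (e \<odot> vm f), BL u \<theta>)"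
        unfolding e(1) cA_def prod.case act[OF e(2) ctxhom_cidc] ccompc_idl[OF ctxhom_ctxw[OF e(2)]] ..
      have "bE k \<Delta>' (vc a') (BR k \<Gamma> (e \<odot> vm f) (BL u \<theta>)) (BR k (vc a) (vm f) (BL u (BR k \<Gamma> e \<theta>)))"
        using BR_comp[OF bS_BL[OF e(3) u] e(2) vh[OF f]] unfolding BR_BL[OF e(3) u e(2)] .
      from isf_trans[OF G 1[OF this] 5[OF bS_BR[OF e(3,2)] u f]]
      show "fE G \<Delta>' a' (\<Phi> \<Delta>' a' (cA (LVar i) u f x)) (fA G u f (\<Phi> \<Delta> a x))" unfolding 6 unfolding e(1) \<Phi> .
    qed
  next
    fix \<Delta> a y y' assume "fE G \<Delta> a y y'"
    from 2[OF this] show "cE (LVar i) k \<Delta> a (\<Psi> \<Delta> a y) (\<Psi> \<Delta> a y')"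
      unfolding \<Psi>_def by (intro cE_cong eqv_refl) (simp_all only: sV ctxhom_cidc el.inject ex_simps simp_thms)
  next
    fix \<Delta> a x assume "cS (LVar i) k \<Delta> a x"
    then obtain \<Gamma> e \<theta> where e: "x = (\<Gamma>, EV e, \<theta>)" "ctxhom A C \<Gamma> (vc a) e" "bS k \<Delta> \<Gamma> \<theta>"
      unfolding vc_def by (rule cS_LVar_cases)
    have a: "act A (LVar i) e (did A a) (EV (cidc A (vc a))) = EV e"
      unfolding act[OF ctxhom_cidc e(2)] vid by (simp only: ccompc_idr[OF ctxhom_ctxw[OF e(2)]])
    show "cE (LVar i) k \<Delta> a (\<Psi> \<Delta> a (\<Phi> \<Delta> a x)) x" unfolding e(1) \<Phi> \<Psi>_def
    proof (rule cE_sym, rule cE_gen[OF e(3) _ e(2)])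
      show "sem A C (LVar i) (N0 + k) (vc a) a (EV (cidc A (vc a)))" unfolding sV using ctxhom_cidc by blast
      show "eqv A C (LVar i) (N0 + k) \<Gamma> a (EV e) (act A (LVar i) e (did A a) (EV (cidc A (vc a))))"
        unfolding a by (rule eqv_refl) (use sV e(2) in blast)
      show "bE k \<Delta> (vc a) (\<rho>' \<Delta> a (\<rho> \<Delta> a (BR k \<Gamma> e \<theta>))) (BR k \<Gamma> e \<theta>)" by (rule 3[OF bS_BR[OF e(3,2)]])
    qed
  next
    fix \<Delta> a y assume y: "fS G \<Delta> a y"
    note t = bE_dom(1)[OF 2[OF isf_refl[OF G y]]]
    show "fE G \<Delta> a (\<Phi> \<Delta> a (\<Psi> \<Delta> a y)) y" unfolding \<Psi>_def \<Phi>
      by (rule isf_trans[OF G 1[OF BR_id[OF t]] 4[OF y]])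
  qed
  then show ?thesis unfolding isom_def by blast
qed

text \<open>Exactly one new position is fed from \<open>p\<close>; a copied or dropped component
  would not give a \<open>vctx\<close> again.\<close>

lemma kob_vctx:
  assumes "\<And>c. c < m \<Longrightarrow> \<kappa>' c = Some p \<longleftrightarrow> c = p'" "kval m \<kappa>' N"
  shows "kob m \<kappa>' (vctx N p a) = vctx m p' a" "kmor m \<kappa>' (vmor N p f) = vmor m p' f"
proof -
  have c: "(case \<kappa>' c of None \<Rightarrow> [] | Some d \<Rightarrow> vctx N p a ! d) = (if c = p' then [a] else [])"
    "(case \<kappa>' c of None \<Rightarrow> ([], []) | Some d \<Rightarrow> vmor N p f ! d) = (if c = p' then ([0], [f]) else ([], []))" if "c < m" for c
    using assms(1)[OF that] assms(2) that by (cases "\<kappa>' c"; auto simp: nth_vctx nth_vmor)+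
  show "kob m \<kappa>' (vctx N p a) = vctx m p' a" "kmor m \<kappa>' (vmor N p f) = vmor m p' f"
    by (auto simp: kob_def kmor_def vctx_def[of m] vmor_def[of m] c)
qed

lemma cprj_single: "length \<Gamma> = m \<Longrightarrow> cprj m [\<Gamma>] 0 = cidc A \<Gamma>"
  using cblock_id[of "[\<Gamma>]" m] by (simp add: cprj_def)

text \<open>With empty bags a generator has nothing to move, and its \<open>wmor\<close> is an
  identity.\<close>

lemma bE_Nil:
  assumes "bE k \<Delta> \<Gamma> \<theta> \<theta>'" "pco \<Gamma> = []"
  shows "\<theta> = \<theta>'"
proof (rule equivclose_map[OF assms(1)[unfolded bE_def], where f="\<lambda>x. x" and T="(=)"])
  fix x y assume x: "bS k \<Delta> \<Gamma> x" "bgen k \<Gamma> x y"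
  then obtain vs where v: "bagto [] (fst x) vs (fst y)" "snd y = snd x \<odot> wmor k \<Gamma> (fst x) vs"
    unfolding bgen_def assms(2) by blast
  have b: "fst x = []" "fst y = []" "vs = []" using bagto_len[OF v(1)] by simp_all
  have h: "ctxhom A C \<Delta> (tgt k \<Gamma> (fst x)) (snd x)" using x(1) by (simp add: bS_def)
  have "wmor k \<Gamma> [] [] = cidc A (tgt k \<Gamma> [])" using wmor_bids[of "[]" "[]" k \<Gamma>] by (simp add: bids_def bagok_def)
  then have "snd y = snd x" using v(2) ccompc_idr[OF ctxhom_ctxw[OF h]] by (simp add: b)
  then show "x = y" using b by (simp add: prod_eq_iff)
qed auto

lemma tgt_Nil: "tgt k \<Gamma> [] = K k \<Gamma>"
  by (simp add: objs_def)

lemma rmap_Nil: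
  assumes "ctxhom A C \<Gamma> \<Gamma>' g" "length \<Gamma> = N0 + k" "pco \<Gamma> = []" "pco \<Gamma>' = []"
  shows "rmap k \<Gamma> [] g = Km k g"
proof -
  have ok: "bagok (pco \<Gamma>) []" using assms by (simp add: bagok_def)
  have s: "shomw [] [] (pcm g)" using shom_shomw[OF shom_pcm[OF assms(1,2)]] assms by simp
  then have b: "bagact (pcm g) [] = []" by (simp add: bagact_def shomw_def)
  have o: "objs k \<Gamma>'' [] = [K k \<Gamma>'']" for \<Gamma>'' by (simp add: objs_def)
  note r = rmap[OF assms(1,2) ok, unfolded b o]
  have R: "ctxw (K k \<Gamma>) (K k \<Gamma>') (rmap k \<Gamma> [] g)" using ctxhom_ctxw[OF r(1)] by simp
  show ?thesis using r(2) ccompc_idr[OF R] ccompc_idl[OF ctxhom_ctxw[OF ctxhom_Km[OF assms(2,1)]]] by (simp add: cprj_single)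
qed

lemma bS_Nil: "pco \<Gamma> = [] \<Longrightarrow> bS k \<Delta> \<Gamma> \<theta> \<longleftrightarrow> length \<Gamma> = N0 + k \<and> fst \<theta> = [] \<and> ctxhom A C \<Delta> (K k \<Gamma>) (snd \<theta>)"
  by (auto simp: bS_def bagok_def tgt_Nil)

lemma BR_Nil:
  assumes "ctxhom A C \<Gamma> \<Gamma>' g" "length \<Gamma> = N0 + k" "pco \<Gamma> = []" "pco \<Gamma>' = []" "fst \<theta> = []"
  shows "BR k \<Gamma> g \<theta> = ([], snd \<theta> \<odot> Km k g)"
proof -
  have "shomw [] [] (pcm g)" using shom_shomw[OF shom_pcm[OF assms(1,2)]] assms by simp
  then have "bagact (pcm g) [] = []" by (simp add: bagact_def shomw_def)
  then show ?thesis by (simp add: BR_def assms rmap_Nil[OF assms(1-4)])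
qed

text \<open>Nothing is demanded from \<open>Q\<close> here, so environments at the representing
  object are plain morphisms into its image under \<open>K\<close>, which is the hom-set of a
  variable again.\<close>

lemma cmp_LVar_other:
  assumes i: "i < N0 + k" and i': "i' < m0 + k" and np: "p0 \<noteq> Some (N0 + k - 1 - i)"
    and c: "\<And>c. c < m0 + k \<Longrightarrow> kap c = Some (N0 + k - 1 - i) \<longleftrightarrow> c = m0 + k - 1 - i'"
  shows "isom (cmp (LVar i) k) (den (LVar i') (m0 + k))"
proof -
  let ?p = "N0 + k - 1 - i" and ?p' = "m0 + k - 1 - i'"
  have kv: "kob (m0 + k) kap (vctx (N0 + k) ?p a) = vctx (m0 + k) ?p' a" "kmor (m0 + k) kap (vmor (N0 + k) ?p f) = vmor (m0 + k) ?p' f" for a f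
    using kob_vctx[of "m0 + k" kap ?p ?p' "N0 + k"] c kval_kap by blast+
  have pc: "pco (vctx (N0 + k) ?p a) = []" for a
    using p0 np by (auto simp: pco_def nth_vctx split: option.split if_splits)
  have S: "bS k \<Delta> (vctx (N0 + k) ?p a) \<theta> \<longleftrightarrow> fst \<theta> = [] \<and> ctxhom A C \<Delta> (vctx (m0 + k) ?p' a) (snd \<theta>)" for \<Delta> a \<theta>
    unfolding bS_Nil[OF pc] kv by simp
  define un where "un = (\<lambda>x :: ('o, 'm) el. case x of EV h \<Rightarrow> h | _ \<Rightarrow> undefined)"
  have un: "un (EV h) = h" for h by (simp add: un_def)
  have s: "sem A C (LVar i') (m0 + k) \<Delta> a y \<longleftrightarrow> (\<exists>h. y = EV h \<and> ctxhom A C \<Delta> (vctx (m0 + k) ?p' a) h)" for \<Delta> a y using i' by auto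
  show ?thesis
  proof (rule cmp_LVar[OF i isf_den, where \<rho>="\<lambda>\<Delta> a \<theta>. EV (snd \<theta>)" and \<rho>'="\<lambda>\<Delta> a y. ([], un y)"], unfold den_simps)
    fix \<Delta> a \<theta> \<theta>' assume e: "bE k \<Delta> (vctx (N0 + k) ?p a) \<theta> \<theta>'"
    then show "eqv A C (LVar i') (m0 + k) \<Delta> a (EV (snd \<theta>)) (EV (snd \<theta>'))"
      using bE_Nil[OF e pc] bE_dom(1)[OF e] unfolding S by (auto intro!: eqv_refl simp: s simp del: sem.simps eqv.simps)
  next
    fix \<Delta> a y y' assume "eqv A C (LVar i') (m0 + k) \<Delta> a y y'"
    then have "y = y'" "sem A C (LVar i') (m0 + k) \<Delta> a y" unfolding eqv.simps by blast+
    then show "bE k \<Delta> (vctx (N0 + k) ?p a) ([], un y) ([], un y')"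
      unfolding s by (elim exE conjE) (hypsubst, unfold un, rule bE_refl, unfold S fst_conv snd_conv, intro conjI refl)
  next
    fix \<Delta> a \<theta> assume t: "bS k \<Delta> (vctx (N0 + k) ?p a) \<theta>"
    then have "([], un (EV (snd \<theta>))) = \<theta>" unfolding S un by (simp add: prod_eq_iff)
    then show "bE k \<Delta> (vctx (N0 + k) ?p a) ([], un (EV (snd \<theta>))) \<theta>" using bE_refl[OF t] by simp
  next
    fix \<Delta> a y assume y: "sem A C (LVar i') (m0 + k) \<Delta> a y"
    then show "eqv A C (LVar i') (m0 + k) \<Delta> a (EV (snd ([], un y))) y" by (auto simp: un s)
  next
    fix \<Delta> a \<Delta>' a' u f \<theta> assume t: "bS k \<Delta> (vctx (N0 + k) ?p a) \<theta>" and u: "ctxhom A C \<Delta>' \<Delta> u" and f: "dhom A C a a' f"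
    have h: "fst \<theta> = []" "ctxhom A C \<Delta> (vctx (m0 + k) ?p' a) (snd \<theta>)" using t unfolding S by auto
    have X: "snd (BR k (vctx (N0 + k) ?p a) (vmor (N0 + k) ?p f) (BL u \<theta>)) = u \<odot> snd \<theta> \<odot> vmor (m0 + k) ?p' f"
      using BR_Nil[OF ctxhom_vmor[OF f] _ pc pc, of k "BL u \<theta>"] h(1) unfolding kv by (simp add: BL_def)
    show "eqv A C (LVar i') (m0 + k) \<Delta>' a' (EV (snd (BR k (vctx (N0 + k) ?p a) (vmor (N0 + k) ?p f) (BL u \<theta>)))) (act A (LVar i') u f (EV (snd \<theta>)))"
      unfolding act_LVar[OF h(2) u] X by (rule eqv_refl, unfold s, rule exI, rule conjI, rule refl) (rule ctxhom_comp[OF ctxhom_comp[OF u h(2)] ctxhom_vmor[OF f]])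
  qed
qed

text \<open>\<open>R k\<close> stands for the syntactic operation below \<open>k\<close> binders,
  weakening or substitution. It has to commute with the constructors; the difference between the two
  operations is confined to \<open>V\<close>.\<close>

theorem cmp_iso:
  assumes R: "\<And>k t. R k (LLam t) = LLam (R (Suc k) t)" "\<And>k s t. R k (LApp s t) = LApp (R k s) (R k t)"
    and V: "\<And>k i. i < N0 + k \<Longrightarrow> isom (cmp (LVar i) k) (den (R k (LVar i)) (m0 + k))"
  shows "fv_below (N0 + k) P \<Longrightarrow> isom (cmp P k) (den (R k P) (m0 + k))"
proof (induction P arbitrary: k)
  case (LVar i)
  then show ?case using V by simp
next
  case (LLam P)
  then show ?case unfolding R using cmp_LLam[of P k "R (Suc k) P"] LLam.IH[of "Suc k"] by simp
next
  case (LApp P M)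
  then show ?case unfolding R by (intro cmp_LApp) simp_all
qed

end

section \<open>Weakening and substitution\<close>

context env
begin

text \<open>The \<open>l\<close> new components come last, so old positions keep their numbers while
  de Bruijn indices, which count from the end, grow by \<open>l\<close> unless they belong to a
  binder met on the way.\<close>

lemma cmp_lift:
  assumes "p0 = None" "m0 = N0 + l" "\<And>c. c < m0 \<Longrightarrow> \<kappa> c = (if c < N0 then Some c else None)" "fv_below N0 P"
  shows "isom (cmp P 0) (den (((\<lambda>s. lift s 0) ^^ l) P) m0)"
proof -
  define R where "R j P = ((\<lambda>s. lift s j) ^^ l) P" for j P
  have v: "R j (LVar i) = LVar (if i < j then i else i + l)" for j i
    unfolding R_def by (induction l) auto
  have "R j (LLam t) = LLam (R (Suc j) t)" "R j (LApp s t) = LApp (R j s) (R j t)" for j s t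
    unfolding R_def by (induction l) auto
  moreover have "isom (cmp (LVar i) j) (den (R j (LVar i)) (m0 + j))" if "i < N0 + j" for j i
    unfolding v using assms that kap_def by (intro cmp_LVar_other) (auto simp: kap_def)
  ultimately have "isom (cmp P 0) (den (R 0 P) (m0 + 0))" by (rule cmp_iso) (use assms(4) in simp_all)
  then show ?thesis by (simp add: R_def)
qed

text \<open>At the replaced variable the bag has one entry and \<open>K\<close> contributes nothing,
  so an environment is an element of \<open>Q\<close> at some \<open>\<Gamma>\<close> with a
  morphism into \<open>J k \<Gamma>\<close>. This is the composite of \<open>Q\<close> with a
  weakening environment, which \<open>cmp_lift\<close> evaluates.\<close>

lemma cmp_LVar_sub:
  assumes i: "i < N0 + k" and p: "p0 = Some (N0 + k - 1 - i)" and kn: "\<And>c. c < m0 + k \<Longrightarrow> kap c \<noteq> Some (N0 + k - 1 - i)"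
    and \<iota>n: "\<And>c. c < m0 \<Longrightarrow> \<iota> c = Some c" and nq: "nq = m0" and Q: "fv_below m0 Q"
  shows "isom (cmp (LVar i) k) (den (((\<lambda>s. lift s 0) ^^ k) Q) (m0 + k))"
proof -
  \<comment> \<open>Environments for weakening \<open>Q\<close> by \<open>k\<close> binders:
    \<open>iot\<close> is the reindexing and no position is fed by elements.\<close>
  interpret W: env A C "m0 + k" m0 m0 iot "\<lambda>_. None" None Q
    by unfold_locales (use kval_iot nq in auto)
  have W: "isom (W.cmp Q 0) (den (((\<lambda>s. lift s 0) ^^ k) Q) (m0 + k))"
    by (rule W.cmp_lift) (use Q \<iota>n in \<open>auto simp: iot_def\<close>)
  have WK: "W.K 0 \<Gamma> = J k \<Gamma>" and WKm: "W.Km 0 v = Jm k v" for \<Gamma> v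
    by (auto simp: kob_def kmor_def W.kap_def)
  have Wp: "W.pco \<Gamma> = []" for \<Gamma> by (simp add: W.pco_def)
  have WbS: "W.bS 0 \<Delta> \<Gamma> \<theta> \<longleftrightarrow> length \<Gamma> = m0 \<and> fst \<theta> = [] \<and> ctxhom A C \<Delta> (J k \<Gamma>) (snd \<theta>)" for \<Delta> \<Gamma> \<theta>
    unfolding W.bS_Nil[OF Wp] WK by simp
  define p where "p = N0 + k - 1 - i"
  have pN: "p < N0 + k" "p0 = Some p" using i assms(2) by (auto simp: p_def)
  let ?vc = "vctx (N0 + k) p" and ?vm = "vmor (N0 + k) p" and ?m = "m0 + k"
  have pc: "pco (?vc a) = [a]" and pm: "pcm (?vm f) = ([0], [f])" for a f
    unfolding pco_def pcm_def using pN by (auto simp: nth_vctx nth_vmor)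
  \<comment> \<open>No new position reads the replaced component, so \<open>K\<close> of the
    representing object is empty everywhere.\<close>
  have Kv: "K k (?vc a) = map (\<lambda>_. []) [0..<?m]" for a
    using kn kval_kap[of k] by (auto simp: kob_def nth_vctx p_def split: option.split)
  have o: "objs k (?vc a) [x] = [map (\<lambda>_. []) [0..<?m], J k (fst x)]" for a x by (simp add: objs_def Kv)
  have t: "tgt k (?vc a) [x] = J k (fst x)" for a x
    unfolding o by (auto simp: ctensor_def intro!: nth_equalityI)
  have pj: "cprj ?m (objs k (?vc a) [x]) (Suc 0) = cidc A (J k (fst x))" for a x
    unfolding o by (auto simp: nth_cprj prj_def sid_def cidc_def map_idI intro!: nth_equalityI)
  have bS: "bS k \<Delta> (?vc a) ([(\<Gamma>, q)], h) \<longleftrightarrow> sem A C Q m0 \<Gamma> a q \<and> ctxhom A C \<Delta> (J k \<Gamma>) h" for \<Delta> a \<Gamma> q h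
    unfolding bS_def bagok_def pc fst_conv t by (simp add: nq)
  have bSD: "\<exists>\<Gamma> q h. \<theta> = ([(\<Gamma>, q)], h) \<and> sem A C Q m0 \<Gamma> a q \<and> ctxhom A C \<Delta> (J k \<Gamma>) h" if "bS k \<Delta> (?vc a) \<theta>" for \<Delta> a \<theta>
  proof -
    obtain b h where \<theta>: "\<theta> = (b, h)" by fastforce
    have "length b = 1" using that unfolding bS_def bagok_def pc \<theta> by simp
    then obtain x where "b = [x]" by (auto simp: length_Suc_conv)
    then have "\<theta> = ([(fst x, snd x)], h)" by (simp add: \<theta>)
    then show ?thesis using that bS by blast
  qed
  have wm: "wmor k (?vc a) [(\<Gamma>, q)] [v] = Jm k v" if b: "bagto [a] [(\<Gamma>, q)] [v] [(\<Gamma>', q')]" for a \<Gamma> q v \<Gamma>' q'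
  proof -
    note w = wmor[of "?vc a", unfolded pc, OF b, where k=k]
    have "ctxhom A C \<Gamma> \<Gamma>' v" "length \<Gamma> = nq" using b sem_len by (auto simp: bagto_def bagok_def)
    note J = ctxhom_ctxw[OF ctxhom_Jm[OF this(2,1), of k]]
    show ?thesis using w(3)[where j=0, unfolded pj nth_Cons_0] ccompc_idr[OF ctxhom_ctxw[OF w(1)]] ccompc_idl[OF J] by (simp add: t)
  qed
  have rm: "rmap k (?vc a) [(\<Gamma>, q)] (?vm f) = cidc A (J k \<Gamma>)"
    "bagact (pcm (?vm f)) [(\<Gamma>, q)] = [(\<Gamma>, act A Q (cidc A \<Gamma>) f q)]" if "dhom A C a a' f" "sem A C Q m0 \<Gamma> a q" for a a' f \<Gamma> q
  proof -
    show e: "bagact (pcm (?vm f)) [(\<Gamma>, q)] = [(\<Gamma>, act A Q (cidc A \<Gamma>) f q)]" by (simp add: bagact_def pm)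
    have "bagok (pco (?vc a)) [(\<Gamma>, q)]" using that(2) unfolding bagok_def pc by (simp add: nq)
    note r = rmap[OF ctxhom_vmor[OF that(1)] length_vctx this, unfolded e]
    show "rmap k (?vc a) [(\<Gamma>, q)] (?vm f) = cidc A (J k \<Gamma>)"
      using r(3)[where j=0, unfolded pj pc pm] ccompc_idr[OF ctxhom_ctxw[OF r(1)]] by (simp add: t pj)
  qed
  \<comment> \<open>\<open>\<rho>\<close> and \<open>\<rho>'\<close> move the single entry between
    the bag and the coend of \<open>W.cmp\<close>; a generator for bags on one side is a sliding on
    the other.\<close>
  define \<rho> where "\<rho> = (\<lambda>\<theta> :: ('o ctx \<times> ('o, 'm) el) list \<times> 'm smor list.
     (fst (hd (fst \<theta>)), snd (hd (fst \<theta>)), ([], snd \<theta>) :: ('o ctx \<times> ('o, 'm) el) list \<times> 'm smor list))"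
  define \<rho>' where "\<rho>' = (\<lambda>(\<Gamma> :: 'o ctx, q :: ('o, 'm) el, \<theta> :: ('o ctx \<times> ('o, 'm) el) list \<times> 'm smor list). ([(\<Gamma>, q)], snd \<theta>))"
  have \<rho>: "\<rho> ([(\<Gamma>, q)], h) = (\<Gamma>, q, ([], h))" and \<rho>': "\<rho>' (\<Gamma>, q, \<theta>) = ([(\<Gamma>, q)], snd \<theta>)" for \<Gamma> q h \<theta>
    by (simp_all add: \<rho>_def \<rho>'_def)
  have gen: "bgen k (?vc a) ([(\<Gamma>, q)], h) ([(\<Gamma>', q')], h \<odot> Jm k v)" "bS k \<Delta> (?vc a) ([(\<Gamma>', q')], h \<odot> Jm k v)"
    if "sem A C Q m0 \<Gamma>' a q'" "ctxhom A C \<Gamma> \<Gamma>' v" "eqv A C Q m0 \<Gamma> a q (act A Q v (did A a) q')" "ctxhom A C \<Delta> (J k \<Gamma>) h" for \<Gamma> q h \<Gamma>' q' v a \<Delta>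
  proof -
    have q: "sem A C Q m0 \<Gamma> a q" by (rule eqv_sem(1)[OF that(3)])
    have b: "bagto [a] [(\<Gamma>, q)] [v] [(\<Gamma>', q')]" using that q unfolding bagto_def bagok_def by (simp add: nq)
    then have "bagto (pco (?vc a)) [(\<Gamma>, q)] [v] [(\<Gamma>', q')]" by (simp only: pc)
    then show "bgen k (?vc a) ([(\<Gamma>, q)], h) ([(\<Gamma>', q')], h \<odot> Jm k v)"
      unfolding bgen_def using wm[OF b] by auto
    have "length \<Gamma> = nq" using sem_len[OF q] nq by simp
    then show "bS k \<Delta> (?vc a) ([(\<Gamma>', q')], h \<odot> Jm k v)" unfolding bS by (intro conjI that(1) ctxhom_comp[OF that(4)] ctxhom_Jm that(2))
  qed
  have "isom (cmp (LVar i) k) (W.cmp Q 0)"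
  proof (rule cmp_LVar[OF i W.isf_cmp[of 0, unfolded add_0_right], where \<rho>="\<lambda>_ _. \<rho>" and \<rho>'="\<lambda>_ _. \<rho>'", unfolded W.cmp_simps, folded p_def])
    fix \<Delta> a \<theta> \<theta>' assume e: "bE k \<Delta> (?vc a) \<theta> \<theta>'"
    show "W.cE Q 0 \<Delta> a (\<rho> \<theta>) (\<rho> \<theta>')"
    proof (rule equivclose_map[OF e[unfolded bE_def], where f=\<rho> and T="W.cE Q 0 \<Delta> a", OF _ _ W.cE_sym W.cE_trans])
      fix x assume "bS k \<Delta> (?vc a) x"
      then obtain \<Gamma> q h where x: "x = ([(\<Gamma>, q)], h)" "sem A C Q m0 \<Gamma> a q" "ctxhom A C \<Delta> (J k \<Gamma>) h" using bSD by blast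
      have "W.cS Q 0 \<Delta> a (\<Gamma>, q, ([], h))" using x sem_len[OF x(2)] by (simp add: WbS)
      then show "W.cE Q 0 \<Delta> a (\<rho> x) (\<rho> x)" unfolding x \<rho> by (rule W.cE_refl)
    next
      fix x y assume "bS k \<Delta> (?vc a) x" "bS k \<Delta> (?vc a) y" and g: "bgen k (?vc a) x y"
      then obtain \<Gamma> q h \<Gamma>' q' h' where x: "x = ([(\<Gamma>, q)], h)" "sem A C Q m0 \<Gamma> a q" "ctxhom A C \<Delta> (J k \<Gamma>) h"
        and y: "y = ([(\<Gamma>', q')], h')" "sem A C Q m0 \<Gamma>' a q'" "ctxhom A C \<Delta> (J k \<Gamma>') h'" using bSD by meson
      obtain vs where vs: "bagto [a] [(\<Gamma>, q)] vs [(\<Gamma>', q')]" "h' = h \<odot> wmor k (?vc a) [(\<Gamma>, q)] vs"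
        using g unfolding bgen_def x y pc by auto
      then obtain v where v: "vs = [v]" by (auto simp: bagto_def length_Suc_conv)
      have h': "h' = h \<odot> Jm k v" using vs(2) unfolding v wm[OF vs(1)[unfolded v]] .
      have b: "ctxhom A C \<Gamma> \<Gamma>' v" "eqv A C Q m0 \<Gamma> a q (act A Q v (did A a) q')" using vs(1) unfolding bagto_def v by (simp_all add: nq)
      have l: "length \<Gamma> = m0" "length \<Gamma>' = m0" using x y sem_len by blast+
      show "W.cE Q 0 \<Delta> a (\<rho> x) (\<rho> y)" unfolding x y \<rho>
      proof (rule W.cE_gen[OF _ _ b(1)])
        show "W.bS 0 \<Delta> \<Gamma> ([], h)" using x l by (simp add: WbS)
        have "W.BR 0 \<Gamma> v ([], h) = ([], snd ([] :: ('o ctx \<times> ('o, 'm) el) list, h) \<odot> W.Km 0 v)" by (rule W.BR_Nil[OF b(1) _ Wp Wp]) (simp_all add: l)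
        then have "W.BR 0 \<Gamma> v ([], h) = ([], h')" unfolding WKm h' by simp
        moreover have "W.bS 0 \<Delta> \<Gamma>' ([], h')" using y l by (simp add: WbS)
        ultimately show "W.bE 0 \<Delta> \<Gamma>' ([], h') (W.BR 0 \<Gamma> v ([], h))" using W.bE_refl by simp
      qed (use b y in simp_all)
    qed
  next
    fix \<Delta> a y y' assume e: "W.cE Q 0 \<Delta> a y y'"
    show "bE k \<Delta> (?vc a) (\<rho>' y) (\<rho>' y')"
    proof (rule W.cE_map[OF e, where f=\<rho>' and T="bE k \<Delta> (?vc a)", OF _ _ bE_sym bE_trans])
      fix x assume x: "W.cS Q 0 \<Delta> a x"
      obtain \<Gamma> q \<theta> where e: "x = (\<Gamma>, q, \<theta>)" by (metis prod_cases3)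
      have "sem A C Q m0 \<Gamma> a q" "ctxhom A C \<Delta> (J k \<Gamma>) (snd \<theta>)" using x by (simp_all add: e WbS)
      then show "bE k \<Delta> (?vc a) (\<rho>' x) (\<rho>' x)" unfolding e \<rho>' by (intro bE_refl) (simp only: bS simp_thms)
    next
      fix \<Gamma> p' \<theta> \<Gamma>' p \<theta>' g
      assume a: "W.bS 0 \<Delta> \<Gamma> \<theta>" "sem A C Q (m0 + 0) \<Gamma>' a p" "ctxhom A C \<Gamma> \<Gamma>' g"
        "eqv A C Q (m0 + 0) \<Gamma> a p' (act A Q g (did A a) p)" "W.bE 0 \<Delta> \<Gamma>' \<theta>' (W.BR 0 \<Gamma> g \<theta>)"
      have s: "length \<Gamma> = m0" "fst \<theta> = []" "ctxhom A C \<Delta> (J k \<Gamma>) (snd \<theta>)" using a(1) unfolding WbS by auto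
      have "\<theta>' = W.BR 0 \<Gamma> g \<theta>" by (rule W.bE_Nil[OF a(5) Wp])
      also have "\<dots> = ([], snd \<theta> \<odot> W.Km 0 g)" by (rule W.BR_Nil[OF a(3) _ Wp Wp s(2)]) (simp add: s(1))
      finally have \<theta>': "snd \<theta>' = snd \<theta> \<odot> Jm k g" unfolding WKm by simp
      note g = gen[OF a(2)[unfolded add_0_right] a(3) a(4)[unfolded add_0_right] s(3)]
      show "bE k \<Delta> (?vc a) (\<rho>' (\<Gamma>, p', \<theta>)) (\<rho>' (\<Gamma>', p, \<theta>'))" unfolding \<rho>' \<theta>'
        by (rule bE_gen[OF _ g(2,1)]) (use s eqv_sem(1)[OF a(4)] in \<open>simp add: bS\<close>)
    qed
  next
    fix \<Delta> a \<theta> assume t: "bS k \<Delta> (?vc a) \<theta>"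
    then obtain \<Gamma> q h where x: "\<theta> = ([(\<Gamma>, q)], h)" using bSD by blast
    show "bE k \<Delta> (?vc a) (\<rho>' (\<rho> \<theta>)) \<theta>" using bE_refl[OF t] by (simp add: x \<rho> \<rho>')
  next
    fix \<Delta> a y assume y: "W.cS Q 0 \<Delta> a y"
    obtain \<Gamma> q \<theta> where e: "y = (\<Gamma>, q, \<theta>)" by (metis prod_cases3)
    have "\<rho> (\<rho>' y) = y" using y by (simp add: e \<rho> \<rho>' WbS prod_eq_iff)
    then show "W.cE Q 0 \<Delta> a (\<rho> (\<rho>' y)) y" using W.cE_refl[OF y] by simp
  next
    fix \<Delta> a \<Delta>' a' u f \<theta> assume th: "bS k \<Delta> (?vc a) \<theta>" and u: "ctxhom A C \<Delta>' \<Delta> u" and f: "dhom A C a a' f"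
    obtain \<Gamma> q h where x: "\<theta> = ([(\<Gamma>, q)], h)" "sem A C Q m0 \<Gamma> a q" "ctxhom A C \<Delta> (J k \<Gamma>) h" using bSD[OF th] by blast
    note uh = ctxhom_comp[OF u x(3)]
    have "BR k (?vc a) (?vm f) (BL u \<theta>) = ([(\<Gamma>, act A Q (cidc A \<Gamma>) f q)], u \<odot> h)"
      unfolding BR_def BL_def x using rm[OF f x(2)] ccompc_idr[OF ctxhom_ctxw[OF uh]] by simp
    moreover have "W.cA Q u f (\<rho> \<theta>) = (\<Gamma>, act A Q (cidc A \<Gamma>) f q, ([], u \<odot> h))" by (simp add: x \<rho> W.cA_def W.BL_def)
    moreover have "W.cS Q 0 \<Delta>' a' (\<Gamma>, act A Q (cidc A \<Gamma>) f q, ([], u \<odot> h))"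
      using sem_act[OF x(2) ctxhom_cidc f] uh sem_len[OF x(2)] by (simp add: WbS)
    ultimately show "W.cE Q 0 \<Delta>' a' (\<rho> (BR k (?vc a) (?vm f) (BL u \<theta>))) (W.cA Q u f (\<rho> \<theta>))"
      using W.cE_refl by (simp add: \<rho>)
  qed
  then show ?thesis by (rule isom_trans[OF isf_cmp W.isf_cmp[of 0, unfolded add_0_right] isf_den _ W])
qed

end

text \<open>Components below \<open>n\<close> are kept by \<open>\<kappa>\<close> and
  \<open>\<iota>\<close>. Component \<open>n\<close>, the last one, is fed by \<open>Q\<close>: it
  belongs to de Bruijn index 0, since the newest binder is appended at the end.\<close>

locale subst_env = env A C n "Suc n" n Some Some "Some n" Q for A :: "('o, 'm) cat" and C n Q
begin

lemma cmp_subst: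
  assumes "fv_below (Suc n) P" "fv_below n Q"
  shows "isom (cmp P 0) (den (subst P Q 0) n)"
proof -
  \<comment> \<open>At each binder \<open>subst\<close> lifts the inserted term and increases the
    index, which amounts to \<open>k\<close> lifts and index \<open>k\<close> below \<open>k\<close>
    binders.\<close>
  define R where "R k P = subst P (((\<lambda>s. lift s 0) ^^ k) Q) k" for k P
  have V: "isom (cmp (LVar i) k) (den (R k (LVar i)) (n + k))" if i: "i < Suc n + k" for k i
  proof (cases "i = k")
    case True
    have "R k (LVar i) = ((\<lambda>s. lift s 0) ^^ k) Q" by (simp add: R_def True)
    then show ?thesis using assms(2) i True by (simp only:) (rule cmp_LVar_sub; auto simp: kap_def)
  next
    case False
    then have "R k (LVar i) = LVar (if k < i then i - 1 else i)" by (simp add: R_def)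
    then show ?thesis using False i by (simp only:) (rule cmp_LVar_other; auto simp: kap_def)
  qed
  have "isom (cmp P 0) (den (R 0 P) (n + 0))"
    by (rule cmp_iso[OF _ _ V]) (use assms in \<open>auto simp: R_def\<close>)
  then show ?thesis by (simp add: R_def)
qed

end

section \<open>The redex\<close>

context subst_env
begin

lemma kob_kap: "length \<Gamma> = n \<Longrightarrow> kob n kap (\<Gamma> @ [x]) = \<Gamma>"
  by (rule nth_equalityI) (simp_all add: kob_def kap_def nth_append)

lemma kmor_kap: "length u = n \<Longrightarrow> kmor n kap (u @ [s]) = u"
  by (rule nth_equalityI) (simp_all add: kmor_def kap_def nth_append)

lemma kob_iot: "length \<Gamma> = n \<Longrightarrow> kob n iot \<Gamma> = \<Gamma>"
  by (rule nth_equalityI) (simp_all add: kob_def iot_def)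

lemma kmor_iot: "length u = n \<Longrightarrow> kmor n iot u = u"
  by (rule nth_equalityI) (simp_all add: kmor_def iot_def)

lemma pco_last: "length \<Gamma> = n \<Longrightarrow> pco (\<Gamma> @ [x]) = x"
  unfolding pco_def by (simp add: nth_append)

lemma pcm_last: "length u = n \<Longrightarrow> pcm (u @ [s]) = s"
  unfolding pcm_def by (simp add: nth_append)

lemma objs_last:
  assumes "length \<Gamma> = n" "\<And>x. x \<in> set b \<Longrightarrow> length (fst x) = n"
  shows "objs 0 (\<Gamma> @ [as]) b = \<Gamma> # map fst b"
  using assms by (auto simp: objs_def kob_kap kob_iot)

lemma bagok_len_set: "bagok as b \<Longrightarrow> x \<in> set b \<Longrightarrow> length (fst x) = n"
  using bagok_len[of as b] by (auto simp: in_set_conv_nth bagok_def)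

lemma bS_last:
  assumes "length \<Gamma> = n"
  shows "bS 0 \<Delta> (\<Gamma> @ [as]) (b, h) \<longleftrightarrow> bagok as b \<and> ctxhom A C \<Delta> (ctensor n (\<Gamma> # map fst b)) h"
proof (cases "bagok as b")
  case True
  then show ?thesis unfolding bS_def pco_last[OF assms] using objs_last[OF assms, of b as] bagok_len_set[OF True] assms by simp
qed (simp add: bS_def pco_last[OF assms])

lemma sem_LLam_EL: "sem A C (LLam P) n \<Gamma> (Fn as a) (EL p) \<longleftrightarrow> sem A C P (Suc n) (\<Gamma> @ [as]) a p"
  by simp

text \<open>At \<open>k = 0\<close>, \<open>K\<close> drops the last component and \<open>J\<close>
  is the identity, so representatives of the two coends carry the same data. Only the equivalences
  remain to be compared.\<close>

lemma sem_redex: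
  assumes "length \<Gamma> = n"
  shows "sem A C (LApp (LLam P) Q) n \<Delta> a (EA as (\<Gamma> # map fst b) (EL p) (map snd b) h) \<longleftrightarrow> cS P 0 \<Delta> a (\<Gamma> @ [as], p, (b, h))"
proof -
  have "lens n (map fst b)" if "bagok as b" using bagok_len_set[OF that] by auto
  then show ?thesis
    unfolding semApp cS_iff bS_last[OF assms] nth_Cons_0 sem_LLam_EL by (auto simp: bagok_def assms)
qed

lemma sem_redexE:
  assumes "sem A C (LApp (LLam P) Q) n \<Delta> a x"
  obtains as \<Gamma> p b h where "x = EA as (\<Gamma> # map fst b) (EL p) (map snd b) h" "length \<Gamma> = n" "length b = length as"
    "cS P 0 \<Delta> a (\<Gamma> @ [as], p, (b, h))"
proof -
  obtain as \<Gamma>s p0 qs h where x: "x = EA as \<Gamma>s p0 qs h" "length \<Gamma>s = Suc (length as)" "lens n \<Gamma>s" "length qs = length as"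
    "sem A C (LLam P) n (\<Gamma>s ! 0) (Fn as a) p0"
    using assms by (rule semApp_cases) blast
  obtain \<Gamma> Gs where \<Gamma>: "\<Gamma>s = \<Gamma> # Gs" using x(2) by (cases \<Gamma>s) auto
  obtain p where p: "p0 = EL p" using x(5) by (rule semLam_cases) blast
  have "x = EA as (\<Gamma> # map fst (zip Gs qs)) (EL p) (map snd (zip Gs qs)) h" "length \<Gamma> = n" "length (zip Gs qs) = length as"
    using x(1-4) by (auto simp: \<Gamma> p)
  then show ?thesis using that assms sem_redex by metis
qed

section \<open>The two coends of a redex against the coend of the composite\<close>

text \<open>A rearrangement of data, strictly inverse to \<open>of_cmp\<close> on well-formed
  representatives; the content lies in the passage between the two equivalences.\<close>

definition to_cmp where
  "to_cmp x = (case x of EA as \<Gamma>s p qs h \<Rightarrow> (hd \<Gamma>s @ [as], (case p of EL p' \<Rightarrow> p' | _ \<Rightarrow> p), (zip (tl \<Gamma>s) qs, h)) | _ \<Rightarrow> undefined)"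

definition of_cmp where
  "of_cmp = (\<lambda>(\<Gamma>, p, (b, h)). EA (last \<Gamma>) (butlast \<Gamma> # map fst b) (EL p) (map snd b) h)"

lemma to_cmp: "to_cmp (EA as (\<Gamma> # map fst b) (EL p) (map snd b) h) = (\<Gamma> @ [as], p, (b, h))"
  by (simp add: to_cmp_def zip_map_fst_snd)

lemma of_cmp: "of_cmp (\<Gamma> @ [as], p, (b, h)) = EA as (\<Gamma> # map fst b) (EL p) (map snd b) h"
  by (simp add: of_cmp_def)

lemma bag_split: "length Gs = length qs \<Longrightarrow> \<exists>b. Gs = map fst b \<and> qs = map snd b"
  by (rule exI[of _ "zip Gs qs"]) simp

text \<open>The second coend relation moves the contexts of the function and of the arguments at
  once. In the composite this takes two steps: sliding \<open>g\<close> with an identity at the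
  bound component, then a generator for the bag.\<close>

lemma to_cmp_ctx:
  assumes \<Gamma>: "length \<Gamma> = n" and g: "ctxhom A C \<Gamma> \<Gamma>' g" and b: "bagto as b vs b'" and p: "sem A C P (Suc n) (\<Gamma>' @ [as]) a p"
    and h: "ctxhom A C \<Delta> (ctensor n (\<Gamma> # map fst b)) h"
  shows "cE P 0 \<Delta> a (\<Gamma> @ [as], act A P (g @ [sid A as]) (did A a) p, (b, h))
    (\<Gamma>' @ [as], p, (b', h \<odot> ctensor_mor n (\<Gamma> # map fst b) (g # vs)))"
proof -
  have \<Gamma>': "length \<Gamma>' = n" "length g = n" using ctxhom_len[OF g] \<Gamma> by simp_all
  let ?g = "g @ [sid A as]"
  have G: "ctxhom A C (\<Gamma> @ [as]) (\<Gamma>' @ [as]) ?g" by (rule ctxhom_snocI[OF g shom_sid])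
  have N: "length (\<Gamma> @ [as]) = Suc n + 0" using \<Gamma> by simp
  have ok: "bagok as b" "bagok as b'" using b by (simp_all add: bagto_def)
  have lb: "length b = length as" "length b' = length as" "length vs = length as" using bagto_len[OF b] by simp_all
  note pc = pco_last[OF \<Gamma>] pco_last[OF \<Gamma>'(1)] pcm_last[OF \<Gamma>'(2)]
  let ?b = "bagact (sid A as) b"
  note ok1 = bagok_bagact[OF shom_shomw[OF shom_sid] ok(1)]
  note r = rmap[OF G N, unfolded pc, OF ok(1), unfolded add_0_right kmor_kap[OF \<Gamma>'(2)]]
  have b1: "?b ! i = (fst (b ! i), act A Q (cidc A (fst (b ! i))) (did A (as ! i)) (snd (b ! i)))" if "i < length as" for i
    using bagact_nth(2)[OF shom_shomw[OF shom_sid] that, of b] that by (simp add: sid_def)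
  have lb1: "length ?b = length as" by (rule bagact_nth(1)[OF shom_shomw[OF shom_sid]])
  have bt: "bagto as ?b vs b'"
    unfolding bagto_def
  proof (intro conjI allI impI ok1 ok(2) lb(3))
    fix i assume i: "i < length as"
    have c: "ctxhom A C (fst (b ! i)) (fst (b' ! i)) (vs ! i)"
      "eqv A C Q n (fst (b ! i)) (as ! i) (snd (b ! i)) (act A Q (vs ! i) (did A (as ! i)) (snd (b' ! i)))"
      using b i by (simp_all add: bagto_def)
    show "ctxhom A C (fst (?b ! i)) (fst (b' ! i)) (vs ! i)" using c(1) by (simp add: b1[OF i])
    show "eqv A C Q n (fst (?b ! i)) (as ! i) (snd (?b ! i)) (act A Q (vs ! i) (did A (as ! i)) (snd (b' ! i)))"
      unfolding b1[OF i] fst_conv snd_conv by (rule eqv_trans[OF act_id[OF eqv_sem(1)[OF c(2)]] c(2)])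
  qed
  note w = wmor[of "\<Gamma>' @ [as]" ?b vs b', where k=0, unfolded pc add_0_right, OF bt]
  have o: "objs 0 (\<Gamma> @ [as]) b = \<Gamma> # map fst b" "objs 0 (\<Gamma>' @ [as]) b' = \<Gamma>' # map fst b'"
    by (rule objs_last[OF \<Gamma> bagok_len_set[OF ok(1)]] objs_last[OF \<Gamma>'(1) bagok_len_set[OF ok(2)]]; assumption)+
  let ?G = "\<Gamma> # map fst b" and ?G' = "\<Gamma>' # map fst b'"
  have vv: "ctxhom A C (?G ! j) (?G' ! j) ((g # vs) ! j)" if "j < length ?G" for j
    using that g b lb by (cases j) (auto simp: bagto_def)
  have lG: "lens n ?G" "lens n ?G'" using \<Gamma> \<Gamma>' bagok_len_set[OF ok(1)] bagok_len_set[OF ok(2)] by auto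
  have T: "ctxhom A C (ctensor n ?G) (ctensor n ?G') (ctensor_mor n ?G (g # vs))"
    by (rule ctxhom_ctensor_mor) (use vv lb lG in auto)
  have Tc: "ctensor_mor n ?G (g # vs) \<odot> cprj n ?G' j = cprj n ?G j \<odot> (g # vs) ! j" if "j < length ?G" for j
    by (rule ctensor_mor_cprj) (use vv lb lG that in \<open>auto intro: ctxhom_ctxw\<close>)
  note R = ctxhom_ctxw[OF r(1)] and W = ctxhom_ctxw[OF w(1)]
  \<comment> \<open>The morphisms of the two steps together have the projections of the single
    \<open>ctensor_mor\<close>.\<close>
  have e: "rmap 0 (\<Gamma> @ [as]) b ?g \<odot> wmor 0 (\<Gamma>' @ [as]) ?b vs = ctensor_mor n ?G (g # vs)"
  proof (rule ctxw_ext[OF ctxw_comp[OF R W, unfolded o] ctxhom_ctxw[OF T]])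
    fix j assume j: "j < length ?G'"
    have pj: "ctxw (ctensor n ?G') (?G' ! j) (cprj n ?G' j)" by (rule ctxw_cprj[OF j lG(2)])
    show "rmap 0 (\<Gamma> @ [as]) b ?g \<odot> wmor 0 (\<Gamma>' @ [as]) ?b vs \<odot> cprj n ?G' j = ctensor_mor n ?G (g # vs) \<odot> cprj n ?G' j"
    proof (cases j)
      case 0
      show ?thesis using ccompc_assoc[OF R W[unfolded o], of _ "cprj n ?G' 0"] pj w(2) r(2) Tc[of 0]
        unfolding o 0 by simp
    next
      case (Suc i)
      then have i: "i < length as" "j < length ?G" using j lb by auto
      have v: "ctxw (fst (b ! i)) (fst (b' ! i)) (vs ! i)" using vv[OF i(2)] Suc i lb by (simp add: ctxhom_ctxw)
      have lv: "length (vs ! i) = n" using v bagok_len[OF ok(1) i(1)] by (simp add: ctxw_def)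
      have p1: "ctxw (tgt 0 (\<Gamma>' @ [as]) ?b) (fst (b ! i)) (cprj n (objs 0 (\<Gamma>' @ [as]) ?b) (Suc i))"
        using ctxw_cprj_objs(2)[of i ?b 0 "\<Gamma>' @ [as]"] i lb1 bagok_len[OF ok(1) i(1)] by (simp add: b1 kob_iot)
      have "rmap 0 (\<Gamma> @ [as]) b ?g \<odot> wmor 0 (\<Gamma>' @ [as]) ?b vs \<odot> cprj n ?G' j =
        rmap 0 (\<Gamma> @ [as]) b ?g \<odot> (wmor 0 (\<Gamma>' @ [as]) ?b vs \<odot> cprj n ?G' j)"
        by (rule ccompc_assoc[OF R W[unfolded o] pj])
      also have "wmor 0 (\<Gamma>' @ [as]) ?b vs \<odot> cprj n ?G' j = cprj n (objs 0 (\<Gamma>' @ [as]) ?b) (Suc i) \<odot> vs ! i"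
        using w(3)[OF i(1)] unfolding o kmor_iot[OF lv] Suc .
      also have "rmap 0 (\<Gamma> @ [as]) b ?g \<odot> (cprj n (objs 0 (\<Gamma>' @ [as]) ?b) (Suc i) \<odot> vs ! i) =
        rmap 0 (\<Gamma> @ [as]) b ?g \<odot> cprj n (objs 0 (\<Gamma>' @ [as]) ?b) (Suc i) \<odot> vs ! i"
        using ccompc_assoc[OF R _ v, of "cprj n (objs 0 (\<Gamma>' @ [as]) ?b) (Suc i)"] p1 by simp
      also have "rmap 0 (\<Gamma> @ [as]) b ?g \<odot> cprj n (objs 0 (\<Gamma>' @ [as]) ?b) (Suc i) = cprj n ?G j"
        using r(3)[OF i(1)] i by (simp add: sid_def o Suc)
      finally show ?thesis using Tc[OF i(2)] Suc by simp
    qed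
  qed
  have h': "ctxhom A C \<Delta> (ctensor n (objs 0 (\<Gamma> @ [as]) b)) h" using h by (simp add: o)
  have S: "bS 0 \<Delta> (\<Gamma> @ [as]) (b, h)" unfolding bS_last[OF \<Gamma>] using ok h by simp
  show ?thesis
  proof (rule cE_gen[OF S _ G])
    show "sem A C P (Suc n + 0) (\<Gamma>' @ [as]) a p" using p by simp
    then show "eqv A C P (Suc n + 0) (\<Gamma> @ [as]) a (act A P ?g (did A a) p) (act A P ?g (did A a) p)"
      by (intro eqv_refl sem_act[OF _ G dhom_did])
    have BR: "BR 0 (\<Gamma> @ [as]) ?g (b, h) = (?b, h \<odot> rmap 0 (\<Gamma> @ [as]) b ?g)" by (simp add: BR_def pc)
    have "bE 0 \<Delta> (\<Gamma>' @ [as]) (BR 0 (\<Gamma> @ [as]) ?g (b, h)) (b', h \<odot> ctensor_mor n ?G (g # vs))"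
    proof (rule bE_gen[OF bS_BR[OF S G]])
      show "bS 0 \<Delta> (\<Gamma>' @ [as]) (b', h \<odot> ctensor_mor n ?G (g # vs))"
        unfolding bS_last[OF \<Gamma>'(1)] using ok ctxhom_comp[OF h T] by simp
      show "bgen 0 (\<Gamma>' @ [as]) (BR 0 (\<Gamma> @ [as]) ?g (b, h)) (b', h \<odot> ctensor_mor n ?G (g # vs))"
        unfolding bgen_def BR fst_conv snd_conv pc
        by (rule exI[of _ vs]) (simp add: bt e[symmetric] ccompc_assoc[OF ctxhom_ctxw[OF h'] R W])
    qed
    then show "bE 0 \<Delta> (\<Gamma>' @ [as]) (b', h \<odot> ctensor_mor n ?G (g # vs)) (BR 0 (\<Gamma> @ [as]) ?g (b, h))" by (rule bE_sym)
  qed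
qed

text \<open>The first relation becomes congruence and the second is \<open>to_cmp_ctx\<close>. The
  third is a sliding along \<open>cidc A \<Gamma> @ [(\<alpha>, fs)]\<close>, for which the second
  stage of \<open>rmap\<close> is an identity and only \<open>cblock\<close> remains.\<close>

lemma to_cmp_resp:
  assumes "eqv A C (LApp (LLam P) Q) n \<Delta> a x y"
  shows "cE P 0 \<Delta> a (to_cmp x) (to_cmp y)"
proof (rule eqvApp_map[OF assms, where f=to_cmp and T="cE P 0 \<Delta> a", OF _ cE_sym cE_trans])
  fix x assume "sem A C (LApp (LLam P) Q) n \<Delta> a x"
  then obtain as \<Gamma> p b h where x: "x = EA as (\<Gamma> # map fst b) (EL p) (map snd b) h" "cS P 0 \<Delta> a (\<Gamma> @ [as], p, (b, h))"
    by (rule sem_redexE)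
  show "cE P 0 \<Delta> a (to_cmp x) (to_cmp x)" unfolding x(1) to_cmp by (rule cE_refl[OF x(2)])
next
  fix as \<Gamma>s p qs p' qs' h
  assume s: "sem A C (LApp (LLam P) Q) n \<Delta> a (EA as \<Gamma>s p qs h)" and e: "eqv A C (LLam P) n (\<Gamma>s ! 0) (Fn as a) p p'"
    and l: "length qs' = length as" and q: "\<And>i. i < length as \<Longrightarrow> eqv A C Q n (\<Gamma>s ! Suc i) (as ! i) (qs ! i) (qs' ! i)"
  obtain \<Gamma> p0 b where x: "\<Gamma>s = \<Gamma> # map fst b" "p = EL p0" "qs = map snd b" "length \<Gamma> = n" "length b = length as"
    "cS P 0 \<Delta> a (\<Gamma> @ [as], p0, (b, h))"
    using s by (rule sem_redexE) auto
  obtain p1 where p1: "p' = EL p1" "eqv A C P (Suc n) (\<Gamma> @ [as]) a p0 p1"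
    using e unfolding x(1,2) nth_Cons_0 by (rule eqvLam_cases) auto
  obtain b' where b': "map fst b = map fst b'" "qs' = map snd b'" using bag_split[of "map fst b" qs'] l x(5) by auto
  have lb: "length b' = length b" using map_eq_imp_length_eq[OF b'(1)] by simp
  have f: "fst (b ! i) = fst (b' ! i)" if "i < length b" for i using arg_cong[OF b'(1), of "\<lambda>x. x ! i"] that lb by simp
  have "bagE as b b'" unfolding bagE_def using x(5) lb f q by (auto simp: x b'(2))
  then have B: "bE 0 \<Delta> (\<Gamma> @ [as]) (b, h) (b', h)" using x(6) by (intro bagE_bE) (simp_all add: pco_last[OF x(4)])
  have "to_cmp (EA as \<Gamma>s p' qs' h) = (\<Gamma> @ [as], p1, (b', h))" unfolding x(1) p1(1) b' to_cmp ..
  moreover have "cE P 0 \<Delta> a (\<Gamma> @ [as], p0, (b, h)) (\<Gamma> @ [as], p1, (b', h))"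
    by (rule cE_cong[OF _ B]) (use p1 in simp)
  ultimately show "cE P 0 \<Delta> a (to_cmp (EA as \<Gamma>s p qs h)) (to_cmp (EA as \<Gamma>s p' qs' h))" by (simp add: x to_cmp)
next
  fix as \<Gamma>s \<Gamma>s' vs p qs h
  assume l: "length \<Gamma>s = Suc (length as)" "length \<Gamma>s' = Suc (length as)" "length vs = Suc (length as)"
    and L: "lens n \<Gamma>s" "lens n \<Gamma>s'" and v: "\<And>j. j < Suc (length as) \<Longrightarrow> ctxhom A C (\<Gamma>s ! j) (\<Gamma>s' ! j) (vs ! j)"
    and p: "sem A C (LLam P) n (\<Gamma>s' ! 0) (Fn as a) p" and lq: "length qs = length as"
    and q: "\<And>i. i < length as \<Longrightarrow> sem A C Q n (\<Gamma>s' ! Suc i) (as ! i) (qs ! i)"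
    and h: "ctxhom A C \<Delta> (ctensor n \<Gamma>s) h"
  let ?qs = "map (\<lambda>i. act A Q (vs ! Suc i) (did A (as ! i)) (qs ! i)) [0..<length as]"
  obtain \<Gamma> Gs \<Gamma>' Gs' g us where e: "\<Gamma>s = \<Gamma> # Gs" "\<Gamma>s' = \<Gamma>' # Gs'" "vs = g # us" using l by (auto simp: length_Suc_conv)
  obtain b where b: "Gs = map fst b" "?qs = map snd b" using bag_split[of Gs ?qs] l(1) unfolding e by auto
  obtain b' where b': "Gs' = map fst b'" "qs = map snd b'" using bag_split[of Gs' qs] l(2) lq unfolding e by auto
  have lb: "length b = length as" "length b' = length as" "length us = length as" using l lq unfolding e b b' by simp_all
  obtain p0 where p0: "p = EL p0" using p by (rule semLam_cases) blast
  have g: "ctxhom A C \<Gamma> \<Gamma>' g" using v[of 0] by (simp add: e)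
  have c: "ctxhom A C (fst (b ! i)) (fst (b' ! i)) (us ! i)" "sem A C Q n (fst (b' ! i)) (as ! i) (snd (b' ! i))"
    "snd (b ! i) = act A Q (us ! i) (did A (as ! i)) (snd (b' ! i))" if i: "i < length as" for i
    using v[of "Suc i"] q[OF i] arg_cong[OF b(2), of "\<lambda>x. x ! i"] i lb by (simp_all add: e b(1) b')
  have t: "bagto as b us b'"
    unfolding bagto_def bagok_def using lb c by (auto intro!: eqv_refl sem_act[OF c(2) c(1) dhom_did])
  have "EA as \<Gamma>s (act A (LLam P) (vs ! 0) (did A (Fn as a)) p) ?qs h =
    EA as (\<Gamma> # map fst b) (EL (act A P (g @ [sid A as]) (did A a) p0)) (map snd b) h"
    unfolding b by (simp add: e p0 sid_def b(1))
  moreover have "cE P 0 \<Delta> a (\<Gamma> @ [as], act A P (g @ [sid A as]) (did A a) p0, (b, h))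
    (\<Gamma>' @ [as], p0, (b', h \<odot> ctensor_mor n (\<Gamma> # map fst b) (g # us)))"
  proof (rule to_cmp_ctx[OF _ g t])
    show "length \<Gamma> = n" using L by (simp add: e)
    show "sem A C P (Suc n) (\<Gamma>' @ [as]) a p0" using p by (simp add: e p0)
    show "ctxhom A C \<Delta> (ctensor n (\<Gamma> # map fst b)) h" using h by (simp add: e b(1))
  qed
  moreover have "EA as \<Gamma>s' p qs (h \<odot> ctensor_mor n \<Gamma>s vs) =
     EA as (\<Gamma>' # map fst b') (EL p0) (map snd b') (h \<odot> ctensor_mor n (\<Gamma> # map fst b) (g # us))" by (simp add: e b b' p0)
  ultimately show "cE P 0 \<Delta> a (to_cmp (EA as \<Gamma>s (act A (LLam P) (vs ! 0) (did A (Fn as a)) p) ?qs h))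
          (to_cmp (EA as \<Gamma>s' p qs (h \<odot> ctensor_mor n \<Gamma>s vs)))"
    by (simp only: to_cmp)
next
  fix as bs \<alpha> fs \<Gamma>s p qs h
  assume u: "shom A C as bs (\<alpha>, fs)" and l: "length \<Gamma>s = Suc (length as)" and L: "lens n \<Gamma>s"
    and p: "sem A C (LLam P) n (\<Gamma>s ! 0) (Fn bs a) p" and lq: "length qs = length as"
    and q: "\<And>i. i < length as \<Longrightarrow> sem A C Q n (\<Gamma>s ! Suc i) (as ! i) (qs ! i)"
    and h: "ctxhom A C \<Delta> (ctensor n \<Gamma>s) h"
  obtain \<Gamma> Gs where e: "\<Gamma>s = \<Gamma> # Gs" using l by (auto simp: length_Suc_conv)
  obtain b where b: "Gs = map fst b" "qs = map snd b" using bag_split[of Gs qs] l lq unfolding e by auto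
  have lb: "length b = length as" using lq b by simp
  obtain p0 where p0: "p = EL p0" using p by (rule semLam_cases) blast
  have \<Gamma>: "length \<Gamma> = n" using L by (simp add: e)
  have ok: "bagok as b" unfolding bagok_def using lb q by (auto simp: e b)
  let ?g = "cidc A \<Gamma> @ [(\<alpha>, fs)]" and ?b = "bagact (\<alpha>, fs) b"
  have G: "ctxhom A C (\<Gamma> @ [as]) (\<Gamma> @ [bs]) ?g" by (rule ctxhom_snocI[OF ctxhom_cidc u])
  have S: "bS 0 \<Delta> (\<Gamma> @ [as]) (b, h)" unfolding bS_last[OF \<Gamma>] using ok h by (simp add: e b)
  have la: "length \<alpha> = length bs" "length fs = length bs" "\<And>i. i < length bs \<Longrightarrow> \<alpha> ! i < length as"
    using shom_shomw[OF u] by (auto simp: shomw_def)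
  have pm: "pcm ?g = (\<alpha>, fs)" by (rule pcm_last) (simp add: \<Gamma>)
  have Km: "kmor n kap ?g = cidc A \<Gamma>" by (rule kmor_kap) (simp add: \<Gamma>)
  have lb': "length (fst x) = n" if "x \<in> set b" for x using bagok_len_set[OF ok that] .
  have ok': "bagok bs ?b" by (rule bagok_bagact[OF shom_shomw[OF u] ok])
  have lb1: "length (fst x) = n" if "x \<in> set ?b" for x using bagok_len_set[OF ok' that] .
  have fb: "map fst ?b = map (\<lambda>j. fst (b ! j)) \<alpha>" "map snd ?b = map2 (\<lambda>j g. act A Q (cidc A (fst (b ! j))) g (snd (b ! j))) \<alpha> fs"
    using la by (auto simp: bagact_def intro!: nth_equalityI)
  have blk: "map ((!) \<Gamma>s) (0 # map Suc \<alpha>) = \<Gamma> # map fst ?b"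
    unfolding fb using la lb by (auto simp: e b(1) in_set_conv_nth)
  have qq: "map2 (\<lambda>j g. act A Q (cidc A (\<Gamma>s ! Suc j)) g (qs ! j)) \<alpha> fs = map snd ?b"
    unfolding fb using la lb by (auto simp: e b in_set_conv_nth in_set_zip)
  have o: "objs 0 (\<Gamma> @ [as]) b = \<Gamma>s" "objs 0 (\<Gamma> @ [as]) ?b = \<Gamma> # map fst ?b"
    using objs_last[OF \<Gamma> lb', of b as] objs_last[OF \<Gamma> lb1, of ?b as] by (simp_all add: e b)
  have lG: "lens n (\<Gamma> # map fst ?b)" using \<Gamma> lb1 by auto
  have ii: "map (\<lambda>x. cidc A (J 0 (fst x))) ?b = map (cidc A) (map fst ?b)"
    using lb1 by (auto simp: kob_iot)
  have "rmap 0 (\<Gamma> @ [as]) b ?g = cblock A n \<Gamma>s (0 # map Suc \<alpha>) \<odot> ctensor_mor n (\<Gamma> # map fst ?b) (map (cidc A) (\<Gamma> # map fst ?b))"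
    unfolding rmap_def pm o ii by (simp add: Km o)
  also have "\<dots> = cblock A n \<Gamma>s (0 # map Suc \<alpha>)"
  proof -
    have "ctxw (ctensor n \<Gamma>s) (ctensor n (\<Gamma> # map fst ?b)) (cblock A n \<Gamma>s (0 # map Suc \<alpha>))"
      unfolding blk[symmetric]
      by (rule ctxhom_ctxw[OF ctxhom_cblock]) (use in_class_Suc[OF shom_in_class[OF u]] la l L in simp_all)
    then show ?thesis unfolding ctensor_mor_id[OF lG] by (rule ccompc_idr)
  qed
  finally have r: "rmap 0 (\<Gamma> @ [as]) b ?g = cblock A n \<Gamma>s (0 # map Suc \<alpha>)" .
  have BR: "BR 0 (\<Gamma> @ [as]) ?g (b, h) = (?b, h \<odot> cblock A n \<Gamma>s (0 # map Suc \<alpha>))" by (simp add: BR_def pm r)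
  have "EA as \<Gamma>s (act A (LLam P) (cidc A (\<Gamma>s ! 0)) (FM \<alpha> fs (did A a)) p) qs h =
    EA as (\<Gamma> # map fst b) (EL (act A P ?g (did A a) p0)) (map snd b) h" by (simp add: e b p0)
  moreover have "EA bs (map ((!) \<Gamma>s) (0 # map Suc \<alpha>)) p (map2 (\<lambda>j g. act A Q (cidc A (\<Gamma>s ! Suc j)) g (qs ! j)) \<alpha> fs)
       (h \<odot> cblock A n \<Gamma>s (0 # map Suc \<alpha>)) = EA bs (\<Gamma> # map fst ?b) (EL p0) (map snd ?b) (h \<odot> cblock A n \<Gamma>s (0 # map Suc \<alpha>))"
    unfolding blk qq p0 ..
  moreover have "cE P 0 \<Delta> a (\<Gamma> @ [as], act A P ?g (did A a) p0, (b, h)) (\<Gamma> @ [bs], p0, (?b, h \<odot> cblock A n \<Gamma>s (0 # map Suc \<alpha>)))"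
  proof (rule cE_gen[OF S _ G])
    show s: "sem A C P (Suc n + 0) (\<Gamma> @ [bs]) a p0" using p by (simp add: e p0)
    show "eqv A C P (Suc n + 0) (\<Gamma> @ [as]) a (act A P ?g (did A a) p0) (act A P ?g (did A a) p0)"
      by (intro eqv_refl sem_act[OF s G dhom_did])
    show "bE 0 \<Delta> (\<Gamma> @ [bs]) (?b, h \<odot> cblock A n \<Gamma>s (0 # map Suc \<alpha>)) (BR 0 (\<Gamma> @ [as]) ?g (b, h))"
      using bE_refl[OF bS_BR[OF S G]] unfolding BR .
  qed
  ultimately show "cE P 0 \<Delta> a (to_cmp (EA as \<Gamma>s (act A (LLam P) (cidc A (\<Gamma>s ! 0)) (FM \<alpha> fs (did A a)) p) qs h))
          (to_cmp (EA bs (map ((!) \<Gamma>s) (0 # map Suc \<alpha>)) p (map2 (\<lambda>j g. act A Q (cidc A (\<Gamma>s ! Suc j)) g (qs ! j)) \<alpha> fs)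
       (h \<odot> cblock A n \<Gamma>s (0 # map Suc \<alpha>))))"
    by (simp only: to_cmp)
qed

text \<open>A generator for bags is the second coend relation with an identity at the
  function.\<close>

lemma of_cmp_bag:
  assumes \<theta>: "bE 0 \<Delta> (\<Gamma> @ [as]) \<theta> \<theta>'" and p: "sem A C P (Suc n) (\<Gamma> @ [as]) a p" and \<Gamma>: "length \<Gamma> = n"
  shows "eqv A C (LApp (LLam P) Q) n \<Delta> a (of_cmp (\<Gamma> @ [as], p, \<theta>)) (of_cmp (\<Gamma> @ [as], p, \<theta>'))"
proof (rule equivclose_map[OF \<theta>[unfolded bE_def], where T="eqv A C (LApp (LLam P) Q) n \<Delta> a" and f="\<lambda>\<theta>. of_cmp (\<Gamma> @ [as], p, \<theta>)", OF _ _ eqv_sym eqv_trans])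
  fix \<theta> assume "bS 0 \<Delta> (\<Gamma> @ [as]) \<theta>"
  then have "cS P 0 \<Delta> a (\<Gamma> @ [as], p, \<theta>)" using p by simp
  then show "eqv A C (LApp (LLam P) Q) n \<Delta> a (of_cmp (\<Gamma> @ [as], p, \<theta>)) (of_cmp (\<Gamma> @ [as], p, \<theta>))"
    by (cases \<theta>) (simp only: of_cmp sem_redex[OF \<Gamma>, symmetric] eqv_refl)
next
  fix \<theta> \<theta>' assume S: "bS 0 \<Delta> (\<Gamma> @ [as]) \<theta>" and g: "bgen 0 (\<Gamma> @ [as]) \<theta> \<theta>'"
  obtain b h b' h' where e: "\<theta> = (b, h)" "\<theta>' = (b', h')" by fastforce
  obtain vs where v: "bagto as b vs b'" "h' = h \<odot> wmor 0 (\<Gamma> @ [as]) b vs"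
    using g unfolding bgen_def e pco_last[OF \<Gamma>] by auto
  have ok: "bagok as b" "bagok as b'" using v by (simp_all add: bagto_def)
  have lb: "length b = length as" "length b' = length as" "length vs = length as" using bagto_len[OF v(1)] by simp_all
  have c: "ctxhom A C (fst (b ! i)) (fst (b' ! i)) (vs ! i)" "sem A C Q n (fst (b' ! i)) (as ! i) (snd (b' ! i))"
    "eqv A C Q n (fst (b ! i)) (as ! i) (snd (b ! i)) (act A Q (vs ! i) (did A (as ! i)) (snd (b' ! i)))" if "i < length as" for i
    using v(1) ok(2) that by (simp_all add: bagto_def bagok_def)
  have lv: "length v = n" if "v \<in> set vs" for v
    using that c(1) lb bagok_len[OF ok(1)] by (auto simp: in_set_conv_nth ctxhom_def)
  have "map (kmor n iot) vs = vs" using lv by (auto intro!: map_idI kmor_iot)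
  moreover have "objs 0 (\<Gamma> @ [as]) b = \<Gamma> # map fst b" by (rule objs_last[OF \<Gamma> bagok_len_set[OF ok(1)]])
  ultimately have h': "h' = h \<odot> ctensor_mor n (\<Gamma> # map fst b) (cidc A \<Gamma> # vs)"
    unfolding v(2) wmor_def by (simp add: kob_kap[OF \<Gamma>])
  have q: "sem A C (LLam P) n \<Gamma> (Fn as a) (EL p)" using p by simp
  have h: "ctxhom A C \<Delta> (ctensor n (\<Gamma> # map fst b)) h" using S unfolding e bS_last[OF \<Gamma>] by simp
  show "eqv A C (LApp (LLam P) Q) n \<Delta> a (of_cmp (\<Gamma> @ [as], p, \<theta>)) (of_cmp (\<Gamma> @ [as], p, \<theta>'))"
    unfolding e of_cmp h'
  proof (rule app_ctx[OF isf_den isf_den])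
    show "eqv A C (LLam P) n ((\<Gamma> # map fst b) ! 0) (Fn as a) (EL p) (act A (LLam P) ((cidc A \<Gamma> # vs) ! 0) (did A (Fn as a)) (EL p))"
      unfolding nth_Cons_0 by (rule eqv_sym[OF act_id[OF q]])
    show "ctxhom A C ((\<Gamma> # map fst b) ! j) ((\<Gamma> # map fst b') ! j) ((cidc A \<Gamma> # vs) ! j)" if "j < Suc (length as)" for j
      using that c(1) lb by (cases j) (auto simp: ctxhom_cidc)
    show "lens n (\<Gamma> # map fst b)" "lens n (\<Gamma> # map fst b')" using \<Gamma> bagok_len_set[OF ok(1)] bagok_len_set[OF ok(2)] by auto
  qed (use q h lb c in \<open>simp_all del: sem.simps eqv.simps act.simps\<close>)
qed

text \<open>A morphism between contexts with a binder consists of \<open>g\<close> and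
  \<open>(\<alpha>, fs)\<close>. The latter is slid by the third coend relation and then the former
  by the second, in accordance with the two stages of \<open>rmap\<close>.\<close>

lemma of_cmp_act:
  assumes S: "bS 0 \<Delta> (\<Gamma> @ [as]) (b, h)" and p: "sem A C P (Suc n) (\<Gamma>' @ [bs]) a p"
    and g: "ctxhom A C \<Gamma> \<Gamma>' g" and u: "shom A C as bs (\<alpha>, fs)" and \<Gamma>: "length \<Gamma> = n"
    and p': "eqv A C P (Suc n) (\<Gamma> @ [as]) a p' (act A P (g @ [(\<alpha>, fs)]) (did A a) p)"
  shows "eqv A C (LApp (LLam P) Q) n \<Delta> a (of_cmp (\<Gamma> @ [as], p', (b, h))) (of_cmp (\<Gamma>' @ [bs], p, BR 0 (\<Gamma> @ [as]) (g @ [(\<alpha>, fs)]) (b, h)))"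
proof -
  have l: "length g = n" "length \<Gamma>' = n" using ctxhom_len[OF g] \<Gamma> by simp_all
  have ok: "bagok as b" and h: "ctxhom A C \<Delta> (ctensor n (\<Gamma> # map fst b)) h" using S unfolding bS_last[OF \<Gamma>] by auto
  have lb: "length b = length as" using ok by (simp add: bagok_def)
  let ?g = "g @ [(\<alpha>, fs)]" and ?b = "bagact (\<alpha>, fs) b" and ?G = "\<Gamma> # map fst b"
  have la: "length \<alpha> = length bs" "length fs = length bs" "\<And>i. i < length bs \<Longrightarrow> \<alpha> ! i < length as"
    using shom_shomw[OF u] by (auto simp: shomw_def)
  have sw: "shomw as bs (\<alpha>, fs)" by (rule shom_shomw[OF u])
  have ok': "bagok bs ?b" by (rule bagok_bagact[OF sw ok])
  have lb': "length ?b = length bs" by (rule bagact_nth(1)[OF sw])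
  note b1 = bagact_nth(2)[OF sw, of _ b, unfolded fst_conv snd_conv]
  have blk: "map ((!) ?G) (0 # map Suc \<alpha>) = \<Gamma> # map fst ?b"
    using la lb lb' by (auto intro!: nth_equalityI simp: b1)
  have lG: "lens n ?G" "lens n (\<Gamma> # map fst ?b)" "lens n (\<Gamma>' # map fst ?b)"
    using \<Gamma> l bagok_len_set[OF ok] bagok_len_set[OF ok'] by auto
  have o: "objs 0 (\<Gamma> @ [as]) b = ?G" "objs 0 (\<Gamma> @ [as]) ?b = \<Gamma> # map fst ?b"
    using objs_last[OF \<Gamma>, of b as] bagok_len_set[OF ok] objs_last[OF \<Gamma>, of ?b as] bagok_len_set[OF ok'] by simp_all
  have ii: "map (\<lambda>x. cidc A (J 0 (fst x))) ?b = map (cidc A) (map fst ?b)"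
    using bagok_len_set[OF ok'] by (auto simp: kob_iot)
  have BR: "BR 0 (\<Gamma> @ [as]) ?g (b, h) = (?b, h \<odot> (cblock A n ?G (0 # map Suc \<alpha>) \<odot>
     ctensor_mor n (\<Gamma> # map fst ?b) (g # map (cidc A) (map fst ?b))))"
    unfolding BR_def fst_conv snd_conv rmap_def pcm_last[OF l(1)] o ii by (simp add: o kmor_kap[OF l(1)])
  have cb: "ctxhom A C (ctensor n ?G) (ctensor n (\<Gamma> # map fst ?b)) (cblock A n ?G (0 # map Suc \<alpha>))"
    unfolding blk[symmetric]
    by (rule ctxhom_cblock) (use in_class_Suc[OF shom_in_class[OF u]] la lb lG in simp_all)
  have vv: "ctxhom A C ((\<Gamma> # map fst ?b) ! j) ((\<Gamma>' # map fst ?b) ! j) ((g # map (cidc A) (map fst ?b)) ! j)" if "j < Suc (length bs)" for j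
    using that g lb' by (cases j) (auto simp: ctxhom_cidc)
  have cm: "ctxhom A C (ctensor n (\<Gamma> # map fst ?b)) (ctensor n (\<Gamma>' # map fst ?b)) (ctensor_mor n (\<Gamma> # map fst ?b) (g # map (cidc A) (map fst ?b)))"
    by (rule ctxhom_ctensor_mor) (use vv lb' lG in auto)
  let ?p = "act A (LLam P) g (did A (Fn bs a)) (EL p)"
  have EL: "sem A C (LLam P) n \<Gamma>' (Fn bs a) (EL p)" using p by simp
  have sp: "sem A C (LLam P) n \<Gamma> (Fn bs a) ?p" by (rule sem_act[OF EL g dhom_did])
  have f: "dhom A C (Fn bs a) (Fn as a) (FM \<alpha> fs (did A a))" by (rule dhom_Fn_fst[OF u])
  have ep: "eqv A C (LLam P) n \<Gamma> (Fn as a) (EL p') (act A (LLam P) (cidc A \<Gamma>) (FM \<alpha> fs (did A a)) ?p)"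
  proof (rule eqv_trans)
    show "eqv A C (LLam P) n \<Gamma> (Fn as a) (EL p') (act A (LLam P) g (FM \<alpha> fs (did A a)) (EL p))" using p' by simp
    show "eqv A C (LLam P) n \<Gamma> (Fn as a) (act A (LLam P) g (FM \<alpha> fs (did A a)) (EL p)) (act A (LLam P) (cidc A \<Gamma>) (FM \<alpha> fs (did A a)) ?p)"
      using isf_ctx_first[OF isf_den, of "LLam P" n, unfolded den_simps, OF EL g f] .
  qed
  have sb: "sem A C Q n (fst (b ! i)) (as ! i) (snd (b ! i))" if "i < length as" for i using ok that by (simp add: bagok_def)
  have sb': "sem A C Q n (fst (?b ! i)) (bs ! i) (snd (?b ! i))" if "i < length bs" for i using ok' that by (simp add: bagok_def)
  have 1: "eqv A C (LApp (LLam P) Q) n \<Delta> a (EA as ?G (EL p') (map snd b) h)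
     (EA bs (\<Gamma> # map fst ?b) ?p (map snd ?b) (h \<odot> cblock A n ?G (0 # map Suc \<alpha>)))"
    unfolding blk[symmetric]
  proof (rule app_arg[OF isf_den isf_den u])
    show "eqv A C Q n (?G ! Suc (\<alpha> ! i)) (bs ! i) (map snd ?b ! i) (act A Q (cidc A (?G ! Suc (\<alpha> ! i))) (fs ! i) (map snd b ! (\<alpha> ! i)))"
      if i: "i < length bs" for i
      using eqv_refl[OF sb'[OF i]] i la(3)[OF i] lb lb' by (simp add: b1[OF i] del: eqv.simps)
  qed (use ep sp sb h lb lb' lG in \<open>simp_all del: sem.simps eqv.simps act.simps\<close>)
  have 2: "eqv A C (LApp (LLam P) Q) n \<Delta> a (EA bs (\<Gamma> # map fst ?b) ?p (map snd ?b) (h \<odot> cblock A n ?G (0 # map Suc \<alpha>)))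
     (EA bs (\<Gamma>' # map fst ?b) (EL p) (map snd ?b) (h \<odot> cblock A n ?G (0 # map Suc \<alpha>) \<odot> ctensor_mor n (\<Gamma> # map fst ?b) (g # map (cidc A) (map fst ?b))))"
  proof (rule app_ctx[OF isf_den isf_den])
    show "eqv A C Q n ((\<Gamma> # map fst ?b) ! Suc i) (bs ! i) (map snd ?b ! i)
       (act A Q ((g # map (cidc A) (map fst ?b)) ! Suc i) (did A (bs ! i)) (map snd ?b ! i))" if i: "i < length bs" for i
      using eqv_sym[OF act_id[OF sb'[OF i]]] i lb' by (simp del: eqv.simps)
    show "eqv A C (LLam P) n ((\<Gamma> # map fst ?b) ! 0) (Fn bs a) ?p (act A (LLam P) ((g # map (cidc A) (map fst ?b)) ! 0) (did A (Fn bs a)) (EL p))"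
      unfolding nth_Cons_0 by (rule eqv_refl[OF sp])
    show "ctxhom A C \<Delta> (ctensor n (\<Gamma> # map fst ?b)) (h \<odot> cblock A n ?G (0 # map Suc \<alpha>))" by (rule ctxhom_comp[OF h cb])
  qed (use vv EL sb' lb' lG in \<open>simp_all del: sem.simps eqv.simps act.simps\<close>)
  show ?thesis
    unfolding BR of_cmp using eqv_trans[OF 1 2] unfolding ccompc_assoc[OF ctxhom_ctxw[OF h] ctxhom_ctxw[OF cb] ctxhom_ctxw[OF cm]] .
qed

lemma snocE:
  assumes "length \<Gamma> = Suc n"
  obtains \<Gamma>0 as where "\<Gamma> = \<Gamma>0 @ [as]" "length \<Gamma>0 = n"
  using length_Suc_snoc[OF assms] by blast

lemma of_cmp_resp:
  assumes "cE P 0 \<Delta> a x y"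
  shows "eqv A C (LApp (LLam P) Q) n \<Delta> a (of_cmp x) (of_cmp y)"
proof (rule cE_map[OF assms, where f=of_cmp and T="eqv A C (LApp (LLam P) Q) n \<Delta> a", OF _ _ eqv_sym eqv_trans])
  fix x assume x: "cS P 0 \<Delta> a x"
  obtain \<Gamma> p \<theta> where e: "x = (\<Gamma>, p, \<theta>)" by (metis prod_cases3)
  have s: "sem A C P (Suc n) \<Gamma> a p" "bS 0 \<Delta> \<Gamma> \<theta>" using x by (simp_all add: e)
  obtain \<Gamma>0 as where \<Gamma>: "\<Gamma> = \<Gamma>0 @ [as]" "length \<Gamma>0 = n" using snocE[OF sem_len[OF s(1)]] .
  show "eqv A C (LApp (LLam P) Q) n \<Delta> a (of_cmp x) (of_cmp x)"
    unfolding e \<Gamma> by (rule of_cmp_bag[OF bE_refl[OF s(2)[unfolded \<Gamma>]] s(1)[unfolded \<Gamma>] \<Gamma>(2)])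
next
  fix \<Gamma> p' \<theta> \<Gamma>' p \<theta>' g
  assume a: "bS 0 \<Delta> \<Gamma> \<theta>" "sem A C P (Suc n + 0) \<Gamma>' a p" "ctxhom A C \<Gamma> \<Gamma>' g"
    "eqv A C P (Suc n + 0) \<Gamma> a p' (act A P g (did A a) p)" "bE 0 \<Delta> \<Gamma>' \<theta>' (BR 0 \<Gamma> g \<theta>)"
  note a' = a(2,4)[unfolded add_0_right]
  obtain b h where \<theta>: "\<theta> = (b, h)" by fastforce
  obtain \<Gamma>0 as where \<Gamma>: "\<Gamma> = \<Gamma>0 @ [as]" "length \<Gamma>0 = n" using snocE[OF sem_len[OF eqv_sem(1)[OF a'(2)]]] .
  obtain \<Gamma>1 bs where \<Gamma>': "\<Gamma>' = \<Gamma>1 @ [bs]" "length \<Gamma>1 = n" using snocE[OF sem_len[OF a'(1)]] .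
  obtain g0 s where g: "g = g0 @ [s]" "length g0 = n" using snocE[of g] ctxhom_len[OF a(3)] sem_len[OF a'(1)] by auto
  obtain \<alpha> fs where s: "s = (\<alpha>, fs)" by fastforce
  have "ctxhom A C \<Gamma>0 \<Gamma>1 g0 \<and> shom A C as bs s"
    using a(3) unfolding \<Gamma> \<Gamma>' g by (subst (asm) ctxhom_snoc) (simp_all add: \<Gamma> \<Gamma>' g)
  then have h: "ctxhom A C \<Gamma>0 \<Gamma>1 g0" "shom A C as bs (\<alpha>, fs)" by (simp_all add: s)
  show "eqv A C (LApp (LLam P) Q) n \<Delta> a (of_cmp (\<Gamma>, p', \<theta>)) (of_cmp (\<Gamma>', p, \<theta>'))"
    unfolding \<Gamma> \<Gamma>' \<theta>
  proof (rule eqv_trans[OF of_cmp_act[OF _ _ h \<Gamma>(2)] eqv_sym[OF of_cmp_bag]])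
    show "bS 0 \<Delta> (\<Gamma>0 @ [as]) (b, h)" using a(1) by (simp add: \<Gamma> \<theta>)
  qed (use a a' in \<open>simp_all add: \<Gamma> \<Gamma>' g s \<theta>\<close>)
qed

lemma isom_redex_cmp: "isom (den (LApp (LLam P) Q) n) (cmp P 0)"
proof -
  have N: "nat_trans (den (LApp (LLam P) Q) n) (cmp P 0) (\<lambda>_ _. to_cmp)"
    unfolding nat_trans_def den_simps cmp_simps
  proof (intro conjI allI impI)
    fix \<Delta> a x y assume "eqv A C (LApp (LLam P) Q) n \<Delta> a x y"
    then show "cE P 0 \<Delta> a (to_cmp x) (to_cmp y)" by (rule to_cmp_resp)
  next
    fix \<Delta> a \<Delta>' a' u f x assume s: "sem A C (LApp (LLam P) Q) n \<Delta> a x" and u: "ctxhom A C \<Delta>' \<Delta> u" and f: "dhom A C a a' f"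
    obtain as \<Gamma> p b h where x: "x = EA as (\<Gamma> # map fst b) (EL p) (map snd b) h" using s by (rule sem_redexE)
    have "act A (LApp (LLam P) Q) u f x = EA as (\<Gamma> # map fst b) (EL (act A P (cidc A (\<Gamma> @ [as])) f p)) (map snd b) (u \<odot> h)"
      by (simp add: x cidc_snoc sid_def)
    then have e: "to_cmp (act A (LApp (LLam P) Q) u f x) = cA P u f (to_cmp x)"
      by (simp only: x to_cmp cA_def BL_def prod.case fst_conv snd_conv)
    have "cE P 0 \<Delta>' a' (to_cmp (act A (LApp (LLam P) Q) u f x)) (to_cmp (act A (LApp (LLam P) Q) u f x))"
      by (rule to_cmp_resp[OF eqv_refl[OF sem_act[OF s u f]]])
    then show "cE P 0 \<Delta>' a' (to_cmp (act A (LApp (LLam P) Q) u f x)) (cA P u f (to_cmp x))" unfolding e .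
  qed
  have "iso_by (den (LApp (LLam P) Q) n) (cmp P 0) (\<lambda>_ _. to_cmp) (\<lambda>_ _. of_cmp)"
  proof (rule iso_byI[OF isf_den isf_cmp[of 0, unfolded add_0_right] N], unfold den_simps cmp_simps)
    fix \<Delta> a x y assume "cE P 0 \<Delta> a x y"
    then show "eqv A C (LApp (LLam P) Q) n \<Delta> a (of_cmp x) (of_cmp y)" by (rule of_cmp_resp)
  next
    fix \<Delta> a x assume s: "sem A C (LApp (LLam P) Q) n \<Delta> a x"
    then obtain as \<Gamma> p b h where x: "x = EA as (\<Gamma> # map fst b) (EL p) (map snd b) h" by (rule sem_redexE)
    have "of_cmp (to_cmp x) = x" by (simp only: x to_cmp of_cmp)
    then show "eqv A C (LApp (LLam P) Q) n \<Delta> a (of_cmp (to_cmp x)) x" using eqv_refl[OF s] by simp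
  next
    fix \<Delta> a x assume s: "cS P 0 \<Delta> a x"
    obtain \<Gamma> p b h where e: "x = (\<Gamma>, p, (b, h))" by (metis prod_cases4)
    have "length \<Gamma> = Suc n" using s sem_len by (simp add: e) blast
    then obtain \<Gamma>0 as where \<Gamma>: "\<Gamma> = \<Gamma>0 @ [as]" by (rule snocE)
    have "to_cmp (of_cmp x) = x" by (simp only: e \<Gamma> to_cmp of_cmp)
    then show "cE P 0 \<Delta> a (to_cmp (of_cmp x)) x" using cE_refl[OF s] by simp
  qed
  then show ?thesis unfolding isom_def by blast
qed

lemma isom_redex:
  assumes "fv_below (Suc n) P" "fv_below n Q"
  shows "isom (den (LApp (LLam P) Q) n) (den (subst P Q 0) n)"
  by (rule isom_trans[OF isf_den isf_cmp[of 0, unfolded add_0_right] isf_den isom_redex_cmp cmp_subst[OF assms]])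

end

section \<open>Beta reduction in arbitrary position and the passage to quotient sets\<close>

context dcat
begin

text \<open>Reduction below a constructor is congruence of isomorphism. Below a binder the context
  grows by one, so \<open>n\<close> is general in the induction.\<close>

lemma isom_beta: "beta M N \<Longrightarrow> fv_below n M \<Longrightarrow> isom (den M n) (den N n)"
proof (induction arbitrary: n rule: beta.induct)
  case (beta_redex s t)
  interpret subst_env A C n t by unfold_locales auto
  show ?case using beta_redex by (intro isom_redex) simp_all
next
  case (beta_appL s t u)
  then show ?case by (intro iso_App isom_refl[OF isf_den]) simp_all
next
  case (beta_appR s t u)
  then show ?case by (intro iso_App isom_refl[OF isf_den]) simp_all
next
  case (beta_abs s t)
  then show ?case by (intro iso_Lam) simp_all
qed

end

theorem theorem4:
  fixes A :: "('o, 'm) cat" and C :: fclass and M N :: lterm and n :: nat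
  assumes "is_category A"
    and "beta M N"
    and "fv_below n M" and "fv_below n N"
  shows "\<exists>\<phi>.
    (\<forall>\<Delta> a. length \<Delta> = n \<longrightarrow>
        bij_betw (\<phi> \<Delta> a) (Den A C M n \<Delta> a) (Den A C N n \<Delta> a)) \<and>
    (\<forall>\<Delta> a \<Delta>' a' u f X. length \<Delta> = n \<longrightarrow> length \<Delta>' = n \<longrightarrow>
        ctxhom A C \<Delta>' \<Delta> u \<longrightarrow> dhom A C a a' f \<longrightarrow> X \<in> Den A C M n \<Delta> a \<longrightarrow>
        \<phi> \<Delta>' a' (DAct A C M n \<Delta>' a' u f X) = DAct A C N n \<Delta>' a' u f (\<phi> \<Delta> a X))"
proof -
  interpret dcat A C by unfold_locales (rule assms(1))
  obtain \<phi> \<psi> where i: "iso_by (den M n) (den N n) \<phi> \<psi>" using isom_beta[OF assms(2,3)] unfolding isom_def by blast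
  note nt = i[unfolded iso_by_def, THEN conjunct1] and rest = i[unfolded iso_by_def, THEN conjunct2]
  note nt' = rest[THEN conjunct1]
  have l: "eqv A C M n \<Delta> a (\<psi> \<Delta> a (\<phi> \<Delta> a x)) x" if "sem A C M n \<Delta> a x" for \<Delta> a x
    using rest that unfolding den_simps by blast
  have r: "eqv A C N n \<Delta> a (\<phi> \<Delta> a (\<psi> \<Delta> a x)) x" if "sem A C N n \<Delta> a x" for \<Delta> a x
    using rest that unfolding den_simps by blast
  note resp = nat_trans_resp[OF nt, unfolded den_simps] and resp' = nat_trans_resp[OF nt', unfolded den_simps]
  note nat = nat_trans_natural[OF nt, unfolded den_simps]
  note ty = nat_trans_typed[OF nt isf_den isf_den, unfolded den_simps] and ty' = nat_trans_typed[OF nt' isf_den isf_den, unfolded den_simps]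
  \<comment> \<open>With classes indexed by representatives, \<open>Den\<close> and
    \<open>DAct\<close> become statements on representatives.\<close>
  define cl where "cl L \<Delta> a x = {y. eqv A C L n \<Delta> a x y}" for L \<Delta> a x
  have cl_eq: "cl L \<Delta> a x = cl L \<Delta> a y" if "eqv A C L n \<Delta> a x y" for L \<Delta> a x y
    unfolding cl_def using eqv_trans[OF that] eqv_trans[OF eqv_sym[OF that]] by blast
  have cl_D: "eqv A C L n \<Delta> a x y" if "cl L \<Delta> a x = cl L \<Delta> a y" "sem A C L n \<Delta> a y" for L \<Delta> a x y
  proof -
    have "y \<in> cl L \<Delta> a x" unfolding that(1) using eqv_refl[OF that(2)] by (simp add: cl_def)
    then show ?thesis by (simp add: cl_def)
  qed
  have Den: "Den A C L n \<Delta> a = {cl L \<Delta> a x | x. sem A C L n \<Delta> a x}" for L \<Delta> a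
    unfolding Den_def cl_def ..
  have some: "eqv A C L n \<Delta> a x (SOME y. y \<in> cl L \<Delta> a x)" if "sem A C L n \<Delta> a x" for L \<Delta> a x
    using someI[of "\<lambda>y. y \<in> cl L \<Delta> a x" x] eqv_refl[OF that] by (simp add: cl_def)
  \<comment> \<open>A representative is chosen as in \<open>DAct\<close>; the resulting class is
    independent of the choice because \<open>\<phi>\<close> respects the equivalence.\<close>
  define \<Phi> where "\<Phi> \<Delta> a X = cl N \<Delta> a (\<phi> \<Delta> a (SOME x. x \<in> X))" for \<Delta> a X
  have \<Phi>: "\<Phi> \<Delta> a (cl M \<Delta> a x) = cl N \<Delta> a (\<phi> \<Delta> a x)" if "sem A C M n \<Delta> a x" for \<Delta> a x
    unfolding \<Phi>_def by (rule cl_eq[OF eqv_sym[OF resp[OF some[OF that]]]])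
  have act: "DAct A C L n \<Delta>' a' u f (cl L \<Delta> a x) = cl L \<Delta>' a' (act A L u f x)"
    if "sem A C L n \<Delta> a x" "ctxhom A C \<Delta>' \<Delta> u" "dhom A C a a' f" for L \<Delta> a \<Delta>' a' u f x
    unfolding DAct_def cl_def[of L \<Delta>' a', symmetric] by (rule cl_eq[OF eqv_sym[OF isf_cong[OF isf_den, unfolded den_simps, OF some[OF that(1)] that(2,3)]]])
  show ?thesis
  proof (rule exI[of _ \<Phi>], intro conjI allI impI)
    fix \<Delta> :: "'o ctx" and a
    show "bij_betw (\<Phi> \<Delta> a) (Den A C M n \<Delta> a) (Den A C N n \<Delta> a)"
      unfolding bij_betw_def
    proof
      show "inj_on (\<Phi> \<Delta> a) (Den A C M n \<Delta> a)"
      proof (rule inj_onI)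
        fix X Y assume "X \<in> Den A C M n \<Delta> a" "Y \<in> Den A C M n \<Delta> a" and e: "\<Phi> \<Delta> a X = \<Phi> \<Delta> a Y"
        then obtain x y where x: "X = cl M \<Delta> a x" "sem A C M n \<Delta> a x" and y: "Y = cl M \<Delta> a y" "sem A C M n \<Delta> a y"
          unfolding Den by blast
        have "eqv A C N n \<Delta> a (\<phi> \<Delta> a x) (\<phi> \<Delta> a y)"
          using e unfolding x(1) y(1) \<Phi>[OF x(2)] \<Phi>[OF y(2)] by (rule cl_D[OF _ ty[OF y(2)]])
        then have "eqv A C M n \<Delta> a x y" by (rule eqv_trans[OF eqv_trans[OF eqv_sym[OF l[OF x(2)]] resp'] l[OF y(2)]])
        then show "X = Y" unfolding x y by (rule cl_eq)
      qed
      show "\<Phi> \<Delta> a ` Den A C M n \<Delta> a = Den A C N n \<Delta> a"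
      proof (intro equalityI subsetI)
        fix Y assume "Y \<in> \<Phi> \<Delta> a ` Den A C M n \<Delta> a"
        then obtain x where x: "sem A C M n \<Delta> a x" "Y = \<Phi> \<Delta> a (cl M \<Delta> a x)" unfolding Den by blast
        then show "Y \<in> Den A C N n \<Delta> a" unfolding x(2) \<Phi>[OF x(1)] Den using ty[OF x(1)] by blast
      next
        fix Y assume "Y \<in> Den A C N n \<Delta> a"
        then obtain y where y: "sem A C N n \<Delta> a y" "Y = cl N \<Delta> a y" unfolding Den by blast
        have "Y = \<Phi> \<Delta> a (cl M \<Delta> a (\<psi> \<Delta> a y))" unfolding y(2) \<Phi>[OF ty'[OF y(1)]] by (rule cl_eq[OF eqv_sym[OF r[OF y(1)]]])
        then show "Y \<in> \<Phi> \<Delta> a ` Den A C M n \<Delta> a" unfolding Den using ty'[OF y(1)] by blast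
      qed
    qed
  next
    fix \<Delta> a \<Delta>' a' u f X
    assume u: "ctxhom A C \<Delta>' \<Delta> u" and f: "dhom A C a a' f" and "X \<in> Den A C M n \<Delta> a"
    then obtain x where x: "sem A C M n \<Delta> a x" "X = cl M \<Delta> a x" unfolding Den by blast
    show "\<Phi> \<Delta>' a' (DAct A C M n \<Delta>' a' u f X) = DAct A C N n \<Delta>' a' u f (\<Phi> \<Delta> a X)"
      unfolding x(2) act[OF x(1) u f] \<Phi>[OF sem_act[OF x(1) u f]] \<Phi>[OF x(1)] act[OF ty[OF x(1)] u f]
      by (rule cl_eq[OF nat[OF x(1) u f]])
  qed
qed

end
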